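(* Let $d\ge1$, let $M$ be a complete smooth Riemannian $d$-manifold and $\Omega\subseteq M$ a bounded domain. Let $\mu$ be a positive finite Borel measure on $M$ with $\operatorname{supp}(\mu)\subseteq\overline\Omega$ and $\mu(\Omega)>0$. Assume that $\mu$ satisfies (MPI) on $M$. If $u\in C(\overline\Omega)$ is a nonconstant $\mu$-subharmonic function, then $u$ cannot attain its maximum value in $\Omega$.
   Context: $(M,g)$ is an oriented complete smooth Riemannian $d$-manifold, $\nu$ its Riemannian volume measure. A domain is an open connected set. $W_0^{1,2}(\Omega)$ is the closure of $C_c^\infty(\Omega)$ in $W^{1,2}(\Omega)$. (MPI) (Poincaré inequality for measures) on an open set $V\subseteq M$: there is a constant $C>0$ such that $\int_V|v|^2\,d\mu\le C\int_V|\nabla v|^2\,d\nu$ for all $v\in C_c^\infty(V)$. Kreĭn–Feller operator: under (MPI) the inclusion $C_c^\infty(\Omega)\to L^2(\Omega,\mu)$ extends to a bounded map $\iota:W_0^{1,2}(\Omega)\to L^2(\Omega,\mu)$; $\iota(u)$ is the $L^2(\Omega,\mu)$-representative of $u$ and is again denoted $u$. Put $\mathcal{E}(u,v)=\int_\Omega\langle\nabla u,\nabla v\rangle\,d\nu$ with $\operatorname{dom}(\mathcal{E})=\{u\in W_0^{1,2}(\Omega):\mathcal{E}(u,w)=0\ \text{for all}\ w\in\ker\iota\}$, which embeds injectively and densely in $L^2(\Omega,\mu)$. Then $\mathcal{E}$ is a closed form on $L^2(\Omega,\mu)$ and $-\Delta_\mu$ is the associated nonnegative self-adjoint operator. Equivalently,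 $u\in\operatorname{dom}(\Delta_\mu)$ and $-\Delta_\mu u=f$ iff $u\in W_0^{1,2}(\Omega)$, $f\in L^2(\Omega,\mu)$ and $\int_\Omega\langle\nabla u,\nabla v\rangle\,d\nu=\int_\Omega fv\,d\mu$ for all $v\in C_c^\infty(\Omega)$. A function $u\in\operatorname{dom}(-\Delta_\mu)$ is $\mu$-subharmonic if $\Delta_\mu u\ge0$ $\mu$-a.e. *)

theory Defs
  imports "HOL-Analysis.Analysis"
begin

section \<open>Smooth maps between Euclidean spaces\<close>

fun Ck_on :: "nat \<Rightarrow> ('a::real_normed_vector \<Rightarrow> 'b::real_normed_vector) \<Rightarrow> 'a set \<Rightarrow> bool" where
  "Ck_on 0 f S \<longleftrightarrow> continuous_on S f"
| "Ck_on (Suc k) f S \<longleftrightarrow>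
     (\<forall>x\<in>S. f differentiable (at x)) \<and>
     (\<forall>v. Ck_on k (\<lambda>x. frechet_derivative f (at x) v) S)"

text \<open>Only used for open \<open>S\<close>.\<close>
definition smooth_on :: "('a::real_normed_vector \<Rightarrow> 'b::real_normed_vector) \<Rightarrow> 'a set \<Rightarrow> bool" where
  "smooth_on f S \<longleftrightarrow> (\<forall>k. Ck_on k f S)"

definition partial :: "'n \<Rightarrow> (real^'n::finite \<Rightarrow> real) \<Rightarrow> real^'n \<Rightarrow> real" where
  "partial i f y = frechet_derivative f (at y) (axis i 1)"

definition compactly_supported_in :: "('a::topological_space \<Rightarrow> real) \<Rightarrow> 'a set \<Rightarrow> bool" where
  "compactly_supported_in f V \<longleftrightarrow>
     compact (closure {x. f x \<noteq> 0}) \<and> closure {x. f x \<noteq> 0} \<subseteq> V"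


section \<open>Oriented Riemannian manifolds\<close>

text \<open>
  The manifold is the whole type \<open>'a\<close>, and its dimension is \<open>CARD('n)\<close>. A chart is a pair of its domain
  and its coordinate map; the coordinate map is irrelevant outside the domain. Tensor fields are
  families of component functions indexed by charts that obey the usual transformation laws. In
  particular, \<open>metric G c p\<close> is the matrix of the metric at the point \<open>p\<close> in the
  coordinates of the chart \<open>c\<close>.
\<close>

type_synonym ('a, 'n) chart = "'a set \<times> ('a \<Rightarrow> real^'n)"

record ('a, 'n) riemannian_structure =
  atlas :: "('a, 'n::finite) chart set"
  metric :: "('a, 'n) chart \<Rightarrow> 'a \<Rightarrow> real^'n^'n"

abbreviation chart_inv :: "('a, 'n::finite) chart \<Rightarrow> real^'n \<Rightarrow> 'a" where
  "chart_inv c \<equiv> inv_into (fst c) (snd c)"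

definition is_chart :: "('a::topological_space, 'n::finite) chart \<Rightarrow> bool" where
  "is_chart c \<longleftrightarrow>
     open (fst c) \<and> open (snd c ` fst c) \<and>
     homeomorphism (fst c) (snd c ` fst c) (snd c) (chart_inv c)"

definition transition ::
  "('a, 'n::finite) chart \<Rightarrow> ('a, 'n) chart \<Rightarrow> real^'n \<Rightarrow> real^'n" where
  "transition c c' = snd c' \<circ> chart_inv c"

definition jacobian ::
  "('a, 'n::finite) chart \<Rightarrow> ('a, 'n) chart \<Rightarrow> 'a \<Rightarrow> real^'n^'n" where
  "jacobian c c' p = matrix (frechet_derivative (transition c c') (at (snd c p)))"

definition oriented_smooth_atlas ::
  "('a::topological_space, 'n::finite) chart set \<Rightarrow> bool" where
  "oriented_smooth_atlas A \<longleftrightarrow>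
     (\<forall>c\<in>A. is_chart c) \<and>
     (\<Union>c\<in>A. fst c) = UNIV \<and>
     (\<forall>c\<in>A. \<forall>c'\<in>A. smooth_on (transition c c') (snd c ` (fst c \<inter> fst c'))) \<and>
     (\<forall>c\<in>A. \<forall>c'\<in>A. \<forall>p\<in>fst c \<inter> fst c'. det (jacobian c c' p) > 0)"

text \<open>The class constraint supplies the Hausdorff and second countability axioms.\<close>
definition oriented_riemannian_manifold ::
  "('a::{t2_space, second_countable_topology}, 'n::finite) riemannian_structure \<Rightarrow> bool" where
  "oriented_riemannian_manifold G \<longleftrightarrow>
     oriented_smooth_atlas (atlas G) \<and>
     (\<forall>c\<in>atlas G.
        smooth_on (metric G c \<circ> chart_inv c) (snd c ` fst c) \<and>
        (\<forall>p\<in>fst c. transpose (metric G c p) = metric G c p \<and>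
                    (\<forall>v. v \<noteq> 0 \<longrightarrow> v \<bullet> (metric G c p *v v) > 0))) \<and>
     (\<forall>c\<in>atlas G. \<forall>c'\<in>atlas G. \<forall>p\<in>fst c \<inter> fst c'.
        metric G c p = transpose (jacobian c c' p) ** metric G c' p ** jacobian c c' p)"

text \<open>An arbitrary chart around \<open>p\<close>; the notions defined through it do not depend on the choice.\<close>
definition chart_at :: "('a, 'n::finite) riemannian_structure \<Rightarrow> 'a \<Rightarrow> ('a, 'n) chart" where
  "chart_at G p = (SOME c. c \<in> atlas G \<and> p \<in> fst c)"


subsection \<open>Riemannian distance\<close>

definition piecewise_C1_curve ::
  "('a::topological_space, 'n::finite) riemannian_structure \<Rightarrow> (real \<Rightarrow> 'a) \<Rightarrow> bool" where
  "piecewise_C1_curve G \<gamma> \<longleftrightarrow>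
     continuous_on {0..1} \<gamma> \<and>
     (\<forall>c\<in>atlas G. \<forall>a b. 0 \<le> a \<and> a < b \<and> b \<le> 1 \<and> \<gamma> ` {a..b} \<subseteq> fst c \<longrightarrow>
        (snd c \<circ> \<gamma>) piecewise_C1_differentiable_on {a..b})"

definition speed :: "('a, 'n::finite) riemannian_structure \<Rightarrow> (real \<Rightarrow> 'a) \<Rightarrow> real \<Rightarrow> real" where
  "speed G \<gamma> t =
     (let c = chart_at G (\<gamma> t); v = vector_derivative (snd c \<circ> \<gamma>) (at t)
      in sqrt (v \<bullet> (metric G c (\<gamma> t) *v v)))"

definition curve_length ::
  "('a, 'n::finite) riemannian_structure \<Rightarrow> (real \<Rightarrow> 'a) \<Rightarrow> ennreal" where
  "curve_length G \<gamma> = (\<integral>\<^sup>+t\<in>{0..1}. ennreal (speed G \<gamma> t) \<partial>lborel)"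

text \<open>The distance between points in different components is \<open>\<infinity>\<close>.\<close>
definition riemannian_dist ::
  "('a::topological_space, 'n::finite) riemannian_structure \<Rightarrow> 'a \<Rightarrow> 'a \<Rightarrow> ennreal" where
  "riemannian_dist G x y =
     (INF \<gamma> \<in> {\<gamma>. piecewise_C1_curve G \<gamma> \<and> \<gamma> 0 = x \<and> \<gamma> 1 = y}. curve_length G \<gamma>)"

definition riemannian_complete ::
  "('a::topological_space, 'n::finite) riemannian_structure \<Rightarrow> bool" where
  "riemannian_complete G \<longleftrightarrow>
     (\<forall>s :: nat \<Rightarrow> 'a.
        (\<forall>e>0. \<exists>N. \<forall>m\<ge>N. \<forall>n\<ge>N. riemannian_dist G (s m) (s n) < e) \<longrightarrow>
        (\<exists>l. (\<lambda>n. riemannian_dist G (s n) l) \<longlonglongrightarrow> 0))"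

definition riemannian_bounded ::
  "('a::topological_space, 'n::finite) riemannian_structure \<Rightarrow> 'a set \<Rightarrow> bool" where
  "riemannian_bounded G S \<longleftrightarrow>
     (\<exists>R::real. \<forall>x\<in>S. \<forall>y\<in>S. riemannian_dist G x y \<le> ennreal R)"


subsection \<open>Riemannian volume\<close>

text \<open>There is exactly one such Borel measure: the domains of countably many charts cover the manifold.\<close>
definition is_riemannian_volume ::
  "('a::topological_space, 'n::finite) riemannian_structure \<Rightarrow> 'a measure \<Rightarrow> bool" where
  "is_riemannian_volume G \<nu> \<longleftrightarrow>
     sets \<nu> = sets borel \<and>
     (\<forall>c\<in>atlas G. \<forall>E\<in>sets borel. E \<subseteq> fst c \<longrightarrow>
        emeasure \<nu> E =
          (\<integral>\<^sup>+y\<in>snd c ` E. ennreal (sqrt (det (metric G c (chart_inv c y)))) \<partial>lborel))"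


subsection \<open>Smooth functions, vector fields and gradients\<close>

definition Cc_inf ::
  "('a::topological_space, 'n::finite) riemannian_structure \<Rightarrow> 'a set \<Rightarrow> ('a \<Rightarrow> real) set" where
  "Cc_inf G V =
     {v. (\<forall>c\<in>atlas G. smooth_on (v \<circ> chart_inv c) (snd c ` fst c)) \<and>
         compactly_supported_in v V}"

text \<open>A vector field is given by its contravariant components \<open>X c p\<close> in each chart \<open>c\<close>.\<close>
type_synonym ('a, 'n) vfield = "('a, 'n) chart \<Rightarrow> 'a \<Rightarrow> real^'n"

definition is_vfield_on ::
  "('a, 'n::finite) riemannian_structure \<Rightarrow> 'a set \<Rightarrow> ('a, 'n) vfield \<Rightarrow> bool" where
  "is_vfield_on G V X \<longleftrightarrow>
     (\<forall>c\<in>atlas G. \<forall>c'\<in>atlas G. \<forall>p\<in>V \<inter> fst c \<inter> fst c'. X c' p = jacobian c c' p *v X c p)"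

definition rinner ::
  "('a, 'n::finite) riemannian_structure \<Rightarrow> ('a, 'n) vfield \<Rightarrow> ('a, 'n) vfield \<Rightarrow> 'a \<Rightarrow> real" where
  "rinner G X Y p = (let c = chart_at G p in X c p \<bullet> (metric G c p *v Y c p))"

definition grad ::
  "('a, 'n::finite) riemannian_structure \<Rightarrow> ('a \<Rightarrow> real) \<Rightarrow> ('a, 'n) vfield" where
  "grad G v c p =
     matrix_inv (metric G c p) *v (\<chi> i. partial i (v \<circ> chart_inv c) (snd c p))"


section \<open>Sobolev spaces\<close>

text \<open>
  Elements of \<open>L\<^sup>2\<close> and of the Sobolev spaces are represented by functions that are defined on all of
  \<open>'a\<close> but whose values outside \<open>V\<close> are irrelevant. Equality in these spaces is equality almost
  everywhere on \<open>V\<close>.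
\<close>

definition L2 :: "'a measure \<Rightarrow> 'a set \<Rightarrow> ('a \<Rightarrow> real) set" where
  "L2 M V = {f. set_borel_measurable M V f \<and> set_integrable M V (\<lambda>x. (f x)\<^sup>2)}"

definition L2_vfield ::
  "('a, 'n::finite) riemannian_structure \<Rightarrow> 'a measure \<Rightarrow> 'a set \<Rightarrow> ('a, 'n) vfield set" where
  "L2_vfield G \<nu> V =
     {X. is_vfield_on G V X \<and>
         (\<forall>c\<in>atlas G. set_borel_measurable \<nu> (V \<inter> fst c) (X c)) \<and>
         set_integrable \<nu> V (rinner G X X)}"

text \<open>
  The distributional derivatives in local coordinates of \<open>u\<close> are the covariant components
  \<open>metric G c p *v X c p\<close> of \<open>X\<close>.
\<close>
definition weak_gradient ::
  "('a::topological_space, 'n::finite) riemannian_structure \<Rightarrow> 'a measure \<Rightarrow> 'a set \<Rightarrow>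
     ('a \<Rightarrow> real) \<Rightarrow> ('a, 'n) vfield \<Rightarrow> bool" where
  "weak_gradient G \<nu> V u X \<longleftrightarrow>
     X \<in> L2_vfield G \<nu> V \<and>
     (\<forall>c\<in>atlas G. \<forall>\<eta>. smooth_on \<eta> UNIV \<and> compactly_supported_in \<eta> (snd c ` (V \<inter> fst c)) \<longrightarrow>
        (\<forall>i. (LINT y|lborel. u (chart_inv c y) * partial i \<eta> y) =
             - (LINT y|lborel.
                  (metric G c (chart_inv c y) *v X c (chart_inv c y)) $ i * \<eta> y)))"

definition W12 ::
  "('a::topological_space, 'n::finite) riemannian_structure \<Rightarrow> 'a measure \<Rightarrow> 'a set \<Rightarrow>
     ('a \<Rightarrow> real) set" where
  "W12 G \<nu> V = {u \<in> L2 \<nu> V. \<exists>X. weak_gradient G \<nu> V u X}"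

text \<open>Weak gradients are unique up to null sets.\<close>
definition wgrad ::
  "('a::topological_space, 'n::finite) riemannian_structure \<Rightarrow> 'a measure \<Rightarrow> 'a set \<Rightarrow>
     ('a \<Rightarrow> real) \<Rightarrow> ('a, 'n) vfield" where
  "wgrad G \<nu> V u = (SOME X. weak_gradient G \<nu> V u X)"

definition dirichlet ::
  "('a::topological_space, 'n::finite) riemannian_structure \<Rightarrow> 'a measure \<Rightarrow> 'a set \<Rightarrow>
     ('a \<Rightarrow> real) \<Rightarrow> ('a \<Rightarrow> real) \<Rightarrow> real" where
  "dirichlet G \<nu> V u v = (LINT x:V|\<nu>. rinner G (wgrad G \<nu> V u) (wgrad G \<nu> V v) x)"

definition W12_norm ::
  "('a::topological_space, 'n::finite) riemannian_structure \<Rightarrow> 'a measure \<Rightarrow> 'a set \<Rightarrow>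
     ('a \<Rightarrow> real) \<Rightarrow> real" where
  "W12_norm G \<nu> V u = sqrt ((LINT x:V|\<nu>. (u x)\<^sup>2) + dirichlet G \<nu> V u u)"

definition W12_0 ::
  "('a::topological_space, 'n::finite) riemannian_structure \<Rightarrow> 'a measure \<Rightarrow> 'a set \<Rightarrow>
     ('a \<Rightarrow> real) set" where
  "W12_0 G \<nu> V =
     {u \<in> W12 G \<nu> V. \<forall>e>0. \<exists>v\<in>Cc_inf G V. W12_norm G \<nu> V (\<lambda>x. u x - v x) < e}"


section \<open>The Krein--Feller operator\<close>

definition measure_support :: "'a::topological_space measure \<Rightarrow> 'a set" where
  "measure_support \<mu> = {x. \<forall>U. open U \<and> x \<in> U \<longrightarrow> emeasure \<mu> U > 0}"

definition MPI ::
  "('a::topological_space, 'n::finite) riemannian_structure \<Rightarrow> 'a measure \<Rightarrow> 'a measure \<Rightarrow>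
     'a set \<Rightarrow> bool" where
  "MPI G \<nu> \<mu> V \<longleftrightarrow>
     (\<exists>C>0. \<forall>v\<in>Cc_inf G V.
        (LINT x:V|\<mu>. (v x)\<^sup>2) \<le> C * (LINT x:V|\<nu>. rinner G (grad G v) (grad G v) x))"

text \<open>
  \<open>\<iota>(u)\<close> is the limit in \<open>L\<^sup>2(\<Omega>,\<mu>)\<close> of any sequence of test functions that converges to \<open>u\<close> in
  \<open>W\<^sup>1\<^sup>,\<^sup>2(\<Omega>)\<close>. Under \<open>MPI\<close> it exists and is unique up to \<open>\<mu>\<close>-null sets.
\<close>
definition is_mu_representative ::
  "('a::topological_space, 'n::finite) riemannian_structure \<Rightarrow> 'a measure \<Rightarrow> 'a measure \<Rightarrow>
     'a set \<Rightarrow> ('a \<Rightarrow> real) \<Rightarrow> ('a \<Rightarrow> real) \<Rightarrow> bool" where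
  "is_mu_representative G \<nu> \<mu> \<Omega> u h \<longleftrightarrow>
     h \<in> L2 \<mu> \<Omega> \<and>
     (\<exists>v :: nat \<Rightarrow> 'a \<Rightarrow> real.
        (\<forall>n. v n \<in> Cc_inf G \<Omega>) \<and>
        (\<lambda>n. W12_norm G \<nu> \<Omega> (\<lambda>x. u x - v n x)) \<longlonglongrightarrow> 0 \<and>
        (\<lambda>n. LINT x:\<Omega>|\<mu>. (v n x - h x)\<^sup>2) \<longlonglongrightarrow> 0)"

definition iota ::
  "('a::topological_space, 'n::finite) riemannian_structure \<Rightarrow> 'a measure \<Rightarrow> 'a measure \<Rightarrow>
     'a set \<Rightarrow> ('a \<Rightarrow> real) \<Rightarrow> ('a \<Rightarrow> real)" where
  "iota G \<nu> \<mu> \<Omega> u = (SOME h. is_mu_representative G \<nu> \<mu> \<Omega> u h)"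

definition ker_iota ::
  "('a::topological_space, 'n::finite) riemannian_structure \<Rightarrow> 'a measure \<Rightarrow> 'a measure \<Rightarrow>
     'a set \<Rightarrow> ('a \<Rightarrow> real) set" where
  "ker_iota G \<nu> \<mu> \<Omega> =
     {w \<in> W12_0 G \<nu> \<Omega>. AE x in \<mu>. x \<in> \<Omega> \<longrightarrow> iota G \<nu> \<mu> \<Omega> w x = 0}"

definition dom_form ::
  "('a::topological_space, 'n::finite) riemannian_structure \<Rightarrow> 'a measure \<Rightarrow> 'a measure \<Rightarrow>
     'a set \<Rightarrow> ('a \<Rightarrow> real) set" where
  "dom_form G \<nu> \<mu> \<Omega> =
     {u \<in> W12_0 G \<nu> \<Omega>. \<forall>w\<in>ker_iota G \<nu> \<mu> \<Omega>. dirichlet G \<nu> \<Omega> u w = 0}"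

text \<open>
  The graph of \<open>-\<Delta>\<^sub>\<mu>\<close>, the operator on \<open>L\<^sup>2(\<Omega>,\<mu>)\<close> associated with the form \<open>dirichlet\<close> on \<open>dom_form\<close>. Its
  arguments are given by their representatives in \<open>W12_0\<close>, which \<open>iota\<close> embeds in \<open>L\<^sup>2(\<Omega>,\<mu>)\<close>.
\<close>
definition krein_feller_graph ::
  "('a::topological_space, 'n::finite) riemannian_structure \<Rightarrow> 'a measure \<Rightarrow> 'a measure \<Rightarrow>
     'a set \<Rightarrow> ('a \<Rightarrow> real) \<Rightarrow> ('a \<Rightarrow> real) \<Rightarrow> bool" where
  "krein_feller_graph G \<nu> \<mu> \<Omega> u f \<longleftrightarrow>
     u \<in> dom_form G \<nu> \<mu> \<Omega> \<and> f \<in> L2 \<mu> \<Omega> \<and>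
     (\<forall>w\<in>dom_form G \<nu> \<mu> \<Omega>.
        dirichlet G \<nu> \<Omega> u w = (LINT x:\<Omega>|\<mu>. f x * iota G \<nu> \<mu> \<Omega> w x))"

definition dom_krein_feller ::
  "('a::topological_space, 'n::finite) riemannian_structure \<Rightarrow> 'a measure \<Rightarrow> 'a measure \<Rightarrow>
     'a set \<Rightarrow> ('a \<Rightarrow> real) set" where
  "dom_krein_feller G \<nu> \<mu> \<Omega> = {u. \<exists>f. krein_feller_graph G \<nu> \<mu> \<Omega> u f}"

text \<open>This is \<open>\<Delta>\<^sub>\<mu> u\<close>, unique up to \<open>\<mu>\<close>-null sets because \<open>dom_form\<close> is dense in \<open>L\<^sup>2(\<Omega>,\<mu>)\<close>.\<close>
definition laplace_mu ::
  "('a::topological_space, 'n::finite) riemannian_structure \<Rightarrow> 'a measure \<Rightarrow> 'a measure \<Rightarrow>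
     'a set \<Rightarrow> ('a \<Rightarrow> real) \<Rightarrow> 'a \<Rightarrow> real" where
  "laplace_mu G \<nu> \<mu> \<Omega> u x = - (SOME f. krein_feller_graph G \<nu> \<mu> \<Omega> u f) x"

definition mu_subharmonic ::
  "('a::topological_space, 'n::finite) riemannian_structure \<Rightarrow> 'a measure \<Rightarrow> 'a measure \<Rightarrow>
     'a set \<Rightarrow> ('a \<Rightarrow> real) \<Rightarrow> bool" where
  "mu_subharmonic G \<nu> \<mu> \<Omega> u \<longleftrightarrow>
     u \<in> dom_krein_feller G \<nu> \<mu> \<Omega> \<and>
     (AE x in \<mu>. x \<in> \<Omega> \<longrightarrow> laplace_mu G \<nu> \<mu> \<Omega> u x \<ge> 0)"

end

theory Submission
  imports Defs
begin

text \<open>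
  Testing the equation shows that \<open>E(u,v) \<le> 0\<close> for every nonnegative test function \<open>v\<close>: if \<open>p\<close> is the
  projection of \<open>v\<close> to \<open>dom_form\<close>, then \<open>E(u,v) = E(u,p)\<close>, because \<open>v - p\<close> lies in the kernel of \<open>\<iota>\<close>, and
  \<open>E(u,p) = - \<integral> \<Delta>\<^sub>\<mu>u v d\<mu>\<close>. So \<open>u\<close> is a continuous weakly subharmonic function, and the measure plays no
  further role. If the set where \<open>u\<close> attains its maximum were not open, a small Euclidean ball in a
  chart would touch it in exactly one point, and comparing \<open>u\<close> with Hopf's exponential barrier near
  this point gives a contradiction. Since \<open>u\<close> is not smooth, the comparison is carried out by testing
  with a smooth function of smooth approximations of \<open>u\<close>.

  The projection needs that \<open>\<Omega>\<close> has finite volume. This follows from completeness as in the Hopf--Rinow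
  theorem: bounded sets are totally bounded, hence contained in a finite union of compact chart balls.
\<close>

text \<open>The operator is tested against \<open>dom_form\<close> only, and a test function need
  not lie there; hence the projection. The projected function has the same representative in
  L2(\<mu>) as \<open>v\<close>, so the sign of \<open>v\<close> is the one that enters the
  integral. The Hilbert space projection theorem does not apply directly: the constraint concerns
  values in L2(\<mu>), and the energy alone is not known to control the norm of L2(\<nu>).

  Hopf's comparison usually evaluates second derivatives at a maximum of the difference. Here all
  derivatives are moved onto the cutoff \<kappa> and the barrier \<psi>: for convex f the lower
  bound for E(v, \<kappa> f'(v - \<psi>)) contains \<open>v\<close> only through its values. These
  converge in L1 on compact subsets of a chart when \<open>v\<close> tends to \<open>u\<close> in
  W12, while the energy of the test function stays bounded. The cutoff does no harm, because it is
  constant wherever \<open>u\<close> exceeds \<psi>, and f vanishes elsewhere. What is left in the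
  limit is a strictly positive number, whereas E(u, w) \<le> 0 for w \<ge> 0.\<close>

section \<open>Calculus of k times continuously differentiable functions\<close>

text \<open>Derivatives at points of an open set depend only on the values in that set. Functions
  composed with \<open>chart_inv c\<close> carry information only on the image of the chart, so they
  are replaced freely outside it.\<close>

lemma Ck_on_cong:
  assumes "open S" "\<And>x. x \<in> S \<Longrightarrow> f x = g x"
  shows "Ck_on k f S \<longleftrightarrow> Ck_on k g S"
proof -
  have "Ck_on k f S \<Longrightarrow> Ck_on k g S" if "\<And>x. x \<in> S \<Longrightarrow> f x = g x" for f g :: "'a \<Rightarrow> 'b"
    using that
  proof (induction k arbitrary: f g)
    case 0
    then show ?case by (metis (full_types) Ck_on.simps(1) continuous_on_cong)
  next
    case (Suc k)
    have d: "(f has_derivative D) (at x) \<longleftrightarrow> (g has_derivative D) (at x)" if "x \<in> S" for x D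
      using has_derivative_transform_within_open[OF _ assms(1) that] Suc.prems(2) by metis
    have fd: "frechet_derivative f (at x) = frechet_derivative g (at x)" if "x \<in> S" for x
      unfolding frechet_derivative_def using d[OF that] by simp
    have "g differentiable at x" if "x \<in> S" for x
      using Suc.prems(1) d[OF that] that unfolding Ck_on.simps differentiable_def by metis
    moreover have "Ck_on k (\<lambda>x. frechet_derivative g (at x) v) S" for v
      by (rule Suc.IH[of "\<lambda>x. frechet_derivative f (at x) v"]) (use Suc.prems fd in auto)
    ultimately show ?case by auto
  qed
  with assms(2) show ?thesis by metis
qed

lemma Ck_on_Suc_D: "Ck_on (Suc k) f S \<Longrightarrow> Ck_on k f S"
proof (induction k arbitrary: f)
  case 0
  then show ?case
    by (auto intro!: continuous_at_imp_continuous_on differentiable_imp_continuous_within)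
next
  case (Suc k)
  then show ?case by (metis Ck_on.simps(2))
qed

text \<open>Meant for functions glued from pieces, such as a function carried over from a chart and
  extended by zero: around each point a different description may be used.\<close>

lemma Ck_on_local:
  assumes "\<And>x. x \<in> S \<Longrightarrow> \<exists>U. open U \<and> x \<in> U \<and> Ck_on k f U"
  shows "Ck_on k f S"
  using assms
proof (induction k arbitrary: f)
  case 0
  have "continuous (at x) f" if "x \<in> S" for x
    using 0[OF that] by (auto simp: continuous_on_eq_continuous_at)
  then show ?case by (auto intro: continuous_at_imp_continuous_on)
next
  case (Suc k)
  then have "f differentiable at x" if "x \<in> S" for x using that by fastforce
  moreover have "Ck_on k (\<lambda>x. frechet_derivative f (at x) v) S" for v
    by (rule Suc.IH) (use Suc.prems in fastforce)
  ultimately show ?case by simp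
qed

lemma Ck_on_const: "Ck_on k (\<lambda>x. c) S"
  by (induction k arbitrary: c) (auto simp: frechet_derivative_const)

text \<open>Replaces the chosen \<open>frechet_derivative\<close> by an explicit \<open>D\<close>;
  most closure properties below take their induction step from this rule.\<close>

lemma Ck_on_SucI:
  assumes "open S" "\<And>x. x \<in> S \<Longrightarrow> (f has_derivative D x) (at x)" "\<And>v. Ck_on k (\<lambda>x. D x v) S"
  shows "Ck_on (Suc k) f S"
proof -
  have "frechet_derivative f (at x) = D x" if "x \<in> S" for x
    using assms(2)[OF that] frechet_derivative_at by metis
  then show ?thesis
    using assms by (auto simp: differentiable_def intro: Ck_on_cong[THEN iffD1, OF assms(1) _ assms(3)])
qed

lemma Ck_on_Suc_derivative:
  assumes "Ck_on (Suc k) f S" "x \<in> S"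
  shows "(f has_derivative frechet_derivative f (at x)) (at x)"
  using assms frechet_derivative_works by auto

lemma Ck_on_bounded_linear:
  assumes "bounded_linear L" "open S"
  shows "Ck_on k L S"
proof (cases k)
  case 0
  then show ?thesis using assms(1) by (simp add: linear_continuous_on)
next
  case (Suc j)
  show ?thesis unfolding Suc
    by (rule Ck_on_SucI[OF assms(2), where D = "\<lambda>x. L"])
      (auto intro: bounded_linear_imp_has_derivative[OF assms(1)] Ck_on_const)
qed

lemma Ck_on_linear_compose:
  assumes "bounded_linear L" "open S" "Ck_on k f S"
  shows "Ck_on k (\<lambda>x. L (f x)) S"
  using assms(3)
proof (induction k arbitrary: f)
  case 0
  then show ?case using assms(1) by (auto intro: bounded_linear.continuous_on)
next
  case (Suc k)
  show ?case
    by (rule Ck_on_SucI[OF assms(2), where D = "\<lambda>x v. L (frechet_derivative f (at x) v)"])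
      (use Suc in \<open>auto simp del: Ck_on.simps(2) intro!: bounded_linear.has_derivative[OF assms(1)] Ck_on_Suc_derivative\<close>, simp)
qed

lemma Ck_on_add:
  assumes "open S" "Ck_on k f S" "Ck_on k g S"
  shows "Ck_on k (\<lambda>x. f x + g x) S"
  using assms(2,3)
proof (induction k arbitrary: f g)
  case 0
  then show ?case by (auto intro: continuous_intros)
next
  case (Suc k)
  show ?case
    by (rule Ck_on_SucI[OF assms(1), where
          D = "\<lambda>x v. frechet_derivative f (at x) v + frechet_derivative g (at x) v"])
      (use Suc Ck_on_Suc_derivative[OF Suc.prems(1)] Ck_on_Suc_derivative[OF Suc.prems(2)]
        in \<open>auto intro: has_derivative_add\<close>)
qed

text \<open>One product rule for scalar multiples, products and inner products. The induction
  generalises over both factors, as the derivative pairs each of them with the derivative of the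
  other.\<close>

lemma Ck_on_bilinear:
  assumes "bounded_bilinear P" "open S" "Ck_on k f S" "Ck_on k g S"
  shows "Ck_on k (\<lambda>x. P (f x) (g x)) S"
  using assms(3,4)
proof (induction k arbitrary: f g)
  case 0
  then show ?case using assms(1) by (auto intro: bounded_bilinear.continuous_on)
next
  case (Suc k)
  have "Ck_on k f S" "Ck_on k g S" using Suc.prems Ck_on_Suc_D by auto
  then show ?case
    by (intro Ck_on_SucI[OF assms(2), where
          D = "\<lambda>x v. P (f x) (frechet_derivative g (at x) v) + P (frechet_derivative f (at x) v) (g x)"]
        bounded_bilinear.FDERIV[OF assms(1)] Ck_on_Suc_derivative[OF Suc.prems(1)]
          Ck_on_Suc_derivative[OF Suc.prems(2)] Ck_on_add[OF assms(2)] Suc.IH)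
      (use Suc.prems in auto)
qed

lemmas Ck_on_scaleR = Ck_on_bilinear[OF bounded_bilinear_scaleR]
lemmas Ck_on_mult = Ck_on_bilinear[OF bounded_bilinear_mult]
lemmas Ck_on_inner = Ck_on_bilinear[OF bounded_bilinear_inner]

lemma Ck_on_sum:
  assumes "open S" "\<And>i. i \<in> I \<Longrightarrow> Ck_on k (f i) S"
  shows "Ck_on k (\<lambda>x. \<Sum>i\<in>I. f i x) S"
  using assms(2) by (induction I rule: infinite_finite_induct) (auto intro: Ck_on_const Ck_on_add[OF assms(1)])

lemma Ck_on_prod:
  fixes f :: "'i \<Rightarrow> 'a::real_normed_vector \<Rightarrow> real"
  assumes "open S" "\<And>i. i \<in> I \<Longrightarrow> Ck_on k (f i) S"
  shows "Ck_on k (\<lambda>x. \<Prod>i\<in>I. f i x) S"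
  using assms(2) by (induction I rule: infinite_finite_induct) (auto intro: Ck_on_const Ck_on_mult[OF assms(1)])

lemma Ck_on_compose:
  fixes f :: "'a::real_normed_vector \<Rightarrow> 'b::euclidean_space" and g :: "'b \<Rightarrow> 'c::real_normed_vector"
  assumes "open S" "open T" "f ` S \<subseteq> T" "Ck_on k f S" "Ck_on k g T"
  shows "Ck_on k (\<lambda>x. g (f x)) S"
  using assms(4,5)
proof (induction k arbitrary: g)
  case 0
  then show ?case using assms(3) by (auto intro: continuous_on_compose2)
next
  case (Suc k)
  have inS: "f x \<in> T" if "x \<in> S" for x using assms(3) that by auto
  have df: "(f has_derivative frechet_derivative f (at x)) (at x)" if "x \<in> S" for x
    using Ck_on_Suc_derivative[OF Suc.prems(1) that] .
  have dg: "(g has_derivative frechet_derivative g (at (f x))) (at (f x))" if "x \<in> S" for x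
    using Ck_on_Suc_derivative[OF Suc.prems(2) inS[OF that]] .
  \<comment> \<open>\<open>Ck_on\<close> speaks of derivatives in a fixed direction, while the chain
    rule differentiates \<open>g\<close> in a direction that varies with \<open>x\<close>. Expanding
    that direction in the basis leaves fixed directions with variable coefficients.\<close>
  define D where "D x v = (\<Sum>b\<in>Basis. (frechet_derivative f (at x) v \<bullet> b) *\<^sub>R frechet_derivative g (at (f x)) b)" for x v
  have D: "D x v = frechet_derivative g (at (f x)) (frechet_derivative f (at x) v)" if "x \<in> S" for x v
  proof -
    have lin: "linear (frechet_derivative g (at (f x)))"
      using dg[OF that] has_derivative_linear by blast
    show ?thesis unfolding D_def
      by (subst (2) euclidean_representation[symmetric]) (simp add: linear_sum[OF lin] linear_scale[OF lin])
  qed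
  show ?case
  proof (rule Ck_on_SucI[OF assms(1), where D = D])
    fix x assume x: "x \<in> S"
    have "D x = frechet_derivative g (at (f x)) \<circ> frechet_derivative f (at x)"
      using D[OF x] by auto
    then show "((\<lambda>x. g (f x)) has_derivative D x) (at x)"
      using diff_chain_at[OF df[OF x] dg[OF x]] by (simp add: o_def)
  next
    fix v
    have "Ck_on k (\<lambda>x. frechet_derivative f (at x) v \<bullet> b) S" for b
      by (rule Ck_on_linear_compose[OF bounded_linear_inner_left assms(1)]) (use Suc.prems(1) in simp)
    moreover have "Ck_on k (\<lambda>x. frechet_derivative g (at (f x)) b) S" for b
      by (rule Suc.IH) (use Suc.prems Ck_on_Suc_D in auto)
    ultimately show "Ck_on k (\<lambda>x. D x v) S"
      unfolding D_def by (intro Ck_on_sum[OF assms(1)] Ck_on_scaleR[OF assms(1)]) auto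
  qed
qed

lemma Ck_on_real_SucI:
  fixes f :: "real \<Rightarrow> real"
  assumes "open S" "\<And>x. x \<in> S \<Longrightarrow> (f has_real_derivative f' x) (at x)" "Ck_on k f' S"
  shows "Ck_on (Suc k) f S"
  by (rule Ck_on_SucI[OF assms(1), where D = "\<lambda>x v. f' x * v"])
    (use assms in \<open>auto simp: has_field_derivative_def intro!: Ck_on_mult Ck_on_const\<close>)

text \<open>The derivative is an expression in the function itself, so the induction hypothesis
  covers it; the square root and the exponential function follow the same pattern.\<close>

lemma Ck_on_inverse_real: "Ck_on k (inverse :: real \<Rightarrow> real) (- {0})"
proof (induction k)
  case 0
  show ?case by (auto intro!: continuous_intros)
next
  case (Suc k)
  have "Ck_on k (\<lambda>x. - 1 * (inverse x * inverse x) :: real) (- {0})"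
    using Suc by (intro Ck_on_mult Ck_on_const) auto
  then show ?case
    by (rule Ck_on_real_SucI[rotated 2]) (auto intro!: DERIV_cong[OF DERIV_inverse] simp: power2_eq_square)
qed

lemma Ck_on_divide:
  fixes f g :: "'a::real_normed_vector \<Rightarrow> real"
  assumes "open S" "Ck_on k f S" "Ck_on k g S" "\<And>x. x \<in> S \<Longrightarrow> g x \<noteq> 0"
  shows "Ck_on k (\<lambda>x. f x / g x) S"
proof -
  have "Ck_on k (\<lambda>x. inverse (g x)) S"
    by (rule Ck_on_compose[OF assms(1) _ _ assms(3) Ck_on_inverse_real]) (use assms(4) in auto)
  then show ?thesis unfolding divide_inverse by (rule Ck_on_mult[OF assms(1,2)])
qed

lemma Ck_on_sqrt: "Ck_on k sqrt {0<..}"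
proof (induction k)
  case 0
  show ?case by (auto intro!: continuous_intros)
next
  case (Suc k)
  have "Ck_on k (\<lambda>x. 1 / (2 * sqrt x)) {0<..}"
    using Suc by (intro Ck_on_divide Ck_on_mult Ck_on_const) auto
  then show ?case
    by (rule Ck_on_real_SucI[rotated 2]) (auto simp: DERIV_real_sqrt field_simps intro!: DERIV_cong[OF DERIV_real_sqrt])
qed

lemma Ck_on_exp: "Ck_on k (exp :: real \<Rightarrow> real) UNIV"
proof (induction k)
  case 0
  show ?case by (auto intro!: continuous_intros)
next
  case (Suc k)
  then show ?case by (intro Ck_on_real_SucI[where f' = exp] DERIV_exp) auto
qed

lemma Ck_on_vec_nth: 
  fixes f :: "'a::real_normed_vector \<Rightarrow> real^'n"
  assumes "open S" "Ck_on k f S"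
  shows "Ck_on k (\<lambda>x. f x $ i) S"
  using Ck_on_linear_compose[OF bounded_linear_vec_nth assms] .

lemma Ck_on_vec_nth2: 
  fixes f :: "'a::real_normed_vector \<Rightarrow> real^'n^'m"
  assumes "open S" "Ck_on k f S"
  shows "Ck_on k (\<lambda>x. f x $ i $ j) S"
  by (rule Ck_on_linear_compose[OF _ assms])
    (rule bounded_linear_compose[OF bounded_linear_vec_nth bounded_linear_vec_nth])

lemma Ck_on_vec_lambda:
  fixes f :: "'n::finite \<Rightarrow> 'a::real_normed_vector \<Rightarrow> real"
  assumes "open S" "\<And>i. Ck_on k (f i) S"
  shows "Ck_on k (\<lambda>x. \<chi> i. f i x) S"
proof -
  have "(\<lambda>x. \<chi> i. f i x) = (\<lambda>x. \<Sum>i\<in>UNIV. f i x *\<^sub>R axis i 1)"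
    by (auto simp: vec_eq_iff axis_def if_distrib cong: if_cong)
  then show ?thesis
    using assms by (auto intro!: Ck_on_sum Ck_on_scaleR Ck_on_const)
qed

lemma Ck_on_det:
  fixes A :: "'a::real_normed_vector \<Rightarrow> real^'n^'n"
  assumes "open S" "\<And>i j. Ck_on k (\<lambda>x. A x $ i $ j) S"
  shows "Ck_on k (\<lambda>x. det (A x)) S"
  unfolding det_def
  by (intro Ck_on_sum Ck_on_mult Ck_on_prod Ck_on_const assms) 

lemma matrix_inv_works:
  fixes A :: "real^'n^'n"
  assumes "det A \<noteq> 0"
  shows "A ** matrix_inv A = mat 1" "matrix_inv A ** A = mat 1"
proof -
  have "\<exists>A'. A ** A' = mat 1 \<and> A' ** A = mat 1"
    using assms invertible_det_nz[of A] by (simp add: invertible_def)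
  from someI_ex[OF this] show "A ** matrix_inv A = mat 1" "matrix_inv A ** A = mat 1"
    by (auto simp: matrix_inv_def)
qed

text \<open>By Cramer's rule each component of the solution is a quotient of determinants. This
  avoids differentiating \<open>matrix_inv\<close>, which is defined by choice.\<close>

lemma Ck_on_matrix_inv:
  fixes A :: "'a::real_normed_vector \<Rightarrow> real^'n^'n"
  assumes S: "open S" and A: "Ck_on k A S" and b: "Ck_on k b S"
    and nz: "\<And>x. x \<in> S \<Longrightarrow> det (A x) \<noteq> 0"
  shows "Ck_on k (\<lambda>x. matrix_inv (A x) *v b x) S"
proof -
  have "Ck_on k (\<lambda>x. \<chi> l. det (\<chi> i j. if j = l then b x $ i else A x $ i $ j) / det (A x)) S"
  proof (intro Ck_on_vec_lambda Ck_on_divide Ck_on_det S nz)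
    fix i j :: 'n
    show "Ck_on k (\<lambda>x. A x $ i $ j) S" by (rule Ck_on_vec_nth2[OF S A])
  next
    fix l i j :: 'n
    show "Ck_on k (\<lambda>x. (\<chi> i j. if j = l then b x $ i else A x $ i $ j) $ i $ j) S"
      using Ck_on_vec_nth[OF S b] Ck_on_vec_nth2[OF S A] by (cases "j = l") auto
  qed auto
  moreover have "matrix_inv (A x) *v b x = (\<chi> l. det (\<chi> i j. if j = l then b x $ i else A x $ i $ j) / det (A x))"
    if "x \<in> S" for x
  proof -
    have "A x *v (matrix_inv (A x) *v b x) = b x"
      by (simp add: matrix_inv_works(1)[OF nz[OF that]] matrix_vector_mul_assoc)
    then show ?thesis using cramer[OF nz[OF that]] by blast
  qed
  ultimately show ?thesis using Ck_on_cong[OF S] by (metis (no_types, lifting))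
qed

lemma smooth_onD: "smooth_on f S \<Longrightarrow> Ck_on k f S"
  by (simp add: smooth_on_def)

lemma smooth_on_derivative: "smooth_on f S \<Longrightarrow> smooth_on (\<lambda>x. frechet_derivative f (at x) v) S"
  unfolding smooth_on_def by (metis Ck_on.simps(2))

lemma smooth_on_differentiable: "smooth_on f S \<Longrightarrow> x \<in> S \<Longrightarrow> f differentiable at x"
  unfolding smooth_on_def by (metis Ck_on.simps(2))

lemma smooth_on_continuous: "smooth_on f S \<Longrightarrow> continuous_on S f"
  unfolding smooth_on_def by (metis Ck_on.simps(1))

subsection \<open>Bump functions\<close>

definition flat :: "real \<Rightarrow> real" where
  "flat t = (if t > 0 then exp (- 1 / t) else 0)"

text \<open>With \<open>x = 1 / t\<close> this is the decay of a polynomial times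
  \<open>exp (- x)\<close> at infinity.\<close>

lemma poly_exp_inverse_tendsto_0:
  "((\<lambda>t. poly p (1 / t) * exp (- 1 / t)) \<longlongrightarrow> 0) (at_right (0::real))"
proof -
  have 1: "((\<lambda>x::real. x ^ k * exp (- x)) \<longlongrightarrow> 0) at_top" for k :: nat
    using tendsto_power_div_exp_0[of k] by (simp add: divide_inverse exp_minus)
  have "((\<lambda>x::real. \<Sum>i\<le>degree p. coeff p i * (x ^ i * exp (- x))) \<longlongrightarrow> (\<Sum>i\<le>degree p. coeff p i * 0)) at_top"
    by (intro tendsto_intros 1)
  then have 2: "((\<lambda>x::real. poly p x * exp (- x)) \<longlongrightarrow> 0) at_top"
    by (simp add: poly_altdef sum_distrib_right mult.assoc)
  have "filterlim (\<lambda>t::real. 1 / t) at_top (at_right 0)"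
    using filterlim_inverse_at_top_right by (simp add: inverse_eq_divide)
  from filterlim_compose[OF 2 this] show ?thesis by (simp)
qed

text \<open>The functions \<open>p(1/t) exp(-1/t)\<close> with a polynomial \<open>p\<close> form a
  class closed under differentiation: the derivative is
  \<open>(1/t)^2 (p(1/t) - p'(1/t)) exp(-1/t)\<close>, which explains \<open>q\<close>. All
  derivatives of \<open>flat\<close> are thus handled at once, including those at 0.\<close>

lemma flat_poly_derivative:
  fixes p :: "real poly"
  defines "q \<equiv> [:0, 0, 1:] * (p - pderiv p)"
  shows "((\<lambda>t. if t > 0 then poly p (1 / t) * exp (- 1 / t) else 0) has_real_derivative
     (if t > 0 then poly q (1 / t) * exp (- 1 / t) else 0)) (at t)"
proof -
  let ?F = "\<lambda>t::real. if t > 0 then poly p (1 / t) * exp (- 1 / t) else 0"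
  consider "t < 0" | "t = 0" | "t > 0" by linarith
  then show ?thesis
  proof cases
    case 1
    have "((\<lambda>t. 0) has_real_derivative 0) (at t)" by simp
    then have "(?F has_real_derivative 0) (at t)"
      by (rule has_field_derivative_transform_within_open[where S = "{..<0}"]) (use 1 in auto)
    then show ?thesis using 1 by simp
  next
    case 2
    have "((\<lambda>h. ?F h / h) \<longlongrightarrow> 0) (at_right 0)"
    proof -
      \<comment> \<open>Dividing by \<open>h\<close> multiplies the polynomial in
        \<open>1 / h\<close> by its variable, that is, turns \<open>p\<close> into
        \<open>pCons 0 p\<close>. The difference quotient at 0 therefore stays in the class.\<close>
      have "((\<lambda>t. poly (pCons 0 p) (1 / t) * exp (- 1 / t)) \<longlongrightarrow> 0) (at_right (0::real))"
        by (rule poly_exp_inverse_tendsto_0)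
      then show ?thesis
        by (rule Lim_transform_eventually) (auto simp: eventually_at_filter field_simps)
    qed
    moreover have "((\<lambda>h. ?F h / h) \<longlongrightarrow> 0) (at_left 0)"
      by (rule Lim_transform_eventually[where f = "\<lambda>_. 0"]) (auto simp: eventually_at_filter)
    ultimately have "((\<lambda>h. ?F h / h) \<longlongrightarrow> 0) (at 0)"
      by (simp add: filterlim_split_at)
    then show ?thesis using 2 by (simp add: has_field_derivative_iff)
  next
    case 3
    have "((\<lambda>t. poly p (1 / t) * exp (- 1 / t)) has_real_derivative poly q (1 / t) * exp (- 1 / t)) (at t)"
      using 3 unfolding q_def
      by (auto intro!: derivative_eq_intros DERIV_chain2[OF poly_DERIV] simp: field_simps power2_eq_square)
    then have "(?F has_real_derivative poly q (1 / t) * exp (- 1 / t)) (at t)"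
      by (rule has_field_derivative_transform_within_open[where S = "{0<..}"]) (use 3 in auto)
    then show ?thesis using 3 by simp
  qed
qed

lemma Ck_on_flat_poly: "Ck_on k (\<lambda>t::real. if t > 0 then poly p (1 / t) * exp (- 1 / t) else 0) UNIV"
proof (induction k arbitrary: p)
  case 0
  show ?case using flat_poly_derivative[of p]
    by (auto intro!: continuous_at_imp_continuous_on DERIV_isCont)
next
  case (Suc k)
  show ?case
    by (rule Ck_on_real_SucI[OF _ flat_poly_derivative Suc]) auto
qed

lemma smooth_flat: "smooth_on flat UNIV"
proof -
  have "flat = (\<lambda>t. if t > 0 then poly [:1:] (1 / t) * exp (- 1 / t) else 0)"
    by (auto simp: flat_def)
  then show ?thesis using Ck_on_flat_poly[of _ "[:1:]"] unfolding smooth_on_def by simp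
qed

lemma flat_bounds: "0 \<le> flat t" "flat t \<le> 1"
  by (auto simp: flat_def)

lemma flat_pos_iff: "0 < flat t \<longleftrightarrow> 0 < t"
  by (auto simp: flat_def)

definition flat' :: "real \<Rightarrow> real" where
  "flat' t = (if t > 0 then exp (- 1 / t) / t\<^sup>2 else 0)"

lemma flat_has_derivative: "(flat has_real_derivative flat' t) (at t)"
proof -
  have "(\<lambda>t. if t > 0 then poly [:1:] (1 / t) * exp (- 1 / t) else 0) = flat"
    by (auto simp: flat_def)
  moreover have "(if t > 0 then poly ([:0, 0, 1:] * ([:1:] - pderiv [:1:])) (1 / t) * exp (- 1 / t) else 0) = flat' t"
    by (auto simp: flat'_def power2_eq_square pderiv_pCons)
  ultimately show ?thesis using flat_poly_derivative[of "[:1:]" t] by simp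
qed

definition smooth_step :: "real \<Rightarrow> real" where
  "smooth_step t = flat t / (flat t + flat (1 - t))"

lemma smooth_step_denom: "flat t + flat (1 - t) > 0"
  using flat_bounds(1)[of t] flat_bounds(1)[of "1 - t"] flat_pos_iff[of t] flat_pos_iff[of "1 - t"]
  by linarith

lemma smooth_smooth_step: "smooth_on smooth_step UNIV"
proof -
  have a: "Ck_on k (\<lambda>t::real. 1 - t) UNIV" for k
  proof -
    have "Ck_on k (\<lambda>t::real. 1 + (-1) * t) UNIV"
      by (rule Ck_on_add[OF open_UNIV Ck_on_const Ck_on_bounded_linear[OF bounded_linear_mult_right open_UNIV]])
    then show ?thesis by simp
  qed
  have "Ck_on k (\<lambda>t. flat (1 - t)) UNIV" for k
    by (rule Ck_on_compose[where T = UNIV and f = "\<lambda>t. 1 - t"]) (use a smooth_flat in \<open>auto simp: smooth_on_def\<close>)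
  then show ?thesis
    using smooth_flat smooth_step_denom unfolding smooth_on_def smooth_step_def[abs_def]
    by (auto intro!: Ck_on_divide Ck_on_add simp: less_imp_neq[symmetric])
qed

lemma smooth_step_bounds: "0 \<le> smooth_step t" "smooth_step t \<le> 1"
  using flat_bounds(1) smooth_step_denom[of t] by (auto simp: smooth_step_def)

lemma smooth_step_0: "t \<le> 0 \<Longrightarrow> smooth_step t = 0"
  by (simp add: smooth_step_def flat_def)

lemma smooth_step_1: "t \<ge> 1 \<Longrightarrow> smooth_step t = 1"
  using smooth_step_denom[of t] by (simp add: smooth_step_def flat_def)

text \<open>A primitive of a bump that equals 1 on [-c, c] and 0 outside [-c - 1, c + 1]. Its slope
  lies in [0, 1], so composing with it raises neither energy nor distances, and it fixes every
  function bounded by \<open>c\<close>.\<close>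

lemma smooth_truncation:
  fixes c :: real
  assumes "c \<ge> 0"
  obtains \<phi> \<phi>' where "smooth_on \<phi> UNIV" "\<And>t. (\<phi> has_real_derivative \<phi>' t) (at t)" "\<And>t. \<bar>\<phi>' t\<bar> \<le> 1"
    "\<And>t. \<bar>t\<bar> \<le> c \<Longrightarrow> \<phi> t = t" "\<And>t. \<bar>\<phi> t\<bar> \<le> c + 1"
proof -
  define \<beta> where "\<beta> t = smooth_step (c + 1 - t) * smooth_step (c + 1 + t)" for t
  have lin: "Ck_on k (\<lambda>t::real. a + b * t) UNIV" for a b :: real and k
    by (rule Ck_on_add[OF open_UNIV Ck_on_const Ck_on_bounded_linear[OF bounded_linear_mult_right open_UNIV]])
  have st: "Ck_on k (\<lambda>t::real. smooth_step (a + b * t)) UNIV" for a b :: real and k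
    using Ck_on_compose[OF open_UNIV open_UNIV subset_UNIV lin smooth_onD[OF smooth_smooth_step]] .
  have b: "Ck_on k \<beta> UNIV" for k
    unfolding \<beta>_def[abs_def] using st[of k "c + 1" "-1"] st[of k "c + 1" 1] by (intro Ck_on_mult) auto
  have cont: "continuous_on UNIV \<beta>" by (rule b[of 0, unfolded Ck_on.simps])
  have b0: "0 \<le> \<beta> t" "\<beta> t \<le> 1" for t
    using smooth_step_bounds by (auto simp: \<beta>_def mult_le_one)
  define G where "G t = (LBINT s=ereal 0..ereal t. \<beta> s)" for t
  have G: "(G has_real_derivative \<beta> t) (at t)" for t
  proof -
    define a where "a = - \<bar>t\<bar> - 1"
    define b where "b = \<bar>t\<bar> + 1"
    have "continuous_on {a..b} \<beta>" using cont continuous_on_subset by blast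
    then have "((\<lambda>u. LBINT y=ereal 0..ereal u. \<beta> y) has_vector_derivative \<beta> t) (at t within {a..b})"
      by (intro interval_integral_FTC2) (auto simp: a_def b_def)
    moreover have "at t within {a..b} = at t"
      by (rule at_within_interior) (auto simp: a_def b_def)
    ultimately show ?thesis
      by (simp only: G_def[abs_def] has_real_derivative_iff_has_vector_derivative)
  qed
  have G0: "G 0 = 0" by (simp only: G_def interval_integral_endpoints_same)
  have "Ck_on (Suc k) G UNIV" for k
    by (rule Ck_on_real_SucI[OF _ G b]) auto
  then have "smooth_on G UNIV" unfolding smooth_on_def using Ck_on_Suc_D by blast
  moreover have "\<bar>\<beta> t\<bar> \<le> 1" for t using b0 by (simp add: abs_le_iff add_increasing2 order_trans[OF _ b0(1)])
  moreover have id: "G t = t" if "\<bar>t\<bar> \<le> c" for t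
  proof -
    have "((\<lambda>t. G t - t) has_real_derivative 0) (at s)" if "\<bar>s\<bar> \<le> c" for s
      using that by (auto intro!: derivative_eq_intros G simp: \<beta>_def smooth_step_1)
    then have "\<And>s. s \<in> {-c..c} \<Longrightarrow> ((\<lambda>t. G t - t) has_real_derivative 0) (at s within {-c..c})"
      by (rule has_field_derivative_at_within) auto
    from has_field_derivative_zero_constant[OF _ this] obtain k where k: "\<And>x. x \<in> {-c..c} \<Longrightarrow> G x - x = k"
      by auto
    have "t \<in> {-c..c}" "0 \<in> {-c..c}" using that assms by auto
    then have "G t - t = k" "G 0 - 0 = k" by (blast intro: k)+
    then show ?thesis using G0 by linarith
  qed
  moreover have "\<bar>G t\<bar> \<le> c + 1" for t
  proof -
    have mono: "G s \<le> G t" if "s \<le> t" for s t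
      by (rule DERIV_nonneg_imp_nondecreasing[OF that]) (use G b0 in blast)
    have lip: "\<bar>G s - G t\<bar> \<le> \<bar>s - t\<bar>" for s t
    proof -
      have "norm (G s - G t) \<le> 1 * norm (s - t)"
        by (rule field_differentiable_bound[where S = UNIV and f' = \<beta>]) (use G b0 in auto)
      then show ?thesis by simp
    qed
    have far: "G t = G (c + 1)" if "t \<ge> c + 1" for t
    proof -
      have "\<exists>k. \<forall>x\<in>{c + 1..t}. G x = k"
        by (rule has_field_derivative_zero_constant, simp, rule has_field_derivative_at_within, rule DERIV_cong[OF G])
          (auto simp: \<beta>_def smooth_step_0)
      then show ?thesis using that by (metis atLeastAtMost_iff order_refl)
    qed
    have far': "G t = G (- c - 1)" if "t \<le> - c - 1" for t
    proof -
      have "\<exists>k. \<forall>x\<in>{t..- c - 1}. G x = k"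
        by (rule has_field_derivative_zero_constant, simp, rule has_field_derivative_at_within, rule DERIV_cong[OF G])
          (auto simp: \<beta>_def smooth_step_0)
      then show ?thesis using that by (metis atLeastAtMost_iff order_refl)
    qed
    show ?thesis
    proof (cases "\<bar>t\<bar> \<le> c + 1")
      case True
      then show ?thesis using lip[of t 0] G0 by simp
    next
      case False
      then have "t \<ge> c + 1 \<or> t \<le> - c - 1" by linarith
      then have "\<bar>G t\<bar> = \<bar>G (c + 1)\<bar> \<or> \<bar>G t\<bar> = \<bar>G (- c - 1)\<bar>" using far far' by metis
      moreover have "\<bar>G (c + 1)\<bar> \<le> c + 1" "\<bar>G (- c - 1)\<bar> \<le> c + 1"
        using lip[of "c + 1" 0] lip[of "- c - 1" 0] G0 assms by linarith+
      ultimately show ?thesis by linarith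
    qed
  qed
  ultimately show ?thesis using that G by blast
qed

section \<open>Semi-inner products and minimising sequences\<close>

text \<open>No sign of \<open>c\<close> is presupposed, and \<open>c\<close> may vanish, as it does
  for semidefinite forms. With \<open>a = 0\<close> the conclusion says \<open>b = 0\<close>, which
  is how a minimiser is seen to be orthogonal.\<close>

lemma discriminant_le:
  fixes a b c :: real
  assumes "\<And>t. a + 2 * t * b + t\<^sup>2 * c \<ge> 0"
  shows "b\<^sup>2 \<le> a * c"
proof -
  have a: "a \<ge> 0" using assms[of 0] by simp
  show ?thesis
  proof (cases "c = 0")
    case True
    have "b = 0"
    proof (rule ccontr)
      assume b: "b \<noteq> 0"
      have "a + 2 * (- (a + 1) / (2 * b)) * b \<ge> 0" using assms[of "- (a + 1) / (2 * b)"] True by simp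
      with b show False by (simp add: field_simps)
    qed
    then show ?thesis by (simp add: True)
  next
    case False
    have "c \<ge> 0"
    proof (rule ccontr)
      assume "\<not> c \<ge> 0"
      then have c: "c < 0" by simp
      \<comment> \<open>At this \<open>t\<close> the product \<open>t * c\<close> equals
        \<open>c - (a + 2 * \<bar>b\<bar>)\<close>, so the quadratic is at most
        \<open>t * c\<close>, a negative number.\<close>
      define t where "t = 1 + (a + 2 * \<bar>b\<bar>) / (- c)"
      have q0: "(a + 2 * \<bar>b\<bar>) / (- c) \<ge> 0" using c a by (intro divide_nonneg_nonneg) auto
      then have t: "t \<ge> 1" by (simp add: t_def)
      have tc: "t * c = c - (a + 2 * \<bar>b\<bar>)" using c by (simp add: t_def field_simps)
      have "a + 2 * t * b + t\<^sup>2 * c \<le> t * a + t * (2 * \<bar>b\<bar>) + t * (t * c)"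
      proof -
        have "a \<le> t * a" "t * b \<le> t * \<bar>b\<bar>" using t a mult_right_mono[OF t a] by (auto intro: mult_left_mono)
        moreover have "t\<^sup>2 * c = t * (t * c)" "2 * t * b = 2 * (t * b)" "t * (2 * \<bar>b\<bar>) = 2 * (t * \<bar>b\<bar>)"
          by (simp_all add: power2_eq_square)
        ultimately show ?thesis by linarith
      qed
      also have "\<dots> = t * (a + 2 * \<bar>b\<bar> + t * c)" by (simp add: algebra_simps)
      also have "\<dots> = t * c" by (simp add: tc)
      also have "\<dots> < 0" using t c by (simp add: mult_pos_neg)
      finally show False using assms[of t] by simp
    qed
    with False have c: "c > 0" by simp
    have "0 \<le> a + 2 * (- b / c) * b + (- b / c)\<^sup>2 * c" by (rule assms)
    also have "\<dots> = a - b\<^sup>2 / c" using c by (simp add: field_simps power2_eq_square)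
    finally show ?thesis using c by (simp add: field_simps)
  qed
qed

text \<open>Only semidefinite, and on a set of functions instead of a type: elements of the function
  spaces are functions, not classes modulo null sets. Instances are L2(\<nu>), L2(\<mu>), the
  Dirichlet form and the form behind \<open>W12_norm\<close>.\<close>

locale semi_inner_product =
  fixes S :: "('x \<Rightarrow> real) set" and B :: "('x \<Rightarrow> real) \<Rightarrow> ('x \<Rightarrow> real) \<Rightarrow> real"
  assumes lin: "u \<in> S \<Longrightarrow> v \<in> S \<Longrightarrow> (\<lambda>x. a * u x + b * v x) \<in> S"
    and sym: "u \<in> S \<Longrightarrow> v \<in> S \<Longrightarrow> B u v = B v u"
    and B_lin: "u \<in> S \<Longrightarrow> v \<in> S \<Longrightarrow> w \<in> S \<Longrightarrow> B (\<lambda>x. a * u x + b * v x) w = a * B u w + b * B v w"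
    and pos: "u \<in> S \<Longrightarrow> B u u \<ge> 0"
begin

lemma diff: "u \<in> S \<Longrightarrow> v \<in> S \<Longrightarrow> (\<lambda>x. u x - v x) \<in> S"
  using lin[of u v 1 "-1"] by simp

lemma add: "u \<in> S \<Longrightarrow> v \<in> S \<Longrightarrow> (\<lambda>x. u x + v x) \<in> S"
  using lin[of u v 1 1] by simp

lemma add_scale: "u \<in> S \<Longrightarrow> v \<in> S \<Longrightarrow> (\<lambda>x. u x + t * v x) \<in> S"
  using lin[of u v 1 t] by simp

lemma B_diff: "u \<in> S \<Longrightarrow> v \<in> S \<Longrightarrow> w \<in> S \<Longrightarrow> B (\<lambda>x. u x - v x) w = B u w - B v w"
  using B_lin[of u v w 1 "-1"] by simp

lemma B_diff_right: "u \<in> S \<Longrightarrow> v \<in> S \<Longrightarrow> w \<in> S \<Longrightarrow> B w (\<lambda>x. u x - v x) = B w u - B w v"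
  using B_diff[of u v w] sym[OF diff, of u v w] sym[of u w] sym[of v w] by simp

lemma B_lin_right: "u \<in> S \<Longrightarrow> v \<in> S \<Longrightarrow> w \<in> S \<Longrightarrow> B w (\<lambda>x. a * u x + b * v x) = a * B w u + b * B w v"
  using B_lin[of u v w a b] sym[OF lin, of u v w a b] sym[of u w] sym[of v w] by simp

lemma B_quad:
  assumes "u \<in> S" "v \<in> S"
  shows "B (\<lambda>x. a * u x + b * v x) (\<lambda>x. a * u x + b * v x) = a\<^sup>2 * B u u + 2 * a * b * B u v + b\<^sup>2 * B v v"
  using assms lin[OF assms, of a b] sym[OF assms]
  by (simp add: B_lin B_lin_right power2_eq_square algebra_simps)

lemma B_add_scale:
  assumes "u \<in> S" "v \<in> S"
  shows "B (\<lambda>x. u x + t * v x) (\<lambda>x. u x + t * v x) = B u u + 2 * t * B u v + t\<^sup>2 * B v v"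
  using B_quad[OF assms, of 1 t] by simp

lemma B_diff_diff:
  assumes "u \<in> S" "v \<in> S"
  shows "B (\<lambda>x. u x - v x) (\<lambda>x. u x - v x) = B u u - 2 * B u v + B v v"
  using B_quad[OF assms, of 1 "-1"] by simp

lemma cauchy_schwarz_sq: "u \<in> S \<Longrightarrow> v \<in> S \<Longrightarrow> (B u v)\<^sup>2 \<le> B u u * B v v"
  using pos[OF add_scale] by (intro discriminant_le) (simp add: B_add_scale[symmetric])

lemma cauchy_schwarz:
  assumes "u \<in> S" "v \<in> S"
  shows "\<bar>B u v\<bar> \<le> sqrt (B u u) * sqrt (B v v)"
  using real_sqrt_le_mono[OF cauchy_schwarz_sq[OF assms]] by (simp add: real_sqrt_mult)

definition nrm :: "('x \<Rightarrow> real) \<Rightarrow> real" where "nrm u = sqrt (B u u)"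

lemma nrm_nonneg: "u \<in> S \<Longrightarrow> nrm u \<ge> 0"
  by (simp add: nrm_def pos)

lemma nrm_sq: "u \<in> S \<Longrightarrow> (nrm u)\<^sup>2 = B u u"
  by (simp add: nrm_def pos)

lemma nrm_lin:
  assumes "u \<in> S" "v \<in> S"
  shows "nrm (\<lambda>x. a * u x + b * v x) \<le> \<bar>a\<bar> * nrm u + \<bar>b\<bar> * nrm v"
proof -
  have "B u v \<le> nrm u * nrm v" "- B u v \<le> nrm u * nrm v"
    using cauchy_schwarz[OF assms] by (auto simp: nrm_def)
  then have "a * b * B u v \<le> \<bar>a * b\<bar> * (nrm u * nrm v)"
    by (smt (verit) mult_left_mono mult_minus_left mult_minus_right abs_ge_zero)
  then have "B (\<lambda>x. a * u x + b * v x) (\<lambda>x. a * u x + b * v x) \<le> (\<bar>a\<bar> * nrm u + \<bar>b\<bar> * nrm v)\<^sup>2"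
    unfolding B_quad[OF assms] by (simp add: power2_sum power_mult_distrib nrm_sq assms abs_mult mult_ac)
  then have "sqrt (B (\<lambda>x. a * u x + b * v x) (\<lambda>x. a * u x + b * v x)) \<le> \<bar>\<bar>a\<bar> * nrm u + \<bar>b\<bar> * nrm v\<bar>"
    using real_sqrt_le_mono by fastforce
  then show ?thesis using nrm_nonneg assms by (simp add: nrm_def pos)
qed

lemma nrm_diff:
  assumes "u \<in> S" "v \<in> S"
  shows "nrm (\<lambda>x. u x - v x) \<le> nrm u + nrm v"
  using nrm_lin[OF assms, of 1 "-1"] by simp

lemma nrm_add:
  assumes "u \<in> S" "v \<in> S"
  shows "nrm (\<lambda>x. u x + v x) \<le> nrm u + nrm v"
  using nrm_lin[OF assms, of 1 1] by simp

lemma nrm_sym: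
  assumes "u \<in> S" "v \<in> S"
  shows "nrm (\<lambda>x. u x - v x) = nrm (\<lambda>x. v x - u x)"
  using B_diff_diff[OF assms] B_diff_diff[OF assms(2,1)] sym[OF assms] by (simp add: nrm_def)

lemma nrm_triangle:
  assumes "u \<in> S" "v \<in> S" "w \<in> S"
  shows "nrm (\<lambda>x. u x - w x) \<le> nrm (\<lambda>x. u x - v x) + nrm (\<lambda>x. v x - w x)"
  using nrm_add[OF diff diff, of u v v w] assms by simp

text \<open>Elements of almost minimal norm are chosen; the parallelogram law makes them Cauchy.\<close>
lemma nested_convex_Cauchy:
  fixes D :: "nat \<Rightarrow> ('x \<Rightarrow> real) set"
  assumes sub: "\<And>k. D k \<subseteq> S" and ne: "\<And>k. D k \<noteq> {}" and dec: "\<And>k. D (Suc k) \<subseteq> D k"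
    and mid: "\<And>k u v. u \<in> D k \<Longrightarrow> v \<in> D k \<Longrightarrow> (\<lambda>x. (1/2) * u x + (1/2) * v x) \<in> D k"
    and bound: "\<And>u. u \<in> D 0 \<Longrightarrow> B u u \<le> C"
  obtains q where "\<And>k. q k \<in> D k" "\<And>e. e > 0 \<Longrightarrow> \<exists>N. \<forall>m\<ge>N. \<forall>n\<ge>N. nrm (\<lambda>x. q m x - q n x) < e"
proof -
  have anti: "D n \<subseteq> D m" if "m \<le> n" for m n
    using that dec by (rule lift_Suc_antimono_le[rotated])
  define b where "b k = (INF u\<in>D k. B u u)" for k
  have bb: "bdd_below ((\<lambda>u. B u u) ` D k)" for k
    using pos sub by (intro bdd_belowI[of _ 0]) auto
  have b_le: "b k \<le> B u u" if "u \<in> D k" for u k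
    unfolding b_def by (rule cINF_lower[OF bb that])
  have mono: "incseq b"
    unfolding b_def by (intro incseq_SucI cINF_superset_mono ne bb dec order_refl)
  have "b k \<le> C" for k
  proof -
    obtain u where "u \<in> D k" using ne by auto
    then show ?thesis using b_le[of u k] bound[of u] anti[of 0 k] by auto
  qed
  then obtain L where L: "b \<longlonglongrightarrow> L" and bL: "\<And>k. b k \<le> L"
    using incseq_convergent[OF mono, of C] by auto
  have "\<exists>u\<in>D k. B u u < b k + inverse (real (Suc k))" for k
    using cINF_less_iff[OF ne bb, of k "b k + inverse (real (Suc k))"] by (auto simp: b_def)
  then obtain q where q: "\<And>k. q k \<in> D k" and qb: "\<And>k. B (q k) (q k) < b k + inverse (real (Suc k))"
    by metis
  \<comment> \<open>The midpoint of \<open>q m\<close> and \<open>q n\<close> lies in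
    \<open>D m\<close>, so \<open>B\<close> of their sum is at least \<open>4 * b m\<close>. By the
    parallelogram law at most \<open>2 * (b m + i) + 2 * (L + i) - 4 * b m\<close> remains, where
    \<open>i = inverse (real (Suc m))\<close>.\<close>
  have key: "B (\<lambda>x. q m x - q n x) (\<lambda>x. q m x - q n x) \<le> 2 * (L - b m) + 4 * inverse (real (Suc m))" if "m \<le> n" for m n
  proof -
    have S: "q m \<in> S" "q n \<in> S" using q sub by blast+
    have "q n \<in> D m" using q anti[OF that] by blast
    then have "b m \<le> B (\<lambda>x. (1/2) * q m x + (1/2) * q n x) (\<lambda>x. (1/2) * q m x + (1/2) * q n x)"
      using mid[OF q] b_le by blast
    then have "4 * b m \<le> B (q m) (q m) + 2 * B (q m) (q n) + B (q n) (q n)"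
      unfolding B_quad[OF S] by (simp add: power2_eq_square)
    moreover have "inverse (real (Suc n)) \<le> inverse (real (Suc m))" using that by (intro le_imp_inverse_le) auto
    moreover have "X - 2 * Y + Z \<le> 2 * (l - bm) + 4 * i"
      if "4 * bm \<le> X + 2 * Y + Z" "j \<le> i" "X < bm + i" "Z < bn + j" "bn \<le> l" for X Y Z bm bn i j l :: real
    proof -
      have "X - 2 * Y + Z = 2 * X + 2 * Z - (X + 2 * Y + Z)" by simp
      also have "\<dots> \<le> 2 * (bm + i) + 2 * (l + i) - 4 * bm" using that by (intro diff_mono add_mono) auto
      finally show ?thesis by simp
    qed
    ultimately show ?thesis
      using qb[of m] qb[of n] bL[of n] unfolding B_diff_diff[OF S] by blast
  qed
  have lim: "(\<lambda>m. 2 * (L - b m) + 4 * inverse (real (Suc m))) \<longlonglongrightarrow> 2 * (L - L) + 4 * 0"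
    by (intro tendsto_intros L LIMSEQ_inverse_real_of_nat)
  have "\<exists>N. \<forall>m\<ge>N. \<forall>n\<ge>N. nrm (\<lambda>x. q m x - q n x) < e" if "e > 0" for e
  proof -
    have "\<forall>\<^sub>F m in sequentially. 2 * (L - b m) + 4 * inverse (real (Suc m)) < e\<^sup>2"
      using order_tendstoD(2)[OF lim, of "e\<^sup>2"] that by simp
    then obtain N where N: "\<And>m. m \<ge> N \<Longrightarrow> 2 * (L - b m) + 4 * inverse (real (Suc m)) < e\<^sup>2"
      by (auto simp: eventually_sequentially)
    have le: "nrm (\<lambda>x. q m x - q n x) < e" if "m \<ge> N" "m \<le> n" for m n
      using key[OF that(2)] N[OF that(1)] \<open>e > 0\<close> real_sqrt_less_mono[of _ "e\<^sup>2"]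
      unfolding nrm_def by (smt (verit) real_sqrt_abs)
    have "nrm (\<lambda>x. q m x - q n x) < e" if "m \<ge> N" "n \<ge> N" for m n
    proof (cases "m \<le> n")
      case False
      then show ?thesis using le[of n m] that nrm_sym[of "q m" "q n"] q sub by fastforce
    qed (use le that in auto)
    then show ?thesis by blast
  qed
  with q show ?thesis using that by blast
qed

end

subsection \<open>Square integrable functions\<close>

lemma L2_iff:
  "f \<in> L2 M V \<longleftrightarrow> (\<lambda>x. indicator V x * f x) \<in> borel_measurable M \<and> integrable M (\<lambda>x. (indicator V x * f x)\<^sup>2)"
proof -
  have "(indicator V x * f x)\<^sup>2 = indicator V x * (f x)\<^sup>2" for x
    by (auto simp: indicator_def)
  then show ?thesis by (simp add: L2_def set_borel_measurable_def set_integrable_def)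
qed

lemma integrable_mult_square:
  fixes f g :: "'x \<Rightarrow> real"
  assumes [measurable]: "f \<in> borel_measurable M" "g \<in> borel_measurable M"
    and "integrable M (\<lambda>x. (f x)\<^sup>2)" "integrable M (\<lambda>x. (g x)\<^sup>2)"
  shows "integrable M (\<lambda>x. f x * g x)"
proof (rule Bochner_Integration.integrable_bound)
  show "integrable M (\<lambda>x. (f x)\<^sup>2 + (g x)\<^sup>2)" using assms by auto
  show "AE x in M. norm (f x * g x) \<le> norm ((f x)\<^sup>2 + (g x)\<^sup>2)"
  proof (rule AE_I2)
    fix x
    have "2 * (\<bar>f x\<bar> * \<bar>g x\<bar>) \<le> (f x)\<^sup>2 + (g x)\<^sup>2"
      using sum_squares_bound[of "\<bar>f x\<bar>" "\<bar>g x\<bar>"] by simp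
    then show "norm (f x * g x) \<le> norm ((f x)\<^sup>2 + (g x)\<^sup>2)"
      by (simp add: abs_mult) (smt (verit) abs_ge_zero mult_nonneg_nonneg)
  qed
qed auto

lemma L2_mult:
  assumes "f \<in> L2 M V" "g \<in> L2 M V"
  shows "set_integrable M V (\<lambda>x. f x * g x)"
proof -
  have "integrable M (\<lambda>x. (indicator V x * f x) * (indicator V x * g x))"
    using assms by (intro integrable_mult_square) (auto simp: L2_iff)
  moreover have "(indicator V x * f x) * (indicator V x * g x) = indicator V x *\<^sub>R (f x * g x)" for x
    by (auto simp: indicator_def)
  ultimately show ?thesis by (simp add: set_integrable_def)
qed

lemma L2_lin:
  assumes "f \<in> L2 M V" "g \<in> L2 M V"
  shows "(\<lambda>x. a * f x + b * g x) \<in> L2 M V"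
proof -
  let ?f = "\<lambda>x. indicator V x * f x" and ?g = "\<lambda>x. indicator V x * g x"
  have eq: "indicator V x * (a * f x + b * g x) = a * ?f x + b * ?g x" for x
    by (simp add: algebra_simps)
  have m[measurable]: "?f \<in> borel_measurable M" "?g \<in> borel_measurable M"
    and i: "integrable M (\<lambda>x. (?f x)\<^sup>2)" "integrable M (\<lambda>x. (?g x)\<^sup>2)"
    using assms by (auto simp: L2_iff)
  have "integrable M (\<lambda>x. a\<^sup>2 * (?f x)\<^sup>2 + (2 * a * b) * (?f x * ?g x) + b\<^sup>2 * (?g x)\<^sup>2)"
    using i integrable_mult_square[OF m i] by (intro Bochner_Integration.integrable_add) auto
  moreover have "a\<^sup>2 * (?f x)\<^sup>2 + (2 * a * b) * (?f x * ?g x) + b\<^sup>2 * (?g x)\<^sup>2 = (a * ?f x + b * ?g x)\<^sup>2" for x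
    by (simp add: power2_eq_square algebra_simps)
  ultimately show ?thesis
    unfolding L2_iff eq by simp
qed

lemma L2_semi_inner_product: "semi_inner_product (L2 M V) (\<lambda>f g. LINT x:V|M. f x * g x)"
proof
  fix u v w and a b :: real assume uv: "u \<in> L2 M V" "v \<in> L2 M V" and w: "w \<in> L2 M V"
  have "(LINT x:V|M. a * (u x * w x) + b * (v x * w x)) = a * (LINT x:V|M. u x * w x) + b * (LINT x:V|M. v x * w x)"
    using L2_mult[OF uv(1) w] L2_mult[OF uv(2) w] by (simp add: set_integral_add)
  then show "(LINT x:V|M. (a * u x + b * v x) * w x) = a * (LINT x:V|M. u x * w x) + b * (LINT x:V|M. v x * w x)"
    by (simp add: algebra_simps)
next
  fix u assume "u \<in> L2 M V"
  show "0 \<le> (LINT x:V|M. u x * u x)" unfolding set_lebesgue_integral_def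
    by (intro integral_nonneg_AE) (auto simp: indicator_def)
qed (auto simp: L2_lin mult.commute)

text \<open>The sum of \<open>2 ^ k * (s k x)\<^sup>2\<close> has a finite integral, hence is finite
  almost everywhere, and \<open>s k x \<le> 2 ^ k * (s k x)\<^sup>2 + (1/2) ^ k\<close> by the
  inequality between arithmetic and geometric means.\<close>

lemma fast_Cauchy_AE:
  fixes s :: "nat \<Rightarrow> 'x \<Rightarrow> real"
  assumes [measurable]: "\<And>k. s k \<in> borel_measurable M" and nonneg: "\<And>k x. s k x \<ge> 0"
    and int: "\<And>k. (\<integral>\<^sup>+x. ennreal ((s k x)\<^sup>2) \<partial>M) \<le> ennreal ((1/4) ^ k)"
  shows "AE x in M. summable (\<lambda>k. s k x)"
proof -
  have "(\<integral>\<^sup>+x. (\<Sum>k. ennreal (2 ^ k * (s k x)\<^sup>2)) \<partial>M) = (\<Sum>k. \<integral>\<^sup>+x. ennreal (2 ^ k * (s k x)\<^sup>2) \<partial>M)"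
    by (rule nn_integral_suminf) auto
  also have "\<dots> \<le> (\<Sum>k. ennreal ((1/2) ^ k))"
  proof (intro suminf_le allI)
    fix k
    have "(\<integral>\<^sup>+x. ennreal (2 ^ k * (s k x)\<^sup>2) \<partial>M) = ennreal (2 ^ k) * (\<integral>\<^sup>+x. ennreal ((s k x)\<^sup>2) \<partial>M)"
      by (simp add: ennreal_mult nn_integral_cmult)
    also have "\<dots> \<le> ennreal (2 ^ k) * ennreal ((1/4) ^ k)" by (intro mult_left_mono int) auto
    also have "\<dots> = ennreal ((1/2) ^ k)"
      by (simp add: ennreal_mult[symmetric] power_mult_distrib[symmetric])
    finally show "(\<integral>\<^sup>+x. ennreal (2 ^ k * (s k x)\<^sup>2) \<partial>M) \<le> ennreal ((1/2) ^ k)" .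
  qed auto
  also have "(\<Sum>k. ennreal ((1/2) ^ k)) = ennreal (\<Sum>k. (1/2) ^ k)"
    by (rule suminf_ennreal2) (auto simp: summable_geometric)
  also have "\<dots> < \<infinity>" by simp
  finally have "AE x in M. (\<Sum>k. ennreal (2 ^ k * (s k x)\<^sup>2)) \<noteq> \<infinity>"
    by (intro nn_integral_PInf_AE) auto
  then show ?thesis
  proof eventually_elim
    fix x assume fin: "(\<Sum>k. ennreal (2 ^ k * (s k x)\<^sup>2)) \<noteq> \<infinity>"
    then have sm: "summable (\<lambda>k. 2 ^ k * (s k x)\<^sup>2)"
      by (intro summable_suminf_not_top) (auto simp: top_unique)
    show "summable (\<lambda>k. s k x)"
    proof (rule summable_comparison_test'[where N = 0])
      show "summable (\<lambda>k. 2 ^ k * (s k x)\<^sup>2 + (1/2) ^ k)"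
        by (intro summable_add sm summable_geometric) auto
      fix k
      have "sqrt (2 ^ k) * sqrt ((1/2) ^ k) = sqrt ((2 * (1/2)) ^ k)"
        by (simp only: real_sqrt_mult power_mult_distrib)
      then have "sqrt (2 ^ k) * sqrt ((1/2) ^ k) = 1" by simp
      then have "2 * s k x = 2 * (sqrt (2 ^ k) * s k x) * sqrt ((1/2) ^ k)" by (metis mult.assoc mult.commute mult.right_neutral)
      also have "\<dots> \<le> (sqrt (2 ^ k) * s k x)\<^sup>2 + (sqrt ((1/2) ^ k))\<^sup>2" by (rule sum_squares_bound)
      finally show "norm (s k x) \<le> 2 ^ k * (s k x)\<^sup>2 + (1/2) ^ k"
        using nonneg[of k x] by (simp add: power_mult_distrib)
    qed
  qed
qed

text \<open>A subsequence along which consecutive distances decay geometrically.\<close>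
lemma fast_subsequence:
  fixes d :: "nat \<Rightarrow> nat \<Rightarrow> real"
  assumes "\<And>e. e > 0 \<Longrightarrow> \<exists>N. \<forall>m\<ge>N. \<forall>n\<ge>N. d m n < e"
  obtains r where "strict_mono r" "\<And>k m n. m \<ge> r k \<Longrightarrow> n \<ge> r k \<Longrightarrow> d m n < (1/2) ^ k"
proof -
  obtain N where N: "\<And>k m n. m \<ge> N k \<Longrightarrow> n \<ge> N k \<Longrightarrow> d m n < (1/2) ^ k"
    using assms[of "(1/2) ^ _"] by (metis zero_less_divide_1_iff zero_less_numeral zero_less_power)
  define r where "r k = (\<Sum>i\<le>k. N i + 1)" for k
  have "strict_mono r" by (rule strict_monoI_Suc) (simp add: r_def)
  moreover have "N k \<le> r k" for k
    by (cases k) (auto simp: r_def)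
  ultimately show ?thesis using that N by (meson order_trans)
qed

text \<open>The argument of Riesz and Fischer, for functions whose values off \<open>V\<close> are
  arbitrary: a fast subsequence converges almost everywhere on \<open>V\<close>, and Fatou's lemma
  upgrades this to convergence of the full sequence in the mean.\<close>

lemma L2_complete:
  assumes V: "V \<in> sets M" and v: "\<And>n. v n \<in> L2 M V"
    and cau: "\<And>e. e > 0 \<Longrightarrow> \<exists>N. \<forall>m\<ge>N. \<forall>n\<ge>N. (LINT x:V|M. (v m x - v n x)\<^sup>2) < e"
  obtains h r where "h \<in> L2 M V" "(\<lambda>n. LINT x:V|M. (v n x - h x)\<^sup>2) \<longlonglongrightarrow> 0"
    "strict_mono r" "AE x in M. x \<in> V \<longrightarrow> (\<lambda>k. v (r k) x) \<longlonglongrightarrow> h x"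
proof -
  let ?f = "\<lambda>n x. indicator V x * v n x :: real"
  have m[measurable]: "?f n \<in> borel_measurable M" for n using v by (simp add: L2_iff)
  have vd: "(\<lambda>x. v m x - v n x) \<in> L2 M V" for m n
    using L2_lin[OF v v, of 1 m "-1" n] by simp
  have sq: "indicator V x *\<^sub>R (v m x - v n x)\<^sup>2 = (?f m x - ?f n x)\<^sup>2" for m n x
    by (auto simp: indicator_def)
  have int: "integrable M (\<lambda>x. (?f m x - ?f n x)\<^sup>2)" for m n
    using vd[of m n] unfolding L2_def set_integrable_def by (simp add: sq[unfolded real_scaleR_def])
  have nn: "(\<integral>\<^sup>+x. ennreal ((?f m x - ?f n x)\<^sup>2) \<partial>M) = ennreal (LINT x:V|M. (v m x - v n x)\<^sup>2)" for m n
    unfolding set_lebesgue_integral_def sq by (rule nn_integral_eq_integral[OF int]) auto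
  have "\<exists>N. \<forall>m\<ge>N. \<forall>n\<ge>N. sqrt (LINT x:V|M. (v m x - v n x)\<^sup>2) < e" if "e > 0" for e
  proof -
    from cau[of "e\<^sup>2"] that obtain N where "\<forall>m\<ge>N. \<forall>n\<ge>N. (LINT x:V|M. (v m x - v n x)\<^sup>2) < e\<^sup>2" by auto
    then have "sqrt (LINT x:V|M. (v m x - v n x)\<^sup>2) < e" if "m \<ge> N" "n \<ge> N" for m n
      using that real_sqrt_less_mono[of _ "e\<^sup>2"] \<open>e > 0\<close> by fastforce
    then show ?thesis by blast
  qed
  then obtain r where r: "strict_mono r" and rs: "\<And>k m n. m \<ge> r k \<Longrightarrow> n \<ge> r k \<Longrightarrow> sqrt (LINT x:V|M. (v m x - v n x)\<^sup>2) < (1/2) ^ k"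
    using fast_subsequence[of "\<lambda>m n. sqrt (LINT x:V|M. (v m x - v n x)\<^sup>2)"] by blast
  have nonneg: "0 \<le> (LINT x:V|M. (v m x - v n x)\<^sup>2)" for m n
    unfolding set_lebesgue_integral_def by (intro integral_nonneg_AE) auto
  have "AE x in M. summable (\<lambda>k. \<bar>?f (r (Suc k)) x - ?f (r k) x\<bar>)"
  proof (rule fast_Cauchy_AE)
    fix k
    have "sqrt (LINT x:V|M. (v (r (Suc k)) x - v (r k) x)\<^sup>2) < (1/2) ^ k"
      using r by (intro rs) (auto simp: strict_mono_less_eq)
    then have "(sqrt (LINT x:V|M. (v (r (Suc k)) x - v (r k) x)\<^sup>2))\<^sup>2 \<le> ((1/2) ^ k)\<^sup>2"
      using nonneg by (intro power_mono) auto
    then have "(LINT x:V|M. (v (r (Suc k)) x - v (r k) x)\<^sup>2) \<le> (1/4) ^ k"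
      using nonneg by (simp add: power_mult[symmetric] mult.commute power_mult power2_eq_square power_mult_distrib[symmetric])
    then show "(\<integral>\<^sup>+x. ennreal (\<bar>?f (r (Suc k)) x - ?f (r k) x\<bar>\<^sup>2) \<partial>M) \<le> ennreal ((1/4) ^ k)"
      by (simp add: nn ennreal_leI)
  qed auto
  then have conv: "AE x in M. convergent (\<lambda>k. ?f (r k) x)"
  proof eventually_elim
    case (elim x)
    have "summable (\<lambda>k. ?f (r (Suc k)) x - ?f (r k) x)" using elim by (rule summable_rabs_cancel)
    then have "convergent (\<lambda>n. \<Sum>k<n. ?f (r (Suc k)) x - ?f (r k) x)" by (simp add: summable_iff_convergent)
    then have "convergent (\<lambda>n. ?f (r n) x - ?f (r 0) x)" by (simp add: sum_lessThan_telescope[of "\<lambda>n. ?f (r n) x"])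
    then have "convergent (\<lambda>n. (?f (r n) x - ?f (r 0) x) + ?f (r 0) x)" by (rule convergent_add[OF _ convergent_const])
    then show ?case by simp
  qed
  \<comment> \<open>On the null set of divergence \<open>lim\<close> has some unspecified value. Off
    \<open>V\<close> the sequence is constantly 0, and so is \<open>h\<close>.\<close>
  define h where "h x = lim (\<lambda>k. ?f (r k) x)" for x
  have hm[measurable]: "h \<in> borel_measurable M" unfolding h_def by measurable
  have hlim: "AE x in M. (\<lambda>k. ?f (r k) x) \<longlonglongrightarrow> h x"
    using conv by eventually_elim (simp add: h_def convergent_LIMSEQ_iff)
  have hV: "AE x in M. x \<notin> V \<longrightarrow> h x = 0"
    by (rule AE_I2) (simp add: h_def)
  \<comment> \<open>With \<open>n\<close> fixed, the integrand is a pointwise limit along the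
    subsequence; its integral is bounded by the lower limit of the integrals, each controlled by
    \<open>rs\<close>.\<close>
  have fatou: "(\<integral>\<^sup>+x. ennreal ((?f n x - h x)\<^sup>2) \<partial>M) \<le> ennreal ((1/4) ^ k)" if "n \<ge> r k" for n k
  proof -
    have "(\<integral>\<^sup>+x. ennreal ((?f n x - h x)\<^sup>2) \<partial>M) = (\<integral>\<^sup>+x. liminf (\<lambda>j. ennreal ((?f n x - ?f (r j) x)\<^sup>2)) \<partial>M)"
    proof (rule nn_integral_cong_AE, use hlim in eventually_elim)
      case (elim x)
      have "(\<lambda>j. ennreal ((?f n x - ?f (r j) x)\<^sup>2)) \<longlonglongrightarrow> ennreal ((?f n x - h x)\<^sup>2)"
        by (intro tendsto_ennrealI tendsto_intros elim)
      then show ?case by (simp only: lim_imp_Liminf[OF trivial_limit_sequentially])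
    qed
    also have "\<dots> \<le> liminf (\<lambda>j. \<integral>\<^sup>+x. ennreal ((?f n x - ?f (r j) x)\<^sup>2) \<partial>M)"
      by (rule nn_integral_liminf) auto
    also have "\<dots> \<le> ennreal ((1/4) ^ k)"
    proof (rule Liminf_le)
      have "(\<integral>\<^sup>+x. ennreal ((?f n x - ?f (r j) x)\<^sup>2) \<partial>M) \<le> ennreal ((1/4) ^ k)" if "j \<ge> k" for j
      proof -
        have "sqrt (LINT x:V|M. (v n x - v (r j) x)\<^sup>2) < (1/2) ^ k"
          using r that \<open>n \<ge> r k\<close> by (intro rs) (auto simp: strict_mono_less_eq)
        then have "(sqrt (LINT x:V|M. (v n x - v (r j) x)\<^sup>2))\<^sup>2 \<le> ((1/2) ^ k)\<^sup>2"
          using nonneg by (intro power_mono) auto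
        then have "(LINT x:V|M. (v n x - v (r j) x)\<^sup>2) \<le> (1/4) ^ k"
          using nonneg by (simp add: power_mult[symmetric] mult.commute power_mult power2_eq_square power_mult_distrib[symmetric])
        then show ?thesis by (simp add: nn ennreal_leI)
      qed
      then show "\<forall>\<^sub>F j in sequentially. (\<integral>\<^sup>+x. ennreal ((?f n x - ?f (r j) x)\<^sup>2) \<partial>M) \<le> ennreal ((1/4) ^ k)"
        by (auto simp: eventually_sequentially)
    qed simp
    finally show ?thesis .
  qed
  have hV': "indicator V x * h x = h x" for x by (simp add: h_def indicator_def)
  have dint: "integrable M (\<lambda>x. (?f n x - h x)\<^sup>2)" if "n \<ge> r k" for n k
    by (rule integrableI_bounded) (use fatou[OF that] in \<open>auto simp: top_unique intro: le_less_trans\<close>)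
  have "(\<lambda>x. v (r 0) x - (v (r 0) x - h x)) \<in> L2 M V"
  proof -
    have "(\<lambda>x. v (r 0) x - h x) \<in> L2 M V"
      using dint[of 0 "r 0"] by (auto simp: L2_iff right_diff_distrib hV')
    from L2_lin[OF v[of "r 0"] this, of 1 "-1"] show ?thesis by simp
  qed
  then have hL: "h \<in> L2 M V" by simp
  have seq: "indicator V x *\<^sub>R (v n x - h x)\<^sup>2 = (?f n x - h x)\<^sup>2" for n x
    by (auto simp: indicator_def h_def)
  have le: "(LINT x:V|M. (v n x - h x)\<^sup>2) \<le> (1/4) ^ k" if "n \<ge> r k" for n k
  proof -
    have "ennreal (LINT x:V|M. (v n x - h x)\<^sup>2) \<le> ennreal ((1/4) ^ k)"
      unfolding set_lebesgue_integral_def seq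
      using fatou[OF that] by (subst nn_integral_eq_integral[symmetric]) (use dint[OF that] in auto)
    then show ?thesis by (simp add: ennreal_le_iff)
  qed
  have lim: "(\<lambda>n. LINT x:V|M. (v n x - h x)\<^sup>2) \<longlonglongrightarrow> 0"
  proof (rule LIMSEQ_I)
    fix e :: real assume "e > 0"
    then obtain k where k: "(1/4) ^ k < e" using real_arch_pow_inv[of e "1/4"] by auto
    have "0 \<le> (LINT x:V|M. (v n x - h x)\<^sup>2)" for n
      unfolding set_lebesgue_integral_def by (intro integral_nonneg_AE) auto
    then have "norm ((LINT x:V|M. (v n x - h x)\<^sup>2) - 0) < e" if "n \<ge> r k" for n
      using le[OF that] k by simp
    then show "\<exists>no. \<forall>n\<ge>no. norm ((LINT x:V|M. (v n x - h x)\<^sup>2) - 0) < e" by blast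
  qed
  have "AE x in M. x \<in> V \<longrightarrow> (\<lambda>k. v (r k) x) \<longlonglongrightarrow> h x"
    using hlim by eventually_elim (intro impI, simp)
  then show ?thesis by (rule that[OF hL lim r])
qed

section \<open>Partial derivatives and the fundamental lemma of the calculus of variations\<close>

lemma partial_has_derivative:
  fixes F :: "real^'n \<Rightarrow> real"
  assumes "F differentiable (at x)"
  shows "((\<lambda>s. F (x + s *\<^sub>R axis i 1)) has_real_derivative partial i F x) (at 0)"
proof -
  have "(F has_derivative frechet_derivative F (at x)) (at x)"
    using assms frechet_derivative_works by blast
  then have F: "(F has_derivative frechet_derivative F (at x)) (at (x + 0 *\<^sub>R axis i 1))" by simp
  have "((\<lambda>s::real. x + s *\<^sub>R axis i (1::real)) has_derivative (\<lambda>s. s *\<^sub>R axis i 1)) (at 0)"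
    by (auto intro!: derivative_eq_intros)
  from diff_chain_at[OF this F]
  have "((\<lambda>s. F (x + s *\<^sub>R axis i 1)) has_derivative (\<lambda>s. frechet_derivative F (at x) (s *\<^sub>R axis i 1))) (at 0)"
    by (simp add: o_def)
  moreover have "frechet_derivative F (at x) (s *\<^sub>R axis i 1) = partial i F x * s" for s
    using linear_scale[OF linear_frechet_derivative[OF assms]] by (simp add: partial_def)
  ultimately show ?thesis by (simp add: has_field_derivative_def)
qed

lemma partial_has_derivative':
  fixes F :: "real^'n \<Rightarrow> real"
  assumes "F differentiable (at (x + s *\<^sub>R axis i 1))"
  shows "((\<lambda>s. F (x + s *\<^sub>R axis i 1)) has_real_derivative partial i F (x + s *\<^sub>R axis i 1)) (at s)"
proof -
  have "((\<lambda>h. F ((x + s *\<^sub>R axis i 1) + h *\<^sub>R axis i 1)) has_real_derivative partial i F (x + s *\<^sub>R axis i 1)) (at 0)"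
    by (rule partial_has_derivative[OF assms])
  then have "((\<lambda>h. F (x + (h + s) *\<^sub>R axis i 1)) has_real_derivative partial i F (x + s *\<^sub>R axis i 1)) (at 0)"
    by (simp add: scaleR_add_left add_ac)
  then show ?thesis
    by (subst (asm) DERIV_shift[of "\<lambda>h. F (x + h *\<^sub>R axis i 1)" _ 0 s, symmetric]) simp
qed

lemma partial_cong_open:
  assumes "open S" "x \<in> S" "\<And>y. y \<in> S \<Longrightarrow> f y = g y"
  shows "partial i f x = partial i g x"
proof -
  have "(f has_derivative D) (at x) \<longleftrightarrow> (g has_derivative D) (at x)" for D
    using has_derivative_transform_within_open[OF _ assms(1,2)] assms(3) by metis
  then show ?thesis by (simp add: partial_def frechet_derivative_def)
qed

lemma partial_const: "partial i (\<lambda>x. c) x = 0"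
  by (simp add: partial_def frechet_derivative_const)

lemma partial_eqI:
  assumes "(f has_derivative D) (at x)"
  shows "partial i f x = D (axis i 1)"
  using frechet_derivative_at[OF assms] by (simp add: partial_def)

lemma differentiable_has_derivative: "f differentiable at x \<Longrightarrow> (f has_derivative frechet_derivative f (at x)) (at x)"
  using frechet_derivative_works by blast

lemma partial_lin:
  assumes "f differentiable at x" "g differentiable at x"
  shows "partial i (\<lambda>x. a * f x + b * g x) x = a * partial i f x + b * partial i g x"
  using assms[THEN differentiable_has_derivative]
  by (subst partial_eqI) (auto intro!: derivative_eq_intros simp: partial_def)

lemma partial_mult:
  assumes "f differentiable at x" "g differentiable at x"
  shows "partial i (\<lambda>x. f x * g x) x = f x * partial i g x + partial i f x * g x"
  using assms[THEN differentiable_has_derivative]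
  by (subst partial_eqI) (auto intro!: derivative_eq_intros simp: partial_def)

lemma partial_compose:
  assumes "f differentiable at x" "(\<phi> has_real_derivative d) (at (f x))"
  shows "partial i (\<lambda>x. \<phi> (f x)) x = d * partial i f x"
proof -
  have "((\<lambda>x. \<phi> (f x)) has_derivative (\<lambda>h. d * frechet_derivative f (at x) h)) (at x)"
    using diff_chain_at[OF differentiable_has_derivative[OF assms(1)] assms(2)[unfolded has_field_derivative_def]]
    by (simp add: o_def)
  from partial_eqI[OF this] show ?thesis by (simp add: partial_def)
qed

lemma integral_translate:
  fixes F :: "'e::euclidean_space \<Rightarrow> real"
  assumes "F \<in> borel_measurable borel"
  shows "(LINT x|lborel. F (x + c)) = (LINT x|lborel. F x)"
proof -
  have "(LINT x|lborel. F x) = (LINT x|distr lborel borel ((+) c). F x)"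
    by (simp add: lborel_distr_plus)
  also have "\<dots> = (LINT x|lborel. F (c + x))"
    using assms by (intro integral_distr) auto
  finally show ?thesis by (simp add: add.commute)
qed

lemma integrable_compact_support:
  fixes F :: "'e::euclidean_space \<Rightarrow> real"
  assumes "continuous_on UNIV F" "compact K" "\<And>x. x \<notin> K \<Longrightarrow> F x = 0"
  shows "integrable lborel F"
proof -
  have "set_integrable lborel K F"
    using borel_integrable_compact[OF assms(2) continuous_on_subset[OF assms(1)]]
    by (simp add: set_integrable_def)
  moreover have "(\<lambda>x. indicator K x *\<^sub>R F x) = F" by (rule ext) (use assms(3) in \<open>auto simp: indicator_def\<close>)
  ultimately show ?thesis by (simp add: set_integrable_def)
qed

text \<open>Difference quotients have integral zero by translation invariance.\<close>
lemma integral_partial_zero: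
  fixes F :: "real^'n \<Rightarrow> real"
  assumes diff: "\<And>x. F differentiable (at x)" and K: "compact K" and out: "\<And>x. x \<notin> K \<Longrightarrow> F x = 0"
    and cont: "continuous_on UNIV (partial i F)"
  shows "(LINT x|lborel. partial i F x) = 0"
proof -
  have contF: "continuous_on UNIV F"
    using diff by (simp add: continuous_at_imp_continuous_on differentiable_imp_continuous_within)
  have outp: "partial i F x = 0" if "x \<notin> K" for x
  proof -
    have "partial i F x = partial i (\<lambda>x. 0) x"
      by (rule partial_cong_open[of "- K"]) (use that out compact_imp_closed[OF K] in auto)
    then show ?thesis by (simp add: partial_const)
  qed
  have "bounded (partial i F ` K)"
    by (intro compact_imp_bounded compact_continuous_image K continuous_on_subset[OF cont]) auto
  then obtain C0 where C0: "\<And>x. x \<in> K \<Longrightarrow> \<bar>partial i F x\<bar> \<le> C0" unfolding bounded_iff by auto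
  define C where "C = max C0 0"
  have C: "\<bar>partial i F x\<bar> \<le> C" for x
    using C0[of x] outp[of x] by (cases "x \<in> K") (auto simp: C_def)
  obtain R where R: "\<And>x. x \<in> K \<Longrightarrow> norm x \<le> R"
    using compact_imp_bounded[OF K] unfolding bounded_iff by auto
  \<comment> \<open>Steps of size at most 1: all difference quotients vanish outside the ball of
    radius \<open>R + 1\<close>, and the mean value theorem bounds them by \<open>C\<close>. This
    yields the dominating function.\<close>
  define h where "h k = inverse (real (Suc k))" for k
  have h: "0 < h k" "h k \<le> 1" for k by (auto simp: h_def inverse_le_1_iff)
  define g where "g k x = (F (x + h k *\<^sub>R axis i 1) - F x) / h k" for k x
  have mF[measurable]: "F \<in> borel_measurable borel" using contF by (rule borel_measurable_continuous_onI)
  have mP[measurable]: "partial i F \<in> borel_measurable borel" using cont by (rule borel_measurable_continuous_onI)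
  have gC: "\<bar>g k x\<bar> \<le> C" for k x
  proof -
    have "norm (F (x + h k *\<^sub>R axis i 1) - F (x + 0 *\<^sub>R axis i 1)) \<le> C * norm (h k - 0)"
      by (rule field_differentiable_bound[where S = UNIV and f' = "\<lambda>s. partial i F (x + s *\<^sub>R axis i 1)"])
        (use C partial_has_derivative'[OF diff] in auto)
    then show ?thesis using h[of k] by (simp add: g_def field_simps)
  qed
  have g0: "g k x = 0" if "norm x > R + 1" for k x
  proof -
    have "norm (x + h k *\<^sub>R axis i 1) \<ge> norm x - h k"
      using norm_diff_ineq[of x "h k *\<^sub>R axis i 1"] h[of k] by simp
    then have "x + h k *\<^sub>R axis i 1 \<notin> K" "x \<notin> K" using R that h[of k] by fastforce+
    then show ?thesis by (simp add: g_def out)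
  qed
  have intF: "integrable lborel F" by (rule integrable_compact_support[OF contF K out])
  have "(LINT x|lborel. g k x) = 0" for k
  proof -
    have "integrable lborel (\<lambda>x. F (h k *\<^sub>R axis i 1 + x))"
      using integrable_distr_eq[of "(+) (h k *\<^sub>R axis i 1)" lborel borel F] intF by (simp add: lborel_distr_plus)
    then have "integrable lborel (\<lambda>x. F (x + h k *\<^sub>R axis i 1))" by (simp add: add.commute)
    then show ?thesis using intF unfolding g_def by (simp add: integral_translate)
  qed
  moreover have "(\<lambda>k. LINT x|lborel. g k x) \<longlonglongrightarrow> (LINT x|lborel. partial i F x)"
  proof (rule integral_dominated_convergence[where w = "\<lambda>x. C * indicator (cball 0 (R + 1)) x"])
    show "integrable lborel (\<lambda>x. C * indicator (cball (0::real^'n) (R + 1)) x)"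
      by (intro integrable_mult_right integrable_real_indicator) (use emeasure_bounded_finite[OF bounded_cball] in \<open>auto simp: less_top\<close>)
    show "AE x in lborel. (\<lambda>k. g k x) \<longlonglongrightarrow> partial i F x"
    proof (rule AE_I2)
      fix x
      have "((\<lambda>s. (F (x + s *\<^sub>R axis i 1) - F x) / s) \<longlongrightarrow> partial i F x) (at 0)"
        using partial_has_derivative[OF diff, of x i] by (simp add: has_field_derivative_iff)
      moreover have "filterlim h (at 0) sequentially"
        unfolding filterlim_at using LIMSEQ_inverse_real_of_nat h by (auto simp: h_def[abs_def])
      ultimately show "(\<lambda>k. g k x) \<longlonglongrightarrow> partial i F x"
        unfolding g_def by (rule filterlim_compose)
    qed
    show "AE x in lborel. norm (g k x) \<le> C * indicator (cball 0 (R + 1)) x" for k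
      using gC g0 by (auto simp: indicator_def not_le)
  qed (auto simp: g_def)
  ultimately show ?thesis by (simp add: LIMSEQ_const_iff)
qed

lemma compactly_supported_inI:
  fixes f :: "'a::t2_space \<Rightarrow> real"
  assumes "compact K" "K \<subseteq> S" "\<And>x. x \<notin> K \<Longrightarrow> f x = 0"
  shows "compactly_supported_in f S"
proof -
  have sub: "closure {x. f x \<noteq> 0} \<subseteq> K"
    using assms by (intro closure_minimal compact_imp_closed) auto
  then have "closure {x. f x \<noteq> 0} = K \<inter> closure {x. f x \<noteq> 0}" by auto
  then have "compact (closure {x. f x \<noteq> 0})" using assms(1) by (metis closed_closure compact_Int_closed)
  then show ?thesis using sub assms(2) by (auto simp: compactly_supported_in_def)
qed

text \<open>Boxes are preferred to balls because open boxes are stable under intersection and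
  generate the Borel sets. The cutoffs are bounded by 1, so dominated convergence passes from them
  to the indicator of the box.\<close>

lemma smooth_box_cutoff:
  fixes a b :: "real^'n"
  defines "\<eta> k y \<equiv> (\<Prod>i\<in>UNIV. smooth_step (real k * (y $ i - a $ i)) * smooth_step (real k * (b $ i - y $ i)))"
  shows "smooth_on (\<eta> k) UNIV" "0 \<le> \<eta> k y" "\<eta> k y \<le> 1" "y \<notin> box a b \<Longrightarrow> \<eta> k y = 0"
    "y \<in> box a b \<Longrightarrow> (\<lambda>k. \<eta> k y) \<longlonglongrightarrow> 1"
proof -
  have lin: "Ck_on m (\<lambda>y::real^'n. c * (y $ i) + d) UNIV" for m i c d
    by (intro Ck_on_add Ck_on_const open_UNIV Ck_on_bounded_linear)
      (auto intro: bounded_linear_compose[OF bounded_linear_mult_right bounded_linear_vec_nth])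
  have st: "Ck_on m (\<lambda>y::real^'n. smooth_step (c * (y $ i) + d)) UNIV" for m i c d
    using Ck_on_compose[OF open_UNIV open_UNIV subset_UNIV lin smooth_onD[OF smooth_smooth_step]] .
  have "Ck_on m (\<eta> k) UNIV" for m
    unfolding \<eta>_def[abs_def]
    using st[of m "real k" _ "- real k * a $ _"] st[of m "- real k" _ "real k * b $ _"]
    by (intro Ck_on_prod Ck_on_mult) (auto simp: algebra_simps)
  then show "smooth_on (\<eta> k) UNIV" by (simp add: smooth_on_def)
  show "0 \<le> \<eta> k y" "\<eta> k y \<le> 1"
    unfolding \<eta>_def by (auto intro!: prod_nonneg prod_le_1 mult_le_one simp: smooth_step_bounds)
  show "\<eta> k y = 0" if "y \<notin> box a b"
  proof -
    from that obtain i where "\<not> (a $ i < y $ i \<and> y $ i < b $ i)" by (auto simp: mem_box_cart)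
    then have "smooth_step (real k * (y $ i - a $ i)) * smooth_step (real k * (b $ i - y $ i)) = 0"
      by (auto simp: not_less intro!: smooth_step_0 mult_nonneg_nonpos)
    then show ?thesis unfolding \<eta>_def by (intro prod_zero) auto
  qed
  show "(\<lambda>k. \<eta> k y) \<longlonglongrightarrow> 1" if y: "y \<in> box a b"
  proof -
    have one: "(\<lambda>k. smooth_step (real k * d)) \<longlonglongrightarrow> 1" if "d > 0" for d
    proof (rule tendsto_eventually)
      obtain n :: nat where n: "1 / d \<le> real n" using real_arch_simple by blast
      have "smooth_step (real k * d) = 1" if "k \<ge> n" for k
      proof -
        have "1 / d \<le> real k" using n that by linarith
        then show ?thesis using \<open>d > 0\<close> by (intro smooth_step_1) (simp add: field_simps)
      qed
      then show "\<forall>\<^sub>F k in sequentially. smooth_step (real k * d) = 1" by (auto simp: eventually_sequentially)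
    qed
    have "(\<lambda>k. \<eta> k y) \<longlonglongrightarrow> (\<Prod>i\<in>(UNIV::'n set). 1 * 1)"
      unfolding \<eta>_def using y by (intro tendsto_prod tendsto_mult one) (auto simp: mem_box_cart)
    then show ?thesis by simp
  qed
qed

text \<open>No mollification is involved. Smooth cutoffs exhaust a box, so \<open>D\<close> has
  integral zero over every box whose closure lies in \<open>S\<close>; the pi-lambda theorem extends
  this to all Borel subsets of such a box, and countably many boxes cover \<open>S\<close>.\<close>

lemma fundamental_lemma_calculus_of_variations:
  fixes D :: "real^'n \<Rightarrow> real"
  assumes S: "open S" and loc: "\<And>K. compact K \<Longrightarrow> K \<subseteq> S \<Longrightarrow> set_integrable lborel K D"
    and zero: "\<And>\<eta>. smooth_on \<eta> UNIV \<Longrightarrow> compactly_supported_in \<eta> S \<Longrightarrow> (LINT y|lborel. D y * \<eta> y) = 0"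
  shows "AE y in lborel. y \<in> S \<longrightarrow> D y = 0"
proof -
  have box0: "(LINT y:box a b|lborel. D y) = 0" if sub: "cbox a b \<subseteq> S" for a b
  proof -
    let ?\<eta> = "\<lambda>k y. (\<Prod>i\<in>UNIV. smooth_step (real k * (y $ i - a $ i)) * smooth_step (real k * (b $ i - y $ i)))"
    note \<eta> = smooth_box_cutoff[where a = a and b = b]
    let ?D = "\<lambda>y. indicator (cbox a b) y *\<^sub>R D y"
    have iD: "integrable lborel ?D" using loc[OF compact_cbox sub] by (simp add: set_integrable_def)
    then have mD[measurable]: "?D \<in> borel_measurable borel" by auto
    have m\<eta>[measurable]: "?\<eta> k \<in> borel_measurable borel" for k
      by (rule borel_measurable_continuous_onI[OF smooth_on_continuous[OF \<eta>(1)]])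
    have D\<eta>: "D y * ?\<eta> k y = ?D y * ?\<eta> k y" for k y
      using \<eta>(4)[of y k] box_subset_cbox[of a b] by (cases "y \<in> box a b") (auto simp: indicator_def)
    have "(LINT y|lborel. D y * ?\<eta> k y) = 0" for k
    proof (rule zero[OF \<eta>(1)])
      show "compactly_supported_in (?\<eta> k) S"
        by (rule compactly_supported_inI[OF compact_cbox sub]) (use \<eta>(4)[of _ k] box_subset_cbox[of a b] in blast)
    qed
    moreover have "(\<lambda>k. LINT y|lborel. D y * ?\<eta> k y) \<longlonglongrightarrow> (LINT y|lborel. indicator (box a b) y *\<^sub>R D y)"
    proof (rule integral_dominated_convergence[where w = "\<lambda>y. norm (?D y)"])
      show "integrable lborel (\<lambda>y. norm (?D y))" using iD by (rule integrable_norm)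
      have "(\<lambda>y. indicator (box a b) y *\<^sub>R D y) = (\<lambda>y. indicator (box a b) y *\<^sub>R ?D y)"
        using box_subset_cbox[of a b] by (intro ext) (auto simp: indicator_def)
      then show "(\<lambda>y. indicator (box a b) y *\<^sub>R D y) \<in> borel_measurable lborel" by (simp only:) measurable
      show "(\<lambda>y. D y * ?\<eta> k y) \<in> borel_measurable lborel" for k unfolding D\<eta> by measurable
      show "AE y in lborel. (\<lambda>k. D y * ?\<eta> k y) \<longlonglongrightarrow> indicator (box a b) y *\<^sub>R D y"
      proof (rule AE_I2)
        fix y show "(\<lambda>k. D y * ?\<eta> k y) \<longlonglongrightarrow> indicator (box a b) y *\<^sub>R D y"
        proof (cases "y \<in> box a b")
          case True
          then show ?thesis using tendsto_mult[OF tendsto_const \<eta>(5)[of y], of "D y"] by simp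
        next
          case False
          show ?thesis unfolding \<eta>(4)[OF False] using False by simp
        qed
      qed
      show "AE y in lborel. norm (D y * ?\<eta> k y) \<le> norm (?D y)" for k
      proof -
        have "norm (d * e) \<le> norm d" if "0 \<le> e" "e \<le> 1" for d e :: real
          using that by (simp add: abs_mult mult_left_le)
        then show ?thesis unfolding D\<eta> by (intro AE_I2) (use \<eta>(2,3) in blast)
      qed
    qed
    ultimately show ?thesis by (simp add: LIMSEQ_const_iff set_lebesgue_integral_def)
  qed
  have cb: "AE y in lborel. y \<in> box a b \<longrightarrow> D y = 0" if sub: "cbox a b \<subseteq> S" for a b
  proof -
    let ?D = "\<lambda>y. indicator (box a b) y *\<^sub>R D y"
    have iD: "integrable lborel ?D"
      using set_integrable_subset[OF loc[OF compact_cbox sub], of "box a b"] box_subset_cbox[of a b]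
      by (simp add: set_integrable_def)
    have ind: "set_lebesgue_integral lborel A ?D = (LINT y:A \<inter> box a b|lborel. D y)" for A
      unfolding set_lebesgue_integral_def by (intro Bochner_Integration.integral_cong) (auto simp: indicator_def)
    have iA: "set_integrable lborel A ?D" if "A \<in> sets borel" for A
      using integrable_mult_indicator[of A lborel ?D] iD that by (simp add: set_integrable_def)
    have "set_lebesgue_integral lborel A ?D = 0" if "A \<in> sets borel" for A
    proof -
      let ?G = "range (\<lambda>(a, b). box a b :: (real^'n) set)"
      have sb: "sets borel = sigma_sets UNIV ?G" by (subst borel_eq_box) simp
      have "Int_stable ?G"
        by (auto simp: Int_stable_def box_Int_box)
      moreover have "?G \<subseteq> Pow UNIV" by simp
      moreover have "A \<in> sigma_sets UNIV ?G" using that sb by simp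
      ultimately show ?thesis
      proof (induction rule: sigma_sets_induct_disjoint)
        case (basic A)
        then obtain c d where A: "A = box c d" by auto
        \<comment> \<open>The intersection of two open boxes is an open box. If it is nonempty,
          taking closures shows that its closed box still lies in \<open>S\<close>, so
          \<open>box0\<close> applies.\<close>
        obtain e f where ef: "box c d \<inter> box a b = box e f" using box_Int_box by blast
        show ?case
        proof (cases "box e f = {}")
          case True
          then show ?thesis unfolding ind A ef by (simp add: set_lebesgue_integral_def)
        next
          case False
          have "box e f \<subseteq> box a b" using ef by blast
          then have "closure (box e f) \<subseteq> closure (box a b)" "box a b \<noteq> {}" using False by (auto simp del: closure_box intro: closure_mono[THEN subsetD])
          then have "cbox e f \<subseteq> cbox a b" using False by (simp add: closure_box)
          then show ?thesis unfolding ind A ef using box0[of e f] sub by blast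
        qed
      next
        case empty
        show ?case by (simp add: set_lebesgue_integral_def)
      next
        case (compl A)
        have A: "A \<in> sets borel" using compl sb by simp
        have "set_lebesgue_integral lborel (A \<union> (UNIV - A)) ?D = set_lebesgue_integral lborel A ?D + set_lebesgue_integral lborel (UNIV - A) ?D"
          using A by (intro set_integral_Un iA) auto
        moreover have "set_lebesgue_integral lborel (A \<union> (UNIV - A)) ?D = 0"
          using ind[of UNIV] box0[OF sub] by simp
        ultimately show ?case using compl by simp
      next
        case (union A)
        have A: "A i \<in> sets borel" for i using union sb by auto
        have "(\<Sum>i. set_lebesgue_integral lborel (A i) ?D) = set_lebesgue_integral lborel (\<Union>i. A i) ?D"
          by (rule lebesgue_integral_countable_add[symmetric]) (use A union iA in \<open>auto simp: disjoint_family_on_def\<close>)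
        then show ?case using union by simp
      qed
    qed
    then have "AE y in lborel. ?D y = 0" by (intro sigma_finite_measure.density_zero[OF sigma_finite_lborel] iD) auto
    then show ?thesis by eventually_elim (simp add: indicator_def)
  qed
  let ?\<F> = "{box a b |a b. cbox a b \<subseteq> S}"
  obtain \<F>' where F': "\<F>' \<subseteq> ?\<F>" "countable \<F>'" "\<Union>\<F>' = \<Union>?\<F>"
  proof (rule Lindelof)
    show "open X" if "X \<in> ?\<F>" for X using that open_box by blast
  qed
  have cover: "S \<subseteq> \<Union>?\<F>"
  proof
    fix y assume y: "y \<in> S"
    obtain a b where "cbox a b \<subseteq> S" "y \<in> box a b" "\<forall>i\<in>Basis. a \<bullet> i < b \<bullet> i"
      by (rule open_contains_cbox[OF S y])
    then have "box a b \<in> ?\<F>" by blast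
    then show "y \<in> \<Union>?\<F>" using \<open>y \<in> box a b\<close> by (rule UnionI)
  qed
  have "AE y in lborel. \<forall>X\<in>\<F>'. y \<in> X \<longrightarrow> D y = 0"
    unfolding AE_ball_countable[OF F'(2)]
  proof
    fix X assume "X \<in> \<F>'"
    then obtain a b where "X = box a b" "cbox a b \<subseteq> S" using F'(1) by blast
    then show "AE y in lborel. y \<in> X \<longrightarrow> D y = 0" using cb by simp
  qed
  then show ?thesis
  proof eventually_elim
    case (elim y)
    show ?case
    proof
      assume "y \<in> S"
      then have "y \<in> \<Union>\<F>'" using cover F'(3) by (metis subsetD)
      then show "D y = 0" using elim by (metis UnionE)
    qed
  qed
qed

section \<open>Positive definite matrices; charts, Jacobians and the metric\<close>

lemma inner_matrix_transpose: "(transpose A *v x) \<bullet> y = x \<bullet> (A *v y)" for A :: "real^'n^'m"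
  by (metis dot_lmul_matrix transpose_matrix_vector)

lemma posdef_det_nonzero:
  fixes A :: "real^'n^'n"
  assumes "\<And>v. v \<noteq> 0 \<Longrightarrow> v \<bullet> (A *v v) > 0"
  shows "det A \<noteq> 0"
proof -
  have "v = 0" if "A *v v = 0" for v using assms[of v] that by force
  then have "inj ((*v) A)" by (simp add: inj_matrix_vector_mult matrix_left_invertible_ker matrix_left_invertible_injective[symmetric])
  then show ?thesis by (metis invertible_det_nz invertible_left_inverse matrix_left_invertible_injective)
qed

text \<open>Along the segment from the identity the determinant does not vanish, so it keeps its sign.\<close>
lemma posdef_det_pos:
  fixes A :: "real^'n^'n"
  assumes "\<And>v. v \<noteq> 0 \<Longrightarrow> v \<bullet> (A *v v) > 0"
  shows "det A > 0"
proof (rule ccontr)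
  assume "\<not> det A > 0"
  define P where "P t = (\<chi> i j. (1 - t) * (mat 1 :: real^'n^'n) $ i $ j + t * A $ i $ j)" for t :: real
  have Pv: "P t *v v = (1 - t) *\<^sub>R v + t *\<^sub>R (A *v v)" for t v
  proof -
    have "P t = (1 - t) *\<^sub>R mat 1 + t *\<^sub>R A" by (simp add: P_def vec_eq_iff)
    then show ?thesis
      by (simp add: matrix_vector_mult_add_rdistrib scaleR_matrix_vector_assoc[symmetric])
  qed
  have nz: "det (P t) \<noteq> 0" if "0 \<le> t" "t \<le> 1" for t
  proof (rule posdef_det_nonzero)
    fix v :: "real^'n" assume v: "v \<noteq> 0"
    have "v \<bullet> (P t *v v) = (1 - t) * (v \<bullet> v) + t * (v \<bullet> (A *v v))" by (simp add: Pv inner_add_right)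
    moreover have "(1 - t) * (v \<bullet> v) \<ge> 0" "t * (v \<bullet> (A *v v)) \<ge> 0" using that assms[OF v] by auto
    moreover have "(1 - t) * (v \<bullet> v) > 0 \<or> t * (v \<bullet> (A *v v)) > 0"
      using that assms[OF v] v by (cases "t = 1") auto
    ultimately show "v \<bullet> (P t *v v) > 0" by linarith
  qed
  have "P 1 = A" "P 0 = mat 1" by (simp_all add: P_def vec_eq_iff)
  then have "det (P 1) \<le> 0" "0 \<le> det (P 0)" using \<open>\<not> det A > 0\<close> by (simp_all add: det_I)
  moreover have "continuous_on {0..1} (\<lambda>t. det (P t))"
    unfolding det_def P_def by (intro continuous_intros)
  ultimately obtain t where "0 \<le> t" "t \<le> 1" "det (P t) = 0"
    using IVT2'[of "\<lambda>t. det (P t)" 1 0 0] by auto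
  then show False using nz by blast
qed

locale riemannian =
  fixes G :: "('a::{t2_space, second_countable_topology}, 'n::finite) riemannian_structure"
    and \<nu> :: "'a measure"
  assumes manifold: "oriented_riemannian_manifold G"
    and volume: "is_riemannian_volume G \<nu>"
begin

abbreviation img :: "('a, 'n) chart \<Rightarrow> (real^'n) set" where "img c \<equiv> snd c ` fst c"
text \<open>The density of the Riemannian volume with respect to Lebesgue measure in the
  chart.\<close>

definition rho :: "('a, 'n) chart \<Rightarrow> real^'n \<Rightarrow> real" where
  "rho c y = sqrt (det (metric G c (chart_inv c y)))"

lemma sets_nu[measurable_cong, simp]: "sets \<nu> = sets borel"
  using volume by (simp add: is_riemannian_volume_def)

lemma emeasure_chart:
  assumes "c \<in> atlas G" "E \<in> sets borel" "E \<subseteq> fst c"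
  shows "emeasure \<nu> E = (\<integral>\<^sup>+y\<in>snd c ` E. ennreal (rho c y) \<partial>lborel)"
  using volume assms unfolding is_riemannian_volume_def rho_def by blast

lemma space_nu[simp]: "space \<nu> = UNIV"
  using sets_eq_imp_space_eq[OF sets_nu] by simp

lemma oriented_atlas: "oriented_smooth_atlas (atlas G)"
  using manifold by (simp add: oriented_riemannian_manifold_def)

lemma is_chart: "c \<in> atlas G \<Longrightarrow> is_chart c"
  using oriented_atlas by (simp add: oriented_smooth_atlas_def)

lemma open_dom: "c \<in> atlas G \<Longrightarrow> open (fst c)"
  and open_img: "c \<in> atlas G \<Longrightarrow> open (img c)"
  and homeo: "c \<in> atlas G \<Longrightarrow> homeomorphism (fst c) (img c) (snd c) (chart_inv c)"
  using is_chart by (auto simp: is_chart_def)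

lemma inj_chart: "c \<in> atlas G \<Longrightarrow> inj_on (snd c) (fst c)"
  using homeo unfolding homeomorphism_def by (metis inj_onI)

lemma chart_inv_chart: "c \<in> atlas G \<Longrightarrow> p \<in> fst c \<Longrightarrow> chart_inv c (snd c p) = p"
  using inj_chart by simp

lemma chart_chart_inv: "y \<in> img c \<Longrightarrow> snd c (chart_inv c y) = y"
  by (rule f_inv_into_f)

lemma chart_inv_dom: "y \<in> img c \<Longrightarrow> chart_inv c y \<in> fst c"
  by (rule inv_into_into)

lemma continuous_chart: "c \<in> atlas G \<Longrightarrow> continuous_on (fst c) (snd c)"
  and continuous_chart_inv: "c \<in> atlas G \<Longrightarrow> continuous_on (img c) (chart_inv c)"
  using homeo unfolding homeomorphism_def by auto

lemma atlas_covers: "\<exists>c\<in>atlas G. p \<in> fst c"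
  using oriented_atlas by (auto simp: oriented_smooth_atlas_def)

lemma chart_at: "chart_at G p \<in> atlas G" "p \<in> fst (chart_at G p)"
proof -
  have "\<exists>c. c \<in> atlas G \<and> p \<in> fst c" using atlas_covers by blast
  from someI_ex[OF this] show "chart_at G p \<in> atlas G" "p \<in> fst (chart_at G p)"
    by (auto simp: chart_at_def)
qed

lemma open_chart_image:
  assumes "c \<in> atlas G" "open U" shows "open (snd c ` (U \<inter> fst c))"
proof -
  have "snd c ` (U \<inter> fst c) = img c \<inter> chart_inv c -` U"
    using assms(1) by (auto simp: chart_inv_chart chart_inv_dom chart_chart_inv image_iff)
  then show ?thesis
    using continuous_open_preimage[OF continuous_chart_inv open_img assms(2)] assms(1) by simp
qed

lemma open_chart_preimage:
  assumes "c \<in> atlas G" "open U" shows "open {p \<in> fst c. snd c p \<in> U}"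
  using continuous_open_preimage[OF continuous_chart open_dom assms(2)] assms(1)
  by (simp add: vimage_def Int_def)

lemma transition_apply: "p \<in> fst c \<Longrightarrow> c \<in> atlas G \<Longrightarrow> transition c c' (snd c p) = snd c' p"
  by (simp add: transition_def chart_inv_chart)

lemma smooth_transition:
  "c \<in> atlas G \<Longrightarrow> c' \<in> atlas G \<Longrightarrow> smooth_on (transition c c') (snd c ` (fst c \<inter> fst c'))"
  using oriented_atlas by (simp add: oriented_smooth_atlas_def)

lemma open_overlap: "c \<in> atlas G \<Longrightarrow> c' \<in> atlas G \<Longrightarrow> open (snd c ` (fst c \<inter> fst c'))"
  using open_chart_image[of c "fst c'"] open_dom[of c'] by (simp add: Int_commute)

lemma transition_has_derivative:
  assumes "c \<in> atlas G" "c' \<in> atlas G" "p \<in> fst c" "p \<in> fst c'"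
  shows "(transition c c' has_derivative (*v) (jacobian c c' p)) (at (snd c p))"
proof -
  have "transition c c' differentiable at (snd c p)"
    using smooth_on_differentiable[OF smooth_transition] assms by blast
  then have "(transition c c' has_derivative frechet_derivative (transition c c') (at (snd c p))) (at (snd c p))"
    by (rule differentiable_has_derivative)
  moreover have "frechet_derivative (transition c c') (at (snd c p)) = (*v) (jacobian c c' p)"
    using calculation by (simp add: jacobian_def matrix_works has_derivative_linear fun_eq_iff)
  ultimately show ?thesis by simp
qed

lemma jacobian_eqI:
  assumes "(transition c c' has_derivative (*v) A) (at (snd c p))"
  shows "jacobian c c' p = A"
  using frechet_derivative_at[OF assms] by (simp add: jacobian_def)
    (metis matrix_of_matrix_vector_mul)

text \<open>The cocycle law of the Jacobians; it makes the coordinate fields of a chart obey the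
  transformation law of vector fields.\<close>

lemma jacobian_chain:
  assumes c: "c \<in> atlas G" "c' \<in> atlas G" "c'' \<in> atlas G" and p: "p \<in> fst c" "p \<in> fst c'" "p \<in> fst c''"
  shows "jacobian c' c'' p ** jacobian c c' p = jacobian c c'' p"
proof (rule jacobian_eqI[symmetric])
  have "(transition c' c'' \<circ> transition c c' has_derivative (*v) (jacobian c' c'' p) \<circ> (*v) (jacobian c c' p)) (at (snd c p))"
    using diff_chain_at[OF transition_has_derivative[OF c(1,2) p(1,2)], of "transition c' c''"]
      transition_has_derivative[OF c(2,3) p(2,3)] by (simp add: transition_apply c p)
  moreover have "(*v) (jacobian c' c'' p) \<circ> (*v) (jacobian c c' p) = (*v) (jacobian c' c'' p ** jacobian c c' p)"
    by (simp add: fun_eq_iff matrix_vector_mul_assoc)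
  ultimately have "(transition c' c'' \<circ> transition c c' has_derivative (*v) (jacobian c' c'' p ** jacobian c c' p)) (at (snd c p))"
    by simp
  then show "(transition c c'' has_derivative (*v) (jacobian c' c'' p ** jacobian c c' p)) (at (snd c p))"
  proof (rule has_derivative_transform_within_open[OF _ open_overlap[OF c(1,2)]])
    show "snd c p \<in> snd c ` (fst c \<inter> fst c')" using p by auto
  qed (auto simp: transition_def c chart_inv_chart)
qed

lemma jacobian_self: "c \<in> atlas G \<Longrightarrow> p \<in> fst c \<Longrightarrow> jacobian c c p = mat 1"
proof (rule jacobian_eqI)
  assume c: "c \<in> atlas G" "p \<in> fst c"
  have "((\<lambda>y. y) has_derivative (*v) (mat 1)) (at (snd c p))"
    by (simp add: has_derivative_ident fun_eq_iff[symmetric] eta_contract_eq matrix_vector_mul_lid[abs_def])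
  then show "(transition c c has_derivative (*v) (mat 1)) (at (snd c p))"
    by (rule has_derivative_transform_within_open[OF _ open_img[OF c(1)]])
      (use c in \<open>auto simp: transition_def chart_inv_chart\<close>)
qed

lemma metric_sym: "c \<in> atlas G \<Longrightarrow> p \<in> fst c \<Longrightarrow> transpose (metric G c p) = metric G c p"
  and metric_pos: "c \<in> atlas G \<Longrightarrow> p \<in> fst c \<Longrightarrow> v \<noteq> 0 \<Longrightarrow> v \<bullet> (metric G c p *v v) > 0"
  and smooth_metric: "c \<in> atlas G \<Longrightarrow> smooth_on (metric G c \<circ> chart_inv c) (img c)"
  and metric_change: "c \<in> atlas G \<Longrightarrow> c' \<in> atlas G \<Longrightarrow> p \<in> fst c \<Longrightarrow> p \<in> fst c' \<Longrightarrow>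
      metric G c p = transpose (jacobian c c' p) ** metric G c' p ** jacobian c c' p"
  using manifold unfolding oriented_riemannian_manifold_def by blast+

lemma metric_nonneg: "c \<in> atlas G \<Longrightarrow> p \<in> fst c \<Longrightarrow> v \<bullet> (metric G c p *v v) \<ge> 0"
  using metric_pos[of c p v] by (cases "v = 0") auto

lemma metric_inner_sym: "c \<in> atlas G \<Longrightarrow> p \<in> fst c \<Longrightarrow> v \<bullet> (metric G c p *v w) = w \<bullet> (metric G c p *v v)"
  using inner_matrix_transpose[of "metric G c p" v w] metric_sym[of c p] by (simp add: inner_commute)

lemma det_metric_pos: "c \<in> atlas G \<Longrightarrow> p \<in> fst c \<Longrightarrow> det (metric G c p) > 0"
  by (rule posdef_det_pos) (rule metric_pos)

lemma rho_pos: "c \<in> atlas G \<Longrightarrow> y \<in> img c \<Longrightarrow> rho c y > 0"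
  by (simp add: rho_def det_metric_pos chart_inv_dom)

lemma Ck_rho: "c \<in> atlas G \<Longrightarrow> Ck_on k (rho c) (img c)"
  unfolding rho_def[abs_def]
proof (rule Ck_on_compose[where T = "{0<..}" and g = sqrt])
  assume c: "c \<in> atlas G"
  show "open (img c)" by (rule open_img[OF c])
  show "Ck_on k (\<lambda>y. det (metric G c (chart_inv c y))) (img c)"
    using Ck_on_vec_nth2[OF open_img[OF c] smooth_onD[OF smooth_metric[OF c]]]
    by (intro Ck_on_det open_img[OF c]) (simp add: o_def)
qed (auto simp: Ck_on_sqrt det_metric_pos chart_inv_dom)

lemma continuous_rho: "c \<in> atlas G \<Longrightarrow> continuous_on (img c) (rho c)"
  using Ck_rho[of c 0] by simp

lemma continuous_metric_chart: "c \<in> atlas G \<Longrightarrow> continuous_on (img c) (\<lambda>y. metric G c (chart_inv c y))"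
  using smooth_on_continuous[OF smooth_metric] by (simp add: o_def)

lemma continuous_metric: assumes c: "c \<in> atlas G" shows "continuous_on (fst c) (metric G c)"
proof -
  have "continuous_on (fst c) (\<lambda>p. metric G c (chart_inv c (snd c p)))"
    by (rule continuous_on_compose2[OF continuous_metric_chart[OF c] continuous_chart[OF c]]) auto
  then show ?thesis by (rule continuous_on_eq) (simp add: chart_inv_chart[OF c])
qed

subsection \<open>Integration in charts\<close>

text \<open>The inverse of the coordinate map, made total by one constant value off the image.
  Unlike \<open>chart_inv c\<close>, which is unspecified there, it is Borel measurable on the whole
  space, as \<open>distr\<close> requires.\<close>

definition chart_map :: "('a, 'n) chart \<Rightarrow> real^'n \<Rightarrow> 'a" where
  "chart_map c y = (if y \<in> img c then chart_inv c y else undefined)"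

lemma measurable_chart_map: 
  assumes c: "c \<in> atlas G" shows "chart_map c \<in> borel_measurable borel"
proof (rule borel_measurableI)
  fix U :: "'a set" assume "open U"
  then have "open (img c \<inter> chart_inv c -` U)"
    using continuous_open_preimage[OF continuous_chart_inv[OF c] open_img[OF c]] by simp
  moreover have "chart_map c -` U \<inter> space borel = (img c \<inter> chart_inv c -` U) \<union> (if undefined \<in> U then - img c else {})"
    by (auto simp: chart_map_def split: if_splits)
  ultimately show "chart_map c -` U \<inter> space borel \<in> sets borel"
    using open_img[OF c] by auto
qed

lemma measurable_rho[measurable]: "c \<in> atlas G \<Longrightarrow> (\<lambda>y. indicator (img c) y * rho c y) \<in> borel_measurable borel"
  using borel_measurable_continuous_on_indicator[OF _ continuous_rho[of c]] open_img[of c] by simp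

text \<open>The volume is specified on sets only. As an identity between measures the formula yields
  the change of variables for arbitrary integrands through \<open>integral_distr\<close> and
  \<open>integral_real_density\<close>.\<close>

lemma chart_measure_eq:
  assumes c: "c \<in> atlas G"
  shows "density \<nu> (\<lambda>x. ennreal (indicator (fst c) x)) =
    distr (density lborel (\<lambda>y. ennreal (indicator (img c) y * rho c y))) borel (chart_map c)" (is "?M1 = ?M2")
proof (rule measure_eqI)
  show "sets ?M1 = sets ?M2" by simp
  fix E assume "E \<in> sets ?M1"
  then have E[measurable]: "E \<in> sets borel" by simp
  have fc[measurable]: "fst c \<in> sets borel" using open_dom[OF c] by simp
  note measurable_chart_map[OF c, measurable] measurable_rho[OF c, measurable]
  have "emeasure ?M1 E = (\<integral>\<^sup>+x. ennreal (indicator (fst c) x) * indicator E x \<partial>\<nu>)"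
    by (rule emeasure_density) auto
  also have "\<dots> = (\<integral>\<^sup>+x. indicator (fst c \<inter> E) x \<partial>\<nu>)"
    by (intro nn_integral_cong) (auto simp: indicator_def)
  also have "\<dots> = emeasure \<nu> (E \<inter> fst c)" by (subst nn_integral_indicator) (auto simp: Int_commute)
  also have "\<dots> = (\<integral>\<^sup>+y\<in>snd c ` (E \<inter> fst c). ennreal (rho c y) \<partial>lborel)"
    by (rule emeasure_chart[OF c]) auto
  also have "\<dots> = (\<integral>\<^sup>+y. ennreal (indicator (img c) y * rho c y) * indicator (chart_map c -` E) y \<partial>lborel)"
  proof (rule nn_integral_cong)
    fix y
    have "y \<in> snd c ` (E \<inter> fst c) \<longleftrightarrow> y \<in> img c \<and> chart_map c y \<in> E"
      by (auto simp: chart_map_def chart_inv_chart[OF c])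
    then show "ennreal (rho c y) * indicator (snd c ` (E \<inter> fst c)) y =
        ennreal (indicator (img c) y * rho c y) * indicator (chart_map c -` E) y"
      by (auto simp: indicator_def)
  qed
  also have "\<dots> = emeasure ?M2 E"
  proof -
    have "chart_map c -` E \<in> sets borel"
      using measurable_sets[OF measurable_chart_map[OF c] E] by simp
    then show ?thesis by (subst emeasure_distr) (auto simp: emeasure_density)
  qed
  finally show "emeasure ?M1 E = emeasure ?M2 E" .
qed

lemma chart_integral:
  fixes F :: "'a \<Rightarrow> real"
  assumes c: "c \<in> atlas G" and F: "(\<lambda>x. indicator (fst c) x * F x) \<in> borel_measurable borel"
  shows "(LINT x:fst c|\<nu>. F x) = (LINT y:img c|lborel. rho c y * F (chart_inv c y))"
    and "set_integrable \<nu> (fst c) F \<longleftrightarrow> set_integrable lborel (img c) (\<lambda>y. rho c y * F (chart_inv c y))"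
proof -
  have fc[measurable]: "fst c \<in> sets borel" using open_dom[OF c] by simp
  note measurable_chart_map[OF c, measurable] measurable_rho[OF c, measurable]
  let ?F = "\<lambda>x. indicator (fst c) x * F x"
  note F[measurable]
  have rn: "0 \<le> indicator (img c) y * rho c y" for y using rho_pos[OF c, of y] by (auto simp: indicator_def)
  have e1: "indicator (fst c) x * ?F x = indicator (fst c) x *\<^sub>R F x" for x by (auto simp: indicator_def)
  have e2: "indicator (img c) y * rho c y * ?F (chart_map c y) = indicator (img c) y *\<^sub>R (rho c y * F (chart_inv c y))" for y
    by (auto simp: indicator_def chart_map_def chart_inv_dom)
  have "(LINT x:fst c|\<nu>. F x) = integral\<^sup>L (density \<nu> (\<lambda>x. ennreal (indicator (fst c) x))) ?F"
    by (subst integral_real_density) (auto simp: e1 set_lebesgue_integral_def)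
  also have "\<dots> = (LINT y|lborel. indicator (img c) y * rho c y * ?F (chart_map c y))"
    unfolding chart_measure_eq[OF c]
    by (subst integral_distr) (auto simp: integral_real_density rn)
  finally show "(LINT x:fst c|\<nu>. F x) = (LINT y:img c|lborel. rho c y * F (chart_inv c y))"
    by (simp only: e2 set_lebesgue_integral_def)
  have "set_integrable \<nu> (fst c) F \<longleftrightarrow> integrable (density \<nu> (\<lambda>x. ennreal (indicator (fst c) x))) ?F"
    by (subst integrable_real_density) (auto simp: e1 set_integrable_def)
  also have "\<dots> \<longleftrightarrow> integrable lborel (\<lambda>y. indicator (img c) y * rho c y * ?F (chart_map c y))"
    unfolding chart_measure_eq[OF c]
    by (subst integrable_distr_eq) (auto simp: integrable_real_density rn)
  finally show "set_integrable \<nu> (fst c) F \<longleftrightarrow> set_integrable lborel (img c) (\<lambda>y. rho c y * F (chart_inv c y))"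
    by (simp only: e2 set_integrable_def)
qed

text \<open>The volume has a density in the chart, so the preimage of a Lebesgue null set is a null
  set. The set where \<open>P\<close> fails need not be measurable, hence the Borel superset
  \<open>N\<close>.\<close>

lemma AE_chart:
  assumes c: "c \<in> atlas G" and "AE y in lborel. y \<in> img c \<longrightarrow> P (chart_inv c y)"
  shows "AE x in \<nu>. x \<in> fst c \<longrightarrow> P x"
proof -
  from assms(2) obtain N where N: "{y. \<not> (y \<in> img c \<longrightarrow> P (chart_inv c y))} \<subseteq> N" "N \<in> sets borel" "emeasure lborel N = 0"
    by (auto elim!: AE_E simp: space_lborel)
  let ?E = "fst c \<inter> snd c -` N"
  have f: "(\<lambda>x. indicator (fst c) x *\<^sub>R snd c x) \<in> borel_measurable borel"
    by (rule borel_measurable_continuous_on_indicator[OF borel_open[OF open_dom[OF c]] continuous_chart[OF c]])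
  have "?E = fst c \<inter> ((\<lambda>x. indicator (fst c) x *\<^sub>R snd c x) -` N \<inter> space borel)"
    by (auto simp: indicator_def)
  then have E: "?E \<in> sets borel"
    using measurable_sets[OF f N(2)] open_dom[OF c] by auto
  have "emeasure \<nu> ?E = (\<integral>\<^sup>+y\<in>snd c ` ?E. ennreal (rho c y) \<partial>lborel)"
    by (rule emeasure_chart[OF c E]) auto
  also have "\<dots> = 0"
  proof -
    have "AE y in lborel. y \<notin> N" using N(2,3) by (intro AE_not_in) (auto simp: null_sets_def)
    then have "AE y in lborel. ennreal (rho c y) * indicator (snd c ` ?E) y = (0::ennreal)"
      by eventually_elim (auto simp: indicator_def)
    from nn_integral_cong_AE[OF this] show ?thesis by simp
  qed
  finally have "?E \<in> null_sets \<nu>" using E by (simp add: null_sets_def)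
  then have "AE x in \<nu>. x \<notin> ?E" by (rule AE_not_in)
  then show ?thesis
  proof eventually_elim
    case (elim x)
    then show ?case using N(1) chart_inv_chart[OF c, of x] by (auto simp: subset_iff)
  qed
qed

text \<open>Second countability, by way of Lindelof. Measurability and statements that hold almost
  everywhere can then be checked chart by chart.\<close>

lemma countable_atlas:
  obtains C where "C \<subseteq> atlas G" "countable C" "(\<Union>c\<in>C. fst c) = UNIV"
proof -
  obtain \<F>' where F: "\<F>' \<subseteq> fst ` atlas G" "countable \<F>'" "\<Union>\<F>' = \<Union>(fst ` atlas G)"
  proof (rule Lindelof)
    show "open X" if "X \<in> fst ` atlas G" for X using that open_dom by auto
  qed
  then obtain C where "C \<subseteq> atlas G" "countable C" "\<F>' = fst ` C"
    using countable_subset_image by metis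
  moreover have "\<Union>(fst ` atlas G) = UNIV" using atlas_covers by auto
  ultimately show ?thesis using that F by metis
qed

text \<open>The density is bounded on a compact coordinate ball. The resulting finiteness on compact
  sets puts test functions and their gradients into the spaces of square integrable objects.\<close>

lemma finite_nu_neighbourhood:
  obtains U where "open U" "p \<in> U" "emeasure \<nu> U < \<infinity>"
proof -
  let ?c = "chart_at G p"
  note c = chart_at[of p]
  have "snd ?c p \<in> img ?c" using c by auto
  then obtain e where e: "e > 0" "cball (snd ?c p) e \<subseteq> img ?c"
    using open_img[OF c(1)] open_contains_cball by metis
  let ?U = "{q \<in> fst ?c. snd ?c q \<in> ball (snd ?c p) e}"
  have U: "open ?U" by (rule open_chart_preimage[OF c(1)]) auto
  have "compact (rho ?c ` cball (snd ?c p) e)"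
    by (intro compact_continuous_image continuous_on_subset[OF continuous_rho[OF c(1)] e(2)]) auto
  then have "bounded (rho ?c ` cball (snd ?c p) e)" by (rule compact_imp_bounded)
  then obtain B where B0: "\<And>r. r \<in> rho ?c ` cball (snd ?c p) e \<Longrightarrow> norm r \<le> B"
    unfolding bounded_iff by blast
  have B: "rho ?c y \<le> B" if "y \<in> cball (snd ?c p) e" for y
    using B0[OF imageI[OF that]] by simp
  have "emeasure \<nu> ?U = (\<integral>\<^sup>+y\<in>snd ?c ` ?U. ennreal (rho ?c y) \<partial>lborel)"
    by (rule emeasure_chart[OF c(1) borel_open[OF U]]) auto
  also have "\<dots> \<le> (\<integral>\<^sup>+y. ennreal B * indicator (cball (snd ?c p) e) y \<partial>lborel)"
    by (intro nn_integral_mono) (use B in \<open>auto simp: indicator_def intro!: ennreal_leI\<close>)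
  also have "\<dots> = ennreal B * emeasure lborel (cball (snd ?c p) e)"
    by (rule nn_integral_cmult_indicator) simp
  also have "\<dots> < \<infinity>"
    using emeasure_bounded_finite[OF bounded_cball, of "snd ?c p" e] by (simp add: ennreal_mult_less_top)
  finally show ?thesis using that[OF U] c(2) e(1) by auto
qed

lemma finite_nu_compact: assumes "compact K" shows "emeasure \<nu> K < \<infinity>"
proof -
  have "\<exists>U. open U \<and> p \<in> U \<and> emeasure \<nu> U < \<infinity>" for p
    using finite_nu_neighbourhood[of p] by blast
  then obtain U where U: "\<And>p. open (U p)" "\<And>p. p \<in> U p" "\<And>p. emeasure \<nu> (U p) < \<infinity>"
    by metis
  obtain F where F: "finite F" "K \<subseteq> (\<Union>p\<in>F. U p)"
    using compactE_image[OF assms, of K U] U by (metis UN_I subsetI)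
  have "emeasure \<nu> K \<le> emeasure \<nu> (\<Union>p\<in>F. U p)" by (rule emeasure_mono[OF F(2)]) (use U(1) in \<open>auto intro!: borel_open open_UN\<close>)
  also have "\<dots> \<le> (\<Sum>p\<in>F. emeasure \<nu> (U p))" using U F by (intro emeasure_subadditive_finite) auto
  also have "\<dots> < \<infinity>" using U(3) F(1) by (simp add: less_top)
  finally show ?thesis .
qed

end

section \<open>Measurable and square integrable vector fields\<close>

lemma bounded_bilinear_matrix_vector: "bounded_bilinear ((*v) :: real^'n^'m \<Rightarrow> real^'n \<Rightarrow> real^'m)"
  unfolding bilinear_conv_bounded_bilinear[symmetric] bilinear_def
  by (auto intro!: linearI simp: matrix_vector_mult_add_rdistrib matrix_vector_right_distrib
      scaleR_matrix_vector_assoc[symmetric] matrix_vector_mult_scaleR)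

lemma borel_measurable_matrix_vector:
  fixes A :: "'x \<Rightarrow> real^'n^'m"
  assumes "A \<in> borel_measurable M" "b \<in> borel_measurable M"
  shows "(\<lambda>x. A x *v b x) \<in> borel_measurable M"
  by (rule borel_measurable_continuous_Pair[OF assms])
    (intro bounded_bilinear.continuous_on[OF bounded_bilinear_matrix_vector] continuous_intros)

lemma borel_measurable_countable_cover:
  fixes F :: "'x \<Rightarrow> 'b::real_normed_vector"
  assumes "countable C" "(\<Union>c\<in>C. A c) = UNIV" "space M = UNIV" "\<And>c. c \<in> C \<Longrightarrow> A c \<in> sets M"
    "\<And>c. c \<in> C \<Longrightarrow> (\<lambda>x. indicator (A c) x *\<^sub>R F x) \<in> borel_measurable M"
  shows "F \<in> borel_measurable M"
proof (rule measurable_piecewise_restrict[where C = "A ` C"])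
  fix S assume "S \<in> A ` C"
  then obtain c where c: "c \<in> C" "S = A c" by auto
  then show "F \<in> borel_measurable (restrict_space M S)"
    using assms(4,5) by (subst borel_measurable_restrict_space_iff) (auto simp: assms(3))
qed (use assms in auto)

locale riemannian_domain = riemannian G \<nu>
  for G :: "('a::{t2_space, second_countable_topology}, 'n::finite) riemannian_structure" and \<nu> +
  fixes \<Omega> :: "'a set"
  assumes open_domain: "open \<Omega>"
begin

lemma domain_sets[measurable]: "\<Omega> \<in> sets borel"
  using open_domain by simp

lemma measurable_nu[simp]: "measurable \<nu> N = measurable borel N"
  by (rule measurable_cong_sets) auto

lemma chart_sets: "c \<in> atlas G \<Longrightarrow> fst c \<in> sets borel"
  using open_dom by simp

definition lc :: "real \<Rightarrow> ('a, 'n) vfield \<Rightarrow> real \<Rightarrow> ('a, 'n) vfield \<Rightarrow> ('a, 'n) vfield" where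
  "lc a X b Y = (\<lambda>c p. a *\<^sub>R X c p + b *\<^sub>R Y c p)"

lemma rinner_lc_left: "rinner G (lc a X b Y) Z p = a * rinner G X Z p + b * rinner G Y Z p"
  by (simp add: rinner_def lc_def Let_def inner_add_left)

lemma rinner_sym: "rinner G X Y p = rinner G Y X p"
  by (simp add: rinner_def Let_def metric_inner_sym[OF chart_at])

lemma rinner_lc_right: "rinner G Z (lc a X b Y) p = a * rinner G Z X p + b * rinner G Z Y p"
  unfolding rinner_sym[of Z] by (rule rinner_lc_left)

lemma rinner_nonneg: "rinner G X X p \<ge> 0"
  by (simp add: rinner_def Let_def metric_nonneg[OF chart_at])

lemma rinner_bound: "2 * \<bar>rinner G X Y p\<bar> \<le> rinner G X X p + rinner G Y Y p"
proof -
  have "rinner G (lc 1 X 1 Y) (lc 1 X 1 Y) p \<ge> 0" "rinner G (lc 1 X (-1) Y) (lc 1 X (-1) Y) p \<ge> 0"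
    by (rule rinner_nonneg)+
  then show ?thesis
    by (simp add: rinner_lc_left rinner_lc_right rinner_sym[of Y X] abs_le_iff)
qed

lemma vfield_change:
  assumes "is_vfield_on G \<Omega> X" "c \<in> atlas G" "c' \<in> atlas G" "p \<in> \<Omega>" "p \<in> fst c" "p \<in> fst c'"
  shows "X c' p = jacobian c c' p *v X c p"
  using assms unfolding is_vfield_on_def by blast

lemma rinner_chart:
  assumes "is_vfield_on G \<Omega> X" "is_vfield_on G \<Omega> Y" "c \<in> atlas G" "p \<in> \<Omega>" "p \<in> fst c"
  shows "rinner G X Y p = X c p \<bullet> (metric G c p *v Y c p)"
proof -
  let ?d = "chart_at G p" and ?J = "jacobian c (chart_at G p) p"
  note d = chart_at[of p]
  have "X ?d p = ?J *v X c p" "Y ?d p = ?J *v Y c p"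
    by (rule vfield_change[OF _ assms(3) d(1) assms(4,5) d(2)], rule assms)+
  then have "rinner G X Y p = (?J *v X c p) \<bullet> (metric G ?d p *v (?J *v Y c p))"
    by (simp add: rinner_def Let_def)
  also have "\<dots> = X c p \<bullet> ((transpose ?J ** metric G ?d p ** ?J) *v Y c p)"
    by (metis inner_matrix_transpose matrix_vector_mul_assoc transpose_transpose)
  also have "transpose ?J ** metric G ?d p ** ?J = metric G c p"
    using metric_change[OF assms(3) d(1) assms(5) d(2)] by simp
  finally show ?thesis .
qed

definition measurable_vfield :: "('a, 'n) vfield \<Rightarrow> bool" where
  "measurable_vfield X \<longleftrightarrow> is_vfield_on G \<Omega> X \<and>
    (\<forall>c\<in>atlas G. (\<lambda>p. indicator (\<Omega> \<inter> fst c) p *\<^sub>R X c p) \<in> borel_measurable borel)"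

abbreviation VF where "VF \<equiv> L2_vfield G \<nu> \<Omega>"

lemma VF_iff: "X \<in> VF \<longleftrightarrow> measurable_vfield X \<and> set_integrable \<nu> \<Omega> (rinner G X X)"
  by (simp add: L2_vfield_def measurable_vfield_def set_borel_measurable_def)

lemma vfield_lc: "is_vfield_on G \<Omega> X \<Longrightarrow> is_vfield_on G \<Omega> Y \<Longrightarrow> is_vfield_on G \<Omega> (lc a X b Y)"
  unfolding is_vfield_on_def[of _ _ "lc a X b Y"]
proof (intro ballI)
  fix c c' p
  assume vf: "is_vfield_on G \<Omega> X" "is_vfield_on G \<Omega> Y" and c: "c \<in> atlas G" "c' \<in> atlas G" "p \<in> \<Omega> \<inter> fst c \<inter> fst c'"
  have "X c' p = jacobian c c' p *v X c p" "Y c' p = jacobian c c' p *v Y c p"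
    using c by (auto intro: vfield_change[OF vf(1)] vfield_change[OF vf(2)])
  then show "lc a X b Y c' p = jacobian c c' p *v lc a X b Y c p"
    by (simp add: lc_def matrix_vector_right_distrib matrix_vector_mult_scaleR)
qed

lemma measurable_vfield_lc: "measurable_vfield X \<Longrightarrow> measurable_vfield Y \<Longrightarrow> measurable_vfield (lc a X b Y)"
  unfolding measurable_vfield_def
proof (intro conjI ballI)
  fix c assume c: "c \<in> atlas G"
  let ?i = "indicator (\<Omega> \<inter> fst c) :: 'a \<Rightarrow> real"
  assume a: "is_vfield_on G \<Omega> X \<and> (\<forall>c\<in>atlas G. (\<lambda>p. indicator (\<Omega> \<inter> fst c) p *\<^sub>R X c p) \<in> borel_measurable borel)"
    "is_vfield_on G \<Omega> Y \<and> (\<forall>c\<in>atlas G. (\<lambda>p. indicator (\<Omega> \<inter> fst c) p *\<^sub>R Y c p) \<in> borel_measurable borel)"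
  have "(\<lambda>p. a *\<^sub>R (?i p *\<^sub>R X c p) + b *\<^sub>R (?i p *\<^sub>R Y c p)) \<in> borel_measurable borel"
    using a c by (intro borel_measurable_add borel_measurable_scaleR[OF borel_measurable_const]) blast+
  then show "(\<lambda>p. ?i p *\<^sub>R lc a X b Y c p) \<in> borel_measurable borel"
    by (simp add: lc_def scaleR_add_right mult.commute)
qed (auto intro: vfield_lc)

lemma rinner_measurable:
  assumes X: "measurable_vfield X" and Y: "measurable_vfield Y"
  shows "(\<lambda>p. indicator \<Omega> p * rinner G X Y p) \<in> borel_measurable borel"
proof -
  obtain C where C: "C \<subseteq> atlas G" "countable C" "(\<Union>c\<in>C. fst c) = UNIV" by (rule countable_atlas)
  show ?thesis
  proof (rule borel_measurable_countable_cover[OF C(2,3)])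
    fix c assume "c \<in> C"
    then have c: "c \<in> atlas G" using C by auto
    show "fst c \<in> sets borel" by (rule chart_sets[OF c])
    let ?i = "indicator (\<Omega> \<inter> fst c) :: 'a \<Rightarrow> real"
    have "(\<lambda>p. indicator (fst c) p *\<^sub>R metric G c p) \<in> borel_measurable borel"
      by (rule borel_measurable_continuous_on_indicator[OF chart_sets[OF c] continuous_metric[OF c]])
    then have "(\<lambda>p. (?i p *\<^sub>R X c p) \<bullet> ((indicator (fst c) p *\<^sub>R metric G c p) *v (?i p *\<^sub>R Y c p))) \<in> borel_measurable borel"
      using X Y c unfolding measurable_vfield_def
      by (intro borel_measurable_inner borel_measurable_matrix_vector) auto
    moreover have "(?i p *\<^sub>R X c p) \<bullet> ((indicator (fst c) p *\<^sub>R metric G c p) *v (?i p *\<^sub>R Y c p)) =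
        indicator (fst c) p *\<^sub>R (indicator \<Omega> p * rinner G X Y p)" for p
      using rinner_chart[of X Y c p] X Y c by (auto simp: indicator_def measurable_vfield_def)
    ultimately show "(\<lambda>p. indicator (fst c) p *\<^sub>R (indicator \<Omega> p * rinner G X Y p)) \<in> borel_measurable borel"
      by simp
  qed auto
qed

lemma rinner_integrable:
  assumes X: "X \<in> VF" and Y: "Y \<in> VF"
  shows "set_integrable \<nu> \<Omega> (rinner G X Y)"
  unfolding set_integrable_def
proof (rule Bochner_Integration.integrable_bound)
  show "integrable \<nu> (\<lambda>p. indicator \<Omega> p *\<^sub>R rinner G X X p + indicator \<Omega> p *\<^sub>R rinner G Y Y p)"
    using X Y by (intro Bochner_Integration.integrable_add) (auto simp: VF_iff set_integrable_def)
  show "(\<lambda>p. indicator \<Omega> p *\<^sub>R rinner G X Y p) \<in> borel_measurable \<nu>"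
    using rinner_measurable[of X Y] X Y by (simp add: VF_iff)
  show "AE p in \<nu>. norm (indicator \<Omega> p *\<^sub>R rinner G X Y p) \<le>
      norm (indicator \<Omega> p *\<^sub>R rinner G X X p + indicator \<Omega> p *\<^sub>R rinner G Y Y p)"
  proof (rule AE_I2)
    fix p
    have "\<bar>rinner G X Y p\<bar> \<le> \<bar>rinner G X X p + rinner G Y Y p\<bar>" using rinner_bound[of X Y p] by linarith
    then show "norm (indicator \<Omega> p *\<^sub>R rinner G X Y p) \<le>
      norm (indicator \<Omega> p *\<^sub>R rinner G X X p + indicator \<Omega> p *\<^sub>R rinner G Y Y p)"
      by (auto simp: indicator_def)
  qed
qed

lemma VF_lc:
  assumes X: "X \<in> VF" and Y: "Y \<in> VF"
  shows "lc a X b Y \<in> VF"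
proof -
  have "set_integrable \<nu> \<Omega> (\<lambda>p. a\<^sup>2 * rinner G X X p + ((2 * a * b) * rinner G X Y p + b\<^sup>2 * rinner G Y Y p))"
    using rinner_integrable[OF X X] rinner_integrable[OF X Y] rinner_integrable[OF Y Y]
    by (intro set_integral_add set_integrable_mult_right) auto
  moreover have "a\<^sup>2 * rinner G X X p + ((2 * a * b) * rinner G X Y p + b\<^sup>2 * rinner G Y Y p) =
      rinner G (lc a X b Y) (lc a X b Y) p" for p
    by (simp add: rinner_lc_left rinner_lc_right rinner_sym[of Y X] power2_eq_square algebra_simps)
  ultimately show ?thesis
    using X Y measurable_vfield_lc by (simp add: VF_iff)
qed

definition ip :: "('a, 'n) vfield \<Rightarrow> ('a, 'n) vfield \<Rightarrow> real" where
  "ip X Y = (LINT x:\<Omega>|\<nu>. rinner G X Y x)"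

lemma ip_sym: "ip X Y = ip Y X"
  by (simp add: ip_def rinner_sym[of X Y])

lemma ip_nonneg: "ip X X \<ge> 0"
  unfolding ip_def set_lebesgue_integral_def
  by (intro integral_nonneg_AE) (auto simp: rinner_nonneg)

lemma ip_lc_left:
  assumes "X \<in> VF" "Y \<in> VF" "Z \<in> VF"
  shows "ip (lc a X b Y) Z = a * ip X Z + b * ip Y Z"
  using rinner_integrable[OF assms(1,3)] rinner_integrable[OF assms(2,3)]
  by (simp add: ip_def rinner_lc_left[abs_def] set_integral_add)

lemma ip_lc_right:
  assumes "X \<in> VF" "Y \<in> VF" "Z \<in> VF"
  shows "ip Z (lc a X b Y) = a * ip Z X + b * ip Z Y"
  unfolding ip_sym[of Z] by (rule ip_lc_left[OF assms])

lemma ip_cauchy_schwarz: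
  assumes "X \<in> VF" "Y \<in> VF"
  shows "\<bar>ip X Y\<bar> \<le> sqrt (ip X X) * sqrt (ip Y Y)"
proof -
  have "(ip X Y)\<^sup>2 \<le> ip X X * ip Y Y"
  proof (rule discriminant_le)
    fix t
    have "ip (lc 1 X t Y) (lc 1 X t Y) \<ge> 0" by (rule ip_nonneg)
    then show "ip X X + 2 * t * ip X Y + t\<^sup>2 * ip Y Y \<ge> 0"
      by (simp add: ip_lc_left ip_lc_right VF_lc assms ip_sym[of Y X] power2_eq_square algebra_simps)
  qed
  from real_sqrt_le_mono[OF this] show ?thesis by (simp add: real_sqrt_mult)
qed

text \<open>The quantifier over \<open>Z\<close> stands inside, so one null set serves all fields.
  \<open>rinner\<close> works in the chart chosen by \<open>chart_at\<close>, of which there may be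
  uncountably many; the transformation law leads back to a chart of the countable cover.\<close>

lemma AE_vfield_cong:
  assumes X: "is_vfield_on G \<Omega> X" "is_vfield_on G \<Omega> Y"
    and eq: "\<And>c. c \<in> atlas G \<Longrightarrow> AE p in \<nu>. p \<in> \<Omega> \<inter> fst c \<longrightarrow> X c p = Y c p"
  shows "AE p in \<nu>. p \<in> \<Omega> \<longrightarrow> (\<forall>Z. rinner G X Z p = rinner G Y Z p)"
proof -
  obtain C where C: "C \<subseteq> atlas G" "countable C" "(\<Union>c\<in>C. fst c) = UNIV" by (rule countable_atlas)
  have "AE p in \<nu>. \<forall>c\<in>C. p \<in> \<Omega> \<inter> fst c \<longrightarrow> X c p = Y c p"
    unfolding AE_ball_countable[OF C(2)] using eq C(1) by blast
  then show ?thesis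
  proof eventually_elim
    case (elim p)
    show ?case
    proof (intro impI allI)
      fix Z assume p: "p \<in> \<Omega>"
      obtain c where c: "c \<in> C" "p \<in> fst c" using C(3) by (metis UN_E UNIV_I)
      have cA: "c \<in> atlas G" using c C by auto
      have "X (chart_at G p) p = jacobian c (chart_at G p) p *v X c p"
        "Y (chart_at G p) p = jacobian c (chart_at G p) p *v Y c p"
        by (rule vfield_change[OF _ cA chart_at(1) p c(2) chart_at(2)], rule X)+
      moreover have "X c p = Y c p" using elim c p by auto
      ultimately show "rinner G X Z p = rinner G Y Z p" by (simp add: rinner_def)
    qed
  qed
qed

subsection \<open>Localised coordinate fields\<close>

text \<open>The coordinate field of the chart \<open>c\<close> in direction \<open>i\<close>,
  multiplied by \<open>h / rho\<close>, extended by zero and expressed in the chart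
  \<open>c'\<close>. Pairing with it reads off a covariant component in \<open>c\<close>, tested
  against \<open>h\<close>.\<close>

definition loc_field :: "('a, 'n) chart \<Rightarrow> (real^'n \<Rightarrow> real) \<Rightarrow> 'n \<Rightarrow> ('a, 'n) vfield" where
  "loc_field c h i c' p =
    (if p \<in> fst c \<and> p \<in> fst c' then (h (snd c p) / rho c (snd c p)) *\<^sub>R (jacobian c c' p *v axis i 1) else 0)"

lemma measurable_chart_comp:
  fixes h :: "real^'n \<Rightarrow> real"
  assumes c: "c \<in> atlas G" and h: "h \<in> borel_measurable borel"
  shows "(\<lambda>p. indicator (fst c) p * h (snd c p)) \<in> borel_measurable borel"
proof -
  have f: "(\<lambda>x. indicator (fst c) x *\<^sub>R snd c x) \<in> borel_measurable borel"
    by (rule borel_measurable_continuous_on_indicator[OF chart_sets[OF c] continuous_chart[OF c]])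
  have "(\<lambda>p. indicator (fst c) p * h (indicator (fst c) p *\<^sub>R snd c p)) \<in> borel_measurable borel"
    using chart_sets[OF c] measurable_compose[OF f h] by (intro borel_measurable_times) auto
  moreover have "indicator (fst c) p * h (indicator (fst c) p *\<^sub>R snd c p) = indicator (fst c) p * h (snd c p)" for p
    by (auto simp: indicator_def)
  ultimately show ?thesis by simp
qed

lemma compact_in_chart:
  assumes c: "c \<in> atlas G" and K: "compact K" "K \<subseteq> img c" and f: "continuous_on (img c) f"
  obtains B :: real where "B > 0" "\<And>y. y \<in> K \<Longrightarrow> \<bar>f y\<bar> \<le> B"
proof -
  have "bounded (f ` K)"
    by (intro compact_imp_bounded compact_continuous_image K continuous_on_subset[OF f])
  then obtain B where B: "B > 0" "\<And>r. r \<in> f ` K \<Longrightarrow> norm r \<le> B" unfolding bounded_pos by auto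
  have "\<bar>f y\<bar> \<le> B" if "y \<in> K" for y using B(2)[OF imageI[OF that]] by simp
  then show ?thesis using that B(1) by blast
qed

lemma integrable_compact_bounded:
  fixes f :: "real^'n \<Rightarrow> real"
  assumes "compact K" "f \<in> borel_measurable borel" "\<And>y. y \<notin> K \<Longrightarrow> f y = 0" "\<And>y. y \<in> K \<Longrightarrow> \<bar>f y\<bar> \<le> B"
  shows "integrable lborel f"
proof (rule Bochner_Integration.integrable_bound[where g = "f" and f = "\<lambda>y. \<bar>B\<bar> * indicator K y"])
  have "emeasure lborel K < \<infinity>" using emeasure_bounded_finite[OF compact_imp_bounded[OF assms(1)]] .
  then show "integrable lborel (\<lambda>y. \<bar>B\<bar> * indicator K y)"
    using compact_imp_closed[OF assms(1)] by (intro integrable_mult_right integrable_real_indicator) auto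
  show "AE y in lborel. norm (f y) \<le> norm (\<bar>B\<bar> * indicator K y)"
    using assms(3,4) by (intro AE_I2) (force simp: indicator_def)
qed (use assms in auto)

text \<open>The factor \<open>1 / rho\<close> turns the Riemannian volume into Lebesgue measure in the chart.\<close>
lemma loc_field:
  assumes c: "c \<in> atlas G" and h: "h \<in> borel_measurable borel" and K: "compact K" "K \<subseteq> snd c ` (\<Omega> \<inter> fst c)"
    and h0: "\<And>y. y \<notin> K \<Longrightarrow> h y = 0" and hB: "\<And>y. \<bar>h y\<bar> \<le> B"
  shows "loc_field c h i \<in> VF"
    and "X \<in> VF \<Longrightarrow> integrable lborel (\<lambda>y. (metric G c (chart_inv c y) *v X c (chart_inv c y)) $ i * h y)"
    and "X \<in> VF \<Longrightarrow> ip X (loc_field c h i) = (LINT y|lborel. (metric G c (chart_inv c y) *v X c (chart_inv c y)) $ i * h y)"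
proof -
  let ?W = "loc_field c h i"
  have Kimg: "K \<subseteq> img c" using K(2) by auto
  have h\<Omega>: "h (snd c p) = 0" if "p \<in> fst c" "p \<notin> \<Omega>" for p
  proof (rule h0)
    show "snd c p \<notin> K" using that K(2) inj_chart[OF c] by (auto simp: inj_on_def)
  qed
  have vf: "is_vfield_on G \<Omega> ?W"
    unfolding is_vfield_on_def
  proof (intro ballI)
    fix c1 c2 p assume *: "c1 \<in> atlas G" "c2 \<in> atlas G" "p \<in> \<Omega> \<inter> fst c1 \<inter> fst c2"
    then show "?W c2 p = jacobian c1 c2 p *v ?W c1 p"
      using jacobian_chain[OF c *(1,2), of p]
      by (auto simp: loc_field_def matrix_vector_mult_scaleR matrix_vector_mul_assoc)
  qed
  have meas: "measurable_vfield ?W"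
    unfolding measurable_vfield_def
  proof (intro conjI vf ballI)
    fix c' assume c': "c' \<in> atlas G"
    let ?S = "fst c \<inter> fst c'"
    have oS: "open ?S" by (rule open_Int[OF open_dom[OF c] open_dom[OF c']])
    have ck: "continuous_on (snd c ` ?S) (\<lambda>y. frechet_derivative (transition c c') (at y) (axis i 1))"
      using smooth_onD[OF smooth_on_derivative[OF smooth_transition[OF c c']], of 0] by simp
    have "continuous_on ?S (\<lambda>p. frechet_derivative (transition c c') (at (snd c p)) (axis i 1))"
      by (rule continuous_on_compose2[OF ck continuous_on_subset[OF continuous_chart[OF c]]]) auto
    moreover have "frechet_derivative (transition c c') (at (snd c p)) (axis i 1) = jacobian c c' p *v axis i 1" if "p \<in> ?S" for p
      using frechet_derivative_at[OF transition_has_derivative[OF c c']] that by auto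
    ultimately have cJ: "continuous_on ?S (\<lambda>p. jacobian c c' p *v axis i 1)"
      by (rule continuous_on_eq)
    have cr: "continuous_on (fst c) (\<lambda>p. 1 / rho c (snd c p))"
    proof (intro continuous_on_divide continuous_on_const ballI)
      show "continuous_on (fst c) (\<lambda>p. rho c (snd c p))"
        by (rule continuous_on_compose2[OF continuous_rho[OF c] continuous_chart[OF c]]) auto
      show "rho c (snd c p) \<noteq> 0" if "p \<in> fst c" for p using rho_pos[OF c, of "snd c p"] that by simp
    qed
    have "(\<lambda>p. indicator \<Omega> p *\<^sub>R ((indicator (fst c) p * h (snd c p)) *\<^sub>R
        ((indicator (fst c) p *\<^sub>R (1 / rho c (snd c p))) *\<^sub>R (indicator ?S p *\<^sub>R (jacobian c c' p *v axis i 1))))) \<in> borel_measurable borel"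
      by (intro borel_measurable_scaleR measurable_chart_comp c h
          borel_measurable_continuous_on_indicator[OF chart_sets[OF c] cr]
          borel_measurable_continuous_on_indicator[OF borel_open[OF oS] cJ]) auto
    moreover have "indicator \<Omega> p *\<^sub>R ((indicator (fst c) p * h (snd c p)) *\<^sub>R
        ((indicator (fst c) p *\<^sub>R (1 / rho c (snd c p))) *\<^sub>R (indicator ?S p *\<^sub>R (jacobian c c' p *v axis i 1)))) =
        indicator (\<Omega> \<inter> fst c') p *\<^sub>R ?W c' p" for p
      by (auto simp: indicator_def loc_field_def)
    ultimately show "(\<lambda>p. indicator (\<Omega> \<inter> fst c') p *\<^sub>R ?W c' p) \<in> borel_measurable borel" by simp
  qed
  have Wc: "?W c p = (h (snd c p) / rho c (snd c p)) *\<^sub>R axis i 1" if "p \<in> fst c" for p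
    using that by (simp add: loc_field_def jacobian_self c)
  have W0: "rinner G X ?W p = 0" if "p \<in> \<Omega>" "p \<notin> fst c" for p X
    using that by (simp add: rinner_def loc_field_def)
  have rX: "rinner G X ?W p = (h (snd c p) / rho c (snd c p)) * (metric G c p *v X c p) $ i"
    if "is_vfield_on G \<Omega> X" "p \<in> \<Omega>" "p \<in> fst c" for p X
  proof -
    have "rinner G X ?W p = ?W c p \<bullet> (metric G c p *v X c p)"
      using rinner_chart[OF vf that(1) c that(2,3)] rinner_sym by simp
    then show ?thesis by (simp add: Wc that inner_axis')
  qed
  \<comment> \<open>Proved for measurable fields, not only for \<open>VF\<close>, because it is
    applied to \<open>?W\<close> itself in order to show that \<open>?W\<close> is square
    integrable.\<close>
  have transfer: "(LINT x:\<Omega>|\<nu>. rinner G X ?W x) = (LINT y|lborel. (metric G c (chart_inv c y) *v X c (chart_inv c y)) $ i * h y)"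
    "set_integrable \<nu> \<Omega> (rinner G X ?W) \<longleftrightarrow> integrable lborel (\<lambda>y. (metric G c (chart_inv c y) *v X c (chart_inv c y)) $ i * h y)"
    if X: "measurable_vfield X" for X
  proof -
    let ?F = "\<lambda>p. indicator \<Omega> p * rinner G X ?W p"
    have vX: "is_vfield_on G \<Omega> X" using X by (simp add: measurable_vfield_def)
    have m: "?F \<in> borel_measurable borel" by (rule rinner_measurable[OF X meas])
    have eq: "indicator \<Omega> p *\<^sub>R rinner G X ?W p = indicator (fst c) p *\<^sub>R ?F p" for p
      using W0[of p X] by (auto simp: indicator_def)
    have m': "(\<lambda>x. indicator (fst c) x * ?F x) \<in> borel_measurable borel"
      using chart_sets[OF c] by (intro borel_measurable_times[OF borel_measurable_indicator m]) auto
    have r: "indicator (img c) y *\<^sub>R (rho c y * ?F (chart_inv c y)) = (metric G c (chart_inv c y) *v X c (chart_inv c y)) $ i * h y" for y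
    proof (cases "y \<in> img c")
      case True
      then have p: "chart_inv c y \<in> fst c" "snd c (chart_inv c y) = y" by (auto simp: chart_inv_dom chart_chart_inv)
      show ?thesis
        using rX[OF vX _ p(1)] h\<Omega>[OF p(1)] p(2) True rho_pos[OF c True] by (cases "chart_inv c y \<in> \<Omega>") auto
    next
      case False
      then show ?thesis using h0[of y] Kimg by auto
    qed
    show "(LINT x:\<Omega>|\<nu>. rinner G X ?W x) = (LINT y|lborel. (metric G c (chart_inv c y) *v X c (chart_inv c y)) $ i * h y)"
      using chart_integral(1)[OF c m'] by (simp only: set_lebesgue_integral_def eq r)
    show "set_integrable \<nu> \<Omega> (rinner G X ?W) \<longleftrightarrow> integrable lborel (\<lambda>y. (metric G c (chart_inv c y) *v X c (chart_inv c y)) $ i * h y)"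
      using chart_integral(2)[OF c m'] by (simp only: set_integrable_def eq r)
  qed
  show W: "?W \<in> VF"
  proof -
    let ?f = "\<lambda>y. (metric G c (chart_inv c y) *v ?W c (chart_inv c y)) $ i * h y"
    have f: "?f y = (indicator (img c) y *\<^sub>R (metric G c (chart_inv c y) $ i $ i / rho c y)) * (h y)\<^sup>2" for y
      using h0[of y] Kimg Wc[of "chart_inv c y"]
      by (cases "y \<in> img c")
        (auto simp: chart_inv_dom chart_chart_inv matrix_vector_mult_scaleR matrix_vector_mult_basis column_def power2_eq_square)
    have cont: "continuous_on (img c) (\<lambda>y. metric G c (chart_inv c y) $ i $ i / rho c y)"
      using rho_pos[OF c] by (intro continuous_on_divide continuous_rho[OF c] continuous_intros continuous_metric_chart[OF c]) force
    obtain B' where B': "B' > 0" "\<And>y. y \<in> K \<Longrightarrow> \<bar>metric G c (chart_inv c y) $ i $ i / rho c y\<bar> \<le> B'"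
      using compact_in_chart[OF c K(1) Kimg cont] by blast
    have "integrable lborel ?f"
    proof (rule integrable_compact_bounded[OF K(1), where B = "B' * B\<^sup>2"])
      show "?f \<in> borel_measurable borel"
        unfolding f by (intro borel_measurable_times borel_measurable_power h
            borel_measurable_continuous_on_indicator[OF _ cont]) (use open_img[OF c] in auto)
      show "?f y = 0" if "y \<notin> K" for y using h0[OF that] by simp
      show "\<bar>?f y\<bar> \<le> B' * B\<^sup>2" if "y \<in> K" for y
      proof -
        have "(h y)\<^sup>2 \<le> B\<^sup>2" using hB[of y] by (metis abs_ge_zero power2_abs power_mono)
        then show ?thesis unfolding f abs_mult using B'(2)[OF that] B'(1) that Kimg
          by (intro mult_mono) auto
      qed
    qed
    then show ?thesis using transfer(2)[OF meas] meas by (simp add: VF_iff)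
  qed
  assume X: "X \<in> VF"
  show "integrable lborel (\<lambda>y. (metric G c (chart_inv c y) *v X c (chart_inv c y)) $ i * h y)"
    using transfer(2)[of X] rinner_integrable[OF X W] X by (simp add: VF_iff)
  show "ip X ?W = (LINT y|lborel. (metric G c (chart_inv c y) *v X c (chart_inv c y)) $ i * h y)"
    unfolding ip_def using transfer(1)[of X] X by (simp add: VF_iff)
qed

end

section \<open>Weak gradients, the Sobolev space and the Dirichlet form\<close>

lemma posdef_norm_bound:
  fixes A :: "real^'n^'n"
  assumes "\<And>v. v \<noteq> 0 \<Longrightarrow> v \<bullet> (A *v v) > 0"
  obtains C where "C > 0" "\<And>v. norm v \<le> C * sqrt (v \<bullet> (A *v v))"
proof -
  have cont: "continuous_on (sphere 0 1) (\<lambda>v. v \<bullet> (A *v v))"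
    by (intro continuous_intros bounded_bilinear.continuous_on[OF bounded_bilinear_matrix_vector])
  obtain e where e: "norm (e::real^'n) = 1" using vector_choose_size[of 1] by auto
  then have "sphere 0 1 \<noteq> ({} :: (real^'n) set)" by auto
  then obtain w where w: "w \<in> sphere 0 1" "\<And>v. v \<in> sphere 0 1 \<Longrightarrow> w \<bullet> (A *v w) \<le> v \<bullet> (A *v v)"
    using continuous_attains_inf[OF compact_sphere _ cont] by metis
  define m where "m = w \<bullet> (A *v w)"
  have m: "m > 0" unfolding m_def using w(1) by (intro assms) auto
  have "norm v \<le> (1 / sqrt m) * sqrt (v \<bullet> (A *v v))" for v
  proof (cases "v = 0")
    case False
    define u where "u = (1 / norm v) *\<^sub>R v"
    have "u \<in> sphere 0 1" using False by (simp add: u_def)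
    then have "m \<le> u \<bullet> (A *v u)" using w(2) m_def by blast
    also have "\<dots> = (v \<bullet> (A *v v)) / (norm v)\<^sup>2"
      by (simp add: u_def matrix_vector_mult_scaleR power2_eq_square)
    finally have "(norm v)\<^sup>2 * m \<le> v \<bullet> (A *v v)" using False by (simp add: field_simps)
    then have "sqrt ((norm v)\<^sup>2 * m) \<le> sqrt (v \<bullet> (A *v v))" by simp
    then show ?thesis using m by (simp add: real_sqrt_mult field_simps)
  qed simp
  then show ?thesis using that[of "1 / sqrt m"] m by simp
qed

context riemannian_domain
begin

text \<open>The scalar counterpart of \<open>loc_field\<close>: the quotient by \<open>rho\<close>
  turns an integral against the volume into a Lebesgue integral in the chart.\<close>

definition loc_fun :: "('a, 'n) chart \<Rightarrow> (real^'n \<Rightarrow> real) \<Rightarrow> 'a \<Rightarrow> real" where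
  "loc_fun c h p = (if p \<in> fst c then h (snd c p) / rho c (snd c p) else 0)"

lemma loc_fun:
  assumes c: "c \<in> atlas G" and h: "h \<in> borel_measurable borel" and K: "compact K" "K \<subseteq> snd c ` (\<Omega> \<inter> fst c)"
    and h0: "\<And>y. y \<notin> K \<Longrightarrow> h y = 0" and hB: "\<And>y. \<bar>h y\<bar> \<le> B"
  shows "loc_fun c h \<in> L2 \<nu> \<Omega>"
    and "u \<in> L2 \<nu> \<Omega> \<Longrightarrow> (LINT x:\<Omega>|\<nu>. u x * loc_fun c h x) = (LINT y|lborel. u (chart_inv c y) * h y)"
proof -
  have Kimg: "K \<subseteq> img c" using K(2) by auto
  have h\<Omega>: "h (snd c p) = 0" if "p \<in> fst c" "p \<notin> \<Omega>" for p
  proof (rule h0)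
    show "snd c p \<notin> K" using that K(2) inj_chart[OF c] by (auto simp: inj_on_def)
  qed
  have crc: "continuous_on (img c) (\<lambda>y. 1 / rho c y)"
    using rho_pos[OF c] by (intro continuous_on_divide continuous_on_const continuous_rho[OF c]) force
  have cr: "continuous_on (fst c) (\<lambda>p. 1 / rho c (snd c p))"
    by (rule continuous_on_compose2[OF crc continuous_chart[OF c]]) auto
  have "(\<lambda>p. indicator \<Omega> p * ((indicator (fst c) p * h (snd c p)) * (indicator (fst c) p *\<^sub>R (1 / rho c (snd c p))))) \<in> borel_measurable borel"
    by (intro borel_measurable_times measurable_chart_comp c h borel_measurable_indicator domain_sets
        borel_measurable_continuous_on_indicator[OF chart_sets[OF c] cr])
  moreover have "indicator \<Omega> p * ((indicator (fst c) p * h (snd c p)) * (indicator (fst c) p *\<^sub>R (1 / rho c (snd c p)))) =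
      indicator \<Omega> p * loc_fun c h p" for p
    by (auto simp: indicator_def loc_fun_def)
  ultimately have m: "(\<lambda>p. indicator \<Omega> p * loc_fun c h p) \<in> borel_measurable borel" by simp
  have eq: "(indicator \<Omega> p * loc_fun c h p)\<^sup>2 = indicator (fst c) p *\<^sub>R (indicator \<Omega> p * loc_fun c h p)\<^sup>2" for p
    by (auto simp: indicator_def loc_fun_def)
  let ?F = "\<lambda>p. (indicator \<Omega> p * loc_fun c h p)\<^sup>2"
  have m2: "(\<lambda>x. indicator (fst c) x * ?F x) \<in> borel_measurable borel"
    using chart_sets[OF c] by (intro borel_measurable_times[OF borel_measurable_indicator borel_measurable_power[OF m]]) auto
  have r: "indicator (img c) y *\<^sub>R (rho c y * ?F (chart_inv c y)) = (indicator (img c) y *\<^sub>R (1 / rho c y)) * (h y)\<^sup>2" for y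
  proof (cases "y \<in> img c")
    case True
    then have p: "chart_inv c y \<in> fst c" "snd c (chart_inv c y) = y" by (auto simp: chart_inv_dom chart_chart_inv)
    show ?thesis
      using h\<Omega>[OF p(1)] p True rho_pos[OF c True]
      by (cases "chart_inv c y \<in> \<Omega>") (auto simp: loc_fun_def power2_eq_square)
  qed simp
  have "integrable lborel (\<lambda>y. (indicator (img c) y *\<^sub>R (1 / rho c y)) * (h y)\<^sup>2)"
  proof -
    obtain B' where B': "B' > 0" "\<And>y. y \<in> K \<Longrightarrow> \<bar>1 / rho c y\<bar> \<le> B'"
      using compact_in_chart[OF c K(1) Kimg crc] by blast
    show ?thesis
    proof (rule integrable_compact_bounded[OF K(1), where B = "B' * B\<^sup>2"])
      show "(\<lambda>y. (indicator (img c) y *\<^sub>R (1 / rho c y)) * (h y)\<^sup>2) \<in> borel_measurable borel"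
        by (intro borel_measurable_times borel_measurable_power h
            borel_measurable_continuous_on_indicator[OF _ crc]) (use open_img[OF c] in auto)
      show "(indicator (img c) y *\<^sub>R (1 / rho c y)) * (h y)\<^sup>2 = 0" if "y \<notin> K" for y using h0[OF that] by simp
      show "\<bar>(indicator (img c) y *\<^sub>R (1 / rho c y)) * (h y)\<^sup>2\<bar> \<le> B' * B\<^sup>2" if y: "y \<in> K" for y
      proof -
        have "(h y)\<^sup>2 \<le> B\<^sup>2" using hB[of y] by (metis abs_ge_zero power2_abs power_mono)
        moreover have "y \<in> img c" using y Kimg by blast
        ultimately show ?thesis unfolding abs_mult using B'(2)[OF y] B'(1)
          by (intro mult_mono) auto
      qed
    qed
  qed
  then show L: "loc_fun c h \<in> L2 \<nu> \<Omega>"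
    using chart_integral(2)[OF c m2] m by (simp only: set_integrable_def L2_iff measurable_nu r eq[symmetric])
  assume u: "u \<in> L2 \<nu> \<Omega>"
  let ?H = "\<lambda>p. (indicator \<Omega> p * u p) * (indicator \<Omega> p * loc_fun c h p)"
  have m3: "(\<lambda>x. indicator (fst c) x * ?H x) \<in> borel_measurable borel"
    using u chart_sets[OF c]
    by (intro borel_measurable_times[OF borel_measurable_indicator borel_measurable_times[OF _ m]]) (auto simp: L2_iff)
  have e3: "indicator \<Omega> p *\<^sub>R (u p * loc_fun c h p) = indicator (fst c) p *\<^sub>R ?H p" for p
    by (auto simp: indicator_def loc_fun_def)
  have r3: "indicator (img c) y *\<^sub>R (rho c y * ?H (chart_inv c y)) = u (chart_inv c y) * h y" for y
  proof (cases "y \<in> img c")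
    case True
    then have p: "chart_inv c y \<in> fst c" "snd c (chart_inv c y) = y" by (auto simp: chart_inv_dom chart_chart_inv)
    show ?thesis
      using h\<Omega>[OF p(1)] p True rho_pos[OF c True]
      by (cases "chart_inv c y \<in> \<Omega>") (auto simp: loc_fun_def)
  next
    case False
    then show ?thesis using h0[of y] Kimg by auto
  qed
  show "(LINT x:\<Omega>|\<nu>. u x * loc_fun c h x) = (LINT y|lborel. u (chart_inv c y) * h y)"
    using chart_integral(1)[OF c m3] by (simp only: set_lebesgue_integral_def e3 r3)
qed

definition admissible :: "('a, 'n) chart \<Rightarrow> (real^'n \<Rightarrow> real) \<Rightarrow> bool" where
  "admissible c \<eta> \<longleftrightarrow> c \<in> atlas G \<and> smooth_on \<eta> UNIV \<and> compactly_supported_in \<eta> (snd c ` (\<Omega> \<inter> fst c))"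

lemma bounded_compact_support:
  fixes f :: "real^'n \<Rightarrow> real"
  assumes "compact K" "continuous_on UNIV f" "\<And>y. y \<notin> K \<Longrightarrow> f y = 0"
  obtains B where "\<And>y. \<bar>f y\<bar> \<le> B"
proof -
  have "bounded (f ` K)"
    by (intro compact_imp_bounded compact_continuous_image assms(1) continuous_on_subset[OF assms(2)]) auto
  then obtain B where B: "B > 0" "\<And>r. r \<in> f ` K \<Longrightarrow> norm r \<le> B" unfolding bounded_pos by auto
  have "\<bar>f y\<bar> \<le> B" for y
    using B(2)[OF imageI, of y] assms(3)[of y] B(1) by (cases "y \<in> K") auto
  then show ?thesis using that by blast
qed

lemma admissible_bounds:
  assumes "admissible c \<eta>"
  shows "\<exists>K B B'. compact K \<and> K \<subseteq> snd c ` (\<Omega> \<inter> fst c) \<and>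
    (\<forall>y. y \<notin> K \<longrightarrow> \<eta> y = 0) \<and> (\<forall>y. \<bar>\<eta> y\<bar> \<le> B) \<and> \<eta> \<in> borel_measurable borel \<and>
    (\<forall>y. y \<notin> K \<longrightarrow> partial i \<eta> y = 0) \<and> (\<forall>y. \<bar>partial i \<eta> y\<bar> \<le> B') \<and> partial i \<eta> \<in> borel_measurable borel"
proof -
  let ?K = "closure {x. \<eta> x \<noteq> 0}"
  have K: "compact ?K" "?K \<subseteq> snd c ` (\<Omega> \<inter> fst c)"
    using assms by (auto simp: admissible_def compactly_supported_in_def)
  have sm: "smooth_on \<eta> UNIV" using assms by (simp add: admissible_def)
  have z: "\<eta> y = 0" if "y \<notin> ?K" for y using that closure_subset[of "{x. \<eta> x \<noteq> 0}"] by blast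
  have pz: "partial i \<eta> y = 0" if "y \<notin> ?K" for y
  proof -
    have "partial i \<eta> y = partial i (\<lambda>y. 0) y"
    proof (rule partial_cong_open)
      show "open (- ?K)" by (rule open_Compl[OF closed_closure])
      show "y \<in> - ?K" using that by (simp only: Compl_iff not_False_eq_True)
      show "\<eta> x = 0" if "x \<in> - ?K" for x using z[of x] that by (simp only: Compl_iff not_False_eq_True)
    qed
    then show ?thesis by (simp add: partial_const)
  qed
  have c1: "continuous_on UNIV \<eta>" by (rule smooth_on_continuous[OF sm])
  have c2: "continuous_on UNIV (partial i \<eta>)"
    unfolding partial_def[abs_def] by (rule smooth_on_continuous[OF smooth_on_derivative[OF sm]])
  obtain B where B: "\<And>y. \<bar>\<eta> y\<bar> \<le> B" using bounded_compact_support[OF K(1) c1 z] by blast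
  obtain B' where B': "\<And>y. \<bar>partial i \<eta> y\<bar> \<le> B'" using bounded_compact_support[OF K(1) c2 pz] by blast
  show ?thesis
    by (intro exI[of _ ?K] exI[of _ B] exI[of _ B'] conjI allI impI K z B pz B'
        borel_measurable_continuous_onI[OF c1] borel_measurable_continuous_onI[OF c2])
qed

lemma admissible_fields:
  assumes "admissible c \<eta>"
  shows "loc_field c \<eta> i \<in> VF" "loc_fun c (partial i \<eta>) \<in> L2 \<nu> \<Omega>"
    "X \<in> VF \<Longrightarrow> ip X (loc_field c \<eta> i) = (LINT y|lborel. (metric G c (chart_inv c y) *v X c (chart_inv c y)) $ i * \<eta> y)"
    "u \<in> L2 \<nu> \<Omega> \<Longrightarrow> (LINT x:\<Omega>|\<nu>. u x * loc_fun c (partial i \<eta>) x) = (LINT y|lborel. u (chart_inv c y) * partial i \<eta> y)"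
proof -
  have c: "c \<in> atlas G" using assms by (simp add: admissible_def)
  obtain K B B' where "compact K \<and> K \<subseteq> snd c ` (\<Omega> \<inter> fst c) \<and>
    (\<forall>y. y \<notin> K \<longrightarrow> \<eta> y = 0) \<and> (\<forall>y. \<bar>\<eta> y\<bar> \<le> B) \<and> \<eta> \<in> borel_measurable borel \<and>
    (\<forall>y. y \<notin> K \<longrightarrow> partial i \<eta> y = 0) \<and> (\<forall>y. \<bar>partial i \<eta> y\<bar> \<le> B') \<and> partial i \<eta> \<in> borel_measurable borel"
    using admissible_bounds[OF assms, of i] by (elim exE)
  then have K: "compact K" "K \<subseteq> snd c ` (\<Omega> \<inter> fst c)"
    "\<And>y. y \<notin> K \<Longrightarrow> \<eta> y = 0" "\<And>y. \<bar>\<eta> y\<bar> \<le> B" "\<eta> \<in> borel_measurable borel"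
    "\<And>y. y \<notin> K \<Longrightarrow> partial i \<eta> y = 0" "\<And>y. \<bar>partial i \<eta> y\<bar> \<le> B'" "partial i \<eta> \<in> borel_measurable borel"
    by blast+
  show "loc_field c \<eta> i \<in> VF" by (rule loc_field(1)[OF c K(5,1-4)])
  show "loc_fun c (partial i \<eta>) \<in> L2 \<nu> \<Omega>" by (rule loc_fun(1)[OF c K(8,1,2,6,7)])
  show "ip X (loc_field c \<eta> i) = (LINT y|lborel. (metric G c (chart_inv c y) *v X c (chart_inv c y)) $ i * \<eta> y)" if "X \<in> VF"
    by (rule loc_field(3)[OF c K(5,1-4) that])
  show "(LINT x:\<Omega>|\<nu>. u x * loc_fun c (partial i \<eta>) x) = (LINT y|lborel. u (chart_inv c y) * partial i \<eta> y)" if "u \<in> L2 \<nu> \<Omega>"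
    by (rule loc_fun(2)[OF c K(8,1,2,6,7) that])
qed

text \<open>Both sides of the defining identity become pairings with fixed elements,
  \<open>loc_fun\<close> in L2(\<nu>) and \<open>loc_field\<close> in \<open>VF\<close>. Linearity
  of the weak gradient is then bilinearity, and its closedness is the Cauchy-Schwarz
  inequality.\<close>

lemma weak_gradient_iff:
  assumes "u \<in> L2 \<nu> \<Omega>"
  shows "weak_gradient G \<nu> \<Omega> u X \<longleftrightarrow> X \<in> VF \<and>
    (\<forall>c \<eta> i. admissible c \<eta> \<longrightarrow> (LINT x:\<Omega>|\<nu>. u x * loc_fun c (partial i \<eta>) x) = - ip X (loc_field c \<eta> i))"
proof (cases "X \<in> VF")
  case True
  show ?thesis
    unfolding weak_gradient_def
  proof (intro conj_cong refl iffI allI ballI impI)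
    fix c \<eta> i
    assume a: "\<forall>c\<in>atlas G. \<forall>\<eta>. smooth_on \<eta> UNIV \<and> compactly_supported_in \<eta> (snd c ` (\<Omega> \<inter> fst c)) \<longrightarrow>
        (\<forall>i. (LINT y|lborel. u (chart_inv c y) * partial i \<eta> y) =
             - (LINT y|lborel. (metric G c (chart_inv c y) *v X c (chart_inv c y)) $ i * \<eta> y))"
      and ad: "admissible c \<eta>"
    then show "(LINT x:\<Omega>|\<nu>. u x * loc_fun c (partial i \<eta>) x) = - ip X (loc_field c \<eta> i)"
      unfolding admissible_fields(3)[OF ad True] admissible_fields(4)[OF ad assms]
      by (simp add: admissible_def)
  next
    fix c \<eta> i
    assume a: "\<forall>c \<eta> i. admissible c \<eta> \<longrightarrow> (LINT x:\<Omega>|\<nu>. u x * loc_fun c (partial i \<eta>) x) = - ip X (loc_field c \<eta> i)"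
      and c: "c \<in> atlas G" and \<eta>: "smooth_on \<eta> UNIV \<and> compactly_supported_in \<eta> (snd c ` (\<Omega> \<inter> fst c))"
    have ad: "admissible c \<eta>" using c \<eta> by (simp add: admissible_def)
    from a[rule_format, OF ad, of i] show "(LINT y|lborel. u (chart_inv c y) * partial i \<eta> y) =
             - (LINT y|lborel. (metric G c (chart_inv c y) *v X c (chart_inv c y)) $ i * \<eta> y)"
      unfolding admissible_fields(3)[OF ad True] admissible_fields(4)[OF ad assms] .
  qed
qed (simp add: weak_gradient_def)

lemma weak_gradient_admissible:
  assumes "u \<in> L2 \<nu> \<Omega>" "weak_gradient G \<nu> \<Omega> u X" "admissible c \<eta>"
  shows "(LINT x:\<Omega>|\<nu>. u x * loc_fun c (partial i \<eta>) x) = - ip X (loc_field c \<eta> i)"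
  using assms(2,3) unfolding weak_gradient_iff[OF assms(1)] by blast

sublocale L2i: semi_inner_product "L2 \<nu> \<Omega>" "\<lambda>f g. LINT x:\<Omega>|\<nu>. f x * g x"
  by (rule L2_semi_inner_product)

lemma weak_gradient_lin:
  assumes "u \<in> L2 \<nu> \<Omega>" "v \<in> L2 \<nu> \<Omega>" "weak_gradient G \<nu> \<Omega> u X" "weak_gradient G \<nu> \<Omega> v Y"
  shows "weak_gradient G \<nu> \<Omega> (\<lambda>x. a * u x + b * v x) (lc a X b Y)"
proof -
  have XY: "X \<in> VF" "Y \<in> VF" using assms weak_gradient_iff by auto
  show ?thesis
    unfolding weak_gradient_iff[OF L2i.lin[OF assms(1,2)]]
  proof (intro conjI VF_lc XY allI impI)
    fix c \<eta> i assume ad: "admissible c \<eta>"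
    show "(LINT x:\<Omega>|\<nu>. (a * u x + b * v x) * loc_fun c (partial i \<eta>) x) = - ip (lc a X b Y) (loc_field c \<eta> i)"
      unfolding L2i.B_lin[OF assms(1,2) admissible_fields(2)[OF ad]] ip_lc_left[OF XY admissible_fields(1)[OF ad]]
        weak_gradient_admissible[OF assms(1,3) ad] weak_gradient_admissible[OF assms(2,4) ad] by simp
  qed
qed

text \<open>Each admissible \<eta> contributes one identity between two continuous functionals, one
  of the function and one of the field, and it survives the two limits.\<close>

lemma weak_gradient_limit:
  assumes u: "u \<in> L2 \<nu> \<Omega>" "\<And>k. v k \<in> L2 \<nu> \<Omega>" and X: "X \<in> VF" "\<And>k. weak_gradient G \<nu> \<Omega> (v k) (Y k)"
    and lim1: "(\<lambda>k. L2i.nrm (\<lambda>x. v k x - u x)) \<longlonglongrightarrow> 0"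
    and lim2: "(\<lambda>k. ip (lc 1 (Y k) (-1) X) (lc 1 (Y k) (-1) X)) \<longlonglongrightarrow> 0"
  shows "weak_gradient G \<nu> \<Omega> u X"
  unfolding weak_gradient_iff[OF u(1)]
proof (intro conjI X(1) allI impI)
  fix c \<eta> i assume ad: "admissible c \<eta>"
  let ?f = "loc_fun c (partial i \<eta>)" and ?Z = "loc_field c \<eta> i"
  have f: "?f \<in> L2 \<nu> \<Omega>" and Z: "?Z \<in> VF" using admissible_fields[OF ad] by auto
  have Y: "Y k \<in> VF" for k using X(2) weak_gradient_iff[OF u(2)] by auto
  have eq: "(LINT x:\<Omega>|\<nu>. v k x * ?f x) = - ip (Y k) ?Z" for k
    by (rule weak_gradient_admissible[OF u(2) X(2) ad])
  have "(\<lambda>k. (LINT x:\<Omega>|\<nu>. v k x * ?f x) - (LINT x:\<Omega>|\<nu>. u x * ?f x)) \<longlonglongrightarrow> 0"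
  proof (rule Lim_null_comparison)
    show "\<forall>\<^sub>F k in sequentially. norm ((LINT x:\<Omega>|\<nu>. v k x * ?f x) - (LINT x:\<Omega>|\<nu>. u x * ?f x)) \<le> L2i.nrm (\<lambda>x. v k x - u x) * L2i.nrm ?f"
      using L2i.cauchy_schwarz[OF L2i.diff[OF u(2,1)] f] L2i.B_diff[OF u(2,1) f]
      by (intro always_eventually) (simp add: L2i.nrm_def)
    show "(\<lambda>k. L2i.nrm (\<lambda>x. v k x - u x) * L2i.nrm ?f) \<longlonglongrightarrow> 0"
      using tendsto_mult[OF lim1 tendsto_const[of "L2i.nrm ?f"]] by simp
  qed
  moreover have "(\<lambda>k. ip (Y k) ?Z - ip X ?Z) \<longlonglongrightarrow> 0"
  proof (rule Lim_null_comparison)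
    have "\<bar>ip (Y k) ?Z - ip X ?Z\<bar> \<le> sqrt (ip (lc 1 (Y k) (-1) X) (lc 1 (Y k) (-1) X)) * sqrt (ip ?Z ?Z)" for k
      using ip_cauchy_schwarz[OF VF_lc[OF Y X(1)] Z, of 1 k "-1"] ip_lc_left[OF Y X(1) Z, of 1 k "-1"] by simp
    then show "\<forall>\<^sub>F k in sequentially. norm (ip (Y k) ?Z - ip X ?Z) \<le> sqrt (ip (lc 1 (Y k) (-1) X) (lc 1 (Y k) (-1) X)) * sqrt (ip ?Z ?Z)"
      by simp
    show "(\<lambda>k. sqrt (ip (lc 1 (Y k) (-1) X) (lc 1 (Y k) (-1) X)) * sqrt (ip ?Z ?Z)) \<longlonglongrightarrow> 0"
      using tendsto_mult[OF tendsto_real_sqrt[OF lim2] tendsto_const[of "sqrt (ip ?Z ?Z)"]] by simp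
  qed
  ultimately have "(\<lambda>k. ((LINT x:\<Omega>|\<nu>. v k x * ?f x) - (LINT x:\<Omega>|\<nu>. u x * ?f x)) + (ip (Y k) ?Z - ip X ?Z)) \<longlonglongrightarrow> 0 + 0"
    by (rule tendsto_add)
  then have "(\<lambda>k::nat. - (LINT x:\<Omega>|\<nu>. u x * ?f x) - ip X ?Z) \<longlonglongrightarrow> 0"
    by (simp add: eq)
  then show "(LINT x:\<Omega>|\<nu>. u x * ?f x) = - ip X ?Z" by (simp add: LIMSEQ_const_iff)
qed

text \<open>The covariant components of the difference of the two fields integrate to zero against
  every admissible \<eta>, so they vanish almost everywhere in each chart; positivity of the metric
  then removes the difference itself.\<close>

lemma weak_gradient_unique:
  assumes u: "u \<in> L2 \<nu> \<Omega>" and X: "weak_gradient G \<nu> \<Omega> u X" and Y: "weak_gradient G \<nu> \<Omega> u Y"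
  shows "AE p in \<nu>. p \<in> \<Omega> \<longrightarrow> (\<forall>Z. rinner G X Z p = rinner G Y Z p)"
proof (rule AE_vfield_cong)
  have XY: "X \<in> VF" "Y \<in> VF" using X Y weak_gradient_iff[OF u] by auto
  then show "is_vfield_on G \<Omega> X" "is_vfield_on G \<Omega> Y" by (auto simp: VF_iff measurable_vfield_def)
  let ?Z = "lc 1 X (-1) Y"
  have Z: "?Z \<in> VF" by (rule VF_lc[OF XY])
  have ip0: "ip ?Z (loc_field c \<eta> i) = 0" if "admissible c \<eta>" for c \<eta> i
    using weak_gradient_admissible[OF u X that, of i] weak_gradient_admissible[OF u Y that, of i]
    by (simp add: ip_lc_left[OF XY admissible_fields(1)[OF that]])
  fix c assume c: "c \<in> atlas G"
  let ?S = "snd c ` (\<Omega> \<inter> fst c)"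
  let ?D = "\<lambda>i y. (metric G c (chart_inv c y) *v ?Z c (chart_inv c y)) $ i"
  have "AE y in lborel. y \<in> ?S \<longrightarrow> ?D i y = 0" for i
  proof (rule fundamental_lemma_calculus_of_variations)
    show "open ?S" by (rule open_chart_image[OF c open_domain])
    fix K assume K: "compact K" "K \<subseteq> ?S"
    have "integrable lborel (\<lambda>y. ?D i y * indicator K y)"
      by (rule loc_field(2)[OF c borel_measurable_indicator[OF borel_closed[OF compact_imp_closed[OF K(1)]]] K _ _ Z, where B = 1])
        (auto simp: indicator_def)
    then show "set_integrable lborel K (?D i)" by (simp add: set_integrable_def mult.commute)
  next
    fix \<eta> assume "smooth_on \<eta> UNIV" "compactly_supported_in \<eta> ?S"
    then have ad: "admissible c \<eta>" using c by (simp add: admissible_def)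
    show "(LINT y|lborel. ?D i y * \<eta> y) = 0"
      using ip0[OF ad] admissible_fields(3)[OF ad Z] by simp
  qed
  then have "AE y in lborel. \<forall>i. y \<in> ?S \<longrightarrow> ?D i y = 0" by (subst AE_all_countable) simp
  then have "AE y in lborel. y \<in> img c \<longrightarrow> (chart_inv c y \<in> \<Omega> \<longrightarrow> X c (chart_inv c y) = Y c (chart_inv c y))"
  proof eventually_elim
    case (elim y)
    show ?case
    proof (intro impI)
      assume y: "y \<in> img c" "chart_inv c y \<in> \<Omega>"
      then have p: "chart_inv c y \<in> fst c" by (simp add: chart_inv_dom)
      have "y = snd c (chart_inv c y)" using y by (simp add: chart_chart_inv)
      then have "y \<in> ?S" using y p by blast
      then have "metric G c (chart_inv c y) *v ?Z c (chart_inv c y) = 0" using elim by (simp add: vec_eq_iff)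
      then have "?Z c (chart_inv c y) \<bullet> (metric G c (chart_inv c y) *v ?Z c (chart_inv c y)) = 0" by simp
      then have "?Z c (chart_inv c y) = 0" using metric_pos[OF c p] by (metis less_irrefl)
      then show "X c (chart_inv c y) = Y c (chart_inv c y)" by (simp add: lc_def)
    qed
  qed
  from AE_chart[OF c this] show "AE p in \<nu>. p \<in> \<Omega> \<inter> fst c \<longrightarrow> X c p = Y c p"
    by eventually_elim simp
qed

abbreviation W where "W \<equiv> W12 G \<nu> \<Omega>"
abbreviation E where "E \<equiv> dirichlet G \<nu> \<Omega>"

lemma W_L2: "u \<in> W \<Longrightarrow> u \<in> L2 \<nu> \<Omega>"
  by (simp add: W12_def)

lemma wgrad: "u \<in> W \<Longrightarrow> weak_gradient G \<nu> \<Omega> u (wgrad G \<nu> \<Omega> u)"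
  unfolding W12_def wgrad_def by (metis (mono_tags, lifting) mem_Collect_eq someI_ex)

lemma wgrad_VF: "u \<in> W \<Longrightarrow> wgrad G \<nu> \<Omega> u \<in> VF"
  using wgrad by (simp add: weak_gradient_def)

lemma W_I: "u \<in> L2 \<nu> \<Omega> \<Longrightarrow> weak_gradient G \<nu> \<Omega> u X \<Longrightarrow> u \<in> W"
  by (auto simp: W12_def)

text \<open>\<open>dirichlet\<close> refers to weak gradients picked by choice. Uniqueness up to
  null sets permits any others, in particular the classical gradient of a test function.\<close>

lemma dirichlet_eq_ip:
  assumes u: "u \<in> L2 \<nu> \<Omega>" "weak_gradient G \<nu> \<Omega> u X" and v: "v \<in> L2 \<nu> \<Omega>" "weak_gradient G \<nu> \<Omega> v Y"
  shows "E u v = ip X Y"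
proof -
  let ?X = "wgrad G \<nu> \<Omega> u" and ?Y = "wgrad G \<nu> \<Omega> v"
  have uW: "u \<in> W" and vW: "v \<in> W" using u v W_I by auto
  have mv: "measurable_vfield X" "measurable_vfield Y" "measurable_vfield ?X" "measurable_vfield ?Y"
    using u v wgrad_VF[OF uW] wgrad_VF[OF vW] unfolding weak_gradient_def VF_iff by auto
  have "AE p in \<nu>. indicator \<Omega> p *\<^sub>R rinner G ?X ?Y p = indicator \<Omega> p *\<^sub>R rinner G X Y p"
    using weak_gradient_unique[OF u(1) wgrad[OF uW] u(2)] weak_gradient_unique[OF v(1) wgrad[OF vW] v(2)]
  proof eventually_elim
    case (elim p)
    show ?case
    proof (cases "p \<in> \<Omega>")
      case True
      then have "rinner G ?X ?Y p = rinner G X ?Y p" using elim by blast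
      also have "\<dots> = rinner G ?Y X p" by (rule rinner_sym)
      also have "\<dots> = rinner G Y X p" using elim True by blast
      also have "\<dots> = rinner G X Y p" by (rule rinner_sym)
      finally show ?thesis by simp
    qed simp
  qed
  then show ?thesis
    unfolding dirichlet_def ip_def set_lebesgue_integral_def
    using rinner_measurable[OF mv(3,4)] rinner_measurable[OF mv(1,2)] by (intro integral_cong_AE) auto
qed

lemma W_lin: "u \<in> W \<Longrightarrow> v \<in> W \<Longrightarrow> (\<lambda>x. a * u x + b * v x) \<in> W"
  using weak_gradient_lin[OF W_L2 W_L2 wgrad wgrad, of u v a b] L2i.lin[OF W_L2 W_L2, of u v a b] W_I by blast

sublocale Ei: semi_inner_product W E
proof
  fix u v w and a b :: real assume uv: "u \<in> W" "v \<in> W" and w: "w \<in> W"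
  have "E (\<lambda>x. a * u x + b * v x) w = ip (lc a (wgrad G \<nu> \<Omega> u) b (wgrad G \<nu> \<Omega> v)) (wgrad G \<nu> \<Omega> w)"
    by (rule dirichlet_eq_ip[OF W_L2[OF W_lin[OF uv]] weak_gradient_lin[OF W_L2 W_L2 wgrad wgrad] W_L2[OF w] wgrad[OF w]])
      (use uv in auto)
  also have "\<dots> = a * E u w + b * E v w"
    using uv w by (simp add: ip_lc_left wgrad_VF dirichlet_def ip_def[symmetric])
  finally show "E (\<lambda>x. a * u x + b * v x) w = a * E u w + b * E v w" .
next
  show "E u v = E v u" for u v by (simp add: dirichlet_def rinner_sym[of "wgrad G \<nu> \<Omega> u"])
  show "E u u \<ge> 0" for u using ip_nonneg by (simp add: dirichlet_def ip_def[symmetric])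
qed (rule W_lin)

sublocale Wi: semi_inner_product W "\<lambda>u v. (LINT x:\<Omega>|\<nu>. u x * v x) + E u v"
proof
  fix u v w and a b :: real assume uv: "u \<in> W" "v \<in> W" and w: "w \<in> W"
  show "(LINT x:\<Omega>|\<nu>. (a * u x + b * v x) * w x) + E (\<lambda>x. a * u x + b * v x) w =
      a * ((LINT x:\<Omega>|\<nu>. u x * w x) + E u w) + b * ((LINT x:\<Omega>|\<nu>. v x * w x) + E v w)"
    unfolding L2i.B_lin[OF W_L2 W_L2 W_L2, OF uv w] Ei.B_lin[OF uv w] by (simp add: algebra_simps)
next
  fix u assume "u \<in> W"
  then show "0 \<le> (LINT x:\<Omega>|\<nu>. u x * u x) + E u u" using L2i.pos[OF W_L2] Ei.pos by (simp add: add_nonneg_nonneg)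
next
  fix u v assume "u \<in> W" "v \<in> W"
  then show "(LINT x:\<Omega>|\<nu>. u x * v x) + E u v = (LINT x:\<Omega>|\<nu>. v x * u x) + E v u"
    using L2i.sym[OF W_L2 W_L2, of u v] Ei.sym[of u v] by simp
qed (rule W_lin)

lemma W12_norm_eq: "W12_norm G \<nu> \<Omega> = Wi.nrm"
  by (simp add: W12_norm_def Wi.nrm_def fun_eq_iff power2_eq_square)

lemma Wi_ge:
  assumes "u \<in> W"
  shows "L2i.nrm u \<le> Wi.nrm u" "Ei.nrm u \<le> Wi.nrm u"
  using L2i.pos[OF W_L2[OF assms]] Ei.pos[OF assms]
  by (auto simp: L2i.nrm_def Ei.nrm_def Wi.nrm_def)

end

section \<open>Completeness of the Sobolev space\<close>

context riemannian_domain
begin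

lemma nn_integral_ip:
  assumes "Z \<in> VF"
  shows "(\<integral>\<^sup>+p. ennreal (indicator \<Omega> p * rinner G Z Z p) \<partial>\<nu>) = ennreal (ip Z Z)"
  unfolding ip_def set_lebesgue_integral_def real_scaleR_def
  using rinner_integrable[OF assms assms] unfolding set_integrable_def real_scaleR_def
  by (rule nn_integral_eq_integral) (simp add: rinner_nonneg)

text \<open>A field has components in every chart, so completeness for scalar functions does not
  apply directly. But the Riemannian norm of successive differences is a scalar; where these norms
  are summable, the components converge in all charts simultaneously, since the metric at a point is
  equivalent to the Euclidean norm.\<close>

lemma VF_complete:
  assumes X: "\<And>n. X n \<in> VF"
    and cau: "\<And>e. e > 0 \<Longrightarrow> \<exists>N. \<forall>m\<ge>N. \<forall>n\<ge>N. ip (lc 1 (X m) (-1) (X n)) (lc 1 (X m) (-1) (X n)) < e"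
  obtains Y where "Y \<in> VF" "(\<lambda>n. ip (lc 1 (X n) (-1) Y) (lc 1 (X n) (-1) Y)) \<longlonglongrightarrow> 0"
proof -
  define D where "D m n = lc 1 (X m) (-1) (X n)" for m n
  have D: "D m n \<in> VF" for m n unfolding D_def by (rule VF_lc[OF X X])
  have Xvf: "is_vfield_on G \<Omega> (X n)" for n using X[of n] by (simp add: VF_iff measurable_vfield_def)
  have Dvf: "is_vfield_on G \<Omega> (D m n)" for m n using D[of m n] by (simp add: VF_iff measurable_vfield_def)
  have "\<exists>N. \<forall>m\<ge>N. \<forall>n\<ge>N. sqrt (ip (D m n) (D m n)) < e" if "e > 0" for e
  proof -
    from that have "e\<^sup>2 > 0" by simp
    from cau[OF this] obtain N where N: "\<And>m n. m \<ge> N \<Longrightarrow> n \<ge> N \<Longrightarrow> ip (D m n) (D m n) < e\<^sup>2"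
      unfolding D_def by blast
    have "sqrt (ip (D m n) (D m n)) < e" if "m \<ge> N" "n \<ge> N" for m n
      using real_sqrt_less_mono[OF N[OF that]] \<open>e > 0\<close> by simp
    then show ?thesis by blast
  qed
  then obtain r where r: "strict_mono r" and rs: "\<And>k m n. m \<ge> r k \<Longrightarrow> n \<ge> r k \<Longrightarrow> sqrt (ip (D m n) (D m n)) < (1/2) ^ k"
    using fast_subsequence[of "\<lambda>m n. sqrt (ip (D m n) (D m n))"] by blast
  have small: "ip (D m n) (D m n) \<le> (1/4) ^ k" if "m \<ge> r k" "n \<ge> r k" for m n k
  proof -
    have "(sqrt (ip (D m n) (D m n)))\<^sup>2 \<le> ((1/2) ^ k)\<^sup>2"
      using rs[OF that] ip_nonneg by (intro power_mono) auto
    also have "((1/2) ^ k)\<^sup>2 = (1/4 :: real) ^ k"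
      by (simp add: power_mult[symmetric] mult.commute[of k]) (simp add: power_mult power2_eq_square)
    finally show ?thesis using ip_nonneg by simp
  qed
  have rmono: "r k \<le> r j" if "k \<le> j" for k j using r that by (simp add: strict_mono_less_eq)
  define s where "s k p = sqrt (indicator \<Omega> p * rinner G (D (r (Suc k)) (r k)) (D (r (Suc k)) (r k)) p)" for k p
  have iq0: "0 \<le> indicator \<Omega> p * rinner G Z Z p" for p Z by (simp add: rinner_nonneg)
  have sm[measurable]: "s k \<in> borel_measurable borel" for k
  proof -
    have "(\<lambda>p. indicator \<Omega> p * rinner G (D (r (Suc k)) (r k)) (D (r (Suc k)) (r k)) p) \<in> borel_measurable borel"
      using D[of "r (Suc k)" "r k"] by (intro rinner_measurable) (auto simp: VF_iff)
    moreover have "sqrt \<in> borel_measurable borel"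
      by (rule borel_measurable_continuous_onI) (intro continuous_intros)
    ultimately show ?thesis unfolding s_def[abs_def] by (rule measurable_compose)
  qed
  have s0: "s k p \<ge> 0" for k p using iq0 by (simp add: s_def)
  have AEs: "AE p in \<nu>. summable (\<lambda>k. s k p)"
  proof (rule fast_Cauchy_AE)
    fix k
    have "(\<integral>\<^sup>+p. ennreal ((s k p)\<^sup>2) \<partial>\<nu>) = ennreal (ip (D (r (Suc k)) (r k)) (D (r (Suc k)) (r k)))"
      unfolding s_def using nn_integral_ip[OF D] iq0 by simp
    also have "\<dots> \<le> ennreal ((1/4) ^ k)" by (intro ennreal_leI small rmono) auto
    finally show "(\<integral>\<^sup>+p. ennreal ((s k p)\<^sup>2) \<partial>\<nu>) \<le> ennreal ((1/4) ^ k)" .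
  qed (auto simp: s0)
  \<comment> \<open>An extended sum is measurable without any convergence assumption, and its
    finiteness describes one exceptional set common to all charts.\<close>
  define T where "T p = (\<Sum>k. ennreal (s k p))" for p
  have Tm[measurable]: "T \<in> borel_measurable borel" unfolding T_def by measurable
  have TI: "T p \<noteq> top" if "summable (\<lambda>k. s k p)" for p
    using suminf_ennreal2[OF s0 that] by (simp add: T_def)
  have TD: "summable (\<lambda>k. s k p)" if "T p \<noteq> top" for p
    using that s0 unfolding T_def by (intro summable_suminf_not_top) auto
  have AET: "AE p in \<nu>. T p \<noteq> top" using AEs by eventually_elim (rule TI)
  \<comment> \<open>The transformation law is demanded at every point of \<Omega>, not almost
    everywhere. The value 0 on the exceptional set, in every chart, is compatible with it.\<close>
  define Y where "Y c p = (if p \<in> \<Omega> \<and> T p \<noteq> top then lim (\<lambda>k. X (r k) c p) else 0)" for c p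
  have conv: "(\<lambda>k. X (r k) c p) \<longlonglongrightarrow> Y c p" if p: "p \<in> \<Omega>" "T p \<noteq> top" and c: "c \<in> atlas G" "p \<in> fst c" for c p
  proof -
    obtain C where C: "C > 0" "\<And>v. norm v \<le> C * sqrt (v \<bullet> (metric G c p *v v))"
      using posdef_norm_bound[of "metric G c p"] metric_pos[OF c] by blast
    have "norm (X (r (Suc k)) c p - X (r k) c p) \<le> C * s k p" for k
    proof -
      have "rinner G (D (r (Suc k)) (r k)) (D (r (Suc k)) (r k)) p =
          D (r (Suc k)) (r k) c p \<bullet> (metric G c p *v D (r (Suc k)) (r k) c p)"
        by (rule rinner_chart[OF Dvf Dvf c(1) p(1) c(2)])
      moreover have "D (r (Suc k)) (r k) c p = X (r (Suc k)) c p - X (r k) c p" by (simp add: D_def lc_def)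
      ultimately show ?thesis using C(2)[of "D (r (Suc k)) (r k) c p"] p(1) by (simp add: s_def)
    qed
    then have "summable (\<lambda>k. norm (X (r (Suc k)) c p - X (r k) c p))"
      by (intro summable_comparison_test'[OF summable_mult[OF TD[OF p(2)]], where N = 0]) auto
    then have "summable (\<lambda>k. X (r (Suc k)) c p - X (r k) c p)" by (rule summable_norm_cancel)
    then have "convergent (\<lambda>n. \<Sum>k<n. X (r (Suc k)) c p - X (r k) c p)" by (simp add: summable_iff_convergent)
    then have "convergent (\<lambda>n. X (r n) c p - X (r 0) c p)"
      by (simp add: sum_lessThan_telescope[of "\<lambda>n. X (r n) c p"])
    then have "convergent (\<lambda>n. (X (r n) c p - X (r 0) c p) + X (r 0) c p)"
      by (rule convergent_add[OF _ convergent_const])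
    then have "convergent (\<lambda>n. X (r n) c p)" by simp
    then show ?thesis using p by (simp add: Y_def convergent_LIMSEQ_iff)
  qed
  have mv_lim: "(\<lambda>k. A *v x k) \<longlonglongrightarrow> A *v l" if "x \<longlonglongrightarrow> l" for A :: "real^'n^'n" and x l
    by (rule bounded_bilinear.tendsto[OF bounded_bilinear_matrix_vector tendsto_const that])
  have Yvf: "is_vfield_on G \<Omega> Y"
    unfolding is_vfield_on_def
  proof (intro ballI)
    fix c1 c2 p assume c: "c1 \<in> atlas G" "c2 \<in> atlas G" "p \<in> \<Omega> \<inter> fst c1 \<inter> fst c2"
    show "Y c2 p = jacobian c1 c2 p *v Y c1 p"
    proof (cases "T p = top")
      case True
      then show ?thesis by (simp add: Y_def)
    next
      case False
      have "(\<lambda>k. jacobian c1 c2 p *v X (r k) c1 p) \<longlonglongrightarrow> jacobian c1 c2 p *v Y c1 p"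
        using c False by (intro mv_lim conv) auto
      moreover have "jacobian c1 c2 p *v X (r k) c1 p = X (r k) c2 p" for k
        using vfield_change[OF Xvf c(1,2), of p] c by simp
      ultimately have "(\<lambda>k. X (r k) c2 p) \<longlonglongrightarrow> jacobian c1 c2 p *v Y c1 p" by simp
      moreover have "(\<lambda>k. X (r k) c2 p) \<longlonglongrightarrow> Y c2 p" using c False by (intro conv) auto
      ultimately show ?thesis by (rule LIMSEQ_unique[rotated])
    qed
  qed
  have Ymeas: "measurable_vfield Y"
    unfolding measurable_vfield_def
  proof (intro conjI Yvf ballI)
    fix c assume c: "c \<in> atlas G"
    let ?i = "indicator (\<Omega> \<inter> fst c) :: 'a \<Rightarrow> real" and ?A = "{p. T p \<noteq> top}"
    have A: "?A \<in> sets borel" by measurable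
    show "(\<lambda>p. ?i p *\<^sub>R Y c p) \<in> borel_measurable borel"
    proof (rule borel_measurable_LIMSEQ_metric)
      show "(\<lambda>p. indicator ?A p *\<^sub>R (?i p *\<^sub>R X (r k) c p)) \<in> borel_measurable borel" for k
      proof (rule borel_measurable_scaleR[OF borel_measurable_indicator[OF A]])
        show "(\<lambda>p. ?i p *\<^sub>R X (r k) c p) \<in> borel_measurable borel"
          using X[of "r k"] c by (simp add: VF_iff measurable_vfield_def)
      qed
      show "(\<lambda>k. indicator ?A p *\<^sub>R (?i p *\<^sub>R X (r k) c p)) \<longlonglongrightarrow> ?i p *\<^sub>R Y c p" for p
      proof (cases "p \<in> \<Omega> \<inter> fst c \<and> T p \<noteq> top")
        case True
        then show ?thesis using conv[of p c] c by simp
      next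
        case False
        then have e: "?i p *\<^sub>R Y c p = 0" "\<And>k. indicator ?A p *\<^sub>R (?i p *\<^sub>R X (r k) c p) = 0"
          by (auto simp: Y_def indicator_def)
        show ?thesis unfolding e by (rule tendsto_const)
      qed
    qed
  qed
  define F where "F n = lc 1 (X n) (-1) Y" for n
  have Fm: "measurable_vfield (F n)" for n
    unfolding F_def using X[of n] Ymeas by (intro measurable_vfield_lc) (simp add: VF_iff)
  have qm: "(\<lambda>p. indicator \<Omega> p * rinner G (F n) (F n) p) \<in> borel_measurable borel" for n
    by (rule rinner_measurable[OF Fm Fm])
  have Dm: "(\<lambda>p. indicator \<Omega> p * rinner G (D m n) (D m n) p) \<in> borel_measurable borel" for m n
    using D[of m n] by (intro rinner_measurable) (auto simp: VF_iff)
  have fatou: "(\<integral>\<^sup>+p. ennreal (indicator \<Omega> p * rinner G (F n) (F n) p) \<partial>\<nu>) \<le> ennreal ((1/4) ^ k)" if n: "n \<ge> r k" for n k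
  proof -
    have "(\<integral>\<^sup>+p. ennreal (indicator \<Omega> p * rinner G (F n) (F n) p) \<partial>\<nu>) =
        (\<integral>\<^sup>+p. liminf (\<lambda>j. ennreal (indicator \<Omega> p * rinner G (D n (r j)) (D n (r j)) p)) \<partial>\<nu>)"
    proof (rule nn_integral_cong_AE, use AET in eventually_elim)
      case (elim p)
      have "(\<lambda>j. indicator \<Omega> p * rinner G (D n (r j)) (D n (r j)) p) \<longlonglongrightarrow> indicator \<Omega> p * rinner G (F n) (F n) p"
      proof (cases "p \<in> \<Omega>")
        case True
        let ?c = "chart_at G p"
        have "(\<lambda>j. X n ?c p - X (r j) ?c p) \<longlonglongrightarrow> X n ?c p - Y ?c p"
          by (intro tendsto_diff tendsto_const conv True elim chart_at)
        then have "(\<lambda>j. (X n ?c p - X (r j) ?c p) \<bullet> (metric G ?c p *v (X n ?c p - X (r j) ?c p))) \<longlonglongrightarrow>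
            (X n ?c p - Y ?c p) \<bullet> (metric G ?c p *v (X n ?c p - Y ?c p))"
          by (intro tendsto_inner mv_lim)
        then show ?thesis using True by (simp add: rinner_def Let_def D_def F_def lc_def)
      qed simp
      then have "(\<lambda>j. ennreal (indicator \<Omega> p * rinner G (D n (r j)) (D n (r j)) p)) \<longlonglongrightarrow> ennreal (indicator \<Omega> p * rinner G (F n) (F n) p)"
        by (rule tendsto_ennrealI)
      then show ?case by (simp only: lim_imp_Liminf[OF trivial_limit_sequentially])
    qed
    also have "\<dots> \<le> liminf (\<lambda>j. \<integral>\<^sup>+p. ennreal (indicator \<Omega> p * rinner G (D n (r j)) (D n (r j)) p) \<partial>\<nu>)"
      using Dm by (intro nn_integral_liminf) auto
    also have "\<dots> \<le> ennreal ((1/4) ^ k)"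
    proof (rule Liminf_le)
      have "(\<integral>\<^sup>+p. ennreal (indicator \<Omega> p * rinner G (D n (r j)) (D n (r j)) p) \<partial>\<nu>) \<le> ennreal ((1/4) ^ k)" if "j \<ge> k" for j
        unfolding nn_integral_ip[OF D] by (intro ennreal_leI small n rmono that)
      then show "\<forall>\<^sub>F j in sequentially. (\<integral>\<^sup>+p. ennreal (indicator \<Omega> p * rinner G (D n (r j)) (D n (r j)) p) \<partial>\<nu>) \<le> ennreal ((1/4) ^ k)"
        unfolding eventually_sequentially by blast
    qed simp
    finally show ?thesis .
  qed
  have FV: "F n \<in> VF" if "n \<ge> r k" for n k
  proof -
    have "integrable \<nu> (\<lambda>p. indicator \<Omega> p *\<^sub>R rinner G (F n) (F n) p)"
    proof (rule integrableI_nonneg)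
      show "(\<integral>\<^sup>+p. ennreal (indicator \<Omega> p *\<^sub>R rinner G (F n) (F n) p) \<partial>\<nu>) < \<infinity>"
        using fatou[OF that] by (auto simp: top_unique less_top[symmetric] intro: le_less_trans)
    qed (use qm iq0 in auto)
    then show ?thesis using Fm by (simp add: VF_iff set_integrable_def)
  qed
  have YV: "Y \<in> VF"
  proof -
    have "lc 1 (X (r 0)) (-1) (F (r 0)) \<in> VF" by (rule VF_lc[OF X FV[OF order_refl]])
    moreover have "lc 1 (X (r 0)) (-1) (F (r 0)) = Y" by (simp add: F_def lc_def)
    ultimately show ?thesis by simp
  qed
  have le: "ip (F n) (F n) \<le> (1/4) ^ k" if "n \<ge> r k" for n k
    using fatou[OF that] nn_integral_ip[OF FV[OF that]] by simp
  have "(\<lambda>n. ip (F n) (F n)) \<longlonglongrightarrow> 0"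
  proof (rule LIMSEQ_I)
    fix e :: real assume "e > 0"
    then obtain k where k: "(1/4) ^ k < e" using real_arch_pow_inv[of e "1/4"] by auto
    have "norm (ip (F n) (F n) - 0) < e" if "n \<ge> r k" for n
      using le[OF that] k ip_nonneg[of "F n"] by simp
    then show "\<exists>no. \<forall>n\<ge>no. norm (ip (F n) (F n) - 0) < e" by blast
  qed
  then show ?thesis using that[OF YV] by (simp add: F_def)
qed

lemma dirichlet_diff_ip:
  assumes u: "u \<in> L2 \<nu> \<Omega>" "weak_gradient G \<nu> \<Omega> u X" and v: "v \<in> L2 \<nu> \<Omega>" "weak_gradient G \<nu> \<Omega> v Y"
  shows "E (\<lambda>x. u x - v x) (\<lambda>x. u x - v x) = ip (lc 1 X (-1) Y) (lc 1 X (-1) Y)"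
proof -
  have "weak_gradient G \<nu> \<Omega> (\<lambda>x. u x - v x) (lc 1 X (-1) Y)"
    using weak_gradient_lin[OF u(1) v(1) u(2) v(2), of 1 "-1"] by simp
  from dirichlet_eq_ip[OF L2i.diff[OF u(1) v(1)] this L2i.diff[OF u(1) v(1)] this] show ?thesis .
qed

text \<open>Functions and weak gradients form Cauchy sequences in two complete spaces, and the weak
  gradient is closed under the pair of limits.\<close>

lemma W_complete:
  assumes v: "\<And>n. v n \<in> W"
    and cau: "\<And>e. e > 0 \<Longrightarrow> \<exists>N. \<forall>m\<ge>N. \<forall>n\<ge>N. Wi.nrm (\<lambda>x. v m x - v n x) < e"
  obtains u where "u \<in> W" "(\<lambda>n. Wi.nrm (\<lambda>x. v n x - u x)) \<longlonglongrightarrow> 0"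
proof -
  define X where "X n = wgrad G \<nu> \<Omega> (v n)" for n
  have X: "X n \<in> VF" "weak_gradient G \<nu> \<Omega> (v n) (X n)" for n
    unfolding X_def by (rule wgrad_VF[OF v], rule wgrad[OF v])
  have L: "v n \<in> L2 \<nu> \<Omega>" for n by (rule W_L2[OF v])
  have sq: "(Wi.nrm (\<lambda>x. v m x - v n x))\<^sup>2 = (LINT x:\<Omega>|\<nu>. (v m x - v n x)\<^sup>2) + ip (lc 1 (X m) (-1) (X n)) (lc 1 (X m) (-1) (X n))" for m n
    using Wi.nrm_sq[OF Wi.diff[OF v v], of m n] dirichlet_diff_ip[OF L X(2) L X(2), of m n] by (simp add: power2_eq_square)
  have cau2: "\<exists>N. \<forall>m\<ge>N. \<forall>n\<ge>N. (Wi.nrm (\<lambda>x. v m x - v n x))\<^sup>2 < e" if "e > 0" for e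
  proof -
    from that have "sqrt e > 0" by simp
    from cau[OF this] obtain N where N: "\<And>m n. m \<ge> N \<Longrightarrow> n \<ge> N \<Longrightarrow> Wi.nrm (\<lambda>x. v m x - v n x) < sqrt e" by blast
    have "(Wi.nrm (\<lambda>x. v m x - v n x))\<^sup>2 < e" if "m \<ge> N" "n \<ge> N" for m n
      using power_strict_mono[OF N[OF that] Wi.nrm_nonneg[OF Wi.diff[OF v v]], of 2] \<open>e > 0\<close> by simp
    then show ?thesis by blast
  qed
  have pos: "0 \<le> (LINT x:\<Omega>|\<nu>. (f x)\<^sup>2)" for f :: "'a \<Rightarrow> real"
    unfolding set_lebesgue_integral_def by (intro integral_nonneg_AE) auto
  have cauL: "\<exists>N. \<forall>m\<ge>N. \<forall>n\<ge>N. (LINT x:\<Omega>|\<nu>. (v m x - v n x)\<^sup>2) < e" if "e > 0" for e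
  proof -
    obtain N where N: "\<And>m n. m \<ge> N \<Longrightarrow> n \<ge> N \<Longrightarrow> (Wi.nrm (\<lambda>x. v m x - v n x))\<^sup>2 < e" using cau2[OF \<open>e > 0\<close>] by blast
    have "(LINT x:\<Omega>|\<nu>. (v m x - v n x)\<^sup>2) < e" if "m \<ge> N" "n \<ge> N" for m n
      using N[OF that] ip_nonneg[of "lc 1 (X m) (-1) (X n)"] unfolding sq by linarith
    then show ?thesis by blast
  qed
  have "\<exists>h. h \<in> L2 \<nu> \<Omega> \<and> (\<lambda>n. LINT x:\<Omega>|\<nu>. (v n x - h x)\<^sup>2) \<longlonglongrightarrow> 0"
  proof (rule L2_complete[of \<Omega> \<nu> v, OF _ L cauL])
    show "\<Omega> \<in> sets \<nu>" by simp
  qed blast+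
  then obtain h where h: "h \<in> L2 \<nu> \<Omega>" "(\<lambda>n. LINT x:\<Omega>|\<nu>. (v n x - h x)\<^sup>2) \<longlonglongrightarrow> 0"
    by blast
  have "\<exists>N. \<forall>m\<ge>N. \<forall>n\<ge>N. ip (lc 1 (X m) (-1) (X n)) (lc 1 (X m) (-1) (X n)) < e" if "e > 0" for e
  proof -
    obtain N where N: "\<And>m n. m \<ge> N \<Longrightarrow> n \<ge> N \<Longrightarrow> (Wi.nrm (\<lambda>x. v m x - v n x))\<^sup>2 < e" using cau2[OF \<open>e > 0\<close>] by blast
    have "ip (lc 1 (X m) (-1) (X n)) (lc 1 (X m) (-1) (X n)) < e" if "m \<ge> N" "n \<ge> N" for m n
      using N[OF that] pos[of "\<lambda>x. v m x - v n x"] unfolding sq by linarith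
    then show ?thesis by blast
  qed
  then obtain Y where Y: "Y \<in> VF" "(\<lambda>n. ip (lc 1 (X n) (-1) Y) (lc 1 (X n) (-1) Y)) \<longlonglongrightarrow> 0"
    using VF_complete[of X] X(1) by blast
  have "(\<lambda>k. L2i.nrm (\<lambda>x. v k x - h x)) \<longlonglongrightarrow> 0"
    using tendsto_real_sqrt[OF h(2)] by (simp add: L2i.nrm_def power2_eq_square)
  from weak_gradient_limit[OF h(1) L Y(1) X(2) this Y(2)] have wg: "weak_gradient G \<nu> \<Omega> h Y" .
  have "Wi.nrm (\<lambda>x. v n x - h x) = sqrt ((LINT x:\<Omega>|\<nu>. (v n x - h x)\<^sup>2) + ip (lc 1 (X n) (-1) Y) (lc 1 (X n) (-1) Y))" for n
    using dirichlet_diff_ip[OF L X(2) h(1) wg, of n] by (simp add: Wi.nrm_def power2_eq_square)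
  moreover have "(\<lambda>n. sqrt ((LINT x:\<Omega>|\<nu>. (v n x - h x)\<^sup>2) + ip (lc 1 (X n) (-1) Y) (lc 1 (X n) (-1) Y))) \<longlonglongrightarrow> sqrt (0 + 0)"
    by (intro tendsto_real_sqrt tendsto_add h(2) Y(2))
  ultimately have "(\<lambda>n. Wi.nrm (\<lambda>x. v n x - h x)) \<longlonglongrightarrow> 0" by simp
  then show ?thesis using that[OF W_I[OF h(1) wg]] by blast
qed

end

section \<open>Test functions and their classical gradients\<close>

lemma continuous_on_extend_zero:
  fixes f :: "'b::t2_space \<Rightarrow> 'c::real_normed_vector"
  assumes "open S" "continuous_on S f" "compact K" "K \<subseteq> S" "\<And>x. x \<notin> K \<Longrightarrow> f x = 0"
  shows "continuous_on UNIV f"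
proof -
  have "continuous_on (- K) f"
  proof (rule continuous_on_eq[OF continuous_on_const])
    show "0 = f x" if "x \<in> - K" for x using assms(5)[of x] that by simp
  qed
  then have "continuous_on (S \<union> - K) f"
    using assms(1,2) compact_imp_closed[OF assms(3)] by (intro continuous_on_open_Un) auto
  moreover have "S \<union> - K = UNIV" using assms(4) by blast
  ultimately show ?thesis by simp
qed

lemma frechet_derivative_inner:
  fixes F :: "real^'n \<Rightarrow> real"
  assumes "F differentiable (at x)"
  shows "frechet_derivative F (at x) w = (\<chi> j. partial j F x) \<bullet> w"
proof -
  have lin: "linear (frechet_derivative F (at x))" by (rule linear_frechet_derivative[OF assms])
  have "w = (\<Sum>j\<in>UNIV. w $ j *\<^sub>R axis j 1)"
    using basis_expansion[of w] by (simp add: scalar_mult_eq_scaleR)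
  then have "frechet_derivative F (at x) w = frechet_derivative F (at x) (\<Sum>j\<in>UNIV. w $ j *\<^sub>R axis j 1)" by simp
  also have "\<dots> = (\<Sum>j\<in>UNIV. w $ j * partial j F x)"
    by (simp add: linear_sum[OF lin] linear_scale[OF lin] partial_def)
  finally show ?thesis by (simp add: inner_vec_def mult.commute)
qed

context riemannian_domain
begin

abbreviation T where "T \<equiv> Cc_inf G \<Omega>"

definition chart_smooth :: "('a \<Rightarrow> real) \<Rightarrow> bool" where
  "chart_smooth v \<longleftrightarrow> (\<forall>c\<in>atlas G. smooth_on (v \<circ> chart_inv c) (img c))"

text \<open>The covariant components of the differential of \<open>v\<close>; \<open>grad\<close>
  raises the index with the inverse metric.\<close>

definition dv :: "('a \<Rightarrow> real) \<Rightarrow> ('a, 'n) chart \<Rightarrow> 'a \<Rightarrow> real^'n" where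
  "dv v c p = (\<chi> i. partial i (v \<circ> chart_inv c) (snd c p))"

lemma chart_smoothD: "chart_smooth v \<Longrightarrow> c \<in> atlas G \<Longrightarrow> smooth_on (v \<circ> chart_inv c) (img c)"
  by (simp add: chart_smooth_def)

lemma chart_smooth_differentiable:
  "chart_smooth v \<Longrightarrow> c \<in> atlas G \<Longrightarrow> p \<in> fst c \<Longrightarrow> (v \<circ> chart_inv c) differentiable (at (snd c p))"
  by (rule smooth_on_differentiable[OF chart_smoothD]) auto

lemma chart_smooth_continuous: assumes "chart_smooth v" shows "continuous_on UNIV v"
proof -
  have "isCont v p" for p
  proof -
    let ?c = "chart_at G p"
    note c = chart_at[of p]
    have "continuous_on (fst ?c) (\<lambda>q. (v \<circ> chart_inv ?c) (snd ?c q))"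
      by (rule continuous_on_compose2[OF smooth_on_continuous[OF chart_smoothD[OF assms c(1)]] continuous_chart[OF c(1)]]) auto
    then have "continuous_on (fst ?c) v"
      by (rule continuous_on_eq) (simp add: chart_inv_chart[OF c(1)])
    then show ?thesis using continuous_on_eq_continuous_at[OF open_dom[OF c(1)]] c(2) by blast
  qed
  then show ?thesis by (simp add: continuous_at_imp_continuous_on)
qed

lemma test_smooth: "v \<in> T \<Longrightarrow> chart_smooth v"
  by (simp add: Cc_inf_def chart_smooth_def)

lemma test_support:
  assumes "v \<in> T"
  obtains K where "compact K" "K \<subseteq> \<Omega>" "\<And>x. x \<notin> K \<Longrightarrow> v x = 0"
proof (rule that)
  show "compact (closure {x. v x \<noteq> 0})" "closure {x. v x \<noteq> 0} \<subseteq> \<Omega>"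
    using assms by (auto simp: Cc_inf_def compactly_supported_in_def)
  show "v x = 0" if "x \<notin> closure {x. v x \<noteq> 0}" for x
    using that closure_subset[of "{x. v x \<noteq> 0}"] by blast
qed

lemma testI:
  assumes "chart_smooth v" "compact K" "K \<subseteq> \<Omega>" "\<And>x. x \<notin> K \<Longrightarrow> v x = 0"
  shows "v \<in> T"
  using assms(1) compactly_supported_inI[OF assms(2-4)] by (simp add: Cc_inf_def chart_smooth_def)

lemma chart_smooth_lin:
  assumes "chart_smooth u" "chart_smooth v"
  shows "chart_smooth (\<lambda>x. a * u x + b * v x)"
  unfolding chart_smooth_def smooth_on_def
proof (intro ballI allI)
  fix c k assume c: "c \<in> atlas G"
  have "Ck_on k (\<lambda>y. a * (u \<circ> chart_inv c) y + b * (v \<circ> chart_inv c) y) (img c)"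
    by (rule Ck_on_add[OF open_img[OF c] Ck_on_mult[OF open_img[OF c] Ck_on_const smooth_onD[OF chart_smoothD[OF assms(1) c]]]
          Ck_on_mult[OF open_img[OF c] Ck_on_const smooth_onD[OF chart_smoothD[OF assms(2) c]]]])
  then show "Ck_on k ((\<lambda>x. a * u x + b * v x) \<circ> chart_inv c) (img c)" by (simp add: o_def)
qed

lemma test_lin:
  assumes "u \<in> T" "v \<in> T"
  shows "(\<lambda>x. a * u x + b * v x) \<in> T"
proof -
  obtain K where K: "compact K" "K \<subseteq> \<Omega>" "\<And>x. x \<notin> K \<Longrightarrow> u x = 0" using test_support[OF assms(1)] by blast
  obtain L where L: "compact L" "L \<subseteq> \<Omega>" "\<And>x. x \<notin> L \<Longrightarrow> v x = 0" using test_support[OF assms(2)] by blast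
  show ?thesis
  proof (rule testI)
    show "a * u x + b * v x = 0" if "x \<notin> K \<union> L" for x using K(3)[of x] L(3)[of x] that by simp
  qed (use K L assms in \<open>auto intro: chart_smooth_lin test_smooth\<close>)
qed

lemma test_compose:
  assumes "v \<in> T" "smooth_on \<phi> UNIV" "\<phi> 0 = 0"
  shows "(\<lambda>x. \<phi> (v x)) \<in> T"
proof -
  obtain K where K: "compact K" "K \<subseteq> \<Omega>" "\<And>x. x \<notin> K \<Longrightarrow> v x = 0" using test_support[OF assms(1)] by blast
  have "chart_smooth (\<lambda>x. \<phi> (v x))"
    unfolding chart_smooth_def smooth_on_def
  proof (intro ballI allI)
    fix c k assume c: "c \<in> atlas G"
    have "Ck_on k (\<lambda>y. \<phi> ((v \<circ> chart_inv c) y)) (img c)"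
      using Ck_on_compose[OF open_img[OF c] open_UNIV subset_UNIV
          smooth_onD[OF chart_smoothD[OF test_smooth[OF assms(1)] c]] smooth_onD[OF assms(2)]] .
    then show "Ck_on k ((\<lambda>x. \<phi> (v x)) \<circ> chart_inv c) (img c)" by (simp add: o_def)
  qed
  then show ?thesis
  proof (rule testI[OF _ K(1,2)])
    show "\<phi> (v x) = 0" if "x \<notin> K" for x using K(3)[OF that] assms(3) by simp
  qed
qed

lemma bounded_on_compact_support:
  fixes f :: "'a \<Rightarrow> real"
  assumes "compact K" "continuous_on K f" "\<And>x. x \<notin> K \<Longrightarrow> f x = 0"
  obtains B where "B \<ge> 0" "\<And>x. \<bar>f x\<bar> \<le> B"
proof -
  have "bounded (f ` K)" by (intro compact_imp_bounded compact_continuous_image assms)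
  then obtain B where B: "B > 0" "\<And>r. r \<in> f ` K \<Longrightarrow> norm r \<le> B" unfolding bounded_pos by auto
  have "\<bar>f x\<bar> \<le> B" for x
  proof (cases "x \<in> K")
    case True then show ?thesis using B(2)[OF imageI[OF True]] by simp
  next
    case False then show ?thesis using assms(3)[OF False] B(1) by simp
  qed
  then show ?thesis using that[of B] B(1) by simp
qed

lemma test_bounded:
  assumes "v \<in> T"
  obtains B where "B \<ge> 0" "\<And>x. \<bar>v x\<bar> \<le> B"
proof -
  obtain K where K: "compact K" "K \<subseteq> \<Omega>" "\<And>x. x \<notin> K \<Longrightarrow> v x = 0" using test_support[OF assms] by blast
  have "continuous_on K v" by (rule continuous_on_subset[OF chart_smooth_continuous[OF test_smooth[OF assms]]]) simp
  from bounded_on_compact_support[OF K(1) this K(3)] that show ?thesis by metis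
qed

lemma integrable_compact_support_measure:
  fixes f :: "'a \<Rightarrow> real"
  assumes M: "sets M = sets borel" "emeasure M K < \<infinity>" and K: "compact K" and f: "f \<in> borel_measurable borel"
    and out: "\<And>x. x \<notin> K \<Longrightarrow> f x = 0" and B: "\<And>x. \<bar>f x\<bar> \<le> B"
  shows "integrable M f"
proof (rule Bochner_Integration.integrable_bound)
  have "K \<in> sets M" using borel_closed[OF compact_imp_closed[OF K]] M(1) by simp
  then show "integrable M (\<lambda>x. B * indicator K x)"
    using M(2) by (intro integrable_mult_right integrable_real_indicator) auto
  show "f \<in> borel_measurable M" using f measurable_cong_sets[OF M(1) refl] by blast
  show "AE x in M. norm (f x) \<le> norm (B * indicator K x)"
  proof (rule AE_I2)
    fix x show "norm (f x) \<le> norm (B * indicator K x)"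
      using out[of x] B[of x] by (cases "x \<in> K") auto
  qed
qed

lemma test_L2:
  assumes v: "v \<in> T" and M: "sets M = sets borel" "\<And>K. compact K \<Longrightarrow> emeasure M K < \<infinity>"
  shows "v \<in> L2 M \<Omega>"
proof -
  obtain K where K: "compact K" "K \<subseteq> \<Omega>" "\<And>x. x \<notin> K \<Longrightarrow> v x = 0" using test_support[OF v] by blast
  obtain B where B: "B \<ge> 0" "\<And>x. \<bar>v x\<bar> \<le> B" using test_bounded[OF v] by blast
  have eq: "indicator \<Omega> x * v x = v x" for x using K by (cases "x \<in> \<Omega>") auto
  have m: "v \<in> borel_measurable borel"
    by (rule borel_measurable_continuous_onI[OF chart_smooth_continuous[OF test_smooth[OF v]]])
  have "integrable M (\<lambda>x. (v x)\<^sup>2)"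
  proof (rule integrable_compact_support_measure[OF M(1) M(2)[OF K(1)] K(1)])
    show "(v x)\<^sup>2 = 0" if "x \<notin> K" for x using K(3)[OF that] by simp
    show "\<bar>(v x)\<^sup>2\<bar> \<le> B\<^sup>2" for x using B(2)[of x] power_mono[of "\<bar>v x\<bar>" B 2] by simp
  qed (use m in simp)
  moreover have "v \<in> borel_measurable M" using m measurable_cong_sets[OF M(1) refl] by blast
  ultimately show ?thesis by (simp add: L2_iff eq)
qed

lemma test_L2_nu: "v \<in> T \<Longrightarrow> v \<in> L2 \<nu> \<Omega>"
  by (rule test_L2[OF _ sets_nu finite_nu_compact])

lemma grad_eq: "grad G v c p = matrix_inv (metric G c p) *v dv v c p"
  by (simp add: grad_def dv_def)

lemma det_metric_nz: "c \<in> atlas G \<Longrightarrow> p \<in> fst c \<Longrightarrow> det (metric G c p) \<noteq> 0"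
  by (rule less_imp_neq[symmetric], rule det_metric_pos)

lemma metric_grad: "c \<in> atlas G \<Longrightarrow> p \<in> fst c \<Longrightarrow> metric G c p *v grad G v c p = dv v c p"
  by (simp add: grad_eq matrix_vector_mul_assoc matrix_inv_works(1)[OF det_metric_nz])

text \<open>Near the point, \<open>v\<close> in the chart \<open>c\<close> is \<open>v\<close> in
  the chart \<open>c'\<close> after the transition map; the chain rule moves the Jacobian onto the
  covector as its transpose.\<close>

lemma dv_change:
  assumes v: "chart_smooth v" and c: "c \<in> atlas G" "c' \<in> atlas G" and p: "p \<in> fst c" "p \<in> fst c'"
  shows "dv v c p = transpose (jacobian c c' p) *v dv v c' p"
proof -
  let ?J = "jacobian c c' p" and ?V = "v \<circ> chart_inv c" and ?V' = "v \<circ> chart_inv c'"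
  have d': "?V' differentiable (at (snd c' p))" by (rule chart_smooth_differentiable[OF v c(2) p(2)])
  have "(?V' has_derivative frechet_derivative ?V' (at (snd c' p))) (at (transition c c' (snd c p)))"
    using differentiable_has_derivative[OF d'] by (simp add: transition_apply p c)
  from diff_chain_at[OF transition_has_derivative[OF c p] this]
  have "(?V' \<circ> transition c c' has_derivative frechet_derivative ?V' (at (snd c' p)) \<circ> (*v) ?J) (at (snd c p))" .
  then have "(?V has_derivative frechet_derivative ?V' (at (snd c' p)) \<circ> (*v) ?J) (at (snd c p))"
  proof (rule has_derivative_transform_within_open[OF _ open_overlap[OF c]])
    show "snd c p \<in> snd c ` (fst c \<inter> fst c')" using p by blast
    fix y assume "y \<in> snd c ` (fst c \<inter> fst c')"
    then obtain q where q: "q \<in> fst c" "q \<in> fst c'" "y = snd c q" by blast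
    then show "(?V' \<circ> transition c c') y = ?V y"
      by (simp add: transition_apply c chart_inv_chart)
  qed
  from partial_eqI[OF this]
  have "partial i ?V (snd c p) = dv v c' p \<bullet> (?J *v axis i 1)" for i
    by (simp add: frechet_derivative_inner[OF d'] dv_def)
  then show ?thesis
    by (simp add: vec_eq_iff dv_def inner_matrix_transpose[symmetric] inner_axis)
qed

lemma grad_change:
  assumes v: "chart_smooth v" and c: "c \<in> atlas G" "c' \<in> atlas G" and p: "p \<in> fst c" "p \<in> fst c'"
  shows "grad G v c' p = jacobian c c' p *v grad G v c p"
proof -
  let ?J = "jacobian c c' p" and ?g = "metric G c p" and ?g' = "metric G c' p"
  \<comment> \<open>Orientation makes the Jacobian determinant positive, so the transposed Jacobian
    can be cancelled from the transformation laws of the metric and of \<open>dv\<close>.\<close>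
  have "det ?J > 0" using oriented_atlas c p by (auto simp: oriented_smooth_atlas_def)
  then have dJ: "det (transpose ?J) \<noteq> 0" by (simp add: det_transpose)
  have "transpose ?J *v (?g' *v (?J *v grad G v c p)) = ?g *v grad G v c p"
    using metric_change[OF c p] by (simp add: matrix_vector_mul_assoc matrix_mul_assoc)
  also have "\<dots> = transpose ?J *v dv v c' p"
    using metric_grad[OF c(1) p(1)] dv_change[OF v c p] by simp
  finally have "matrix_inv (transpose ?J) *v (transpose ?J *v (?g' *v (?J *v grad G v c p))) =
      matrix_inv (transpose ?J) *v (transpose ?J *v dv v c' p)" by simp
  then have e: "?g' *v (?J *v grad G v c p) = dv v c' p"
    unfolding matrix_vector_mul_assoc matrix_mul_assoc matrix_inv_works(2)[OF dJ]
    by (simp add: matrix_vector_mul_assoc[symmetric])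
  have "grad G v c' p = matrix_inv ?g' *v dv v c' p" by (rule grad_eq)
  also have "\<dots> = matrix_inv ?g' *v (?g' *v (?J *v grad G v c p))" by (simp only: e)
  also have "\<dots> = ?J *v grad G v c p"
    unfolding matrix_vector_mul_assoc[of "matrix_inv ?g'"] matrix_inv_works(2)[OF det_metric_nz[OF c(2) p(2)]] by simp
  finally show ?thesis .
qed

lemma grad_vfield: "chart_smooth v \<Longrightarrow> is_vfield_on G \<Omega> (grad G v)"
  unfolding is_vfield_on_def using grad_change by blast

lemma Ck_dv:
  assumes v: "chart_smooth v" and c: "c \<in> atlas G"
  shows "Ck_on k (\<lambda>y. dv v c (chart_inv c y)) (img c)"
proof -
  have "Ck_on k (\<lambda>y. \<chi> i. partial i (v \<circ> chart_inv c) y) (img c)"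
    unfolding partial_def
    by (intro Ck_on_vec_lambda open_img[OF c] smooth_onD[OF smooth_on_derivative[OF chart_smoothD[OF v c]]])
  then show ?thesis
    by (rule Ck_on_cong[OF open_img[OF c], THEN iffD1, rotated]) (simp add: dv_def chart_chart_inv)
qed

lemma Ck_grad:
  assumes v: "chart_smooth v" and c: "c \<in> atlas G"
  shows "Ck_on k (\<lambda>y. grad G v c (chart_inv c y)) (img c)"
  unfolding grad_eq
  using smooth_onD[OF smooth_metric[OF c]]
  by (intro Ck_on_matrix_inv open_img[OF c] Ck_dv[OF v c] det_metric_nz[OF c] chart_inv_dom) (simp_all add: o_def)

lemma continuous_grad:
  assumes v: "chart_smooth v" and c: "c \<in> atlas G"
  shows "continuous_on (fst c) (grad G v c)"
proof -
  have "continuous_on (fst c) (\<lambda>p. grad G v c (chart_inv c (snd c p)))"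
    using Ck_grad[OF v c, of 0] by (intro continuous_on_compose2[OF _ continuous_chart[OF c]]) auto
  then show ?thesis by (rule continuous_on_eq) (simp add: chart_inv_chart[OF c])
qed

lemma measurable_vfield_grad: "chart_smooth v \<Longrightarrow> measurable_vfield (grad G v)"
  unfolding measurable_vfield_def
proof (intro conjI ballI grad_vfield)
  fix c assume v: "chart_smooth v" and c: "c \<in> atlas G"
  show "(\<lambda>p. indicator (\<Omega> \<inter> fst c) p *\<^sub>R grad G v c p) \<in> borel_measurable borel"
    by (rule borel_measurable_continuous_on_indicator[OF _ continuous_on_subset[OF continuous_grad[OF v c]]])
      (use chart_sets[OF c] in auto)
qed

lemma grad_outside:
  assumes c: "c \<in> atlas G" "p \<in> fst c" and K: "compact K" "p \<notin> K" "\<And>x. x \<notin> K \<Longrightarrow> v x = 0"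
  shows "grad G v c p = 0"
proof -
  have "partial i (v \<circ> chart_inv c) (snd c p) = partial i (\<lambda>y. 0) (snd c p)" for i
  proof (rule partial_cong_open)
    show "open (snd c ` (- K \<inter> fst c))"
      by (rule open_chart_image[OF c(1) open_Compl[OF compact_imp_closed[OF K(1)]]])
    show "snd c p \<in> snd c ` (- K \<inter> fst c)" using c K by blast
    fix y assume "y \<in> snd c ` (- K \<inter> fst c)"
    then obtain q where "q \<in> fst c" "q \<notin> K" "y = snd c q" by blast
    then show "(v \<circ> chart_inv c) y = 0" using K(3)[of q] by (simp add: chart_inv_chart[OF c(1)])
  qed
  then have "dv v c p = 0" by (simp add: dv_def partial_const vec_eq_iff)
  then show ?thesis by (simp add: grad_eq)
qed

lemma rinner_grad_outside:
  assumes "compact K" "p \<notin> K" "\<And>x. x \<notin> K \<Longrightarrow> v x = 0"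
  shows "rinner G (grad G v) X p = 0"
  unfolding rinner_def Let_def by (simp add: grad_outside[OF chart_at assms])

lemma test_grad_VF:
  assumes v: "v \<in> T" shows "grad G v \<in> VF"
proof -
  obtain K where K: "compact K" "K \<subseteq> \<Omega>" "\<And>x. x \<notin> K \<Longrightarrow> v x = 0" using test_support[OF v] by blast
  have sm: "chart_smooth v" by (rule test_smooth[OF v])
  let ?r = "rinner G (grad G v) (grad G v)"
  have "isCont ?r p" if p: "p \<in> \<Omega>" for p
  proof -
    let ?c = "chart_at G p"
    note c = chart_at[of p]
    have "continuous_on (\<Omega> \<inter> fst ?c) (\<lambda>q. grad G v ?c q \<bullet> (metric G ?c q *v grad G v ?c q))"
      by (intro continuous_intros bounded_bilinear.continuous_on[OF bounded_bilinear_matrix_vector]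
          continuous_on_subset[OF continuous_grad[OF sm c(1)]] continuous_on_subset[OF continuous_metric[OF c(1)]]) auto
    then have "continuous_on (\<Omega> \<inter> fst ?c) ?r"
      by (rule continuous_on_eq) (simp add: rinner_chart[OF grad_vfield[OF sm] grad_vfield[OF sm] c(1)])
    then show ?thesis
      using continuous_on_eq_continuous_at[OF open_Int[OF open_domain open_dom[OF c(1)]]] p c(2) by blast
  qed
  then have "continuous_on K ?r" using K(2) by (meson continuous_at_imp_continuous_on subsetD)
  moreover have out: "?r x = 0" if "x \<notin> K" for x by (rule rinner_grad_outside[OF K(1) that K(3)])
  ultimately obtain B where B: "B \<ge> 0" "\<And>x. \<bar>?r x\<bar> \<le> B" using bounded_on_compact_support[OF K(1)] by metis
  have "integrable \<nu> (\<lambda>x. indicator \<Omega> x * ?r x)"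
  proof (rule integrable_compact_support_measure[OF sets_nu finite_nu_compact[OF K(1)] K(1)])
    show "(\<lambda>x. indicator \<Omega> x * ?r x) \<in> borel_measurable borel"
      using measurable_vfield_grad[OF sm] by (intro rinner_measurable)
    show "indicator \<Omega> x * ?r x = 0" if "x \<notin> K" for x by (simp add: out[OF that])
    show "\<bar>indicator \<Omega> x * ?r x\<bar> \<le> B" for x using B(2)[of x] B(1) by (cases "x \<in> \<Omega>") auto
  qed
  then show ?thesis using measurable_vfield_grad[OF sm] by (simp add: VF_iff set_integrable_def)
qed

text \<open>Off the image of the chart \<open>v \<circ> chart_inv c\<close> is arbitrary, but the
  product with \<eta> vanishes off a compact subset of the image. It is therefore differentiable on
  the whole Euclidean space, where \<open>integral_partial_zero\<close> applies.\<close>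

lemma integration_by_parts_chart:
  assumes v: "chart_smooth v" and ad: "admissible c \<eta>"
  shows "(LINT y|lborel. (v \<circ> chart_inv c) y * partial i \<eta> y) = - (LINT y|lborel. partial i (v \<circ> chart_inv c) y * \<eta> y)"
proof -
  let ?V = "v \<circ> chart_inv c" and ?F = "\<lambda>y. (v \<circ> chart_inv c) y * \<eta> y"
  have c: "c \<in> atlas G" using ad by (simp add: admissible_def)
  have sm\<eta>: "smooth_on \<eta> UNIV" using ad by (simp add: admissible_def)
  obtain K B B' where "compact K \<and> K \<subseteq> snd c ` (\<Omega> \<inter> fst c) \<and>
    (\<forall>y. y \<notin> K \<longrightarrow> \<eta> y = 0) \<and> (\<forall>y. \<bar>\<eta> y\<bar> \<le> B) \<and> \<eta> \<in> borel_measurable borel \<and>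
    (\<forall>y. y \<notin> K \<longrightarrow> partial i \<eta> y = 0) \<and> (\<forall>y. \<bar>partial i \<eta> y\<bar> \<le> B') \<and> partial i \<eta> \<in> borel_measurable borel"
    using admissible_bounds[OF ad, of i] by (elim exE)
  then have K: "compact K" "K \<subseteq> snd c ` (\<Omega> \<inter> fst c)"
    "\<And>y. y \<notin> K \<Longrightarrow> \<eta> y = 0" "\<And>y. y \<notin> K \<Longrightarrow> partial i \<eta> y = 0" by blast+
  have Kimg: "K \<subseteq> img c" using K(2) by blast
  have smV: "smooth_on ?V (img c)" by (rule chart_smoothD[OF v c])
  have oK: "open (- K)" by (rule open_Compl[OF compact_imp_closed[OF K(1)]])
  have zero: "?F y = 0" if "y \<in> - K" for y using K(3)[of y] that by simp
  have dF: "?F differentiable (at y) \<and> partial i ?F y = ?V y * partial i \<eta> y + partial i ?V y * \<eta> y" for y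
  proof (cases "y \<in> img c")
    case True
    have d: "?V differentiable (at y)" "\<eta> differentiable (at y)"
      using smooth_on_differentiable[OF smV True] smooth_on_differentiable[OF sm\<eta>] by auto
    show ?thesis using differentiable_mult[OF d] partial_mult[OF d] by simp
  next
    case False
    then have y: "y \<in> - K" using Kimg by blast
    have "((\<lambda>y. 0) has_derivative (\<lambda>h. 0)) (at y)" by simp
    then have "(?F has_derivative (\<lambda>h. 0)) (at y)"
      by (rule has_derivative_transform_within_open[OF _ oK y]) (simp only: zero)
    then show ?thesis using partial_eqI[of ?F "\<lambda>h. 0" y i] K(3,4)[of y] y by (auto simp: differentiable_def)
  qed
  have contA: "continuous_on UNIV (\<lambda>y. ?V y * partial i \<eta> y)"
  proof (rule continuous_on_extend_zero[OF open_img[OF c] _ K(1) Kimg])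
    show "continuous_on (img c) (\<lambda>y. ?V y * partial i \<eta> y)"
      unfolding partial_def
      by (intro continuous_on_mult smooth_on_continuous[OF smV]
          continuous_on_subset[OF smooth_on_continuous[OF smooth_on_derivative[OF sm\<eta>]]]) auto
    show "?V y * partial i \<eta> y = 0" if "y \<notin> K" for y using K(4)[OF that] by simp
  qed
  have contB: "continuous_on UNIV (\<lambda>y. partial i ?V y * \<eta> y)"
  proof (rule continuous_on_extend_zero[OF open_img[OF c] _ K(1) Kimg])
    show "continuous_on (img c) (\<lambda>y. partial i ?V y * \<eta> y)"
      unfolding partial_def
      by (intro continuous_on_mult smooth_on_continuous[OF smooth_on_derivative[OF smV]]
          continuous_on_subset[OF smooth_on_continuous[OF sm\<eta>]]) auto
    show "partial i ?V y * \<eta> y = 0" if "y \<notin> K" for y using K(3)[OF that] by simp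
  qed
  have iA: "integrable lborel (\<lambda>y. ?V y * partial i \<eta> y)"
    by (rule integrable_compact_support[OF contA K(1)]) (simp add: K(4))
  have iB: "integrable lborel (\<lambda>y. partial i ?V y * \<eta> y)"
    by (rule integrable_compact_support[OF contB K(1)]) (simp add: K(3))
  have pF: "partial i ?F = (\<lambda>y. ?V y * partial i \<eta> y + partial i ?V y * \<eta> y)" using dF by blast
  have "(LINT y|lborel. partial i ?F y) = 0"
  proof (rule integral_partial_zero[OF _ K(1)])
    show "?F differentiable (at y)" for y using dF by blast
    show "?F y = 0" if "y \<notin> K" for y using K(3)[OF that] by simp
    show "continuous_on UNIV (partial i ?F)" unfolding pF by (intro continuous_on_add contA contB)
  qed
  then show ?thesis unfolding pF using Bochner_Integration.integral_add[OF iA iB] by simp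
qed

lemma test_weak_gradient:
  assumes v: "v \<in> T" shows "weak_gradient G \<nu> \<Omega> v (grad G v)"
  unfolding weak_gradient_iff[OF test_L2_nu[OF v]]
proof (intro conjI test_grad_VF[OF v] allI impI)
  fix c \<eta> i assume ad: "admissible c \<eta>"
  have c: "c \<in> atlas G" using ad by (simp add: admissible_def)
  have eq: "(metric G c (chart_inv c y) *v grad G v c (chart_inv c y)) $ i * \<eta> y = partial i (v \<circ> chart_inv c) y * \<eta> y" for y
  proof (cases "y \<in> img c")
    case True
    then show ?thesis by (simp add: metric_grad[OF c chart_inv_dom] dv_def chart_chart_inv)
  next
    case False
    have "closure {x. \<eta> x \<noteq> 0} \<subseteq> img c"
      using ad unfolding admissible_def compactly_supported_in_def by blast
    then have "\<eta> y = 0" using False closure_subset[of "{x. \<eta> x \<noteq> 0}"] by blast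
    then show ?thesis by simp
  qed
  show "(LINT x:\<Omega>|\<nu>. v x * loc_fun c (partial i \<eta>) x) = - ip (grad G v) (loc_field c \<eta> i)"
    unfolding admissible_fields(3)[OF ad test_grad_VF[OF v]] admissible_fields(4)[OF ad test_L2_nu[OF v]] eq
    using integration_by_parts_chart[OF test_smooth[OF v] ad, of i] by (simp only: o_apply)
qed

lemma test_W: "v \<in> T \<Longrightarrow> v \<in> W"
  by (rule W_I[OF test_L2_nu test_weak_gradient])

lemma test_E: "u \<in> T \<Longrightarrow> v \<in> T \<Longrightarrow> E u v = ip (grad G u) (grad G v)"
  by (rule dirichlet_eq_ip[OF test_L2_nu test_weak_gradient test_L2_nu test_weak_gradient])

lemma grad_compose:
  assumes v: "chart_smooth v" and \<phi>: "\<And>t. (\<phi> has_real_derivative \<phi>' t) (at t)" and c: "c \<in> atlas G" "p \<in> fst c"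
  shows "grad G (\<lambda>x. \<phi> (v x)) c p = \<phi>' (v p) *\<^sub>R grad G v c p"
proof -
  have "partial i ((\<lambda>x. \<phi> (v x)) \<circ> chart_inv c) (snd c p) = \<phi>' (v p) * partial i (v \<circ> chart_inv c) (snd c p)" for i
    using partial_compose[OF chart_smooth_differentiable[OF v c], of \<phi> "\<phi>' (v p)" i] \<phi>[of "v p"]
    by (simp add: o_def chart_inv_chart[OF c])
  then have "dv (\<lambda>x. \<phi> (v x)) c p = \<phi>' (v p) *\<^sub>R dv v c p" by (simp add: dv_def vec_eq_iff)
  then show ?thesis by (simp add: grad_eq matrix_vector_mult_scaleR)
qed

text \<open>The gradient is multiplied pointwise by \<open>\<phi>' (v p)\<close>, a factor of
  absolute value at most 1. This is what allows minimising sequences to be truncated.\<close>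

lemma E_compose_le:
  assumes v: "v \<in> T" and \<phi>: "smooth_on \<phi> UNIV" "\<phi> 0 = 0" "\<And>t. (\<phi> has_real_derivative \<phi>' t) (at t)" "\<And>t. \<bar>\<phi>' t\<bar> \<le> 1"
  shows "E (\<lambda>x. \<phi> (v x)) (\<lambda>x. \<phi> (v x)) \<le> E v v"
proof -
  let ?w = "\<lambda>x. \<phi> (v x)"
  have w: "?w \<in> T" by (rule test_compose[OF v \<phi>(1,2)])
  have "rinner G (grad G ?w) (grad G ?w) p = (\<phi>' (v p))\<^sup>2 * rinner G (grad G v) (grad G v) p" for p
    unfolding rinner_def Let_def grad_compose[OF test_smooth[OF v] \<phi>(3) chart_at]
    by (simp add: matrix_vector_mult_scaleR power2_eq_square)
  moreover have "(\<phi>' t)\<^sup>2 \<le> 1" for t using \<phi>(4)[of t] by (simp add: abs_square_le_1)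
  ultimately have "rinner G (grad G ?w) (grad G ?w) p \<le> rinner G (grad G v) (grad G v) p" for p
    using mult_right_mono[OF _ rinner_nonneg[of "grad G v" p], of "(\<phi>' (v p))\<^sup>2" 1] by simp
  then show ?thesis
    unfolding test_E[OF w w] test_E[OF v v] ip_def
    by (intro set_integral_mono rinner_integrable test_grad_VF v w)
qed

end

section \<open>The embedding into L2(\<mu>) and the projection of test functions\<close>

text \<open>Completeness of the manifold and boundedness of \<Omega> enter through the finite
  volume, which is therefore assumed in their place.\<close>

locale krein_feller = riemannian_domain G \<nu> \<Omega>
  for G :: "('a::{t2_space, second_countable_topology}, 'n::finite) riemannian_structure" and \<nu> \<Omega> +
  fixes \<mu> :: "'a measure"
  assumes sets_mu: "sets \<mu> = sets borel" and finite_mu: "finite_measure \<mu>"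
    and poincare: "MPI G \<nu> \<mu> UNIV" and finite_volume: "emeasure \<nu> \<Omega> < \<infinity>"
begin

abbreviation W0 where "W0 \<equiv> W12_0 G \<nu> \<Omega>"
abbreviation rep where "rep \<equiv> is_mu_representative G \<nu> \<mu> \<Omega>"

sublocale Mi: semi_inner_product "L2 \<mu> \<Omega>" "\<lambda>f g. LINT x:\<Omega>|\<mu>. f x * g x"
  by (rule L2_semi_inner_product)

lemma test_Mi: "v \<in> T \<Longrightarrow> v \<in> L2 \<mu> \<Omega>"
  using finite_measure.emeasure_finite[OF finite_mu] by (intro test_L2[OF _ sets_mu]) (auto simp: less_top)

lemma Mi_nrm_sq: "(LINT x:\<Omega>|\<mu>. (f x)\<^sup>2) = (Mi.nrm f)\<^sup>2"
proof -
  have "0 \<le> (LINT x:\<Omega>|\<mu>. (f x)\<^sup>2)"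
    unfolding set_lebesgue_integral_def by (intro integral_nonneg_AE) auto
  then show ?thesis by (simp add: Mi.nrm_def power2_eq_square)
qed

lemma Mi_tendsto:
  "(\<lambda>n. LINT x:\<Omega>|\<mu>. (f n x)\<^sup>2) \<longlonglongrightarrow> 0 \<longleftrightarrow> (\<lambda>n. Mi.nrm (f n)) \<longlonglongrightarrow> 0"
  unfolding Mi_nrm_sq
proof
  assume "(\<lambda>n. (Mi.nrm (f n))\<^sup>2) \<longlonglongrightarrow> 0"
  from tendsto_real_sqrt[OF this] have "(\<lambda>n. \<bar>Mi.nrm (f n)\<bar>) \<longlonglongrightarrow> 0" by simp
  then show "(\<lambda>n. Mi.nrm (f n)) \<longlonglongrightarrow> 0" by (simp add: tendsto_rabs_zero_iff)
next
  assume "(\<lambda>n. Mi.nrm (f n)) \<longlonglongrightarrow> 0"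
  from tendsto_power[OF this, of 2] show "(\<lambda>n. (Mi.nrm (f n))\<^sup>2) \<longlonglongrightarrow> 0" by simp
qed

text \<open>A test function supported in \<Omega> is also one on the whole manifold, and both
  integrands vanish off \<Omega>; so the inequality assumed on the manifold holds on
  \<Omega>.\<close>

lemma mpi_test:
  obtains C where "C \<ge> 0" "\<And>v. v \<in> T \<Longrightarrow> Mi.nrm v \<le> C * Ei.nrm v"
proof -
  obtain C where C: "C > 0" "\<And>v. v \<in> Cc_inf G UNIV \<Longrightarrow>
      (LINT x:UNIV|\<mu>. (v x)\<^sup>2) \<le> C * (LINT x:UNIV|\<nu>. rinner G (grad G v) (grad G v) x)"
    using poincare unfolding MPI_def by blast
  have "Mi.nrm v \<le> sqrt C * Ei.nrm v" if v: "v \<in> T" for v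
  proof -
    obtain K where K: "compact K" "K \<subseteq> \<Omega>" "\<And>x. x \<notin> K \<Longrightarrow> v x = 0" using test_support[OF v] by blast
    have out: "v x = 0" "rinner G (grad G v) (grad G v) x = 0" if "x \<notin> \<Omega>" for x
    proof -
      have x: "x \<notin> K" using that K(2) by blast
      show "v x = 0" by (rule K(3)[OF x])
      show "rinner G (grad G v) (grad G v) x = 0" by (rule rinner_grad_outside[OF K(1) x K(3)])
    qed
    have e1: "indicator UNIV x *\<^sub>R (v x)\<^sup>2 = indicator \<Omega> x *\<^sub>R (v x)\<^sup>2" for x
      using out(1)[of x] by (cases "x \<in> \<Omega>") auto
    have e2: "indicator UNIV x *\<^sub>R rinner G (grad G v) (grad G v) x = indicator \<Omega> x *\<^sub>R rinner G (grad G v) (grad G v) x" for x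
      using out(2)[of x] by (cases "x \<in> \<Omega>") auto
    have "v \<in> Cc_inf G UNIV" using v by (auto simp: Cc_inf_def compactly_supported_in_def)
    from C(2)[OF this] have "(LINT x:\<Omega>|\<mu>. (v x)\<^sup>2) \<le> C * ip (grad G v) (grad G v)"
      unfolding set_lebesgue_integral_def ip_def e1 e2 .
    then have "(Mi.nrm v)\<^sup>2 \<le> C * (Ei.nrm v)\<^sup>2"
      by (simp add: Mi_nrm_sq Ei.nrm_sq[OF test_W[OF v]] test_E[OF v v])
    also have "\<dots> = (sqrt C * Ei.nrm v)\<^sup>2" using C(1) by (simp add: power_mult_distrib)
    finally show ?thesis
      by (rule power2_le_imp_le) (use C(1) Ei.nrm_nonneg[OF test_W[OF v]] in simp)
  qed
  then show ?thesis using that[of "sqrt C"] C(1) by simp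
qed

lemma rep_iff: "rep u h \<longleftrightarrow> h \<in> L2 \<mu> \<Omega> \<and> (\<exists>v. (\<forall>n. v n \<in> T) \<and>
    (\<lambda>n. Wi.nrm (\<lambda>x. u x - v n x)) \<longlonglongrightarrow> 0 \<and> (\<lambda>n. Mi.nrm (\<lambda>x. v n x - h x)) \<longlonglongrightarrow> 0)"
  unfolding is_mu_representative_def W12_norm_eq Mi_tendsto[of "\<lambda>n x. _ n x - h x"] ..

text \<open>Stated for two sequences: a sequence compared with itself gives existence of the
  representative, two sequences compared with each other show that it does not depend on the
  approximation.\<close>

lemma test_approx_Cauchy:
  assumes u: "u \<in> W" and v: "\<And>n. v n \<in> T" "\<And>n. v' n \<in> T"
    and lim: "(\<lambda>n. Wi.nrm (\<lambda>x. u x - v n x)) \<longlonglongrightarrow> 0" "(\<lambda>n. Wi.nrm (\<lambda>x. u x - v' n x)) \<longlonglongrightarrow> 0"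
  obtains C where "C \<ge> 0" "\<And>m n. Mi.nrm (\<lambda>x. v m x - v' n x) \<le> C * (Wi.nrm (\<lambda>x. u x - v m x) + Wi.nrm (\<lambda>x. u x - v' n x))"
proof -
  obtain C where C: "C \<ge> 0" "\<And>v. v \<in> T \<Longrightarrow> Mi.nrm v \<le> C * Ei.nrm v" using mpi_test by blast
  have "Mi.nrm (\<lambda>x. v m x - v' n x) \<le> C * (Wi.nrm (\<lambda>x. u x - v m x) + Wi.nrm (\<lambda>x. u x - v' n x))" for m n
  proof -
    have vW: "v m \<in> W" "v' n \<in> W" using v test_W by auto
    have d: "(\<lambda>x. v m x - v' n x) \<in> T" using test_lin[OF v(1,2), of 1 m "-1" n] by simp
    have "Ei.nrm (\<lambda>x. v m x - v' n x) \<le> Wi.nrm (\<lambda>x. v m x - v' n x)" by (rule Wi_ge(2)[OF test_W[OF d]])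
    also have "\<dots> \<le> Wi.nrm (\<lambda>x. u x - v m x) + Wi.nrm (\<lambda>x. u x - v' n x)"
      using Wi.nrm_triangle[OF vW(1) u vW(2)] Wi.nrm_sym[OF vW(1) u] by simp
    finally show ?thesis using C(2)[OF d] C(1) by (meson mult_left_mono order_trans)
  qed
  then show ?thesis using that C(1) by blast
qed

lemma rep_unique:
  assumes u: "u \<in> W" and h: "rep u h" "rep u h'"
  shows "AE x in \<mu>. x \<in> \<Omega> \<longrightarrow> h x = h' x"
proof -
  from h obtain v v' where v: "\<And>n. v n \<in> T" "(\<lambda>n. Wi.nrm (\<lambda>x. u x - v n x)) \<longlonglongrightarrow> 0" "(\<lambda>n. Mi.nrm (\<lambda>x. v n x - h x)) \<longlonglongrightarrow> 0"
    and v': "\<And>n. v' n \<in> T" "(\<lambda>n. Wi.nrm (\<lambda>x. u x - v' n x)) \<longlonglongrightarrow> 0" "(\<lambda>n. Mi.nrm (\<lambda>x. v' n x - h' x)) \<longlonglongrightarrow> 0"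
    and L: "h \<in> L2 \<mu> \<Omega>" "h' \<in> L2 \<mu> \<Omega>"
    unfolding rep_iff by blast
  obtain C where C: "C \<ge> 0" "\<And>m n. Mi.nrm (\<lambda>x. v m x - v' n x) \<le> C * (Wi.nrm (\<lambda>x. u x - v m x) + Wi.nrm (\<lambda>x. u x - v' n x))"
    using test_approx_Cauchy[OF u v(1) v'(1) v(2) v'(2)] by blast
  have le: "Mi.nrm (\<lambda>x. h x - h' x) \<le> Mi.nrm (\<lambda>x. v n x - h x) +
      (C * (Wi.nrm (\<lambda>x. u x - v n x) + Wi.nrm (\<lambda>x. u x - v' n x)) + Mi.nrm (\<lambda>x. v' n x - h' x))" for n
  proof -
    have M: "v n \<in> L2 \<mu> \<Omega>" "v' n \<in> L2 \<mu> \<Omega>" using v(1) v'(1) test_Mi by auto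
    have "Mi.nrm (\<lambda>x. h x - h' x) \<le> Mi.nrm (\<lambda>x. h x - v n x) + Mi.nrm (\<lambda>x. v n x - h' x)"
      by (rule Mi.nrm_triangle[OF L(1) M(1) L(2)])
    moreover have "Mi.nrm (\<lambda>x. v n x - h' x) \<le> Mi.nrm (\<lambda>x. v n x - v' n x) + Mi.nrm (\<lambda>x. v' n x - h' x)"
      by (rule Mi.nrm_triangle[OF M L(2)])
    ultimately show ?thesis using C(2)[of n n] Mi.nrm_sym[OF L(1) M(1)] by linarith
  qed
  have "(\<lambda>n. Mi.nrm (\<lambda>x. v n x - h x) +
      (C * (Wi.nrm (\<lambda>x. u x - v n x) + Wi.nrm (\<lambda>x. u x - v' n x)) + Mi.nrm (\<lambda>x. v' n x - h' x))) \<longlonglongrightarrow> 0 + (C * (0 + 0) + 0)"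
    by (intro tendsto_add tendsto_mult tendsto_const v v')
  from LIMSEQ_le_const[OF this] le have "Mi.nrm (\<lambda>x. h x - h' x) \<le> 0" by auto
  then have "Mi.nrm (\<lambda>x. h x - h' x) = 0" using Mi.nrm_nonneg[OF Mi.diff[OF L]] by simp
  then have "(LINT x:\<Omega>|\<mu>. (h x - h' x)\<^sup>2) = 0" by (simp add: Mi_nrm_sq)
  moreover have i: "integrable \<mu> (\<lambda>x. indicator \<Omega> x *\<^sub>R (h x - h' x)\<^sup>2)"
    using Mi.diff[OF L] unfolding L2_def set_integrable_def by (rule CollectE) (erule conjunct2)
  moreover have nn: "AE x in \<mu>. 0 \<le> indicator \<Omega> x *\<^sub>R (h x - h' x)\<^sup>2"
    by (rule AE_I2) simp
  ultimately have "AE x in \<mu>. indicator \<Omega> x *\<^sub>R (h x - h' x)\<^sup>2 = 0"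
    unfolding set_lebesgue_integral_def using integral_nonneg_eq_0_iff_AE[OF i nn] by (rule_tac iffD1)
  then show ?thesis
  proof eventually_elim
    case (elim x)
    show ?case
    proof
      assume "x \<in> \<Omega>"
      with elim show "h x = h' x" by simp
    qed
  qed
qed

lemma W0_W: "u \<in> W0 \<Longrightarrow> u \<in> W"
  by (simp add: W12_0_def)

lemma W0_approx:
  assumes "u \<in> W0"
  obtains v where "\<And>n. v n \<in> T" "(\<lambda>n. Wi.nrm (\<lambda>x. u x - v n x)) \<longlonglongrightarrow> 0"
proof -
  have ex: "\<exists>v. v \<in> T \<and> Wi.nrm (\<lambda>x. u x - v x) < inverse (real (Suc n))" for n
  proof -
    have "inverse (real (Suc n)) > 0" by simp
    then show ?thesis using assms unfolding W12_0_def W12_norm_eq by blast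
  qed
  define v where "v n = (SOME v. v \<in> T \<and> Wi.nrm (\<lambda>x. u x - v x) < inverse (real (Suc n)))" for n
  have v: "v n \<in> T" "Wi.nrm (\<lambda>x. u x - v n x) < inverse (real (Suc n))" for n
    using someI_ex[OF ex[of n]] unfolding v_def by (rule conjunct1, rule conjunct2)
  have "(\<lambda>n. Wi.nrm (\<lambda>x. u x - v n x)) \<longlonglongrightarrow> 0"
  proof (rule Lim_null_comparison[OF _ LIMSEQ_inverse_real_of_nat])
    have "norm (Wi.nrm (\<lambda>x. u x - v n x)) \<le> inverse (real (Suc n))" for n
      using v(2)[of n] Wi.nrm_nonneg[OF Wi.diff[OF W0_W[OF assms] test_W[OF v(1)]], of n] by simp
    then show "\<forall>\<^sub>F n in sequentially. norm (Wi.nrm (\<lambda>x. u x - v n x)) \<le> inverse (real (Suc n))" by (rule always_eventually[OF allI])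
  qed
  then show ?thesis using that v(1) by blast
qed

lemma W0_I:
  assumes "u \<in> W" "\<And>n. v n \<in> T" "(\<lambda>n. Wi.nrm (\<lambda>x. u x - v n x)) \<longlonglongrightarrow> 0"
  shows "u \<in> W0"
proof -
  have "\<exists>v\<in>T. Wi.nrm (\<lambda>x. u x - v x) < e" if "e > 0" for e
  proof -
    have "\<forall>\<^sub>F n in sequentially. Wi.nrm (\<lambda>x. u x - v n x) < e" using order_tendstoD(2)[OF assms(3) that] .
    then show ?thesis using assms(2) eventually_happens'[OF sequentially_bot] by blast
  qed
  then show ?thesis using assms(1) by (simp add: W12_0_def W12_norm_eq)
qed

lemma iota_rep:
  assumes u: "u \<in> W0" shows "rep u (iota G \<nu> \<mu> \<Omega> u)"
proof -
  obtain v where v: "\<And>n. v n \<in> T" "(\<lambda>n. Wi.nrm (\<lambda>x. u x - v n x)) \<longlonglongrightarrow> 0" using W0_approx[OF u] by blast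
  obtain C where C: "C \<ge> 0" "\<And>m n. Mi.nrm (\<lambda>x. v m x - v n x) \<le> C * (Wi.nrm (\<lambda>x. u x - v m x) + Wi.nrm (\<lambda>x. u x - v n x))"
    using test_approx_Cauchy[OF W0_W[OF u] v(1) v(1) v(2) v(2)] by blast
  have cau: "\<exists>N. \<forall>m\<ge>N. \<forall>n\<ge>N. (LINT x:\<Omega>|\<mu>. (v m x - v n x)\<^sup>2) < e" if e: "e > 0" for e
  proof -
    \<comment> \<open>Two distances below \<open>d\<close> give the bound
      \<open>C * (d + d)\<close>, which is less than \<open>sqrt e\<close>. The summand 1 in the
      denominator covers \<open>C = 0\<close>.\<close>
    define d where "d = sqrt e / (2 * C + 1)"
    have d: "d > 0" using e C(1) by (simp add: d_def)
    obtain N where N: "\<And>n. n \<ge> N \<Longrightarrow> Wi.nrm (\<lambda>x. u x - v n x) < d"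
      using order_tendstoD(2)[OF v(2) d] unfolding eventually_sequentially by blast
    have "(LINT x:\<Omega>|\<mu>. (v m x - v n x)\<^sup>2) < e" if "m \<ge> N" "n \<ge> N" for m n
    proof -
      have "C * (Wi.nrm (\<lambda>x. u x - v m x) + Wi.nrm (\<lambda>x. u x - v n x)) \<le> C * (d + d)"
        using N[OF that(1)] N[OF that(2)] C(1) by (intro mult_left_mono add_mono) auto
      also have "\<dots> < (2 * C + 1) * d" using d by (simp add: algebra_simps)
      also have "\<dots> = sqrt e" using C(1) by (simp add: d_def)
      finally have "Mi.nrm (\<lambda>x. v m x - v n x) < sqrt e" using C(2)[of m n] by linarith
      then have "(Mi.nrm (\<lambda>x. v m x - v n x))\<^sup>2 < (sqrt e)\<^sup>2"
        using Mi.nrm_nonneg[OF Mi.diff[OF test_Mi[OF v(1)] test_Mi[OF v(1)]]] by (intro power_strict_mono) auto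
      then show ?thesis using e by (simp add: Mi_nrm_sq)
    qed
    then show ?thesis by blast
  qed
  have "\<exists>h. rep u h"
  proof (rule L2_complete[of \<Omega> \<mu> v, OF _ test_Mi[OF v(1)] cau])
    show "\<Omega> \<in> sets \<mu>" by (simp add: sets_mu)
    fix h assume "h \<in> L2 \<mu> \<Omega>" "(\<lambda>n. LINT x:\<Omega>|\<mu>. (v n x - h x)\<^sup>2) \<longlonglongrightarrow> 0"
    then show "\<exists>h. rep u h" unfolding rep_iff Mi_tendsto[of "\<lambda>n x. v n x - h x"] using v by blast
  qed blast
  then show ?thesis unfolding iota_def by (rule someI_ex)
qed

text \<open>
  The minimiser of the energy among all functions that agree with \<open>v\<close> in \<open>L\<^sup>2(\<Omega>,\<mu>)\<close> is orthogonal to the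
  kernel of \<open>\<iota>\<close>. A minimising sequence of test functions may be truncated, so it is bounded in
  \<open>L\<^sup>2(\<Omega>,\<nu>)\<close> because \<open>\<Omega>\<close> has finite volume; no Poincare inequality for \<open>\<nu>\<close> is needed.
\<close>
lemma test_projection:
  assumes v: "v \<in> T"
  obtains p q where "p \<in> W0" "rep p v" "\<And>w. w \<in> ker_iota G \<nu> \<mu> \<Omega> \<Longrightarrow> E p w = 0"
    "\<And>n. q n \<in> T" "(\<lambda>n. Wi.nrm (\<lambda>x. p x - q n x)) \<longlonglongrightarrow> 0" "(\<lambda>n. Mi.nrm (\<lambda>x. q n x - v x)) \<longlonglongrightarrow> 0"
proof -
  obtain c where c: "c \<ge> 0" "\<And>x. \<bar>v x\<bar> \<le> c" using test_bounded[OF v] by blast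
  obtain \<phi> \<phi>' where \<phi>: "smooth_on \<phi> UNIV" "\<And>t. (\<phi> has_real_derivative \<phi>' t) (at t)" "\<And>t. \<bar>\<phi>' t\<bar> \<le> 1"
    "\<And>t. \<bar>t\<bar> \<le> c \<Longrightarrow> \<phi> t = t" "\<And>t. \<bar>\<phi> t\<bar> \<le> c + 1"
    using smooth_truncation[OF c(1)] by blast
  have \<phi>0: "\<phi> 0 = 0" using \<phi>(4)[of 0] c(1) by simp
  have lip: "\<bar>\<phi> s - \<phi> t\<bar> \<le> \<bar>s - t\<bar>" for s t
  proof -
    have "norm (\<phi> s - \<phi> t) \<le> 1 * norm (s - t)"
      by (rule field_differentiable_bound[where S = UNIV and f' = \<phi>']) (use \<phi>(2,3) in auto)
    then show ?thesis by simp
  qed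
  \<comment> \<open>The condition of agreeing with \<open>v\<close> in L2(\<mu>) is relaxed to
    closeness, so that all competitors are test functions and can be composed with \<phi>.\<close>
  define S where "S k = {q \<in> T. Mi.nrm (\<lambda>x. q x - v x) \<le> inverse (real (Suc k))}" for k
  have inv_mono: "inverse (real (Suc n)) \<le> inverse (real (Suc m))" if "m \<le> n" for m n
    using that by (intro le_imp_inverse_le) auto
  have "Mi.nrm (\<lambda>x. v x - v x) = 0" unfolding Mi.nrm_def by (simp add: set_lebesgue_integral_def)
  then have vS: "v \<in> S k" for k unfolding S_def using v by (simp only: mem_Collect_eq) simp
  define e where "e k = (INF q\<in>S k. Ei.nrm q)" for k
  have bdd: "bdd_below (Ei.nrm ` S k)" for k
    using Ei.nrm_nonneg test_W by (intro bdd_belowI[of _ 0]) (auto simp: S_def)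
  have e_le: "e k \<le> Ei.nrm q" if "q \<in> S k" for k q
    unfolding e_def by (rule cINF_lower[OF bdd that])
  have ev: "e k \<le> Ei.nrm v" for k by (rule e_le[OF vS])
  \<comment> \<open>The relaxed infima approach the true minimum from below. Below,
    \<open>Ei.nrm p \<le> a\<close> and \<open>a \<le> Ei.nrm (\<lambda>x. p x + t * w x)\<close>
    together say that \<open>p\<close> is a minimiser in every direction \<open>w\<close> of the
    kernel.\<close>
  define a where "a = (SUP k. e k)"
  have ea: "e k \<le> a" for k unfolding a_def by (rule cSUP_upper) (auto intro!: bdd_aboveI[of _ "Ei.nrm v"] ev)
  have aI: "a \<le> r" if "\<And>k. e k \<le> r" for r unfolding a_def by (rule cSUP_least) (auto intro: that)
  have a0: "a \<ge> 0"
  proof -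
    have "0 \<le> e 0" unfolding e_def
    proof (rule cINF_greatest)
      show "S 0 \<noteq> {}" using vS by blast
      show "0 \<le> Ei.nrm q" if "q \<in> S 0" for q
        using that by (intro Ei.nrm_nonneg test_W) (simp add: S_def)
    qed
    then show ?thesis using ea[of 0] by simp
  qed
  \<comment> \<open>The bound on the values and the bound on the energy are both preserved by
    midpoints, and together they keep \<open>D 0\<close> bounded in W12, as
    \<open>nested_convex_Cauchy\<close> demands.\<close>
  define D where "D k = {q \<in> S k. (\<forall>x. \<bar>q x\<bar> \<le> c + 1) \<and> Ei.nrm q \<le> a + inverse (real (Suc k))}" for k
  have DT: "D k \<subseteq> T" "D k \<subseteq> W" for k using test_W by (auto simp: D_def S_def)
  have "\<exists>q. (\<forall>k. q k \<in> D k) \<and> (\<forall>d>0. \<exists>N. \<forall>m\<ge>N. \<forall>n\<ge>N. Wi.nrm (\<lambda>x. q m x - q n x) < d)"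
  proof (rule Wi.nested_convex_Cauchy[of D "(c + 1)\<^sup>2 * measure \<nu> \<Omega> + (a + 1)\<^sup>2"])
    show "D k \<subseteq> W" for k by (rule DT)
    show "D k \<noteq> {}" for k
    proof -
      have "0 < inverse (real (Suc k))" by simp
      then have "e k < a + inverse (real (Suc k))" using ea[of k] by linarith
      moreover have ne: "S k \<noteq> {}" using vS by blast
      ultimately have "\<exists>q\<in>S k. Ei.nrm q < a + inverse (real (Suc k))"
        unfolding e_def cINF_less_iff[OF ne bdd] by simp
      then obtain q where q: "q \<in> S k" "Ei.nrm q < a + inverse (real (Suc k))" by (elim bexE)
      have qT: "q \<in> T" using q(1) by (simp add: S_def)
      \<comment> \<open>Truncation keeps the competitor in \<open>S k\<close>: \<phi> fixes the
        values of \<open>v\<close> and is 1-Lipschitz, so the distance to \<open>v\<close> in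
        L2(\<mu>) does not grow.\<close>
      let ?q = "\<lambda>x. \<phi> (q x)"
      have T': "?q \<in> T" by (rule test_compose[OF qT \<phi>(1) \<phi>0])
      have "(LINT x:\<Omega>|\<mu>. (?q x - v x)\<^sup>2) \<le> (LINT x:\<Omega>|\<mu>. (q x - v x)\<^sup>2)"
      proof (rule set_integral_mono)
        show "set_integrable \<mu> \<Omega> (\<lambda>x. (?q x - v x)\<^sup>2)" "set_integrable \<mu> \<Omega> (\<lambda>x. (q x - v x)\<^sup>2)"
          using Mi.diff[OF test_Mi[OF T'] test_Mi[OF v]] Mi.diff[OF test_Mi[OF qT] test_Mi[OF v]] by (auto simp: L2_def)
        show "(?q x - v x)\<^sup>2 \<le> (q x - v x)\<^sup>2" for x
          using lip[of "q x" "v x"] \<phi>(4)[OF c(2)[of x]] by (simp add: abs_le_square_iff)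
      qed
      then have "Mi.nrm (\<lambda>x. ?q x - v x) \<le> Mi.nrm (\<lambda>x. q x - v x)"
        unfolding Mi.nrm_def power2_eq_square[symmetric] by (rule real_sqrt_le_mono)
      then have "?q \<in> S k" using q(1) T' by (simp add: S_def)
      moreover have "Ei.nrm ?q \<le> Ei.nrm q"
        unfolding Ei.nrm_def by (rule real_sqrt_le_mono[OF E_compose_le[OF qT \<phi>(1) \<phi>0 \<phi>(2,3)]])
      ultimately have "?q \<in> D k" using q(2) \<phi>(5) by (simp add: D_def)
      then show ?thesis by blast
    qed
    show "D (Suc k) \<subseteq> D k" for k
    proof
      fix q assume q: "q \<in> D (Suc k)"
      have i: "inverse (real (Suc (Suc k))) \<le> inverse (real (Suc k))" by (rule inv_mono) simp
      have *: "q \<in> T" "Mi.nrm (\<lambda>x. q x - v x) \<le> inverse (real (Suc (Suc k)))" "\<forall>x. \<bar>q x\<bar> \<le> c + 1"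
        "Ei.nrm q \<le> a + inverse (real (Suc (Suc k)))"
        using q unfolding D_def S_def by blast+
      show "q \<in> D k" unfolding D_def S_def
        using *(1,3) order_trans[OF *(2) i] order_trans[OF *(4) add_left_mono[OF i]] by blast
    qed
    show "(\<lambda>x. (1/2) * q x + (1/2) * q' x) \<in> D k" if q: "q \<in> D k" "q' \<in> D k" for k q q'
    proof -
      let ?m = "\<lambda>x. (1/2) * q x + (1/2) * q' x"
      have T: "q \<in> T" "q' \<in> T" using q DT by auto
      have "Mi.nrm (\<lambda>x. (1/2) * (q x - v x) + (1/2) * (q' x - v x)) \<le> \<bar>1/2\<bar> * Mi.nrm (\<lambda>x. q x - v x) + \<bar>1/2\<bar> * Mi.nrm (\<lambda>x. q' x - v x)"
        by (rule Mi.nrm_lin[OF Mi.diff Mi.diff]) (use T v test_Mi in auto)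
      also have "\<dots> \<le> inverse (real (Suc k))" using q by (simp add: D_def S_def del: of_nat_Suc)
      also have "(\<lambda>x. (1/2) * (q x - v x) + (1/2) * (q' x - v x)) = (\<lambda>x. ?m x - v x)" by (simp add: fun_eq_iff field_simps)
      finally have nm: "Mi.nrm (\<lambda>x. ?m x - v x) \<le> inverse (real (Suc k))" .
      have "?m \<in> S k" unfolding S_def by (intro CollectI conjI test_lin[OF T] nm)
      moreover have "\<bar>?m x\<bar> \<le> c + 1" for x
      proof -
        have "\<bar>q x\<bar> \<le> c + 1" "\<bar>q' x\<bar> \<le> c + 1" using q by (auto simp: D_def)
        then show ?thesis by (simp add: abs_le_iff)
      qed
      moreover have "Ei.nrm ?m \<le> a + inverse (real (Suc k))"
      proof -
        have "Ei.nrm ?m \<le> \<bar>1/2\<bar> * Ei.nrm q + \<bar>1/2\<bar> * Ei.nrm q'" by (rule Ei.nrm_lin) (use T test_W in auto)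
        also have "\<dots> \<le> a + inverse (real (Suc k))" using q by (simp add: D_def del: of_nat_Suc)
        finally show ?thesis .
      qed
      ultimately show ?thesis by (simp add: D_def)
    qed
    show "(LINT x:\<Omega>|\<nu>. q x * q x) + E q q \<le> (c + 1)\<^sup>2 * measure \<nu> \<Omega> + (a + 1)\<^sup>2" if q: "q \<in> D 0" for q
    proof -
      have T: "q \<in> T" and b: "\<And>x. \<bar>q x\<bar> \<le> c + 1" and n: "Ei.nrm q \<le> a + 1" using q by (auto simp: D_def S_def)
      have "E q q = (Ei.nrm q)\<^sup>2" by (simp add: Ei.nrm_sq test_W T)
      also have "\<dots> \<le> (a + 1)\<^sup>2" using n Ei.nrm_nonneg[OF test_W[OF T]] by (intro power_mono) auto
      finally have 1: "E q q \<le> (a + 1)\<^sup>2" .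
      have "(LINT x:\<Omega>|\<nu>. q x * q x) \<le> (LINT x:\<Omega>|\<nu>. (c + 1)\<^sup>2)"
      proof (rule set_integral_mono)
        show "set_integrable \<nu> \<Omega> (\<lambda>x. q x * q x)" by (rule L2_mult[OF test_L2_nu[OF T] test_L2_nu[OF T]])
        show "set_integrable \<nu> \<Omega> (\<lambda>x. (c + 1)\<^sup>2)"
          unfolding set_integrable_def using finite_volume by (intro integrable_scaleR_left integrable_real_indicator) auto
        show "q x * q x \<le> (c + 1)\<^sup>2" for x
          using power_mono[OF b[of x], of 2] by (simp add: power2_eq_square)
      qed
      also have "\<dots> = (c + 1)\<^sup>2 * measure \<nu> \<Omega>" using finite_volume by (simp add: set_lebesgue_integral_def)
      finally show ?thesis using 1 by simp
    qed
  qed blast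
  then obtain q where q: "\<And>k. q k \<in> D k" and qc: "\<And>d. d > 0 \<Longrightarrow> \<exists>N. \<forall>m\<ge>N. \<forall>n\<ge>N. Wi.nrm (\<lambda>x. q m x - q n x) < d" by blast
  have qT: "q n \<in> T" for n using q DT by blast
  have qW: "q n \<in> W" for n by (rule test_W[OF qT])
  obtain p where p: "p \<in> W" "(\<lambda>n. Wi.nrm (\<lambda>x. q n x - p x)) \<longlonglongrightarrow> 0" using W_complete[OF qW qc] by blast
  have pq: "(\<lambda>n. Wi.nrm (\<lambda>x. p x - q n x)) \<longlonglongrightarrow> 0" using p(2) Wi.nrm_sym[OF qW p(1)] by simp
  have pW0: "p \<in> W0" by (rule W0_I[OF p(1) qT pq])
  have qv: "(\<lambda>n. Mi.nrm (\<lambda>x. q n x - v x)) \<longlonglongrightarrow> 0"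
  proof (rule Lim_null_comparison[OF _ LIMSEQ_inverse_real_of_nat])
    have "norm (Mi.nrm (\<lambda>x. q n x - v x)) \<le> inverse (real (Suc n))" for n
      using q[of n] Mi.nrm_nonneg[OF Mi.diff[OF test_Mi[OF qT] test_Mi[OF v]], of n] by (simp add: D_def S_def)
    then show "\<forall>\<^sub>F n in sequentially. norm (Mi.nrm (\<lambda>x. q n x - v x)) \<le> inverse (real (Suc n))" by (rule always_eventually[OF allI])
  qed
  have rep: "rep p v" unfolding rep_iff using test_Mi[OF v] qT pq qv by blast
  have pa: "Ei.nrm p \<le> a"
  proof -
    have le: "Ei.nrm p \<le> Wi.nrm (\<lambda>x. p x - q n x) + (a + inverse (real (Suc n)))" for n
    proof -
      have "Ei.nrm p \<le> Ei.nrm (\<lambda>x. p x - q n x) + Ei.nrm (q n)"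
        using Ei.nrm_add[OF Ei.diff[OF p(1) qW] qW, of n n] by simp
      moreover have "Ei.nrm (\<lambda>x. p x - q n x) \<le> Wi.nrm (\<lambda>x. p x - q n x)" by (rule Wi_ge(2)[OF Wi.diff[OF p(1) qW]])
      moreover have "Ei.nrm (q n) \<le> a + inverse (real (Suc n))" using q[of n] by (simp add: D_def)
      ultimately show ?thesis by linarith
    qed
    have "(\<lambda>n. Wi.nrm (\<lambda>x. p x - q n x) + (a + inverse (real (Suc n)))) \<longlonglongrightarrow> 0 + (a + 0)"
      by (intro tendsto_add tendsto_const pq LIMSEQ_inverse_real_of_nat)
    from LIMSEQ_le_const[OF this] le show ?thesis by auto
  qed
  have orth: "E p w = 0" if w: "w \<in> ker_iota G \<nu> \<mu> \<Omega>" for w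
  proof -
    have wW0: "w \<in> W0" and w0: "AE x in \<mu>. x \<in> \<Omega> \<longrightarrow> iota G \<nu> \<mu> \<Omega> w x = 0" using w by (auto simp: ker_iota_def)
    have wW: "w \<in> W" by (rule W0_W[OF wW0])
    let ?h = "iota G \<nu> \<mu> \<Omega> w"
    obtain y where y: "\<And>n. y n \<in> T" "(\<lambda>n. Wi.nrm (\<lambda>x. w x - y n x)) \<longlonglongrightarrow> 0" "(\<lambda>n. Mi.nrm (\<lambda>x. y n x - ?h x)) \<longlonglongrightarrow> 0"
      and hL: "?h \<in> L2 \<mu> \<Omega>"
      using iota_rep[OF wW0] unfolding rep_iff by blast
    have yW: "y n \<in> W" for n by (rule test_W[OF y(1)])
    have h0: "Mi.nrm ?h = 0"
    proof -
      have "(LINT x:\<Omega>|\<mu>. ?h x * ?h x) = (LINT x|\<mu>. 0)"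
        unfolding set_lebesgue_integral_def
      proof (rule integral_cong_AE)
        show "(\<lambda>x. indicator \<Omega> x *\<^sub>R (?h x * ?h x)) \<in> borel_measurable \<mu>"
          using L2_mult[OF hL hL] unfolding set_integrable_def by (rule borel_measurable_integrable)
        show "AE x in \<mu>. indicator \<Omega> x *\<^sub>R (?h x * ?h x) = 0"
          using w0 by eventually_elim (auto simp: indicator_def)
      qed simp
      then show ?thesis by (simp add: Mi.nrm_def)
    qed
    have y0: "(\<lambda>n. Mi.nrm (y n)) \<longlonglongrightarrow> 0"
    proof (rule Lim_null_comparison[OF _ y(3)])
      have "norm (Mi.nrm (y n)) \<le> Mi.nrm (\<lambda>x. y n x - ?h x)" for n
        using Mi.nrm_add[OF Mi.diff[OF test_Mi[OF y(1)] hL] hL, of n] h0 Mi.nrm_nonneg[OF test_Mi[OF y(1)], of n] by simp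
      then show "\<forall>\<^sub>F n in sequentially. norm (Mi.nrm (y n)) \<le> Mi.nrm (\<lambda>x. y n x - ?h x)" by (rule always_eventually[OF allI])
    qed
    \<comment> \<open>The functions \<open>y n\<close> tend to \<open>w\<close> in W12 and to 0 in
      L2(\<mu>). Adding \<open>t * y n\<close> to \<open>q n\<close> therefore ends up in every
      \<open>S k\<close>, and the energy norms of these sums are asymptotically at most that of
      \<open>p + t * w\<close>.\<close>
    have "a \<le> Ei.nrm (\<lambda>x. p x + t * w x)" for t
    proof (rule aI)
      fix k
      let ?s = "\<lambda>n x. 1 * q n x + t * y n x" and ?pt = "\<lambda>x. 1 * p x + t * w x"
      have sT: "?s n \<in> T" for n by (rule test_lin[OF qT y(1)])
      have ptW: "?pt \<in> W" by (rule W_lin[OF p(1) wW])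
      have sle: "Mi.nrm (\<lambda>x. ?s n x - v x) \<le> Mi.nrm (\<lambda>x. q n x - v x) + \<bar>t\<bar> * Mi.nrm (y n)" for n
        using Mi.nrm_lin[OF Mi.diff[OF test_Mi[OF qT] test_Mi[OF v]] test_Mi[OF y(1)], of 1 n t n] by (simp add: algebra_simps)
      have "(\<lambda>n. Mi.nrm (\<lambda>x. q n x - v x) + \<bar>t\<bar> * Mi.nrm (y n)) \<longlonglongrightarrow> 0 + \<bar>t\<bar> * 0"
        by (intro tendsto_intros qv y0)
      then have "\<forall>\<^sub>F n in sequentially. Mi.nrm (\<lambda>x. q n x - v x) + \<bar>t\<bar> * Mi.nrm (y n) < inverse (real (Suc k))"
        by (rule order_tendstoD(2)) simp
      then have "\<forall>\<^sub>F n in sequentially. ?s n \<in> S k"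
      proof (rule eventually_mono)
        fix n assume "Mi.nrm (\<lambda>x. q n x - v x) + \<bar>t\<bar> * Mi.nrm (y n) < inverse (real (Suc k))"
        then have "Mi.nrm (\<lambda>x. ?s n x - v x) \<le> inverse (real (Suc k))" using sle[of n] by linarith
        then show "?s n \<in> S k" unfolding S_def by (intro CollectI conjI sT)
      qed
      moreover have "Ei.nrm (?s n) \<le> Ei.nrm ?pt + (Wi.nrm (\<lambda>x. q n x - p x) + \<bar>t\<bar> * Wi.nrm (\<lambda>x. w x - y n x))" for n
      proof -
        have d: "(\<lambda>x. 1 * (q n x - p x) + (- t) * (w x - y n x)) \<in> W"
          by (intro W_lin Wi.diff qW p(1) wW yW)
        have "Ei.nrm (\<lambda>x. ?pt x + (1 * (q n x - p x) + (- t) * (w x - y n x))) \<le>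
            Ei.nrm ?pt + Ei.nrm (\<lambda>x. 1 * (q n x - p x) + (- t) * (w x - y n x))"
          by (rule Ei.nrm_add[OF ptW d])
        also have "(\<lambda>x. ?pt x + (1 * (q n x - p x) + (- t) * (w x - y n x))) = ?s n" by (simp add: fun_eq_iff algebra_simps)
        also have "Ei.nrm (\<lambda>x. 1 * (q n x - p x) + (- t) * (w x - y n x)) \<le> Wi.nrm (\<lambda>x. 1 * (q n x - p x) + (- t) * (w x - y n x))"
          by (rule Wi_ge(2)[OF d])
        also have "\<dots> \<le> \<bar>1\<bar> * Wi.nrm (\<lambda>x. q n x - p x) + \<bar>- t\<bar> * Wi.nrm (\<lambda>x. w x - y n x)"
          by (intro Wi.nrm_lin Wi.diff qW p(1) wW yW)
        finally show ?thesis by simp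
      qed
      ultimately have "\<forall>\<^sub>F n in sequentially. e k \<le> Ei.nrm ?pt + (Wi.nrm (\<lambda>x. q n x - p x) + \<bar>t\<bar> * Wi.nrm (\<lambda>x. w x - y n x))"
        by (elim eventually_mono) (meson e_le order_trans)
      moreover have "(\<lambda>n. Ei.nrm ?pt + (Wi.nrm (\<lambda>x. q n x - p x) + \<bar>t\<bar> * Wi.nrm (\<lambda>x. w x - y n x))) \<longlonglongrightarrow> Ei.nrm ?pt + (0 + \<bar>t\<bar> * 0)"
        by (intro tendsto_intros p(2) y(2))
      ultimately have "e k \<le> Ei.nrm ?pt + (0 + \<bar>t\<bar> * 0)"
        using tendsto_lowerbound[OF _ _ sequentially_bot] by blast
      then show "e k \<le> Ei.nrm (\<lambda>x. p x + t * w x)" by simp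
    qed
    then have "(Ei.nrm p)\<^sup>2 \<le> (Ei.nrm (\<lambda>x. p x + t * w x))\<^sup>2" for t
      using pa Ei.nrm_nonneg[OF p(1)] by (intro power_mono) (auto intro: order_trans)
    then have "E p p \<le> E p p + 2 * t * E p w + t\<^sup>2 * E w w" for t
      by (simp only: Ei.nrm_sq[OF p(1)] Ei.nrm_sq[OF Ei.add_scale[OF p(1) wW]] Ei.B_add_scale[OF p(1) wW])
    \<comment> \<open>A quadratic in \<open>t\<close> without constant term is nonnegative
      everywhere only if its linear coefficient vanishes.\<close>
    then have "0 + 2 * t * E p w + t\<^sup>2 * E w w \<ge> 0" for t by (simp add: algebra_simps)
    from discriminant_le[OF this] show ?thesis by simp
  qed
  show ?thesis by (rule that[OF pW0 rep orth qT pq qv])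
qed

lemma subharmonic_test:
  assumes sub: "mu_subharmonic G \<nu> \<mu> \<Omega> u" and v: "v \<in> T" "\<And>x. v x \<ge> 0"
  shows "E u v \<le> 0"
proof -
  define f where "f = (SOME f. krein_feller_graph G \<nu> \<mu> \<Omega> u f)"
  have "\<exists>f. krein_feller_graph G \<nu> \<mu> \<Omega> u f"
    using sub by (simp add: mu_subharmonic_def dom_krein_feller_def)
  from someI_ex[OF this] have "krein_feller_graph G \<nu> \<mu> \<Omega> u f" unfolding f_def .
  then have ud: "u \<in> dom_form G \<nu> \<mu> \<Omega>"
    and eq: "\<And>w. w \<in> dom_form G \<nu> \<mu> \<Omega> \<Longrightarrow> E u w = (LINT x:\<Omega>|\<mu>. f x * iota G \<nu> \<mu> \<Omega> w x)"
    by (auto simp: krein_feller_graph_def)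
  have f: "AE x in \<mu>. x \<in> \<Omega> \<longrightarrow> f x \<le> 0"
    using sub unfolding mu_subharmonic_def laplace_mu_def f_def[symmetric] by simp
  have uW: "u \<in> W" using ud W0_W by (simp add: dom_form_def)
  obtain p q where p: "p \<in> W0" "rep p v" "\<And>w. w \<in> ker_iota G \<nu> \<mu> \<Omega> \<Longrightarrow> E p w = 0"
    and q: "\<And>n. q n \<in> T" "(\<lambda>n. Wi.nrm (\<lambda>x. p x - q n x)) \<longlonglongrightarrow> 0" "(\<lambda>n. Mi.nrm (\<lambda>x. q n x - v x)) \<longlonglongrightarrow> 0"
    using test_projection[OF v(1)] by blast
  have pW: "p \<in> W" by (rule W0_W[OF p(1)])
  have vW: "v \<in> W" by (rule test_W[OF v(1)])
  have pd: "p \<in> dom_form G \<nu> \<mu> \<Omega>" using p by (simp add: dom_form_def)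
  let ?w = "\<lambda>x. v x - p x"
  have wW: "?w \<in> W" by (rule Wi.diff[OF vW pW])
  have sT: "(\<lambda>x. v x - q n x) \<in> T" for n using test_lin[OF v(1) q(1), of 1 "-1" n] by simp
  have l1: "(\<lambda>n. Wi.nrm (\<lambda>x. ?w x - (v x - q n x))) \<longlonglongrightarrow> 0"
    using q(2) Wi.nrm_sym[OF pW test_W[OF q(1)]] by simp
  have l2: "(\<lambda>n. Mi.nrm (\<lambda>x. (v x - q n x) - 0)) \<longlonglongrightarrow> 0"
    using q(3) Mi.nrm_sym[OF test_Mi[OF q(1)] test_Mi[OF v(1)]] by simp
  have wW0: "?w \<in> W0" by (rule W0_I[OF wW sT l1])
  \<comment> \<open>The test functions \<open>v - q n\<close> tend to \<open>v - p\<close> in W12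
    and to 0 in L2(\<mu>), so 0 is a representative of \<open>v - p\<close>; by uniqueness it is the
    one that \<open>iota\<close> selects, up to null sets.\<close>
  have "(\<lambda>x. 0) \<in> L2 \<mu> \<Omega>" by (simp add: L2_iff)
  then have "rep ?w (\<lambda>x. 0)" unfolding rep_iff
    by (intro conjI exI[of _ "\<lambda>n x. v x - q n x"] allI sT l1 l2)
  from rep_unique[OF wW iota_rep[OF wW0] this] have "?w \<in> ker_iota G \<nu> \<mu> \<Omega>"
    using wW0 by (simp add: ker_iota_def)
  then have "E u ?w = 0" using ud by (simp add: dom_form_def)
  then have "E u v = E u p" using Ei.B_diff_right[OF vW pW uW] by simp
  also have "\<dots> = (LINT x:\<Omega>|\<mu>. f x * iota G \<nu> \<mu> \<Omega> p x)" by (rule eq[OF pd])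
  also have "\<dots> \<le> 0"
  proof -
    have "0 \<le> (LINT x|\<mu>. - (indicator \<Omega> x *\<^sub>R (f x * iota G \<nu> \<mu> \<Omega> p x)))"
    proof (rule integral_nonneg_AE)
      show "AE x in \<mu>. 0 \<le> - (indicator \<Omega> x *\<^sub>R (f x * iota G \<nu> \<mu> \<Omega> p x))"
        using f rep_unique[OF pW iota_rep[OF p(1)] p(2)]
      proof eventually_elim
        case (elim x)
        then show ?case using v(2)[of x] by (cases "x \<in> \<Omega>") (auto simp: mult_nonpos_nonneg)
      qed
    qed
    then show ?thesis by (simp add: set_lebesgue_integral_def)
  qed
  finally show ?thesis .
qed

lemma subharmonic_W0: "mu_subharmonic G \<nu> \<mu> \<Omega> u \<Longrightarrow> u \<in> W0"
  by (auto simp: mu_subharmonic_def dom_krein_feller_def krein_feller_graph_def dom_form_def)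

end

section \<open>Curves, their length and the Riemannian distance\<close>

text \<open>Differentiability off the finite set is two-sided, and agreement on the closed interval
  says nothing about derivatives at its ends. Both endpoints are therefore added to the exceptional
  points.\<close>

lemma piecewise_C1_cong:
  fixes f g :: "real \<Rightarrow> 'b::real_normed_vector"
  assumes "f piecewise_C1_differentiable_on {a..b}" "\<And>x. x \<in> {a..b} \<Longrightarrow> f x = g x"
  shows "g piecewise_C1_differentiable_on {a..b}"
proof -
  obtain S D where S: "finite S" "continuous_on {a..b} f" "\<And>x. x \<in> {a..b} - S \<Longrightarrow> (f has_vector_derivative D x) (at x)"
    "continuous_on ({a..b} - S) D"
    using assms(1) unfolding piecewise_C1_differentiable_on_def C1_differentiable_on_def by blast
  have "(g has_vector_derivative D x) (at x)" if "x \<in> {a..b} - (S \<union> {a, b})" for x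
  proof (rule has_vector_derivative_transform_within_open)
    show "(f has_vector_derivative D x) (at x)" using that by (intro S(3)) blast
    show "x \<in> {a<..<b}" using that by auto
  qed (use assms(2) in auto)
  moreover have "continuous_on {a..b} g" using S(2) assms(2) by (rule continuous_on_eq)
  moreover have "continuous_on ({a..b} - (S \<union> {a, b})) D" by (rule continuous_on_subset[OF S(4)]) blast
  ultimately show ?thesis
    unfolding piecewise_C1_differentiable_on_def C1_differentiable_on_def
    using S(1) by (intro conjI exI[of _ "S \<union> {a, b}"] exI[of _ D]) auto
qed

lemma nn_integral_minus_finite:
  fixes f :: "real \<Rightarrow> ennreal"
  assumes "finite S"
  shows "(\<integral>\<^sup>+t\<in>A. f t \<partial>lborel) = (\<integral>\<^sup>+t\<in>A - S. f t \<partial>lborel)"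
proof (rule nn_integral_cong_AE)
  have "AE t in lborel. t \<notin> S"
    using finite_imp_null_set_lborel[OF assms] by (rule AE_not_in)
  then show "AE t in lborel. f t * indicator A t = f t * indicator (A - S) t"
    by eventually_elim (auto simp: indicator_def)
qed

context riemannian
begin

text \<open>\<open>piecewise_C1_curve\<close> on an arbitrary interval, so that curves can be cut,
  shifted and joined before they are rescaled to the unit interval; \<open>len\<close> is the
  corresponding form of \<open>curve_length\<close>.\<close>

definition pw :: "(real \<Rightarrow> 'a) \<Rightarrow> real \<Rightarrow> real \<Rightarrow> bool" where
  "pw \<gamma> a b \<longleftrightarrow> continuous_on {a..b} \<gamma> \<and>
     (\<forall>c\<in>atlas G. \<forall>a' b'. a \<le> a' \<and> a' < b' \<and> b' \<le> b \<and> \<gamma> ` {a'..b'} \<subseteq> fst c \<longrightarrow>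
        (snd c \<circ> \<gamma>) piecewise_C1_differentiable_on {a'..b'})"

definition len :: "(real \<Rightarrow> 'a) \<Rightarrow> real \<Rightarrow> real \<Rightarrow> ennreal" where
  "len \<gamma> a b = (\<integral>\<^sup>+t\<in>{a..b}. ennreal (speed G \<gamma> t) \<partial>lborel)"

abbreviation d where "d \<equiv> riemannian_dist G"

lemma pwD: "pw \<gamma> a b \<Longrightarrow> c \<in> atlas G \<Longrightarrow> a \<le> a' \<Longrightarrow> a' < b' \<Longrightarrow> b' \<le> b \<Longrightarrow> \<gamma> ` {a'..b'} \<subseteq> fst c \<Longrightarrow>
    (snd c \<circ> \<gamma>) piecewise_C1_differentiable_on {a'..b'}"
  unfolding pw_def by blast

lemma pw_continuous: "pw \<gamma> a b \<Longrightarrow> continuous_on {a..b} \<gamma>"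
  by (simp add: pw_def)

lemma pw_sub: "pw \<gamma> a b \<Longrightarrow> a \<le> a' \<Longrightarrow> b' \<le> b \<Longrightarrow> pw \<gamma> a' b'"
  unfolding pw_def
proof (intro conjI ballI allI impI)
  assume p: "continuous_on {a..b} \<gamma> \<and> (\<forall>c\<in>atlas G. \<forall>a' b'. a \<le> a' \<and> a' < b' \<and> b' \<le> b \<and> \<gamma> ` {a'..b'} \<subseteq> fst c \<longrightarrow>
        (snd c \<circ> \<gamma>) piecewise_C1_differentiable_on {a'..b'})" and ab: "a \<le> a'" "b' \<le> b"
  show "continuous_on {a'..b'} \<gamma>" using p ab by (auto intro: continuous_on_subset)
  fix c a'' b'' assume "c \<in> atlas G" "a' \<le> a'' \<and> a'' < b'' \<and> b'' \<le> b' \<and> \<gamma> ` {a''..b''} \<subseteq> fst c"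
  then show "(snd c \<circ> \<gamma>) piecewise_C1_differentiable_on {a''..b''}" using p ab by (meson order_trans)
qed

text \<open>At such times the speed may be computed in any chart around the point, although
  \<open>speed\<close> uses the chart chosen by \<open>chart_at\<close>, which can jump along the
  curve.\<close>

definition regular :: "(real \<Rightarrow> 'a) \<Rightarrow> real \<Rightarrow> bool" where
  "regular \<gamma> s \<longleftrightarrow> isCont \<gamma> s \<and> (\<forall>c\<in>atlas G. \<gamma> s \<in> fst c \<longrightarrow> (snd c \<circ> \<gamma>) differentiable (at s))"

lemma chart_change_curve:
  assumes c: "c \<in> atlas G" "c' \<in> atlas G" and s: "\<gamma> s \<in> fst c" "\<gamma> s \<in> fst c'" and cont: "isCont \<gamma> s"
    and v: "((snd c \<circ> \<gamma>) has_vector_derivative v) (at s)"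
  shows "((snd c' \<circ> \<gamma>) has_vector_derivative (jacobian c c' (\<gamma> s) *v v)) (at s)"
proof -
  have "((\<lambda>x. transition c c' ((snd c \<circ> \<gamma>) x)) has_derivative (\<lambda>x. jacobian c c' (\<gamma> s) *v (x *\<^sub>R v))) (at s)"
    using diff_chain_at[OF v[unfolded has_vector_derivative_def], of "transition c c'" "(*v) (jacobian c c' (\<gamma> s))"]
      transition_has_derivative[OF c s] by (simp add: o_def)
  then have 1: "((transition c c' \<circ> (snd c \<circ> \<gamma>)) has_vector_derivative (jacobian c c' (\<gamma> s) *v v)) (at s)"
    by (simp add: has_vector_derivative_def matrix_vector_mult_scaleR o_def)
  have "\<exists>U. open U \<and> s \<in> U \<and> (\<forall>t\<in>U. \<gamma> t \<in> fst c)"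
    using cont[unfolded continuous_at_open, rule_format, of "fst c"] open_dom[OF c(1)] s(1) by simp
  then obtain U where U: "open U" "s \<in> U" "\<forall>t\<in>U. \<gamma> t \<in> fst c" by (elim exE conjE)
  show ?thesis
    by (rule has_vector_derivative_transform_within_open[OF 1 U(1,2)]) (use U(3) c in \<open>simp add: transition_apply\<close>)
qed

lemma regularI:
  assumes c: "c \<in> atlas G" "\<gamma> s \<in> fst c" and cont: "isCont \<gamma> s" and dif: "(snd c \<circ> \<gamma>) differentiable (at s)"
  shows "regular \<gamma> s"
  unfolding regular_def
proof (intro conjI cont ballI impI)
  fix c' assume c': "c' \<in> atlas G" "\<gamma> s \<in> fst c'"
  have "((snd c \<circ> \<gamma>) has_vector_derivative vector_derivative (snd c \<circ> \<gamma>) (at s)) (at s)"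
    by (rule vector_derivative_works[THEN iffD1, OF dif])
  from chart_change_curve[OF c(1) c'(1) c(2) c'(2) cont this] show "(snd c' \<circ> \<gamma>) differentiable (at s)"
    by (rule differentiableI_vector)
qed

lemma speed_chart:
  assumes c: "c \<in> atlas G" "\<gamma> s \<in> fst c" and cont: "isCont \<gamma> s"
    and v: "((snd c \<circ> \<gamma>) has_vector_derivative v) (at s)"
  shows "speed G \<gamma> s = sqrt (v \<bullet> (metric G c (\<gamma> s) *v v))"
proof -
  let ?c = "chart_at G (\<gamma> s)" and ?J = "jacobian c (chart_at G (\<gamma> s)) (\<gamma> s)"
  note c0 = chart_at[of "\<gamma> s"]
  have vd: "vector_derivative (snd ?c \<circ> \<gamma>) (at s) = ?J *v v"
    by (rule vector_derivative_at[OF chart_change_curve[OF c(1) c0(1) c(2) c0(2) cont v]])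
  have "(?J *v v) \<bullet> (metric G ?c (\<gamma> s) *v (?J *v v)) = v \<bullet> ((transpose ?J ** metric G ?c (\<gamma> s) ** ?J) *v v)"
    by (metis inner_matrix_transpose matrix_vector_mul_assoc transpose_transpose)
  also have "transpose ?J ** metric G ?c (\<gamma> s) ** ?J = metric G c (\<gamma> s)"
    using metric_change[OF c(1) c0(1) c(2) c0(2)] by simp
  finally show ?thesis by (simp only: speed_def Let_def vd)
qed

text \<open>Continuity on two sets passes to their union when both are open. With the endpoints
  among the exceptional points, what is left of each interval is open.\<close>

lemma continuous_on_union_open:
  assumes "a \<le> b" "b \<le> c" "finite S" "finite S'" "a \<in> S" "b \<in> S" "b \<in> S'" "c \<in> S'"
    "continuous_on ({a..b} - S) f" "continuous_on ({b..c} - S') f"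
  shows "continuous_on ({a..c} - (S \<union> S')) (f :: real \<Rightarrow> real)"
proof -
  have o: "open ({x..y} - R)" if "finite R" "x \<in> R" "y \<in> R" for x y and R :: "real set"
  proof -
    have "t \<in> {x..y} - R \<longleftrightarrow> t \<in> {x<..<y} - R" for t
      using that(2,3) by (cases "t = x"; cases "t = y") auto
    then have "{x..y} - R = {x<..<y} - R" by (rule set_eqI)
    then show ?thesis using open_Diff[OF open_greaterThanLessThan finite_imp_closed[OF that(1)]] by simp
  qed
  have "continuous_on (({a..b} - S) \<union> ({b..c} - S')) f"
    using assms o by (intro continuous_on_open_Un) auto
  then show ?thesis by (rule continuous_on_subset) (use assms in auto)
qed

text \<open>Bisection in the form of \<open>Bolzano\<close>: on a short interval the curve stays in
  one chart, where the derivative and the metric are continuous off finitely many times, and the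
  property passes to the union of adjacent intervals.\<close>

lemma pw_regular:
  assumes pw: "pw \<gamma> a b" and ab: "a \<le> b"
  shows "\<exists>S. finite S \<and> a \<in> S \<and> b \<in> S \<and> (\<forall>s\<in>{a..b} - S. regular \<gamma> s) \<and> continuous_on ({a..b} - S) (speed G \<gamma>)"
proof -
  let ?P = "\<lambda>x y. a \<le> x \<and> x \<le> y \<and> y \<le> b \<longrightarrow>
    (\<exists>S. finite S \<and> x \<in> S \<and> y \<in> S \<and> (\<forall>s\<in>{x..y} - S. regular \<gamma> s) \<and> continuous_on ({x..y} - S) (speed G \<gamma>))"
  have "?P a b"
  proof (rule Bolzano[where P = ?P, OF ab])
    fix x y z assume xy: "?P x y" and yz: "?P y z" and le: "x \<le> y" "y \<le> z"
    show "?P x z"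
    proof
      assume *: "a \<le> x \<and> x \<le> z \<and> z \<le> b"
      obtain S where S: "finite S" "x \<in> S" "y \<in> S" "\<forall>s\<in>{x..y} - S. regular \<gamma> s" "continuous_on ({x..y} - S) (speed G \<gamma>)"
        using xy * le by auto
      obtain R where R: "finite R" "y \<in> R" "z \<in> R" "\<forall>s\<in>{y..z} - R. regular \<gamma> s" "continuous_on ({y..z} - R) (speed G \<gamma>)"
        using yz * le by auto
      have "continuous_on ({x..z} - (S \<union> R)) (speed G \<gamma>)"
        by (rule continuous_on_union_open[OF le S(1) R(1) S(2,3) R(2,3) S(5) R(5)])
      moreover have "\<forall>s\<in>{x..z} - (S \<union> R). regular \<gamma> s"
      proof
        fix s assume s: "s \<in> {x..z} - (S \<union> R)"
        show "regular \<gamma> s"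
        proof (cases "s \<le> y")
          case True then show ?thesis using s S(4) by auto
        next
          case False then show ?thesis using s R(4) by auto
        qed
      qed
      ultimately show "\<exists>S. finite S \<and> x \<in> S \<and> z \<in> S \<and> (\<forall>s\<in>{x..z} - S. regular \<gamma> s) \<and> continuous_on ({x..z} - S) (speed G \<gamma>)"
        using S(1,2) R(1,3) by (intro exI[of _ "S \<union> R"]) auto
    qed
  next
    fix t assume t: "a \<le> t" "t \<le> b"
    let ?c = "chart_at G (\<gamma> t)"
    note c = chart_at[of "\<gamma> t"]
    have "continuous (at t within {a..b}) \<gamma>"
      using pw_continuous[OF pw] t by (simp add: continuous_on_eq_continuous_within)
    then have "\<forall>\<^sub>F s in at t within {a..b}. \<gamma> s \<in> fst ?c"
      using topological_tendstoD[OF _ open_dom[OF c(1)] c(2)] by (simp add: continuous_within)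
    then obtain e where e: "e > 0" "\<And>s. s \<in> {a..b} \<Longrightarrow> s \<noteq> t \<Longrightarrow> dist s t < e \<Longrightarrow> \<gamma> s \<in> fst ?c"
      unfolding eventually_at by blast
    show "\<exists>\<delta>>0. \<forall>x y. x \<le> t \<and> t \<le> y \<and> y - x < \<delta> \<longrightarrow> ?P x y"
    proof (intro exI[of _ e] conjI e(1) allI impI)
      fix x y assume xy: "x \<le> t \<and> t \<le> y \<and> y - x < e" and ab': "a \<le> x \<and> x \<le> y \<and> y \<le> b"
      have sub: "\<gamma> ` {x..y} \<subseteq> fst ?c"
      proof
        fix p assume "p \<in> \<gamma> ` {x..y}"
        then obtain s where s: "s \<in> {x..y}" "p = \<gamma> s" by blast
        have "dist s t < e" using s xy by (auto simp: dist_real_def)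
        then show "p \<in> fst ?c" using e(2)[of s] c(2) s ab' by (cases "s = t") auto
      qed
      show "\<exists>S. finite S \<and> x \<in> S \<and> y \<in> S \<and> (\<forall>s\<in>{x..y} - S. regular \<gamma> s) \<and> continuous_on ({x..y} - S) (speed G \<gamma>)"
      proof (cases "x = y")
        case True
        then show ?thesis by (intro exI[of _ "{x}"]) auto
      next
        case False
        then have "x < y" using ab' by simp
        with pwD[OF pw c(1) _ _ _ sub] ab' have "(snd ?c \<circ> \<gamma>) piecewise_C1_differentiable_on {x..y}" by blast
        then obtain S D where S: "finite S" "\<And>s. s \<in> {x..y} - S \<Longrightarrow> ((snd ?c \<circ> \<gamma>) has_vector_derivative D s) (at s)"
          "continuous_on ({x..y} - S) D"
          unfolding piecewise_C1_differentiable_on_def C1_differentiable_on_def by blast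
        let ?S = "S \<union> {x, y}"
        have ic: "isCont \<gamma> s" if "s \<in> {x..y} - ?S" for s
        proof -
          have "s \<in> interior {a..b}" using that ab' by auto
          then show ?thesis using continuous_on_interior[OF pw_continuous[OF pw]] by blast
        qed
        have reg: "regular \<gamma> s" if "s \<in> {x..y} - ?S" for s
        proof (rule regularI[OF c(1) _ ic[OF that]])
          show "\<gamma> s \<in> fst ?c" using sub that by blast
          show "(snd ?c \<circ> \<gamma>) differentiable at s" using S(2)[of s] that by (blast intro: differentiableI_vector)
        qed
        have "continuous_on ({x..y} - ?S) (\<lambda>s. sqrt (D s \<bullet> (metric G ?c (\<gamma> s) *v D s)))"
        proof -
          have "continuous_on ({x..y} - ?S) D" by (rule continuous_on_subset[OF S(3)]) blast
          moreover have "continuous_on ({x..y} - ?S) (\<lambda>s. metric G ?c (\<gamma> s))"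
          proof (rule continuous_on_compose2[OF continuous_metric[OF c(1)]])
            show "continuous_on ({x..y} - ?S) \<gamma>" by (rule continuous_on_subset[OF pw_continuous[OF pw]]) (use ab' in auto)
            show "\<gamma> ` ({x..y} - ?S) \<subseteq> fst ?c" using sub by blast
          qed
          ultimately show ?thesis
            by (intro continuous_intros bounded_bilinear.continuous_on[OF bounded_bilinear_matrix_vector])
        qed
        then have "continuous_on ({x..y} - ?S) (speed G \<gamma>)"
        proof (rule continuous_on_eq)
          fix s assume s: "s \<in> {x..y} - ?S"
          have "speed G \<gamma> s = sqrt (D s \<bullet> (metric G ?c (\<gamma> s) *v D s))"
            by (rule speed_chart[OF c(1) _ ic[OF s] S(2)]) (use s sub in blast)+
          then show "sqrt (D s \<bullet> (metric G ?c (\<gamma> s) *v D s)) = speed G \<gamma> s" by simp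
        qed
        then show ?thesis using S(1) reg by (intro exI[of _ ?S]) auto
      qed
    qed
  qed
  then show ?thesis using ab by simp
qed

lemma speed_measurable:
  assumes "pw \<gamma> a b" "a \<le> b"
  obtains S where "finite S" "a \<in> S" "b \<in> S" "\<And>s. s \<in> {a..b} - S \<Longrightarrow> regular \<gamma> s"
    "(\<lambda>t. indicator ({a..b} - S) t * speed G \<gamma> t) \<in> borel_measurable borel"
proof -
  obtain S where S: "finite S" "a \<in> S" "b \<in> S" "\<forall>s\<in>{a..b} - S. regular \<gamma> s" "continuous_on ({a..b} - S) (speed G \<gamma>)"
    using pw_regular[OF assms] by blast
  have "{a..b} - S \<in> sets borel"
    by (rule sets.Diff[OF _ borel_closed[OF finite_imp_closed[OF S(1)]]]) simp
  from borel_measurable_continuous_on_indicator[OF this S(5)] that S show ?thesis by simp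
qed

lemma len_split:
  assumes "pw \<gamma> a b" "a \<le> c" "c \<le> b"
  shows "len \<gamma> a b = len \<gamma> a c + len \<gamma> c b"
proof -
  obtain S where S: "finite S" "(\<lambda>t. indicator ({a..b} - S) t * speed G \<gamma> t) \<in> borel_measurable borel"
    using speed_measurable[OF assms(1)] assms by (metis order_trans)
  let ?S = "S \<union> {c}"
  let ?f = "\<lambda>t. ennreal (indicator ({a..b} - S) t * speed G \<gamma> t)"
  have m: "?f \<in> borel_measurable lborel" using S(2) by (simp add: measurable_compose[OF _ measurable_ennreal])
  have fS: "finite ?S" using S(1) by simp
  have R: "{x..y} - ?S \<in> sets lborel" for x y
    unfolding sets_lborel by (rule sets.Diff[OF _ borel_closed[OF finite_imp_closed[OF fS]]]) simp
  have f: "len \<gamma> x y = (\<integral>\<^sup>+t. ?f t * indicator ({x..y} - ?S) t \<partial>lborel)" if "a \<le> x" "y \<le> b" for x y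
  proof -
    have "len \<gamma> x y = (\<integral>\<^sup>+t\<in>{x..y} - ?S. ennreal (speed G \<gamma> t) \<partial>lborel)"
      unfolding len_def by (rule nn_integral_minus_finite) (use S(1) in simp)
    also have "\<dots> = (\<integral>\<^sup>+t. ?f t * indicator ({x..y} - ?S) t \<partial>lborel)"
      using that by (intro nn_integral_cong) (auto simp: indicator_def)
    finally show ?thesis .
  qed
  have "(\<integral>\<^sup>+t. ?f t * indicator ({a..b} - ?S) t \<partial>lborel) =
      (\<integral>\<^sup>+t. ?f t * indicator ({a..c} - ?S) t + ?f t * indicator ({c..b} - ?S) t \<partial>lborel)"
    using assms(2,3) by (intro nn_integral_cong) (auto simp: indicator_def)
  also have "\<dots> = (\<integral>\<^sup>+t. ?f t * indicator ({a..c} - ?S) t \<partial>lborel) + (\<integral>\<^sup>+t. ?f t * indicator ({c..b} - ?S) t \<partial>lborel)"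
    using R by (intro nn_integral_add borel_measurable_times_ennreal m borel_measurable_indicator) auto
  finally show ?thesis using f[of a b] f[of a c] f[of c b] assms(2,3) by simp
qed

lemma speed_cong:
  assumes U: "open U" "t \<in> U" "\<And>s. s \<in> U \<Longrightarrow> \<gamma> s = \<gamma>' s"
  shows "speed G \<gamma> t = speed G \<gamma>' t"
proof -
  have "\<gamma> t = \<gamma>' t" using U by blast
  moreover have "vector_derivative (snd c \<circ> \<gamma>) (at t) = vector_derivative (snd c \<circ> \<gamma>') (at t)" for c :: "('a, 'n) chart"
  proof (rule vector_derivative_cong_eq)
    show "\<forall>\<^sub>F x in nhds t. x \<in> UNIV \<longrightarrow> (snd c \<circ> \<gamma>) x = (snd c \<circ> \<gamma>') x"
      unfolding eventually_nhds using U by auto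
  qed auto
  ultimately show ?thesis by (simp add: speed_def)
qed

lemma len_cong:
  assumes "\<And>t. t \<in> {a..b} \<Longrightarrow> \<gamma> t = \<gamma>' t"
  shows "len \<gamma> a b = len \<gamma>' a b"
proof -
  have "speed G \<gamma> t = speed G \<gamma>' t" if "t \<in> {a..b} - {a, b}" for t
    by (rule speed_cong[of "{a<..<b}"]) (use that assms in auto)
  then have "(\<integral>\<^sup>+t\<in>{a..b} - {a, b}. ennreal (speed G \<gamma> t) \<partial>lborel) = (\<integral>\<^sup>+t\<in>{a..b} - {a, b}. ennreal (speed G \<gamma>' t) \<partial>lborel)"
    by (intro nn_integral_cong) (auto simp: indicator_def)
  then show ?thesis unfolding len_def
    using nn_integral_minus_finite[where S = "{a, b}" and A = "{a..b}"] by simp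
qed

lemma pw_join:
  assumes 1: "pw \<gamma> a b" and 2: "pw \<gamma>' b c" and eq: "\<gamma> b = \<gamma>' b" and le: "a \<le> b" "b \<le> c"
  shows "pw (\<lambda>t. if t \<le> b then \<gamma> t else \<gamma>' t) a c"
  unfolding pw_def
proof (intro conjI ballI allI impI)
  let ?g = "\<lambda>t. if t \<le> b then \<gamma> t else \<gamma>' t"
  have "continuous_on ({a..b} \<union> {b..c}) ?g"
    by (rule continuous_on_cases) (use pw_continuous[OF 1] pw_continuous[OF 2] eq in auto)
  moreover have "{a..b} \<union> {b..c} = {a..c}" using le by auto
  ultimately show "continuous_on {a..c} ?g" by simp
  fix k a' b' assume k: "k \<in> atlas G" and *: "a \<le> a' \<and> a' < b' \<and> b' \<le> c \<and> ?g ` {a'..b'} \<subseteq> fst k"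
  consider "b' \<le> b" | "b \<le> a'" | "a' < b" "b < b'" by linarith
  then show "(snd k \<circ> ?g) piecewise_C1_differentiable_on {a'..b'}"
  proof cases
    case 1
    have "\<gamma> ` {a'..b'} = ?g ` {a'..b'}" using 1 by (intro image_cong) auto
    then have "(snd k \<circ> \<gamma>) piecewise_C1_differentiable_on {a'..b'}"
      using * 1 by (intro pwD[OF assms(1) k]) auto
    then show ?thesis by (rule piecewise_C1_cong) (use 1 in auto)
  next
    case 2
    have e: "\<gamma>' t = ?g t" if "t \<in> {a'..b'}" for t using that 2 eq by (cases "t = b") auto
    then have "\<gamma>' ` {a'..b'} = ?g ` {a'..b'}" by (rule image_cong[OF refl])
    then have "(snd k \<circ> \<gamma>') piecewise_C1_differentiable_on {a'..b'}"
      using * 2 by (intro pwD[OF assms(2) k]) auto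
    then show ?thesis by (rule piecewise_C1_cong) (use e in auto)
  next
    case 3
    have i1: "\<gamma> ` {a'..b} \<subseteq> fst k"
    proof
      fix p assume "p \<in> \<gamma> ` {a'..b}"
      then obtain t where "t \<in> {a'..b}" "p = ?g t" by auto
      then show "p \<in> fst k" using * 3 by (auto simp del: if_split simp: image_subset_iff)
    qed
    have i2: "\<gamma>' ` {b..b'} \<subseteq> fst k"
    proof
      fix p assume "p \<in> \<gamma>' ` {b..b'}"
      then obtain t where t: "t \<in> {b..b'}" "p = \<gamma>' t" by auto
      then have "p = ?g t" using eq by (cases "t = b") auto
      moreover have "t \<in> {a'..b'}" using t 3 by auto
      ultimately show "p \<in> fst k" using * by (auto simp del: if_split simp: image_subset_iff)
    qed
    have "(snd k \<circ> \<gamma>) piecewise_C1_differentiable_on {a'..b}" "(snd k \<circ> \<gamma>') piecewise_C1_differentiable_on {b..b'}"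
      using * 3 by (intro pwD[OF assms(1) k _ _ _ i1] pwD[OF assms(2) k _ _ _ i2]; simp)+
    then have "(\<lambda>x. if x \<le> b then (snd k \<circ> \<gamma>) x else (snd k \<circ> \<gamma>') x) piecewise_C1_differentiable_on {a'..b'}"
      by (rule piecewise_C1_differentiable_cases) (use 3 eq in auto)
    moreover have "(\<lambda>x. if x \<le> b then (snd k \<circ> \<gamma>) x else (snd k \<circ> \<gamma>') x) = snd k \<circ> ?g" by (simp add: fun_eq_iff)
    ultimately show ?thesis by simp
  qed
qed

text \<open>The slope may be negative, so that reversal of a curve is included. Symmetry of the
  distance, the shift in the triangle inequality and the rescaling of a subarc are three
  instances.\<close>

lemma affine_curve:
  fixes m k :: real
  assumes pw: "pw \<gamma> a b" and m: "m \<noteq> 0" and ab: "a \<le> b" "a' \<le> b'" and im: "(\<lambda>t. m * t + k) ` {a'..b'} = {a..b}"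
  shows "pw (\<lambda>t. \<gamma> (m * t + k)) a' b'" "len (\<lambda>t. \<gamma> (m * t + k)) a' b' = len \<gamma> a b"
proof -
  let ?h = "\<lambda>t. m * t + k" and ?g = "\<lambda>t. \<gamma> (m * t + k)"
  show "pw ?g a' b'"
    unfolding pw_def
  proof (intro conjI ballI allI impI)
    show "continuous_on {a'..b'} ?g"
      by (rule continuous_on_compose2[OF pw_continuous[OF pw]]) (use im in \<open>auto intro!: continuous_intros\<close>)
    fix c x y assume c: "c \<in> atlas G" and xy: "a' \<le> x \<and> x < y \<and> y \<le> b' \<and> ?g ` {x..y} \<subseteq> fst c"
    obtain x' y' where x'y': "?h ` {x..y} = {x'..y'}" "x' < y'"
    proof (cases "m > 0")
      case True
      then show ?thesis using that[of "m * x + k" "m * y + k"] xy by (simp add: image_affinity_atLeastAtMost)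
    next
      case False
      then show ?thesis using that[of "m * y + k" "m * x + k"] xy m by (simp add: image_affinity_atLeastAtMost)
    qed
    have sub: "{x'..y'} \<subseteq> {a..b}" unfolding x'y'(1)[symmetric] im[symmetric] using xy by (intro image_mono) auto
    have "\<gamma> ` {x'..y'} \<subseteq> fst c" unfolding x'y'(1)[symmetric] using xy by (simp add: image_image)
    moreover have "a \<le> x'" "y' \<le> b" using sub x'y'(2) by auto
    ultimately have "(snd c \<circ> \<gamma>) piecewise_C1_differentiable_on {x'..y'}" using x'y'(2) by (intro pwD[OF pw c])
    then have "((snd c \<circ> \<gamma>) \<circ> (\<lambda>x. m *\<^sub>R x + k)) piecewise_C1_differentiable_on {x..y}"
      by (intro piecewise_C1_differentiable_affine) (simp add: x'y'(1))
    then show "(snd c \<circ> ?g) piecewise_C1_differentiable_on {x..y}" by (simp add: o_def)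
  qed
  obtain S where S: "finite S" "\<And>s. s \<in> {a..b} - S \<Longrightarrow> regular \<gamma> s"
      "(\<lambda>t. indicator ({a..b} - S) t * speed G \<gamma> t) \<in> borel_measurable borel"
    using speed_measurable[OF pw ab(1)] by metis
  let ?R = "?h -` S"
  have R: "finite ?R"
  proof (rule finite_vimageI[OF S(1)])
    show "inj ?h" using m by (auto simp: inj_on_def)
  qed
  have sp: "speed G ?g t = \<bar>m\<bar> * speed G \<gamma> (?h t)" if t: "t \<in> {a'..b'} - ?R" for t
  proof -
    let ?c = "chart_at G (\<gamma> (?h t))"
    note c = chart_at[of "\<gamma> (?h t)"]
    have "?h t \<in> {a..b} - S" using t im by blast
    then have reg: "regular \<gamma> (?h t)" by (rule S(2))
    define v where "v = vector_derivative (snd ?c \<circ> \<gamma>) (at (?h t))"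
    have v: "((snd ?c \<circ> \<gamma>) has_vector_derivative v) (at (?h t))"
      using reg c unfolding regular_def v_def vector_derivative_works by blast
    have cont: "isCont \<gamma> (?h t)" using reg by (simp add: regular_def)
    have h: "(?h has_vector_derivative m) (at t)" by (auto intro!: derivative_eq_intros)
    have "((snd ?c \<circ> \<gamma>) \<circ> ?h has_vector_derivative m *\<^sub>R v) (at t)"
      by (rule vector_diff_chain_at[OF h v])
    then have v': "((snd ?c \<circ> ?g) has_vector_derivative m *\<^sub>R v) (at t)" by (simp add: o_def)
    have cont': "isCont ?g t"
    proof (rule isCont_o2[where f = ?h and g = \<gamma>, OF _ cont])
      show "isCont ?h t" by (intro continuous_intros)
    qed
    have "speed G ?g t = sqrt ((m *\<^sub>R v) \<bullet> (metric G ?c (?g t) *v (m *\<^sub>R v)))"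
      by (rule speed_chart[where \<gamma> = ?g, OF c cont' v'])
    also have "\<dots> = sqrt (m\<^sup>2 * (v \<bullet> (metric G ?c (?g t) *v v)))"
      by (simp add: matrix_vector_mult_scaleR power2_eq_square mult.assoc)
    also have "\<dots> = \<bar>m\<bar> * sqrt (v \<bullet> (metric G ?c (?g t) *v v))" by (simp add: real_sqrt_mult)
    also have "sqrt (v \<bullet> (metric G ?c (?g t) *v v)) = speed G \<gamma> (?h t)"
      by (rule speed_chart[OF c cont v, symmetric])
    finally show ?thesis .
  qed
  let ?f = "\<lambda>t. ennreal (indicator ({a..b} - S) t * speed G \<gamma> t)"
  have m1: "?f \<in> borel_measurable borel" using S(3) by (simp add: measurable_compose[OF _ measurable_ennreal])
  have "len \<gamma> a b = (\<integral>\<^sup>+t\<in>{a..b} - S. ennreal (speed G \<gamma> t) \<partial>lborel)"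
    unfolding len_def by (rule nn_integral_minus_finite[OF S(1)])
  also have "\<dots> = (\<integral>\<^sup>+t. ?f t \<partial>lborel)" by (intro nn_integral_cong) (auto simp: indicator_def)
  also have "\<dots> = \<bar>m\<bar> * (\<integral>\<^sup>+t. ?f (k + m * t) \<partial>lborel)" by (rule nn_integral_real_affine[OF m1 m])
  also have "\<dots> = (\<integral>\<^sup>+t. \<bar>m\<bar> * ?f (k + m * t) \<partial>lborel)"
    using m1 by (intro nn_integral_cmult[symmetric]) auto
  also have "\<dots> = (\<integral>\<^sup>+t\<in>{a'..b'} - ?R. ennreal (speed G ?g t) \<partial>lborel)"
  proof (rule nn_integral_cong)
    fix t
    have mem: "m * t + k \<in> {a..b} \<longleftrightarrow> t \<in> {a'..b'}"
    proof
      assume "m * t + k \<in> {a..b}"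
      then obtain s where "s \<in> {a'..b'}" "m * t + k = m * s + k" unfolding im[symmetric] by blast
      then show "t \<in> {a'..b'}" using m by simp
    qed (use im in blast)
    show "\<bar>m\<bar> * ?f (k + m * t) = ennreal (speed G ?g t) * indicator ({a'..b'} - ?R) t"
    proof (cases "t \<in> {a'..b'} - ?R")
      case True
      then have "k + m * t \<in> {a..b} - S" using mem by (simp add: add.commute)
      then show ?thesis using sp[OF True] True by (simp add: ennreal_mult'' add.commute ennreal_mult')
    next
      case False
      then have "k + m * t \<notin> {a..b} - S" using mem by (auto simp: add.commute)
      then show ?thesis using False by simp
    qed
  qed
  also have "\<dots> = len ?g a' b'" unfolding len_def by (rule nn_integral_minus_finite[OF R, symmetric])
  finally show "len ?g a' b' = len \<gamma> a b" by simp
qed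

lemma dist_lessE:
  assumes "d x y < r"
  obtains \<gamma> where "pw \<gamma> 0 1" "\<gamma> 0 = x" "\<gamma> 1 = y" "len \<gamma> 0 1 < r"
  using assms unfolding riemannian_dist_def INF_less_iff piecewise_C1_curve_def curve_length_def
  by (auto simp: pw_def len_def)

lemma dist_le_len:
  assumes pw: "pw \<gamma> a b" and ab: "a < b"
  shows "d (\<gamma> a) (\<gamma> b) \<le> len \<gamma> a b"
proof -
  have im: "(\<lambda>t. (b - a) * t + a) ` {0..1} = {a..b}" using ab by (simp add: image_affinity_atLeastAtMost)
  let ?g = "\<lambda>t. \<gamma> ((b - a) * t + a)"
  have ne: "b - a \<noteq> 0" using ab by simp
  have g: "pw ?g 0 1" "len ?g 0 1 = len \<gamma> a b"
    using affine_curve[OF pw ne _ _ im] ab by auto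
  have "piecewise_C1_curve G ?g" using g(1) by (simp add: pw_def piecewise_C1_curve_def)
  then have "d (\<gamma> a) (\<gamma> b) \<le> curve_length G ?g"
    unfolding riemannian_dist_def by (intro INF_lower) auto
  then show ?thesis using g(2) by (simp add: curve_length_def len_def)
qed

text \<open>The distance is an infimum that need not be attained. Strict upper bounds are witnessed
  by actual curves, so this section works with those.\<close>

lemma dist_triangle_less:
  assumes "d x y < r" "d y z < s" shows "d x z < r + s"
proof -
  obtain \<gamma> where g: "pw \<gamma> 0 1" "\<gamma> 0 = x" "\<gamma> 1 = y" "len \<gamma> 0 1 < r" using dist_lessE[OF assms(1)] by blast
  obtain \<gamma>' where g': "pw \<gamma>' 0 1" "\<gamma>' 0 = y" "\<gamma>' 1 = z" "len \<gamma>' 0 1 < s" using dist_lessE[OF assms(2)] by blast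
  have im: "(\<lambda>t::real. 1 * t + - 1) ` {1..2} = {0..1}" by (subst image_affinity_atLeastAtMost) auto
  let ?g' = "\<lambda>t. \<gamma>' (1 * t + - 1)" and ?j = "\<lambda>t. if t \<le> 1 then \<gamma> t else \<gamma>' (1 * t + - 1)"
  have h: "pw ?g' 1 2" "len ?g' 1 2 = len \<gamma>' 0 1" using affine_curve[OF g'(1) _ _ _ im] by auto
  have j: "pw ?j 0 2" by (rule pw_join[OF g(1) h(1)]) (use g g' in auto)
  have "d x z \<le> len ?j 0 2" using dist_le_len[OF j] g g' by simp
  also have "\<dots> = len ?j 0 1 + len ?j 1 2" by (rule len_split[OF j]) auto
  also have "len ?j 0 1 = len \<gamma> 0 1" by (rule len_cong) auto
  also have "len ?j 1 2 = len ?g' 1 2" by (rule len_cong) (use g g' in auto)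
  also have "len \<gamma> 0 1 + len ?g' 1 2 < r + s" unfolding h(2) using g(4) g'(4) by (rule add_strict_mono)
  finally show ?thesis .
qed

lemma dist_sym_less:
  assumes "d x y < r" shows "d y x < r"
proof -
  obtain \<gamma> where g: "pw \<gamma> 0 1" "\<gamma> 0 = x" "\<gamma> 1 = y" "len \<gamma> 0 1 < r" using dist_lessE[OF assms] by blast
  have im: "(\<lambda>t::real. (-1) * t + 1) ` {0..1} = {0..1}" by (subst image_affinity_atLeastAtMost) auto
  have h: "pw (\<lambda>t. \<gamma> ((-1) * t + 1)) 0 1" "len (\<lambda>t. \<gamma> ((-1) * t + 1)) 0 1 = len \<gamma> 0 1"
    using affine_curve[OF g(1) _ _ _ im] by auto
  have "d y x \<le> len (\<lambda>t. \<gamma> ((-1) * t + 1)) 0 1" using dist_le_len[OF h(1)] g by simp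
  then show ?thesis using h(2) g(4) by simp
qed

end

section \<open>Riemannian against Euclidean distance in a chart\<close>

context riemannian
begin

text \<open>The quadratic form of the metric attains its extrema on the compact product of
  \<open>K\<close> with the unit sphere, and both are positive. \<open>C\<close> is made large
  enough to serve in both directions.\<close>

lemma uniform_norm_bound:
  assumes c: "c \<in> atlas G" and K: "compact K" "K \<subseteq> img c"
  shows "\<exists>C>0. \<forall>y\<in>K. \<forall>v. norm v \<le> C * sqrt (v \<bullet> (metric G c (chart_inv c y) *v v)) \<and>
    sqrt (v \<bullet> (metric G c (chart_inv c y) *v v)) \<le> C * norm v"
proof (cases "K = {}")
  case True
  then show ?thesis by (intro exI[of _ 1]) simp
next
  case False
  define q where "q z = snd z \<bullet> (metric G c (chart_inv c (fst z)) *v snd z)" for z :: "(real^'n) \<times> (real^'n)"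
  let ?S = "K \<times> sphere (0 :: real^'n) 1"
  have comp: "compact ?S" by (intro compact_Times K compact_sphere)
  obtain e where e: "norm (e::real^'n) = 1" using vector_choose_size[of 1] by auto
  then have "e \<in> sphere 0 1" by simp
  then have ne: "?S \<noteq> {}" using False by blast
  have cont: "continuous_on ?S q"
    unfolding q_def
  proof (intro continuous_on_inner bounded_bilinear.continuous_on[OF bounded_bilinear_matrix_vector] continuous_on_snd continuous_on_id)
    show "continuous_on ?S (\<lambda>z. metric G c (chart_inv c (fst z)))"
      by (rule continuous_on_compose2[OF continuous_metric_chart[OF c] continuous_on_fst[OF continuous_on_id]]) (use K(2) in auto)
  qed
  obtain z0 where z0: "z0 \<in> ?S" "\<And>z. z \<in> ?S \<Longrightarrow> q z0 \<le> q z"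
    using continuous_attains_inf[OF comp ne cont] by blast
  obtain z1 where z1: "z1 \<in> ?S" "\<And>z. z \<in> ?S \<Longrightarrow> q z \<le> q z1"
    using continuous_attains_sup[OF comp ne cont] by blast
  have pos: "q z > 0" if "z \<in> ?S" for z
  proof -
    have "fst z \<in> img c" "norm (snd z) = 1" using that K(2) by auto
    then show ?thesis unfolding q_def by (intro metric_pos[OF c chart_inv_dom]) auto
  qed
  define C where "C = 1 / sqrt (q z0) + sqrt (q z1)"
  have p0: "sqrt (q z0) > 0" "sqrt (q z1) > 0" using pos[OF z0(1)] pos[OF z1(1)] by auto
  have C0: "C > 0" using p0 by (simp add: C_def add_pos_pos)
  have "norm v \<le> C * sqrt (v \<bullet> (metric G c (chart_inv c y) *v v)) \<and>
      sqrt (v \<bullet> (metric G c (chart_inv c y) *v v)) \<le> C * norm v" if y: "y \<in> K" for y v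
  proof (cases "v = 0")
    case False
    define u where "u = (1 / norm v) *\<^sub>R v"
    have u: "(y, u) \<in> ?S" using False y by (simp add: u_def)
    have v: "v = norm v *\<^sub>R u" using False by (simp add: u_def)
    have "v \<bullet> (metric G c (chart_inv c y) *v v) = (norm v)\<^sup>2 * q (y, u)"
      by (subst (1 2) v) (simp add: q_def matrix_vector_mult_scaleR power2_eq_square)
    then have sq: "sqrt (v \<bullet> (metric G c (chart_inv c y) *v v)) = norm v * sqrt (q (y, u))" by (simp add: real_sqrt_mult)
    have lo: "sqrt (q z0) \<le> sqrt (q (y, u))" and hi: "sqrt (q (y, u)) \<le> sqrt (q z1)"
      using z0(2)[OF u] z1(2)[OF u] by auto
    have "norm v = (1 / sqrt (q z0)) * (norm v * sqrt (q z0))" using p0 by simp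
    also have "\<dots> \<le> C * (norm v * sqrt (q (y, u)))"
      using lo p0 C0 by (intro mult_mono mult_left_mono) (auto simp: C_def)
    finally have 1: "norm v \<le> C * (norm v * sqrt (q (y, u)))" .
    have "sqrt (q (y, u)) \<le> C" using hi p0 by (simp add: C_def add_increasing)
    then have "norm v * sqrt (q (y, u)) \<le> C * norm v" using mult_left_mono[of "sqrt (q (y, u))" C "norm v"] by (simp add: mult.commute)
    with 1 show ?thesis unfolding sq by blast
  qed simp
  then show ?thesis using C0 by blast
qed

text \<open>The displacement in coordinates is the integral of the coordinate velocity, whose norm
  is at most \<open>C\<close> times the speed.\<close>

lemma curve_lower_bound:
  assumes c: "c \<in> atlas G" and pw: "pw \<gamma> a b" and ab: "a < b" and sub: "\<gamma> ` {a..b} \<subseteq> fst c" and C: "C > 0"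
    and bd: "\<And>t v. t \<in> {a..b} \<Longrightarrow> norm v \<le> C * sqrt (v \<bullet> (metric G c (\<gamma> t) *v v))"
    and len: "len \<gamma> a b < ennreal r" and r: "r > 0"
  shows "norm (snd c (\<gamma> b) - snd c (\<gamma> a)) \<le> C * r"
proof -
  let ?f = "snd c \<circ> \<gamma>"
  have pc: "?f piecewise_C1_differentiable_on {a..b}" by (rule pwD[OF pw c _ ab _ sub]) auto
  then obtain S0 D where S0: "finite S0" "continuous_on {a..b} ?f" "\<And>s. s \<in> {a..b} - S0 \<Longrightarrow> (?f has_vector_derivative D s) (at s)"
    "continuous_on ({a..b} - S0) D"
    unfolding piecewise_C1_differentiable_on_def C1_differentiable_on_def by blast
  define S where "S = S0 \<union> {a, b}"
  have S: "finite S" using S0(1) by (simp add: S_def)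
  have der: "(?f has_vector_derivative D s) (at s)" if "s \<in> {a..b} - S" for s
    using S0(3)[of s] that by (simp add: S_def)
  have le: "norm (D s) \<le> C * speed G \<gamma> s" if s: "s \<in> {a..b} - S" for s
  proof -
    have "s \<in> interior {a..b}" using s by (auto simp: S_def)
    then have ic: "isCont \<gamma> s" using continuous_on_interior[OF pw_continuous[OF pw]] by blast
    have "\<gamma> s \<in> fst c" using s sub by blast
    from speed_chart[OF c this ic der[OF s]] bd[of s "D s"] s show ?thesis by simp
  qed
  \<comment> \<open>The velocity set to zero at the exceptional times and off the interval: Borel
    measurable on the whole line, so that the Lebesgue integral can be compared with the one in the
    fundamental theorem of calculus.\<close>
  define D' where "D' s = indicator ({a..b} - S) s *\<^sub>R D s" for s
  have "{a..b} - S \<in> sets borel" by (rule sets.Diff[OF _ borel_closed[OF finite_imp_closed[OF S]]]) simp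
  moreover have "continuous_on ({a..b} - S) D" by (rule continuous_on_subset[OF S0(4)]) (auto simp: S_def)
  ultimately have m: "D' \<in> borel_measurable borel"
    unfolding D'_def by (rule borel_measurable_continuous_on_indicator)
  have nn: "(\<integral>\<^sup>+s. ennreal (norm (D' s) / C) \<partial>lborel) \<le> len \<gamma> a b"
    unfolding len_def
  proof (rule nn_integral_mono)
    fix s
    show "ennreal (norm (D' s) / C) \<le> ennreal (speed G \<gamma> s) * indicator {a..b} s"
    proof (cases "s \<in> {a..b} - S")
      case True
      then have "norm (D' s) / C \<le> speed G \<gamma> s" using le[OF True] C by (simp add: D'_def field_simps)
      then show ?thesis using True by (simp add: ennreal_leI)
    next
      case False
      then show ?thesis by (simp add: D'_def)
    qed
  qed
  have m': "(\<lambda>s. norm (D' s) / C) \<in> borel_measurable lborel" using m by simp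
  have fin: "(\<integral>\<^sup>+s. ennreal (norm (D' s) / C) \<partial>lborel) < ennreal r" using nn len by (rule le_less_trans)
  have i1: "integrable lborel (\<lambda>s. norm (D' s) / C)"
  proof (rule integrableI_nonneg[OF m'])
    show "(\<integral>\<^sup>+s. ennreal (norm (D' s) / C) \<partial>lborel) < \<infinity>" using fin by (simp add: less_trans[OF _ ennreal_less_top])
  qed (use C in auto)
  have "ennreal (LINT s|lborel. norm (D' s) / C) < ennreal r"
    using fin by (subst nn_integral_eq_integral[OF i1, symmetric]) (use C in auto)
  then have I: "(LINT s|lborel. norm (D' s) / C) < r" using r by (simp add: ennreal_less_iff integral_nonneg_AE C less_imp_le)
  have i2: "integrable lborel D'"
  proof -
    have "integrable lborel (\<lambda>s. C * (norm (D' s) / C))" using i1 by (rule integrable_mult_right)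
    then have "integrable lborel (\<lambda>s. norm (D' s))" using C by simp
    then show ?thesis using m by (simp add: integrable_norm_iff)
  qed
  have eqD: "indicator {a..b} s *\<^sub>R D' s = D' s" for s by (simp add: D'_def indicator_def)
  have si: "set_integrable lborel {a..b} D'" unfolding set_integrable_def eqD by (rule i2)
  have LI: "(LINT s:{a..b}|lborel. D' s) = (LINT s|lborel. D' s)" unfolding set_lebesgue_integral_def eqD ..
  have "(D' has_integral integral {a..b} D') {a..b}"
    using set_borel_integral_eq_integral(1)[OF si] by (rule integrable_integral)
  then have h1: "(D' has_integral (LINT s|lborel. D' s)) {a..b}"
    unfolding set_borel_integral_eq_integral(2)[OF si, symmetric] LI .
  have "(D has_integral (?f b - ?f a)) {a..b}"
  proof (rule fundamental_theorem_of_calculus_interior_strong[OF S])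
    show "a \<le> b" using ab by simp
    show "(?f has_vector_derivative D x) (at x)" if "x \<in> {a<..<b} - S" for x by (rule der) (use that in auto)
    show "continuous_on {a..b} ?f" by (rule S0(2))
  qed
  then have h2: "(D' has_integral (?f b - ?f a)) {a..b}"
    by (rule has_integral_spike_finite[OF S, rotated]) (simp add: D'_def)
  have "?f b - ?f a = (LINT s|lborel. D' s)" by (rule has_integral_unique[OF h2 h1])
  then have "norm (?f b - ?f a) \<le> (LINT s|lborel. norm (D' s))" using integral_norm_bound[of lborel D'] by simp
  also have "\<dots> = (LINT s|lborel. C * (norm (D' s) / C))" using C by simp
  also have "\<dots> = C * (LINT s|lborel. norm (D' s) / C)" by (rule integral_mult_right_zero)
  also have "\<dots> \<le> C * r" by (rule mult_left_mono[OF less_imp_le[OF I] less_imp_le[OF C]])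
  finally show ?thesis by simp
qed

text \<open>A curve that leaves the coordinate ball must first cover the coordinate distance \<rho>
  inside it, which requires a length of at least \<open>\<rho> / C\<close>. So small distance balls
  stay in the domain of the chart.\<close>

lemma dist_ball_in_chart:
  assumes c: "c \<in> atlas G" "x \<in> fst c" and \<rho>: "\<rho> > 0" "cball (snd c x) \<rho> \<subseteq> img c"
  obtains \<delta> where "\<delta> > 0" "\<And>y. d x y < ennreal \<delta> \<Longrightarrow> y \<in> fst c \<and> snd c y \<in> ball (snd c x) \<rho>"
proof -
  let ?\<xi> = "snd c x" and ?U = "{p \<in> fst c. snd c p \<in> ball (snd c x) \<rho>}" and ?K = "chart_inv c ` cball (snd c x) \<rho>"
  obtain C where C: "C > 0" "\<And>y v. y \<in> cball ?\<xi> \<rho> \<Longrightarrow> norm v \<le> C * sqrt (v \<bullet> (metric G c (chart_inv c y) *v v))"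
    using uniform_norm_bound[OF c(1) compact_cball \<rho>(2)] by blast
  \<comment> \<open>Half of the critical length: a curve shorter than \<delta> moves at most
    \<open>\<rho> / 2\<close> in coordinates and is still strictly inside the ball.\<close>
  define \<delta> where "\<delta> = \<rho> / (2 * C)"
  have d0: "\<delta> > 0" using C \<rho> by (simp add: \<delta>_def)
  have "compact ?K" by (intro compact_continuous_image compact_cball continuous_on_subset[OF continuous_chart_inv[OF c(1)] \<rho>(2)])
  then have clK: "closed ?K" by (rule compact_imp_closed)
  have oU: "open ?U" by (rule open_chart_preimage[OF c(1)]) simp
  have UK: "?U \<subseteq> ?K"
  proof
    fix p assume p: "p \<in> ?U"
    then have "p = chart_inv c (snd c p)" "snd c p \<in> cball ?\<xi> \<rho>" using chart_inv_chart[OF c(1)] by auto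
    then show "p \<in> ?K" by blast
  qed
  have "y \<in> ?U" if y: "d x y < ennreal \<delta>" for y
  proof (rule ccontr)
    assume ny: "y \<notin> ?U"
    obtain \<gamma> where g: "pw \<gamma> 0 1" "\<gamma> 0 = x" "\<gamma> 1 = y" "len \<gamma> 0 1 < ennreal \<delta>" using dist_lessE[OF y] by blast
    have cg: "continuous_on {0..1} \<gamma>" by (rule pw_continuous[OF g(1)])
    let ?A = "{0..1} \<inter> \<gamma> -` (- ?U)"
    have clA: "closed ?A" by (rule continuous_closed_preimage[OF cg]) (use oU in auto)
    have A1: "1 \<in> ?A" using ny g(3) by simp
    have bA: "bdd_below ?A" by (rule bdd_belowI[of _ 0]) auto
    \<comment> \<open>The first exit time. It is attained because the set of times off
      \<open>?U\<close> is closed, and up to it the curve stays in the compact set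
      \<open>?K\<close>, where the bound \<open>C\<close> is valid.\<close>
    define t1 where "t1 = Inf ?A"
    have t1A: "t1 \<in> ?A" unfolding t1_def using closed_contains_Inf[OF _ bA clA] A1 by blast
    have below: "\<gamma> t \<in> ?U" if "0 \<le> t" "t < t1" for t
    proof (rule ccontr)
      assume "\<gamma> t \<notin> ?U"
      then have "t \<in> ?A" using that t1A by auto
      then have "t1 \<le> t" unfolding t1_def by (rule cInf_lower[OF _ bA])
      then show False using that by simp
    qed
    have xU: "\<gamma> 0 \<in> ?U" using g(2) c \<rho> by simp
    have t1p: "0 < t1" "t1 \<le> 1" using t1A xU by (auto simp: less_le)
    have img: "\<gamma> ` {0..t1} \<subseteq> ?K"
    proof -
      have "closure {0..<t1} = {0..t1}" using t1p by simp
      moreover have "continuous_on {0..t1} \<gamma>" by (rule continuous_on_subset[OF cg]) (use t1p in auto)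
      moreover have "\<gamma> ` {0..<t1} \<subseteq> ?K" using below UK by auto
      ultimately show ?thesis using image_closure_subset[of "{0..<t1}" \<gamma> ?K] clK by simp
    qed
    have onK: "p \<in> fst c \<and> snd c p \<in> cball ?\<xi> \<rho> \<and> chart_inv c (snd c p) = p" if pK: "p \<in> ?K" for p
    proof -
      obtain z where z: "z \<in> cball ?\<xi> \<rho>" "p = chart_inv c z" using pK by blast
      then have zi: "z \<in> img c" using \<rho>(2) by blast
      show ?thesis using z chart_inv_dom[OF zi] chart_chart_inv[OF zi] by simp
    qed
    have "norm (snd c (\<gamma> t1) - snd c (\<gamma> 0)) \<le> C * \<delta>"
    proof (rule curve_lower_bound[OF c(1) pw_sub[OF g(1)] t1p(1) _ C(1) _ _ d0])
      show "\<gamma> ` {0..t1} \<subseteq> fst c" using img onK by blast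
      show "norm v \<le> C * sqrt (v \<bullet> (metric G c (\<gamma> t) *v v))" if t: "t \<in> {0..t1}" for t v
      proof -
        have "\<gamma> t \<in> ?K" using img t by blast
        from onK[OF this] have "snd c (\<gamma> t) \<in> cball ?\<xi> \<rho>" and e: "chart_inv c (snd c (\<gamma> t)) = \<gamma> t" by blast+
        from C(2)[OF this(1), of v] show ?thesis unfolding e .
      qed
      have "len \<gamma> 0 t1 \<le> len \<gamma> 0 1" using len_split[OF g(1), of t1] t1p by simp
      then show "len \<gamma> 0 t1 < ennreal \<delta>" using g(4) by (rule le_less_trans)
    qed (use t1p in auto)
    also have "C * \<delta> = \<rho> / 2" using C(1) by (simp add: \<delta>_def)
    finally have "snd c (\<gamma> t1) \<in> ball ?\<xi> \<rho>" using g(2) \<rho>(1) by (simp add: dist_norm norm_minus_commute)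
    moreover have "\<gamma> t1 \<in> ?K" using img t1p by auto
    then have "\<gamma> t1 \<in> fst c" using onK by blast
    ultimately show False using t1A by simp
  qed
  then show ?thesis using that[OF d0] by blast
qed

text \<open>The straight segment in coordinates is a competitor for the distance. Since
  \<open>pw\<close> quantifies over all charts, its velocity is computed in each of them with the
  Jacobian of the transition map.\<close>

lemma dist_segment:
  assumes c: "c \<in> atlas G" and pq: "p \<in> fst c" "q \<in> fst c" and S: "convex S" "S \<subseteq> img c" "snd c p \<in> S" "snd c q \<in> S"
    and C: "C \<ge> 0" "\<And>y v. y \<in> S \<Longrightarrow> sqrt (v \<bullet> (metric G c (chart_inv c y) *v v)) \<le> C * norm v"
  shows "d p q \<le> ennreal (C * norm (snd c q - snd c p))"
proof -
  define w where "w = snd c q - snd c p"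
  define l where "l t = snd c p + t *\<^sub>R w" for t :: real
  define \<gamma> where "\<gamma> t = chart_inv c (l t)" for t
  have lS: "l t \<in> S" if "t \<in> {0..1}" for t
  proof -
    have "(1 - t) *\<^sub>R snd c p + t *\<^sub>R snd c q \<in> S" using S that by (intro convexD_alt) auto
    moreover have "(1 - t) *\<^sub>R snd c p + t *\<^sub>R snd c q = l t" by (simp add: l_def w_def algebra_simps)
    ultimately show ?thesis by simp
  qed
  have li: "l t \<in> img c" if "t \<in> {0..1}" for t using lS[OF that] S(2) by blast
  have gd: "\<gamma> t \<in> fst c" "snd c (\<gamma> t) = l t" if "t \<in> {0..1}" for t
    using chart_inv_dom[OF li[OF that]] chart_chart_inv[OF li[OF that]] by (simp_all add: \<gamma>_def)
  have cl: "isCont l t" for t unfolding l_def by (intro continuous_intros)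
  have ic: "isCont \<gamma> t" if "t \<in> {0..1}" for t
  proof -
    have "isCont (chart_inv c) (l t)"
      using continuous_on_eq_continuous_at[OF open_img[OF c]] continuous_chart_inv[OF c] li[OF that] by blast
    then show ?thesis unfolding \<gamma>_def by (rule isCont_o2[where f = l and g = "chart_inv c", OF cl])
  qed
  have dl: "(l has_vector_derivative w) (at t)" for t
    unfolding l_def by (auto intro!: derivative_eq_intros)
  have der: "((snd c' \<circ> \<gamma>) has_vector_derivative (jacobian c c' (\<gamma> t) *v w)) (at t)"
    if "c' \<in> atlas G" "t \<in> {0..1}" "\<gamma> t \<in> fst c'" for c' t
  proof -
    have "(transition c c' has_derivative (*v) (jacobian c c' (\<gamma> t))) (at (l t))"
      using transition_has_derivative[OF c that(1) gd(1)[OF that(2)] that(3)] gd(2)[OF that(2)] by simp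
    from diff_chain_at[OF dl[of t, unfolded has_vector_derivative_def] this]
    have "(transition c c' \<circ> l has_derivative (\<lambda>x. jacobian c c' (\<gamma> t) *v (x *\<^sub>R w))) (at t)" by (simp add: o_def)
    moreover have "transition c c' \<circ> l = snd c' \<circ> \<gamma>" by (simp add: fun_eq_iff transition_def \<gamma>_def)
    ultimately show ?thesis by (simp add: has_vector_derivative_def matrix_vector_mult_scaleR)
  qed
  have pwg: "pw \<gamma> 0 1"
    unfolding pw_def
  proof (intro conjI ballI allI impI)
    show "continuous_on {0..1} \<gamma>" using ic by (intro continuous_at_imp_continuous_on) blast
    fix c' a' b' assume c': "c' \<in> atlas G" and *: "0 \<le> a' \<and> a' < b' \<and> b' \<le> 1 \<and> \<gamma> ` {a'..b'} \<subseteq> fst c'"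
    have t01: "t \<in> {0..1}" "\<gamma> t \<in> fst c'" if "t \<in> {a'..b'}" for t using that * by auto
    have lo: "l ` {a'..b'} \<subseteq> snd c ` (fst c \<inter> fst c')"
    proof
      fix y assume "y \<in> l ` {a'..b'}"
      then obtain t where t: "t \<in> {a'..b'}" "y = l t" by blast
      have "y = snd c (\<gamma> t)" using gd(2)[OF t01(1)[OF t(1)]] t(2) by simp
      then show "y \<in> snd c ` (fst c \<inter> fst c')" using gd(1)[OF t01(1)[OF t(1)]] t01(2)[OF t(1)] by blast
    qed
    have "continuous_on {a'..b'} (\<lambda>t. frechet_derivative (transition c c') (at (l t)) w)"
      by (rule continuous_on_compose2[OF smooth_on_continuous[OF smooth_on_derivative[OF smooth_transition[OF c c']]] _ lo])
        (rule continuous_at_imp_continuous_on[OF ballI[OF cl]])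
    moreover have "frechet_derivative (transition c c') (at (l t)) w = jacobian c c' (\<gamma> t) *v w" if "t \<in> {a'..b'}" for t
      using fun_cong[OF frechet_derivative_at[OF transition_has_derivative[OF c c' gd(1)[OF t01(1)[OF that]] t01(2)[OF that]]], of w]
      unfolding gd(2)[OF t01(1)[OF that]] by (rule sym)
    ultimately have "continuous_on {a'..b'} (\<lambda>t. jacobian c c' (\<gamma> t) *v w)" by (rule continuous_on_eq)
    then have "(snd c' \<circ> \<gamma>) C1_differentiable_on {a'..b'}"
      unfolding C1_differentiable_on_def
      by (intro exI[of _ "\<lambda>t. jacobian c c' (\<gamma> t) *v w"] conjI ballI) (rule der[OF c' t01(1) t01(2)])
    then show "(snd c' \<circ> \<gamma>) piecewise_C1_differentiable_on {a'..b'}" by (rule C1_differentiable_imp_piecewise)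
  qed
  have sp: "speed G \<gamma> t \<le> C * norm w" if t: "t \<in> {0..1}" for t
  proof -
    have v: "((snd c \<circ> \<gamma>) has_vector_derivative w) (at t)"
      using der[OF c t gd(1)[OF t]] by (simp add: jacobian_self[OF c gd(1)[OF t]])
    have "speed G \<gamma> t = sqrt (w \<bullet> (metric G c (\<gamma> t) *v w))" by (rule speed_chart[OF c gd(1)[OF t] ic[OF t] v])
    then show ?thesis using C(2)[OF lS[OF t], of w] by (simp add: \<gamma>_def)
  qed
  have "len \<gamma> 0 1 \<le> (\<integral>\<^sup>+t. ennreal (C * norm w) * indicator {0..1::real} t \<partial>lborel)"
    unfolding len_def by (intro nn_integral_mono) (auto simp: indicator_def intro!: ennreal_leI sp)
  also have "\<dots> = ennreal (C * norm w)" by (subst nn_integral_cmult_indicator) auto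
  finally have "len \<gamma> 0 1 \<le> ennreal (C * norm w)" .
  moreover have "\<gamma> 0 = p" "\<gamma> 1 = q" using pq chart_inv_chart[OF c] by (simp_all add: \<gamma>_def l_def w_def)
  ultimately show ?thesis using dist_le_len[OF pwg] by (simp add: w_def)
qed

lemma dist_self: "d x x = 0"
proof -
  let ?c = "chart_at G x"
  note c = chart_at[of x]
  have sub: "{snd ?c x} \<subseteq> img ?c" using c by blast
  obtain C where C: "C > 0" "\<And>y v. y \<in> {snd ?c x} \<Longrightarrow> sqrt (v \<bullet> (metric G ?c (chart_inv ?c y) *v v)) \<le> C * norm v"
    using uniform_norm_bound[OF c(1) compact_sing sub] by blast
  have "d x x \<le> ennreal (C * norm (snd ?c x - snd ?c x))"
    by (rule dist_segment[OF c(1) c(2) c(2) convex_singleton sub _ _ less_imp_le[OF C(1)] C(2)]) auto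
  then show ?thesis by simp
qed

text \<open>Length measured from the start is a continuous function of time, so a curve can be cut
  at any prescribed length. Consequently every point of a slightly larger ball is close to some
  point of the smaller one.\<close>

lemma dist_split:
  assumes xz: "d x z < ennreal (s + e)" and s: "s > 0" and e: "e > 0"
  obtains y where "d x y < ennreal s" "d y z < ennreal e"
proof -
  obtain \<gamma> where g: "pw \<gamma> 0 1" "\<gamma> 0 = x" "\<gamma> 1 = z" "len \<gamma> 0 1 < ennreal (s + e)" using dist_lessE[OF xz] by blast
  obtain S where S: "finite S" "(\<lambda>t. indicator ({0..1} - S) t * speed G \<gamma> t) \<in> borel_measurable borel"
    using speed_measurable[OF g(1) zero_le_one] by blast
  define f where "f t = indicator ({0..1} - S) t * \<bar>speed G \<gamma> t\<bar>" for t
  have sp0: "speed G \<gamma> t \<ge> 0" for t by (simp add: speed_def Let_def metric_nonneg[OF chart_at])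
  have "f = (\<lambda>t. indicator ({0..1} - S) t * speed G \<gamma> t)" by (simp add: fun_eq_iff f_def abs_of_nonneg[OF sp0])
  then have fm: "f \<in> borel_measurable borel" using S(2) by simp
  have f0: "f t \<ge> 0" for t by (simp add: f_def)
  have L: "len \<gamma> 0 t = (\<integral>\<^sup>+u. ennreal (indicator {0..t} u * f u) \<partial>lborel)" if "t \<in> {0..1}" for t
  proof -
    have "len \<gamma> 0 t = (\<integral>\<^sup>+u\<in>{0..t} - S. ennreal (speed G \<gamma> u) \<partial>lborel)"
      unfolding len_def by (rule nn_integral_minus_finite[OF S(1)])
    also have "\<dots> = (\<integral>\<^sup>+u. ennreal (indicator {0..t} u * f u) \<partial>lborel)"
      using that sp0 by (intro nn_integral_cong) (auto simp: indicator_def f_def)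
    finally show ?thesis .
  qed
  have f1: "indicator {0..1} u * f u = f u" for u by (simp add: f_def indicator_def)
  have fi: "integrable lborel f"
  proof (rule integrableI_nonneg)
    show "(\<integral>\<^sup>+u. ennreal (f u) \<partial>lborel) < \<infinity>"
      using L[of 1] g(4) by (simp add: f1 less_trans[OF _ ennreal_less_top])
  qed (use fm f0 in auto)
  have si: "set_integrable lborel {0..t} f" for t
    unfolding set_integrable_def using fi by (intro integrable_mult_indicator) auto
  define I where "I t = integral {0..t} f" for t
  have LI: "len \<gamma> 0 t = ennreal (I t)" if "t \<in> {0..1}" for t
  proof -
    have "(\<integral>\<^sup>+u. ennreal (indicator {0..t} u * f u) \<partial>lborel) = ennreal (LINT u:{0..t}|lborel. f u)"
      unfolding set_lebesgue_integral_def real_scaleR_def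
      using si[of t] unfolding set_integrable_def real_scaleR_def
      by (rule nn_integral_eq_integral) (simp add: f0)
    then show ?thesis unfolding L[OF that] I_def using set_borel_integral_eq_integral(2)[OF si[of t]] by simp
  qed
  have I0: "I t \<ge> 0" for t unfolding I_def by (rule integral_nonneg[OF set_borel_integral_eq_integral(1)[OF si]]) (rule f0)
  have cI: "continuous_on {0..1} I"
    unfolding I_def by (rule indefinite_integral_continuous_1[OF set_borel_integral_eq_integral(1)[OF si]])
  have I1: "I 1 < s + e" using g(4) LI[of 1] I0[of 1] by (simp add: ennreal_less_iff)
  \<comment> \<open>Cutting in the ratio \<open>s : e\<close> makes the two parts shorter than
    \<open>s\<close> and \<open>e\<close>, because the total is less than
    \<open>s + e\<close>.\<close>
  define m where "m = I 1 * s / (s + e)"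
  have se: "s + e > 0" using s e by simp
  have m0: "m \<ge> 0" using I0 s se by (simp add: m_def)
  have ms: "m < s" using mult_strict_right_mono[OF I1 s] se by (simp add: m_def field_simps)
  have dm: "I 1 - m = I 1 * e / (s + e)" using se by (simp add: m_def field_simps)
  have me: "I 1 - m < e" unfolding dm using mult_strict_right_mono[OF I1 e] se by (simp add: field_simps)
  have mI: "m \<le> I 1" using dm I0[of 1] e se by (smt (verit) divide_nonneg_pos mult_nonneg_nonneg)
  have "I 0 = 0" by (simp add: I_def)
  then obtain t where t: "0 \<le> t" "t \<le> 1" "I t = m" using IVT'[of I 0 m 1] m0 mI cI by auto
  have t01: "t \<in> {0..1}" using t by simp
  have "d x (\<gamma> t) < ennreal s"
  proof (cases "t = 0")
    case True
    then show ?thesis using g(2) s by (simp add: dist_self)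
  next
    case False
    have "d (\<gamma> 0) (\<gamma> t) \<le> len \<gamma> 0 t" by (rule dist_le_len[OF pw_sub[OF g(1)]]) (use t False in auto)
    also have "\<dots> = ennreal m" using LI[OF t01] t(3) by simp
    also have "\<dots> < ennreal s" using ms m0 by (simp add: ennreal_less_iff)
    finally show ?thesis using g(2) by simp
  qed
  moreover have "d (\<gamma> t) z < ennreal e"
  proof (cases "t = 1")
    case True
    then show ?thesis using g(3) e by (simp add: dist_self)
  next
    case False
    have "len \<gamma> 0 1 = len \<gamma> 0 t + len \<gamma> t 1" by (rule len_split[OF g(1) t(1,2)])
    then have sum: "ennreal (I 1) = ennreal m + len \<gamma> t 1" using LI[of 1] LI[OF t01] t(3) by simp
    then have "len \<gamma> t 1 = ennreal (I 1) - ennreal m" by (simp add: ennreal_add_diff_cancel_left)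
    also have "\<dots> = ennreal (I 1 - m)" by (rule ennreal_minus[OF m0])
    also have "\<dots> < ennreal e" using me mI by (simp add: ennreal_less_iff)
    finally have "len \<gamma> t 1 < ennreal e" .
    moreover have "d (\<gamma> t) (\<gamma> 1) \<le> len \<gamma> t 1" by (rule dist_le_len[OF pw_sub[OF g(1)]]) (use t False in auto)
    ultimately show ?thesis using g(3) by (simp add: le_less_trans)
  qed
  ultimately show ?thesis by (rule that)
qed

subsection \<open>Bounded sets have finite volume\<close>

definition Ball :: "'a \<Rightarrow> real \<Rightarrow> 'a set" where "Ball x r = {y. d x y < ennreal r}"

text \<open>Total boundedness combined with finite volume; both pass to subsets and finite unions.
  Finite volume is formulated with a Borel superset, so that measurability of distance balls is not
  at issue.\<close>

definition small :: "'a set \<Rightarrow> bool" where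
  "small A \<longleftrightarrow> (\<forall>e>0. \<exists>F. finite F \<and> A \<subseteq> (\<Union>y\<in>F. Ball y e)) \<and> (\<exists>B\<in>sets borel. A \<subseteq> B \<and> emeasure \<nu> B < \<infinity>)"

lemma small_subset: "small B \<Longrightarrow> A \<subseteq> B \<Longrightarrow> small A"
  unfolding small_def by (meson order_trans)

lemma small_UN:
  assumes I: "finite I" and A: "\<And>i. i \<in> I \<Longrightarrow> small (A i)" shows "small (\<Union>i\<in>I. A i)"
  unfolding small_def
proof (intro conjI allI impI)
  fix e :: real assume e: "e > 0"
  have "\<exists>F. finite F \<and> A i \<subseteq> (\<Union>y\<in>F. Ball y e)" if "i \<in> I" for i
    using A[OF that] e unfolding small_def by blast
  then have "\<forall>i\<in>I. \<exists>F. finite F \<and> A i \<subseteq> (\<Union>y\<in>F. Ball y e)" by (rule ballI)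
  from bchoice[OF this] obtain F where F: "\<forall>i\<in>I. finite (F i) \<and> A i \<subseteq> (\<Union>y\<in>F i. Ball y e)" by (rule exE)
  have 1: "finite (\<Union>i\<in>I. F i)" using I F by (intro finite_UN_I) blast+
  have 2: "(\<Union>i\<in>I. A i) \<subseteq> (\<Union>y\<in>(\<Union>i\<in>I. F i). Ball y e)"
  proof (rule UN_least)
    fix i assume i: "i \<in> I"
    have "A i \<subseteq> (\<Union>y\<in>F i. Ball y e)" using bspec[OF F i] by (rule conjunct2)
    also have "\<dots> \<subseteq> (\<Union>y\<in>(\<Union>i\<in>I. F i). Ball y e)" by (rule UN_mono) (use i in auto)
    finally show "A i \<subseteq> (\<Union>y\<in>(\<Union>i\<in>I. F i). Ball y e)" .
  qed
  show "\<exists>F. finite F \<and> (\<Union>i\<in>I. A i) \<subseteq> (\<Union>y\<in>F. Ball y e)" by (intro exI conjI, rule 1, rule 2)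
next
  have "\<exists>B. B \<in> sets borel \<and> A i \<subseteq> B \<and> emeasure \<nu> B < \<infinity>" if "i \<in> I" for i
    using A[OF that] unfolding small_def by blast
  then have "\<forall>i\<in>I. \<exists>B. B \<in> sets borel \<and> A i \<subseteq> B \<and> emeasure \<nu> B < \<infinity>" by (rule ballI)
  from bchoice[OF this] obtain B where B: "\<forall>i\<in>I. B i \<in> sets borel \<and> A i \<subseteq> B i \<and> emeasure \<nu> (B i) < \<infinity>" by (rule exE)
  have "emeasure \<nu> (\<Union>i\<in>I. B i) \<le> (\<Sum>i\<in>I. emeasure \<nu> (B i))"
    using B I by (intro emeasure_subadditive_finite) auto
  also have "\<dots> < \<infinity>" using B I by (simp add: ennreal_sum_less_top)
  finally have 1: "emeasure \<nu> (\<Union>i\<in>I. B i) < \<infinity>" .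
  have 2: "(\<Union>i\<in>I. B i) \<in> sets borel" using B I by (intro sets.finite_UN) auto
  have 3: "(\<Union>i\<in>I. A i) \<subseteq> (\<Union>i\<in>I. B i)" by (rule UN_mono) (use B in auto)
  show "\<exists>B\<in>sets borel. (\<Union>i\<in>I. A i) \<subseteq> B \<and> emeasure \<nu> B < \<infinity>" by (intro bexI conjI, rule 3, rule 1, rule 2)
qed

text \<open>A small distance ball lies in a compact coordinate ball, which has finite volume. There
  the distance is at most a multiple of the Euclidean one, so a finite Euclidean net becomes a
  finite net for the distance.\<close>

lemma local_small: "\<exists>\<eta>>0. small (Ball x \<eta>)"
proof -
  let ?c = "chart_at G x"
  note c = chart_at[of x]
  have "snd ?c x \<in> img ?c" using c by blast
  then obtain \<rho> where \<rho>: "\<rho> > 0" "cball (snd ?c x) \<rho> \<subseteq> img ?c"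
    using open_img[OF c(1)] unfolding open_contains_cball by blast
  let ?S = "cball (snd ?c x) \<rho>"
  obtain \<delta> where \<delta>: "\<delta> > 0" "\<And>y. d x y < ennreal \<delta> \<Longrightarrow> y \<in> fst ?c \<and> snd ?c y \<in> ball (snd ?c x) \<rho>"
    using dist_ball_in_chart[OF c \<rho>] by blast
  obtain C where C: "C > 0" "\<And>y v. y \<in> ?S \<Longrightarrow> sqrt (v \<bullet> (metric G ?c (chart_inv ?c y) *v v)) \<le> C * norm v"
    using uniform_norm_bound[OF c(1) compact_cball \<rho>(2)] by blast
  have onS: "chart_inv ?c y \<in> fst ?c" "snd ?c (chart_inv ?c y) = y" if "y \<in> ?S" for y
  proof -
    have "y \<in> img ?c" using that \<rho>(2) by blast
    then show "chart_inv ?c y \<in> fst ?c" "snd ?c (chart_inv ?c y) = y" by (rule chart_inv_dom, rule chart_chart_inv)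
  qed
  have "\<exists>F. finite F \<and> Ball x \<delta> \<subseteq> (\<Union>y\<in>F. Ball y e)" if e: "e > 0" for e
  proof -
    have eC: "e / C > 0" using e C(1) by simp
    obtain k where k: "finite k" "k \<subseteq> ?S" "?S \<subseteq> (\<Union>y\<in>k. ball y (e / C))"
    proof (rule compactE_image[OF compact_cball[of "snd ?c x" \<rho>], of ?S "\<lambda>y. ball y (e / C)"])
      show "?S \<subseteq> (\<Union>y\<in>?S. ball y (e / C))"
      proof
        fix y assume "y \<in> ?S"
        moreover have "y \<in> ball y (e / C)" using eC by simp
        ultimately show "y \<in> (\<Union>y\<in>?S. ball y (e / C))" by (rule UN_I)
      qed
    qed auto
    have "Ball x \<delta> \<subseteq> (\<Union>y\<in>chart_inv ?c ` k. Ball y e)"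
    proof
      fix p assume "p \<in> Ball x \<delta>"
      then have p: "p \<in> fst ?c" "snd ?c p \<in> ?S" using \<delta>(2)[of p] by (auto simp: Ball_def)
      then obtain y where y: "y \<in> k" "dist y (snd ?c p) < e / C" using k(3) by auto
      have yS: "y \<in> ?S" using y k by blast
      have "d (chart_inv ?c y) p \<le> ennreal (C * norm (snd ?c p - snd ?c (chart_inv ?c y)))"
        by (rule dist_segment[OF c(1) onS(1)[OF yS] p(1) convex_cball \<rho>(2) _ p(2) less_imp_le[OF C(1)] C(2)])
          (use yS onS(2)[OF yS] in auto)
      also have "\<dots> < ennreal e"
        using y(2) C(1) e by (intro ennreal_lessI) (auto simp: onS(2)[OF yS] dist_norm norm_minus_commute field_simps)
      finally have "p \<in> Ball (chart_inv ?c y) e" by (simp add: Ball_def)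
      then show "p \<in> (\<Union>y\<in>chart_inv ?c ` k. Ball y e)" by (rule UN_I[OF imageI[OF y(1)]])
    qed
    with finite_imageI[OF k(1)] have "finite (chart_inv ?c ` k) \<and> Ball x \<delta> \<subseteq> (\<Union>y\<in>chart_inv ?c ` k. Ball y e)"
      by (rule conjI)
    then show ?thesis by (rule exI)
  qed
  moreover have "\<exists>B\<in>sets borel. Ball x \<delta> \<subseteq> B \<and> emeasure \<nu> B < \<infinity>"
  proof -
    have cK: "compact (chart_inv ?c ` ?S)"
      by (intro compact_continuous_image compact_cball continuous_on_subset[OF continuous_chart_inv[OF c(1)] \<rho>(2)])
    have "Ball x \<delta> \<subseteq> chart_inv ?c ` ?S"
    proof
      fix p assume "p \<in> Ball x \<delta>"
      then have p: "p \<in> fst ?c" "snd ?c p \<in> ?S" using \<delta>(2)[of p] by (auto simp: Ball_def)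
      then have "p = chart_inv ?c (snd ?c p)" by (simp add: chart_inv_chart[OF c(1)])
      then show "p \<in> chart_inv ?c ` ?S" using p(2) by blast
    qed
    then have "Ball x \<delta> \<subseteq> chart_inv ?c ` ?S \<and> emeasure \<nu> (chart_inv ?c ` ?S) < \<infinity>"
      using finite_nu_compact[OF cK] by (rule conjI)
    then show ?thesis by (rule bexI[OF _ borel_closed[OF compact_imp_closed[OF cK]]])
  qed
  ultimately have "small (Ball x \<delta>)" unfolding small_def by (intro conjI allI impI)
  with \<delta>(1) have "\<delta> > 0 \<and> small (Ball x \<delta>)" by (rule conjI)
  then show ?thesis by (rule exI)
qed

lemma dist_tri:
  assumes "d x y < ennreal r" "d y z < ennreal s" "r > 0" "s > 0"
  shows "d x z < ennreal (r + s)"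
  using dist_triangle_less[OF assms(1,2)] assms(3,4) by simp

text \<open>The radius is enlarged in steps of \<open>r / 8\<close>, using that balls are totally bounded.\<close>
lemma small_Ball_step:
  assumes r: "r > 0" and half: "\<And>y. y \<in> Ball x r \<Longrightarrow> small (Ball y (r / 2))"
  shows "small (Ball x r)"
proof -
  \<comment> \<open>Four steps of \<open>r / 8\<close> lead from \<open>r / 2\<close> to
    \<open>r\<close>; the condition \<open>n \<le> 4\<close> keeps every earlier radius below
    \<open>r\<close>.\<close>
  have "n \<le> 4 \<Longrightarrow> small (Ball x (r / 2 + real n * (r / 8)))" for n
  proof (induction n)
    case 0
    then show ?case using half[of x] r by (simp add: Ball_def dist_self)
  next
    case (Suc n)
    let ?s = "r / 2 + real n * (r / 8)"
    have n3: "real n \<le> 3" using Suc.prems by simp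
    have "real n * (r / 8) \<le> 3 * (r / 8)" using n3 r by (intro mult_right_mono) auto
    moreover have "real n * (r / 8) \<ge> 0" using r by simp
    ultimately have s: "0 < ?s" "?s < r" using r by linarith+
    have r8: "r / 8 > 0" using r by simp
    have "small (Ball x ?s)" using Suc by simp
    then obtain F where F: "finite F" "Ball x ?s \<subseteq> (\<Union>y\<in>F. Ball y (r / 8))" unfolding small_def using r8 by blast
    \<comment> \<open>The centres of the net are moved into the smaller ball, because
      \<open>half\<close> is available only for points of \<open>Ball x r\<close>.\<close>
    define g where "g y = (SOME z. z \<in> Ball x ?s \<inter> Ball y (r / 8))" for y
    define F' where "F' = {y \<in> F. Ball x ?s \<inter> Ball y (r / 8) \<noteq> {}}"
    have g: "g y \<in> Ball x ?s" "g y \<in> Ball y (r / 8)" if "y \<in> F'" for y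
    proof -
      have "\<exists>z. z \<in> Ball x ?s \<inter> Ball y (r / 8)" using that by (auto simp: F'_def)
      from someI_ex[OF this] show "g y \<in> Ball x ?s" "g y \<in> Ball y (r / 8)" by (auto simp: g_def)
    qed
    have "Ball x (?s + r / 8) \<subseteq> (\<Union>y\<in>F'. Ball (g y) (r / 2))"
    proof
      fix z assume "z \<in> Ball x (?s + r / 8)"
      then have "d x z < ennreal (?s + r / 8)" by (simp add: Ball_def)
      then obtain w where w: "d x w < ennreal ?s" "d w z < ennreal (r / 8)" by (rule dist_split[OF _ s(1) r8])
      then have "w \<in> Ball x ?s" by (simp add: Ball_def)
      then have wB: "w \<in> Ball x ?s \<inter> Ball y (r / 8)" if "w \<in> Ball y (r / 8)" for y using that by (rule IntI)
      obtain y where y: "y \<in> F" "w \<in> Ball y (r / 8)" using subsetD[OF F(2) \<open>w \<in> Ball x ?s\<close>] by (rule UN_E)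
      have "Ball x ?s \<inter> Ball y (r / 8) \<noteq> {}" using wB[OF y(2)] by (rule ex_in_conv[THEN iffD1, OF exI])
      with y(1) have yF: "y \<in> F'" unfolding F'_def by simp
      \<comment> \<open>From \<open>g y\<close> over \<open>y\<close> and \<open>w\<close> to
        \<open>z\<close> there are three distances below \<open>r / 8\<close>, together less than
        \<open>r / 2\<close>.\<close>
      have "d (g y) y < ennreal (r / 8)" using g(2)[OF yF] unfolding Ball_def mem_Collect_eq by (rule dist_sym_less)
      then have "d (g y) w < ennreal (r / 8 + r / 8)" by (rule dist_tri[OF _ _ r8 r8]) (use y(2) in \<open>simp add: Ball_def\<close>)
      then have "d (g y) z < ennreal (r / 8 + r / 8 + r / 8)" by (rule dist_tri[OF _ w(2) _ r8]) (use r8 in simp)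
      also have "\<dots> \<le> ennreal (r / 2)" using r by (intro ennreal_leI) simp
      finally have "z \<in> Ball (g y) (r / 2)" by (simp add: Ball_def)
      then show "z \<in> (\<Union>y\<in>F'. Ball (g y) (r / 2))" by (rule UN_I[OF yF])
    qed
    moreover have "small (\<Union>y\<in>F'. Ball (g y) (r / 2))"
    proof (rule small_UN)
      show "finite F'" using F(1) by (simp add: F'_def)
      show "small (Ball (g y) (r / 2))" if "y \<in> F'" for y
      proof (rule half)
        have "d x (g y) < ennreal ?s" using g(1)[OF that] by (simp add: Ball_def)
        also have "\<dots> \<le> ennreal r" using s by (intro ennreal_leI) simp
        finally show "g y \<in> Ball x r" by (simp add: Ball_def)
      qed
    qed
    ultimately have "small (Ball x (?s + r / 8))" by (rule small_subset[rotated])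
    moreover have "?s + r / 8 = r / 2 + real (Suc n) * (r / 8)" by (simp add: field_simps)
    ultimately show ?case by simp
  qed
  from this[of 4] show ?thesis by simp
qed

text \<open>By the step lemma a ball that is not small contains the centre of one with half the
  radius that is not small either. Iteration gives a Cauchy sequence of centres, and near its limit,
  which completeness supplies, these balls would fit into a small one.\<close>

lemma small_Ball:
  assumes complete: "riemannian_complete G" and r: "r > 0"
  shows "small (Ball x r)"
proof (rule ccontr)
  assume bad: "\<not> small (Ball x r)"
  define h where "h n = r * (1/2) ^ n" for n :: nat
  have h0: "h n > 0" for n using r by (simp add: h_def)
  have hS: "h (Suc n) = h n / 2" for n by (simp add: h_def)
  have "\<exists>X. \<forall>n. \<not> small (Ball (X n) (h n)) \<and> d (X n) (X (Suc n)) < ennreal (h n)"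
  proof (rule dependent_nat_choice)
    show "\<exists>x. \<not> small (Ball x (h 0))" using bad by (auto simp: h_def)
    fix y n assume "\<not> small (Ball y (h n))"
    then obtain z where "z \<in> Ball y (h n)" "\<not> small (Ball z (h n / 2))" using small_Ball_step[OF h0, of y n] by blast
    then show "\<exists>z. \<not> small (Ball z (h (Suc n))) \<and> d y z < ennreal (h n)" unfolding hS Ball_def[of y] by blast
  qed
  then obtain X where X: "\<And>n. \<not> small (Ball (X n) (h n))" "\<And>n. d (X n) (X (Suc n)) < ennreal (h n)" by blast
  \<comment> \<open>The distances from \<open>m\<close> to \<open>n\<close> add up to less than the
    geometric sum \<open>2 * h m - 2 * h n\<close>. An extra \<open>h m\<close> keeps the bound
    positive for \<open>m = n\<close>, where strictness would otherwise fail.\<close>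
  have le: "d (X m) (X n) < ennreal (3 * h m - 2 * h n)" if "m \<le> n" for m n
    using that
  proof (induction n rule: dec_induct)
    case base
    then show ?case using h0[of m] by (simp add: dist_self)
  next
    case (step n)
    have "h n \<le> h m" unfolding h_def using step(1) r by (intro mult_left_mono power_decreasing) auto
    then have p: "3 * h m - 2 * h n > 0" using h0[of m] by linarith
    have "d (X m) (X (Suc n)) < ennreal (3 * h m - 2 * h n + h n)" by (rule dist_tri[OF step.IH X(2) p h0])
    also have "3 * h m - 2 * h n + h n = 3 * h m - 2 * h (Suc n)" by (simp add: hS)
    finally show ?case .
  qed
  have le3: "d (X m) (X n) < ennreal (3 * h m)" if "m \<le> n" for m n
    by (rule less_le_trans[OF le[OF that]]) (use h0[of n] in \<open>auto intro!: ennreal_leI\<close>)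
  have h_lim: "h \<longlonglongrightarrow> 0"
    unfolding h_def using tendsto_mult[OF tendsto_const[of r] LIMSEQ_realpow_zero[of "1/2"]] by simp
  have "\<exists>N. \<forall>m\<ge>N. \<forall>n\<ge>N. d (X m) (X n) < e" if e: "e > 0" for e
  proof -
    have "(\<lambda>n. ennreal (3 * h n)) \<longlonglongrightarrow> ennreal (3 * 0)"
      by (intro tendsto_ennrealI tendsto_mult tendsto_const h_lim)
    then have "\<forall>\<^sub>F n in sequentially. ennreal (3 * h n) < e" using e by (intro order_tendstoD(2)[where y = "ennreal (3 * 0)"]) auto
    then obtain N where N: "\<And>n. n \<ge> N \<Longrightarrow> ennreal (3 * h n) < e" unfolding eventually_sequentially by blast
    have lt: "d (X m) (X n) < e" if "m \<ge> N" "m \<le> n" for m n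
      using less_trans[OF le3[OF that(2)] N[OF that(1)]] .
    have "d (X m) (X n) < e" if "m \<ge> N" "n \<ge> N" for m n
    proof (cases "m \<le> n")
      case True then show ?thesis using lt that by blast
    next
      case False then show ?thesis using dist_sym_less[OF lt[of n m]] that by simp
    qed
    then show ?thesis by blast
  qed
  then obtain l where l: "(\<lambda>n. d (X n) l) \<longlonglongrightarrow> 0" using complete unfolding riemannian_complete_def by blast
  obtain \<eta> where \<eta>: "\<eta> > 0" "small (Ball l \<eta>)" using local_small[of l] by blast
  have h2: "\<eta> / 2 > 0" using \<eta>(1) by simp
  have "\<forall>\<^sub>F n in sequentially. d (X n) l < ennreal (\<eta> / 2)" using order_tendstoD(2)[OF l] h2 by simp
  moreover have "\<forall>\<^sub>F n in sequentially. h n < \<eta> / 2" using order_tendstoD(2)[OF h_lim h2] .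
  ultimately have "\<forall>\<^sub>F n in sequentially. d (X n) l < ennreal (\<eta> / 2) \<and> h n < \<eta> / 2" by (rule eventually_conj)
  then obtain n where n: "d (X n) l < ennreal (\<eta> / 2)" "h n < \<eta> / 2"
    using eventually_happens'[OF sequentially_bot] by blast
  have "Ball (X n) (h n) \<subseteq> Ball l \<eta>"
  proof
    fix y assume "y \<in> Ball (X n) (h n)"
    then have "d (X n) y < ennreal (h n)" by (simp add: Ball_def)
    then have "d l y < ennreal (\<eta> / 2 + h n)" by (rule dist_tri[OF dist_sym_less[OF n(1)] _ h2 h0])
    also have "\<dots> \<le> ennreal \<eta>" using n(2) by (intro ennreal_leI) simp
    finally show "y \<in> Ball l \<eta>" by (simp add: Ball_def)
  qed
  then show False using small_subset[OF \<eta>(2)] X(1) by blast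
qed

lemma bounded_finite_volume:
  assumes "riemannian_complete G" "riemannian_bounded G S"
  shows "emeasure \<nu> S < \<infinity>"
proof (cases "S = {}")
  case False
  then obtain x where x: "x \<in> S" by blast
  obtain R where R: "\<And>y. y \<in> S \<Longrightarrow> d x y \<le> ennreal R" using assms(2) x unfolding riemannian_bounded_def by blast
  \<comment> \<open>\<open>R\<close> may be negative, and \<open>Ball\<close> is defined by a strict
    inequality.\<close>
  have pos: "max R 0 + 1 > 0" by simp
  have "S \<subseteq> Ball x (max R 0 + 1)"
  proof
    fix y assume "y \<in> S"
    then have "d x y \<le> ennreal R" by (rule R)
    also have "\<dots> < ennreal (max R 0 + 1)" using pos by (intro ennreal_lessI) auto
    finally show "y \<in> Ball x (max R 0 + 1)" by (simp add: Ball_def)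
  qed
  then have "small S" using small_subset[OF small_Ball[OF assms(1) pos]] by blast
  then obtain B where B: "B \<in> sets borel" "S \<subseteq> B" "emeasure \<nu> B < \<infinity>" unfolding small_def by blast
  have "emeasure \<nu> S \<le> emeasure \<nu> B" by (rule emeasure_mono[OF B(2)]) (simp add: B(1))
  then show ?thesis using B(3) by (rule le_less_trans)
qed simp

end

section \<open>A smooth convex profile; gradient and divergence in Euclidean space\<close>

text \<open>A smooth substitute for the positive part: convex, zero exactly for
  \<open>t \<le> 0\<close>, with bounded first and second derivatives. The function
  \<open>flat\<close> itself is not convex on the whole line.\<close>

definition convex_flat :: "real \<Rightarrow> real" where "convex_flat t = t * flat t"

text \<open>Written with a polynomial in \<open>1 / t\<close> so that
  \<open>flat_poly_derivative\<close> and \<open>Ck_on_flat_poly\<close> apply.\<close>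

definition convex_flat' :: "real \<Rightarrow> real" where
  "convex_flat' t = (if t > 0 then poly [:1, 1:] (1 / t) * exp (- 1 / t) else 0)"

definition convex_flat'' :: "real \<Rightarrow> real" where
  "convex_flat'' t = (if t > 0 then poly [:0, 0, 0, 1:] (1 / t) * exp (- 1 / t) else 0)"

lemma convex_flat_has_derivative: "(convex_flat has_real_derivative convex_flat' t) (at t)"
proof -
  have "((\<lambda>t. t * flat t) has_real_derivative (1 * flat t + flat' t * t)) (at t)"
    by (rule DERIV_mult[OF DERIV_ident flat_has_derivative])
  moreover have "1 * flat t + flat' t * t = convex_flat' t"
    by (simp add: flat_def flat'_def convex_flat'_def power2_eq_square field_simps)
  ultimately show ?thesis by (simp add: convex_flat_def[abs_def])
qed

lemma convex_flat'_has_derivative: "(convex_flat' has_real_derivative convex_flat'' t) (at t)"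
proof -
  have "[:0, 0, 1:] * ([:1, 1:] - pderiv [:1, 1:]) = ([:0, 0, 0, 1:] :: real poly)"
    by (simp add: pderiv_pCons)
  from flat_poly_derivative[of "[:1, 1:]" t, unfolded this] show ?thesis
    unfolding convex_flat'_def[abs_def] convex_flat''_def .
qed

lemma smooth_convex_flat': "smooth_on convex_flat' UNIV"
  using Ck_on_flat_poly[of _ "[:1, 1:]"] unfolding smooth_on_def convex_flat'_def[abs_def] by blast

lemma smooth_convex_flat: "smooth_on convex_flat UNIV"
  unfolding smooth_on_def convex_flat_def[abs_def]
  by (intro allI Ck_on_bilinear[OF bounded_bilinear_mult] open_UNIV Ck_on_bounded_linear[OF bounded_linear_ident]
      smooth_onD[OF smooth_flat])

lemma convex_flat'_bounds: "0 \<le> convex_flat' t" "convex_flat' t \<le> 1"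
proof -
  show "0 \<le> convex_flat' t" by (auto simp: convex_flat'_def)
  have "(1 + 1 / t) * exp (- (1 / t)) \<le> exp (1 / t) * exp (- (1 / t))" by (intro mult_right_mono exp_ge_add_one_self) simp
  then show "convex_flat' t \<le> 1" by (simp add: convex_flat'_def exp_minus)
qed

lemma convex_flat'_pos: "t > 0 \<Longrightarrow> convex_flat' t > 0"
  by (auto simp: convex_flat'_def intro!: mult_pos_pos add_pos_pos)

text \<open>The number 6 is \<open>fact 3\<close>: with \<open>x = 1 / t\<close> the second
  derivative is \<open>x ^ 3 * exp (- x)\<close>, and the exponential series dominates its term of
  degree 3.\<close>

lemma convex_flat''_bounds: "0 \<le> convex_flat'' t" "convex_flat'' t \<le> 6"
proof -
  show "0 \<le> convex_flat'' t" by (auto simp: convex_flat''_def)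
  have "x ^ 3 * exp (- x) \<le> 6" if "x \<ge> 0" for x :: real
  proof -
    have "x ^ 3 \<le> fact 3 * exp x"
    proof -
      have "x ^ 3 /\<^sub>R fact 3 \<le> (\<Sum>n\<le>3. x ^ n /\<^sub>R fact n)"
        by (rule member_le_sum) (use that in auto)
      also have "\<dots> \<le> exp x" unfolding exp_def lessThan_Suc_atMost[symmetric]
        by (rule sum_le_suminf[OF summable_exp_generic]) (use that in auto)
      finally show ?thesis by (simp add: field_simps)
    qed
    also have "fact 3 = (6::real)" by (simp add: fact_numeral)
    finally show ?thesis by (simp add: exp_minus field_simps)
  qed
  from this[of "1 / t"] show "convex_flat'' t \<le> 6"
    by (auto simp: convex_flat''_def power3_eq_cube algebra_simps)
qed

lemma convex_flat_nonpos: "t \<le> 0 \<Longrightarrow> convex_flat t = 0"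
  by (simp add: convex_flat_def flat_def)

lemma convex_flat_lipschitz: "\<bar>convex_flat s - convex_flat t\<bar> \<le> \<bar>s - t\<bar>"
proof -
  have "norm (convex_flat s - convex_flat t) \<le> 1 * norm (s - t)"
    by (rule field_differentiable_bound[where S = UNIV and f' = convex_flat'])
      (use convex_flat_has_derivative convex_flat'_bounds in auto)
  then show ?thesis by simp
qed

lemma convex_flat'_lipschitz: "\<bar>convex_flat' s - convex_flat' t\<bar> \<le> 6 * \<bar>s - t\<bar>"
proof -
  have "norm (convex_flat' s - convex_flat' t) \<le> 6 * norm (s - t)"
    by (rule field_differentiable_bound[where S = UNIV and f' = convex_flat''])
      (use convex_flat'_has_derivative convex_flat''_bounds in auto)
  then show ?thesis by simp
qed

definition gradient :: "(real^'n \<Rightarrow> real) \<Rightarrow> real^'n \<Rightarrow> real^'n" where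
  "gradient F y = (\<chi> i. partial i F y)"

lemma smooth_gradient:
  fixes F :: "real^'n \<Rightarrow> real"
  assumes "open S" "smooth_on F S" shows "smooth_on (gradient F) S"
proof -
  have "Ck_on k (\<lambda>y. \<chi> i. frechet_derivative F (at y) (axis i 1)) S" for k
    by (intro Ck_on_vec_lambda assms smooth_onD smooth_on_derivative)
  then show ?thesis unfolding smooth_on_def gradient_def[abs_def] partial_def by blast
qed

lemma gradient_diff:
  fixes f g :: "real^'n \<Rightarrow> real"
  assumes "f differentiable at x" "g differentiable at x"
  shows "gradient (\<lambda>x. f x - g x) x = gradient f x - gradient g x"
  using partial_lin[OF assms, of _ 1 "-1"] by (simp add: gradient_def vec_eq_iff)

lemma gradient_mult:
  fixes f g :: "real^'n \<Rightarrow> real"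
  assumes "f differentiable at x" "g differentiable at x"
  shows "gradient (\<lambda>x. f x * g x) x = f x *\<^sub>R gradient g x + g x *\<^sub>R gradient f x"
  using partial_mult[OF assms] by (simp add: gradient_def vec_eq_iff mult.commute)

lemma gradient_compose:
  fixes f :: "real^'n \<Rightarrow> real"
  assumes "f differentiable at x" "(\<phi> has_real_derivative d) (at (f x))"
  shows "gradient (\<lambda>x. \<phi> (f x)) x = d *\<^sub>R gradient f x"
  using partial_compose[OF assms] by (simp add: gradient_def vec_eq_iff)

lemma gradient_const_open:
  fixes f :: "real^'n \<Rightarrow> real"
  assumes "open S" "x \<in> S" "\<And>y. y \<in> S \<Longrightarrow> f y = k" shows "gradient f x = 0"
  using partial_cong_open[OF assms(1,2), of f "\<lambda>_. k"] assms(3)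
  by (simp add: gradient_def vec_eq_iff partial_const)

lemma smooth_sqdist: "smooth_on (\<lambda>y :: real^'n. (y - p) \<bullet> (y - p)) S" if "open S"
proof -
  have "Ck_on k (\<lambda>y :: real^'n. y + (- p)) S" for k
    by (intro Ck_on_add that Ck_on_bounded_linear[OF bounded_linear_ident] Ck_on_const)
  then have "Ck_on k (\<lambda>y :: real^'n. y - p) S" for k by simp
  then show ?thesis unfolding smooth_on_def by (intro allI Ck_on_bilinear[OF bounded_bilinear_inner that])
qed

lemma gradient_sqdist: "gradient (\<lambda>y :: real^'n. (y - p) \<bullet> (y - p)) x = 2 *\<^sub>R (x - p)"
proof -
  have "((\<lambda>y. (y - p) \<bullet> (y - p)) has_derivative (\<lambda>v. 2 * ((x - p) \<bullet> v))) (at x)"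
    by (auto intro!: derivative_eq_intros simp: inner_commute)
  from partial_eqI[OF this] show ?thesis by (simp add: gradient_def vec_eq_iff inner_axis)
qed

lemma set_integrable_continuous_compact:
  fixes f :: "real^'n \<Rightarrow> real"
  shows "compact K \<Longrightarrow> continuous_on K f \<Longrightarrow> set_integrable lborel K f"
  unfolding set_integrable_def by (rule borel_integrable_compact)

lemma set_integral_sum_compact:
  fixes f :: "'n::finite \<Rightarrow> real^'n \<Rightarrow> real"
  assumes "compact K" "\<And>i. continuous_on K (f i)"
  shows "(LINT y:K|lborel. (\<Sum>i\<in>UNIV. f i y)) = (\<Sum>i\<in>UNIV. LINT y:K|lborel. f i y)"
  unfolding set_lebesgue_integral_def scaleR_sum_right
  by (rule Bochner_Integration.integral_sum) (rule borel_integrable_compact[OF assms])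

lemma smooth_partial: "smooth_on F S \<Longrightarrow> smooth_on (partial i F) S"
  unfolding partial_def[abs_def] by (rule smooth_on_derivative)

lemma integration_by_parts_open:
  fixes F W :: "real^'n \<Rightarrow> real"
  assumes S: "open S" and F: "smooth_on F S" and W: "smooth_on W S" and K: "compact K" "K \<subseteq> S"
    and W0: "\<And>y. y \<notin> K \<Longrightarrow> W y = 0"
  shows "(LINT y:K|lborel. F y * partial i W y) = - (LINT y:K|lborel. partial i F y * W y)"
proof -
  have oK: "open (- K)" by (rule open_Compl[OF compact_imp_closed[OF K(1)]])
  have pW0: "partial i W y = 0" if "y \<notin> K" for y
  proof -
    have "partial i W y = partial i (\<lambda>_. 0) y" by (rule partial_cong_open[OF oK]) (use that W0 in auto)
    then show ?thesis by (simp add: partial_const)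
  qed
  have dF: "(\<lambda>y. F y * W y) differentiable (at y) \<and>
      partial i (\<lambda>y. F y * W y) y = F y * partial i W y + partial i F y * W y" for y
  proof (cases "y \<in> S")
    case True
    have d: "F differentiable (at y)" "W differentiable (at y)"
      using smooth_on_differentiable[OF F True] smooth_on_differentiable[OF W True] by auto
    show ?thesis using differentiable_mult[OF d] partial_mult[OF d] by simp
  next
    case False
    then have y: "y \<in> - K" using K by blast
    have z: "F x * W x = 0" if "x \<in> - K" for x using W0[of x] that by simp
    have "((\<lambda>y. 0) has_derivative (\<lambda>h. 0)) (at y)" by simp
    then have "((\<lambda>y. F y * W y) has_derivative (\<lambda>h. 0)) (at y)"
      by (rule has_derivative_transform_within_open[OF _ oK y]) (simp only: z)
    then show ?thesis using partial_eqI[of "\<lambda>y. F y * W y" "\<lambda>h. 0" y i] W0[of y] pW0[of y] y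
      by (auto simp: differentiable_def)
  qed
  have cA: "continuous_on UNIV (\<lambda>y. F y * partial i W y)"
    by (rule continuous_on_extend_zero[OF S _ K])
      (auto intro!: continuous_on_mult smooth_on_continuous[OF F] smooth_on_continuous[OF smooth_partial[OF W]] simp: pW0)
  have cB: "continuous_on UNIV (\<lambda>y. partial i F y * W y)"
    by (rule continuous_on_extend_zero[OF S _ K])
      (auto intro!: continuous_on_mult smooth_on_continuous[OF W] smooth_on_continuous[OF smooth_partial[OF F]] simp: W0)
  have iA: "integrable lborel (\<lambda>y. F y * partial i W y)"
    by (rule integrable_compact_support[OF cA K(1)]) (simp add: pW0)
  have iB: "integrable lborel (\<lambda>y. partial i F y * W y)"
    by (rule integrable_compact_support[OF cB K(1)]) (simp add: W0)
  have pF: "partial i (\<lambda>y. F y * W y) = (\<lambda>y. F y * partial i W y + partial i F y * W y)" using dF by blast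
  have "(LINT y|lborel. partial i (\<lambda>y. F y * W y) y) = 0"
  proof (rule integral_partial_zero[OF _ K(1)])
    show "(\<lambda>y. F y * W y) differentiable (at y)" for y using dF by blast
    show "F y * W y = 0" if "y \<notin> K" for y using W0[OF that] by simp
    show "continuous_on UNIV (partial i (\<lambda>y. F y * W y))" unfolding pF by (intro continuous_on_add cA cB)
  qed
  then have "(LINT y|lborel. F y * partial i W y) = - (LINT y|lborel. partial i F y * W y)"
    unfolding pF using Bochner_Integration.integral_add[OF iA iB] by simp
  moreover have "indicator K y *\<^sub>R (F y * partial i W y) = F y * partial i W y" for y
    using pW0[of y] by (cases "y \<in> K") auto
  moreover have "indicator K y *\<^sub>R (partial i F y * W y) = partial i F y * W y" for y
    using W0[of y] by (cases "y \<in> K") auto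
  ultimately show ?thesis unfolding set_lebesgue_integral_def by presburger
qed

definition divergence :: "(real^'n \<Rightarrow> real^'n) \<Rightarrow> real^'n \<Rightarrow> real" where
  "divergence X y = (\<Sum>i\<in>UNIV. partial i (\<lambda>y. X y $ i) y)"

lemma smooth_nth: "open S \<Longrightarrow> smooth_on X S \<Longrightarrow> smooth_on (\<lambda>y. X y $ i) S" for X :: "real^'n \<Rightarrow> real^'m"
  unfolding smooth_on_def by (intro allI Ck_on_vec_nth) auto

lemma continuous_divergence:
  fixes X :: "real^'n \<Rightarrow> real^'n"
  assumes "open S" "smooth_on X S" shows "continuous_on S (divergence X)"
  unfolding divergence_def[abs_def]
  by (intro continuous_on_sum smooth_on_continuous smooth_partial smooth_nth assms)

text \<open>There is no boundary term as soon as one of the two factors vanishes off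
  \<open>K\<close>. Both alternatives occur: for the cutoff it is the conormal field that vanishes,
  for the barrier it is the function.\<close>

lemma divergence_theorem:
  fixes X :: "real^'n \<Rightarrow> real^'n" and F :: "real^'n \<Rightarrow> real"
  assumes S: "open S" and X: "smooth_on X S" and F: "smooth_on F S" and K: "compact K" "K \<subseteq> S"
    and zero: "(\<forall>y. y \<notin> K \<longrightarrow> X y = 0) \<or> (\<forall>y. y \<notin> K \<longrightarrow> F y = 0)"
  shows "(LINT y:K|lborel. X y \<bullet> gradient F y) = - (LINT y:K|lborel. divergence X y * F y)"
proof -
  note Xi = smooth_nth[OF S X]
  have c: "continuous_on K f" if "smooth_on f S" for f :: "real^'n \<Rightarrow> real"
    using continuous_on_subset[OF smooth_on_continuous[OF that] K(2)] .
  have each: "(LINT y:K|lborel. X y $ i * partial i F y) = - (LINT y:K|lborel. partial i (\<lambda>y. X y $ i) y * F y)" for i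
  proof (cases "\<forall>y. y \<notin> K \<longrightarrow> F y = 0")
    case True
    show ?thesis by (rule integration_by_parts_open[OF S Xi F K]) (use True in blast)
  next
    case False
    then have X0: "\<forall>y. y \<notin> K \<longrightarrow> X y = 0" using zero by blast
    have "X y $ i = 0" if y: "y \<notin> K" for y unfolding mp[OF spec[OF X0] y] by simp
    from integration_by_parts_open[OF S F Xi K this, of i]
    show ?thesis by (simp add: mult.commute)
  qed
  have "(LINT y:K|lborel. X y \<bullet> gradient F y) = (\<Sum>i\<in>UNIV. LINT y:K|lborel. X y $ i * partial i F y)"
    unfolding inner_vec_def gradient_def inner_real_def vec_lambda_beta
    by (rule set_integral_sum_compact[OF K(1)]) (intro continuous_on_mult c Xi smooth_partial F)
  also have "\<dots> = - (\<Sum>i\<in>UNIV. LINT y:K|lborel. partial i (\<lambda>y. X y $ i) y * F y)"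
    unfolding each by (simp add: sum_negf)
  also have "(\<Sum>i\<in>UNIV. LINT y:K|lborel. partial i (\<lambda>y. X y $ i) y * F y) = (LINT y:K|lborel. divergence X y * F y)"
    unfolding divergence_def sum_distrib_right
    by (rule set_integral_sum_compact[OF K(1), symmetric]) (intro continuous_on_mult c Xi smooth_partial F)
  finally show ?thesis .
qed

lemma divergence_zero_open:
  fixes X :: "real^'n \<Rightarrow> real^'n"
  assumes "open S" "x \<in> S" "\<And>y. y \<in> S \<Longrightarrow> X y = 0" shows "divergence X x = 0"
proof -
  have "partial i (\<lambda>y. X y $ i) x = partial i (\<lambda>_. 0) x" for i
    by (rule partial_cong_open[OF assms(1,2)]) (simp add: assms(3))
  then show ?thesis by (simp add: divergence_def partial_const)
qed

lemma divergence_scale: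
  fixes X :: "real^'n \<Rightarrow> real^'n"
  assumes S: "open S" "x \<in> S" and X: "smooth_on X S" and f: "smooth_on f S"
  shows "divergence (\<lambda>y. f y *\<^sub>R X y) x = f x * divergence X x + gradient f x \<bullet> X x"
proof -
  have "partial i (\<lambda>y. f y * X y $ i) x = f x * partial i (\<lambda>y. X y $ i) x + partial i f x * X x $ i" for i
    by (rule partial_mult[OF smooth_on_differentiable[OF f S(2)] smooth_on_differentiable[OF smooth_nth[OF S(1) X] S(2)]])
  then show ?thesis
    by (simp add: divergence_def inner_vec_def gradient_def sum.distrib sum_distrib_left)
qed

lemma negative_on_compact:
  fixes f :: "'b::topological_space \<Rightarrow> real"
  assumes "compact S" "continuous_on S f" "\<And>x. x \<in> S \<Longrightarrow> f x < 0"
  obtains e where "e > 0" "\<And>x. x \<in> S \<Longrightarrow> f x \<le> - e"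
proof (cases "S = {}")
  case True
  then show ?thesis using that[of 1] by simp
next
  case False
  obtain x where x: "x \<in> S" "\<And>y. y \<in> S \<Longrightarrow> f y \<le> f x"
    using continuous_attains_sup[OF assms(1) False assms(2)] by blast
  show ?thesis by (rule that[of "- f x"]) (use x assms(3) in auto)
qed

text \<open>A point \<open>y'\<close> off the level set has a closest point \<open>y1\<close> in it.
  The ball about \<open>y'\<close> through \<open>y1\<close> has no level points inside but may have
  several on its sphere; a ball of half the radius, tangent from within at \<open>y1\<close>, meets
  the level set only there.\<close>

lemma interior_touching_ball:
  fixes f :: "real^'n \<Rightarrow> real"
  assumes D: "open D" and f: "continuous_on D f" and y0: "y0 \<in> D" "f y0 = m"
    and near: "\<And>r. r > 0 \<Longrightarrow> \<exists>y. dist y0 y < r \<and> f y \<noteq> m"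
  obtains y1 yc R where "R > 0" "cball yc R \<subseteq> D" "norm (y1 - yc) = R" "f y1 = m"
    "\<And>y. y \<in> cball yc R \<Longrightarrow> y \<noteq> y1 \<Longrightarrow> f y \<noteq> m"
proof -
  obtain r0 where r0: "r0 > 0" "cball y0 r0 \<subseteq> D" using D y0(1) open_contains_cball by blast
  \<comment> \<open>\<open>y'\<close> is chosen within \<open>r\<close> of \<open>y0\<close>, and
    the tangent ball lies within \<open>r\<close> of \<open>y'\<close>. So everything takes place in
    the ball of radius \<open>2 * r\<close> about \<open>y0\<close>.\<close>
  define r where "r = r0 / 2"
  have r: "r > 0" "cball y0 (2 * r) \<subseteq> D" using r0 by (auto simp: r_def)
  obtain y' where y': "dist y0 y' < r" "f y' \<noteq> m" using near[OF r(1)] by blast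
  define Z where "Z = cball y0 (2 * r) \<inter> f -` {m}"
  have "closed Z" unfolding Z_def
    by (rule continuous_closed_preimage[OF continuous_on_subset[OF f r(2)]]) auto
  then have cZ: "compact Z" unfolding Z_def using compact_Int_closed[OF compact_cball] 
    by (metis Int_absorb Int_assoc)
  have y0Z: "y0 \<in> Z" using y0 r by (simp add: Z_def)
  obtain y1 where y1: "y1 \<in> Z" "\<And>z. z \<in> Z \<Longrightarrow> dist y' y1 \<le> dist y' z"
    using distance_attains_inf[of Z y'] compact_imp_closed[OF cZ] y0Z by blast
  define R where "R = dist y' y1 / 2"
  \<comment> \<open>The midpoint of \<open>y'\<close> and \<open>y1\<close>, so that
    \<open>y'\<close> and \<open>y1\<close> are antipodal on the sphere of radius \<open>R\<close>
    about it.\<close>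
  define yc where "yc = (1/2) *\<^sub>R (y' + y1)"
  have "y' \<noteq> y1" using y1(1) y'(2) by (auto simp: Z_def)
  then have R: "R > 0" by (simp add: R_def)
  have yc1: "y1 - yc = (1/2) *\<^sub>R (y1 - y')" "y' - yc = (1/2) *\<^sub>R (y' - y1)"
    by (simp_all add: yc_def vec_eq_iff field_simps)
  have n1: "norm (y1 - yc) = R" unfolding yc1 by (simp add: R_def dist_norm norm_minus_commute)
  have n2: "norm (y' - yc) = R" unfolding yc1 by (simp add: R_def dist_norm)
  have Rr: "2 * R < r" using y1(2)[OF y0Z] y'(1) by (simp add: R_def dist_commute)
  have dist': "dist y' y \<le> 2 * R" if "y \<in> cball yc R" for y
    using that n2 dist_triangle[of y' y yc] by (simp add: dist_norm)
  have sub: "y \<in> cball y0 (2 * r)" if "y \<in> cball yc R" for y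
    using dist'[OF that] dist_triangle[of y0 y y'] y'(1) Rr by simp
  have uniq: "y = y1" if y: "y \<in> cball yc R" and m: "f y = m" for y
  proof -
    have "y \<in> Z" using sub[OF y] m by (simp add: Z_def)
    then have "2 * R \<le> dist y' y" using y1(2) by (simp add: R_def)
    then have d: "norm (y - y') = 2 * R" using dist'[OF y] by (simp add: dist_norm norm_minus_commute)
    define a where "a = y - yc"
    define b where "b = y' - yc"
    have a: "norm a \<le> R" using y by (simp add: a_def dist_norm norm_minus_commute)
    have b: "norm b = R" using n2 by (simp add: b_def)
    have ab: "norm (a - b) = 2 * R" using d by (simp add: a_def b_def)
    \<comment> \<open>By the parallelogram law two vectors of norm at most \<open>R\<close> at
      distance \<open>2 * R\<close> are opposite. So a level point in the ball is the antipode of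
      \<open>y'\<close>, which is \<open>y1\<close>.\<close>
    have "(norm (a + b))\<^sup>2 = 2 * (norm a)\<^sup>2 + 2 * (norm b)\<^sup>2 - (norm (a - b))\<^sup>2"
      by (simp add: power2_norm_eq_inner inner_add inner_diff inner_commute algebra_simps)
    also have "\<dots> \<le> 2 * R\<^sup>2 + 2 * R\<^sup>2 - (2 * R)\<^sup>2"
      using power_mono[OF a norm_ge_zero, of 2] by (simp add: ab b)
    also have "\<dots> = 0" by (simp add: power2_eq_square)
    finally have "a + b = 0" by simp
    then have "y = yc + yc - y'" by (simp add: a_def b_def algebra_simps)
    also have "yc + yc = y' + y1" by (simp add: yc_def vec_eq_iff)
    finally show ?thesis by simp
  qed
  show ?thesis
  proof (rule that[OF R _ n1])
    show "cball yc R \<subseteq> D" using sub r(2) by blast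
    show "f y1 = m" using y1(1) by (simp add: Z_def)
    show "f y \<noteq> m" if "y \<in> cball yc R" "y \<noteq> y1" for y using uniq that by blast
  qed
qed

lemma set_integral_pos_compact:
  fixes f :: "real^'n \<Rightarrow> real"
  assumes K: "compact K" "continuous_on K f" "\<And>y. y \<in> K \<Longrightarrow> f y \<ge> 0" and x: "x \<in> interior K" "f x > 0"
  shows "(LINT y:K|lborel. f y) > 0"
proof -
  have "open (interior K \<inter> f -` {f x / 2<..})"
    by (rule continuous_open_preimage[OF continuous_on_subset[OF K(2) interior_subset]]) auto
  moreover have "x \<in> interior K \<inter> f -` {f x / 2<..}" using x by simp
  ultimately obtain r where r: "r > 0" "ball x r \<subseteq> interior K \<inter> f -` {f x / 2<..}"
    using open_contains_ball by blast
  have B: "y \<in> K \<and> f x / 2 < f y" if "y \<in> ball x r" for y using r(2) that interior_subset by fastforce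
  have i: "set_integrable lborel K f" by (rule set_integrable_continuous_compact[OF K(1,2)])
  have iB: "integrable lborel (\<lambda>y. (f x / 2) * indicator (ball x r) y)"
    using emeasure_bounded_finite[OF bounded_ball, of x r] by (intro integrable_mult_right integrable_real_indicator) auto
  have "0 < f x / 2 * measure lborel (ball x r)" using x(2) content_ball_pos[OF r(1), of x] by simp
  also have "\<dots> = (LINT y|lborel. (f x / 2) * indicator (ball x r) y)" by simp
  also have "\<dots> \<le> (LINT y|lborel. indicator K y *\<^sub>R f y)"
  proof (rule integral_mono[OF iB])
    show "integrable lborel (\<lambda>y. indicator K y *\<^sub>R f y)" using i by (simp add: set_integrable_def)
    show "(f x / 2) * indicator (ball x r) y \<le> indicator K y *\<^sub>R f y" for y
      using B[of y] K(3)[of y] by (cases "y \<in> ball x r"; cases "y \<in> K") (auto simp: indicator_def)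
  qed
  finally show ?thesis by (simp add: set_lebesgue_integral_def)
qed

section \<open>The Laplacian in a chart and testing with cutoff functions\<close>

context riemannian_domain
begin

abbreviation dom where "dom c \<equiv> snd c ` (\<Omega> \<inter> fst c)"

text \<open>\<open>cometric c y\<close> is \<open>\<surd>det g \<cdot> g\<inverse>\<close>, so \<open>divergence (conormal c F) / \<surd>det g\<close> is the Laplacian of \<open>F\<close>.\<close>
definition cometric :: "('a, 'n) chart \<Rightarrow> real^'n \<Rightarrow> real^'n \<Rightarrow> real^'n" where
  "cometric c y v = rho c y *\<^sub>R (matrix_inv (metric G c (chart_inv c y)) *v v)"

definition conormal :: "('a, 'n) chart \<Rightarrow> (real^'n \<Rightarrow> real) \<Rightarrow> real^'n \<Rightarrow> real^'n" where
  "conormal c F y = cometric c y (gradient F y)"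

lemma cometric_add: "cometric c y (v + w) = cometric c y v + cometric c y w"
  by (simp add: cometric_def matrix_vector_right_distrib scaleR_add_right)

lemma cometric_scale: "cometric c y (a *\<^sub>R v) = a *\<^sub>R cometric c y v"
  by (simp add: cometric_def matrix_vector_mult_scaleR)

lemma cometric_zero: "cometric c y 0 = 0"
  by (simp add: cometric_def)

lemma
  assumes c: "c \<in> atlas G" and y: "y \<in> img c"
  shows cometric_sym: "cometric c y v \<bullet> w = cometric c y w \<bullet> v"
    and cometric_pos: "v \<noteq> 0 \<Longrightarrow> cometric c y v \<bullet> v > 0"
    and cometric_nonneg: "cometric c y v \<bullet> v \<ge> 0"
proof -
  let ?g = "metric G c (chart_inv c y)"
  have d: "chart_inv c y \<in> fst c" by (rule chart_inv_dom[OF y])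
  have inv: "?g *v (matrix_inv ?g *v v) = v" for v
    by (simp add: matrix_vector_mul_assoc matrix_inv_works(1)[OF det_metric_nz[OF c d]])
  have r: "rho c y > 0" by (rule rho_pos[OF c y])
  have "(matrix_inv ?g *v v) \<bullet> w = (matrix_inv ?g *v w) \<bullet> v"
    using metric_inner_sym[OF c d, of "matrix_inv ?g *v v" "matrix_inv ?g *v w"] by (simp add: inv)
  then show "cometric c y v \<bullet> w = cometric c y w \<bullet> v" by (simp add: cometric_def)
  show p: "cometric c y v \<bullet> v > 0" if v: "v \<noteq> 0"
  proof -
    have "matrix_inv ?g *v v \<noteq> 0" using inv[of v] v by force
    from metric_pos[OF c d this] have "(matrix_inv ?g *v v) \<bullet> v > 0" by (simp add: inv)
    then show ?thesis using r by (simp add: cometric_def)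
  qed
  show "cometric c y v \<bullet> v \<ge> 0" using p by (cases "v = 0") auto
qed

lemma cometric_add_le:
  assumes c: "c \<in> atlas G" and y: "y \<in> img c"
  shows "cometric c y (v + w) \<bullet> (v + w) \<le> 2 * (cometric c y v \<bullet> v) + 2 * (cometric c y w \<bullet> w)"
proof -
  have "0 \<le> cometric c y (v + (-1) *\<^sub>R w) \<bullet> (v + (-1) *\<^sub>R w)" by (rule cometric_nonneg[OF c y])
  then show ?thesis
    unfolding cometric_add cometric_scale inner_add using cometric_sym[OF c y, of v w] by simp
qed

lemma smooth_cometric:
  assumes c: "c \<in> atlas G" and b: "smooth_on b (img c)"
  shows "smooth_on (\<lambda>y. cometric c y (b y)) (img c)"
  unfolding smooth_on_def cometric_def
proof (intro allI Ck_on_bilinear[OF bounded_bilinear_scaleR open_img[OF c]] Ck_rho[OF c])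
  fix k
  have m: "Ck_on k (\<lambda>y. metric G c (chart_inv c y)) (img c)" using smooth_onD[OF smooth_metric[OF c]] by (simp add: o_def)
  show "Ck_on k (\<lambda>y. matrix_inv (metric G c (chart_inv c y)) *v b y) (img c)"
    by (rule Ck_on_matrix_inv[OF open_img[OF c] m smooth_onD[OF b] det_metric_nz[OF c chart_inv_dom]])
qed

lemma smooth_conormal:
  "c \<in> atlas G \<Longrightarrow> smooth_on F (img c) \<Longrightarrow> smooth_on (conormal c F) (img c)"
  unfolding conormal_def[abs_def] by (intro smooth_cometric smooth_gradient open_img)

lemma dv_gradient: "c \<in> atlas G \<Longrightarrow> y \<in> img c \<Longrightarrow> dv v c (chart_inv c y) = gradient (v \<circ> chart_inv c) y"
  by (simp add: dv_def gradient_def chart_chart_inv)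

lemma compact_chart_inv:
  assumes c: "c \<in> atlas G" and K: "compact K" "K \<subseteq> dom c"
  shows "compact (chart_inv c ` K)" "chart_inv c ` K \<subseteq> \<Omega> \<inter> fst c" "K \<subseteq> img c"
proof -
  show i: "K \<subseteq> img c" using K(2) by blast
  show "compact (chart_inv c ` K)" by (intro compact_continuous_image K continuous_on_subset[OF continuous_chart_inv[OF c] i])
  show "chart_inv c ` K \<subseteq> \<Omega> \<inter> fst c"
  proof
    fix p assume "p \<in> chart_inv c ` K"
    then obtain y where y: "y \<in> K" "p = chart_inv c y" by blast
    then obtain q where q: "q \<in> \<Omega>" "q \<in> fst c" "y = snd c q" using K(2) by blast
    then show "p \<in> \<Omega> \<inter> fst c" using y(2) by (simp add: chart_inv_chart[OF c])
  qed
qed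

text \<open>The density \<open>rho\<close> of the volume and the inverse metric merge into
  \<open>cometric\<close>, so the energy over a compact part of a chart becomes a Lebesgue integral
  to which the Euclidean divergence theorem applies.\<close>

lemma chart_energy:
  assumes c: "c \<in> atlas G" and u: "chart_smooth u" and w: "chart_smooth w" and K: "compact K" "K \<subseteq> dom c"
  shows "(LINT x:chart_inv c ` K|\<nu>. rinner G (grad G u) (grad G w) x) =
    (LINT y:K|lborel. conormal c (u \<circ> chart_inv c) y \<bullet> gradient (w \<circ> chart_inv c) y)"
proof -
  let ?L = "chart_inv c ` K" and ?r = "rinner G (grad G u) (grad G w)"
  note L = compact_chart_inv[OF c K]
  define F where "F x = indicator ?L x * ?r x" for x
  have Lb: "?L \<in> sets borel" by (rule borel_closed[OF compact_imp_closed[OF L(1)]])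
  have "(\<lambda>x. indicator ?L x * (indicator \<Omega> x * ?r x)) \<in> borel_measurable borel"
    using Lb by (intro borel_measurable_times borel_measurable_indicator rinner_measurable measurable_vfield_grad u w)
  moreover have "indicator ?L x * (indicator \<Omega> x * ?r x) = indicator (fst c) x * F x" for x
    using L(2) by (auto simp: F_def indicator_def)
  ultimately have m: "(\<lambda>x. indicator (fst c) x * F x) \<in> borel_measurable borel" by simp
  have "indicator (fst c) x *\<^sub>R F x = indicator ?L x *\<^sub>R ?r x" for x using L(2) by (auto simp: F_def indicator_def)
  then have "(LINT x:?L|\<nu>. ?r x) = (LINT x:fst c|\<nu>. F x)" by (simp add: set_lebesgue_integral_def)
  also have "\<dots> = (LINT y:img c|lborel. rho c y * F (chart_inv c y))" by (rule chart_integral(1)[OF c m])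
  also have "\<dots> = (LINT y:K|lborel. conormal c (u \<circ> chart_inv c) y \<bullet> gradient (w \<circ> chart_inv c) y)"
    unfolding set_lebesgue_integral_def
  proof (intro Bochner_Integration.integral_cong refl)
    fix y
    show "indicator (img c) y *\<^sub>R (rho c y * F (chart_inv c y)) =
      indicator K y *\<^sub>R (conormal c (u \<circ> chart_inv c) y \<bullet> gradient (w \<circ> chart_inv c) y)"
    proof (cases "y \<in> K")
      case True
      then have y: "y \<in> img c" using L(3) by blast
      have p: "chart_inv c y \<in> ?L" using True by blast
      then have pd: "chart_inv c y \<in> \<Omega>" "chart_inv c y \<in> fst c" using L(2) by blast+
      let ?p = "chart_inv c y" and ?gu = "gradient (u \<circ> chart_inv c) y" and ?gw = "gradient (w \<circ> chart_inv c) y"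
      have eu: "grad G u c ?p = matrix_inv (metric G c ?p) *v ?gu" using grad_eq[of u c ?p] dv_gradient[OF c y, of u] by (rule trans[OF _ arg_cong])
      have ew: "metric G c ?p *v grad G w c ?p = ?gw" using metric_grad[OF c pd(2)] dv_gradient[OF c y] by (rule trans)
      have "?r ?p = grad G u c ?p \<bullet> (metric G c ?p *v grad G w c ?p)"
        by (rule rinner_chart[OF grad_vfield[OF u] grad_vfield[OF w] c pd])
      then have r: "?r ?p = (matrix_inv (metric G c ?p) *v ?gu) \<bullet> ?gw" unfolding ew eu .
      have i: "indicator (img c) y = (1::real)" "indicator K y = (1::real)" "indicator ?L ?p = (1::real)"
        by (rule indicator_simps(1)[OF y], rule indicator_simps(1)[OF True], rule indicator_simps(1)[OF p])
      show ?thesis unfolding F_def conormal_def cometric_def r i inner_scaleR_left by simp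
    next
      case False
      have "chart_inv c y \<notin> ?L" if y: "y \<in> img c"
      proof
        assume "chart_inv c y \<in> ?L"
        then obtain k where k: "chart_inv c y = chart_inv c k" "k \<in> K" by (rule imageE)
        have "y = snd c (chart_inv c k)" unfolding k(1)[symmetric] by (rule chart_chart_inv[OF y, symmetric])
        also have "\<dots> = k" by (rule chart_chart_inv[OF subsetD[OF L(3) k(2)]])
        finally show False using False k(2) by simp
      qed
      then have "indicator (img c) y * F (chart_inv c y) = (0::real)"
        unfolding F_def by (cases "y \<in> img c") (simp_all only: indicator_simps mult_zero_left mult_zero_right not_False_eq_True)
      then have "indicator (img c) y *\<^sub>R (rho c y * F (chart_inv c y)) = 0" by (simp only: real_scaleR_def mult.left_commute mult_zero_right)
      then show ?thesis unfolding indicator_simps(2)[OF False] by simp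
    qed
  qed
  finally show ?thesis .
qed

lemma energy_in_chart:
  assumes c: "c \<in> atlas G" and u: "u \<in> T" and w: "w \<in> T" and K: "compact K" "K \<subseteq> dom c"
    and out: "\<And>x. x \<notin> chart_inv c ` K \<Longrightarrow> w x = 0"
  shows "E u w = (LINT y:K|lborel. conormal c (u \<circ> chart_inv c) y \<bullet> gradient (w \<circ> chart_inv c) y)"
proof -
  note L = compact_chart_inv[OF c K]
  have z: "rinner G (grad G u) (grad G w) x = 0" if "x \<notin> chart_inv c ` K" for x
    unfolding rinner_sym[of "grad G u"] by (rule rinner_grad_outside[OF L(1) that out])
  have "indicator \<Omega> x *\<^sub>R rinner G (grad G u) (grad G w) x = indicator (chart_inv c ` K) x *\<^sub>R rinner G (grad G u) (grad G w) x" for x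
    using L(2) z[of x] by (cases "x \<in> chart_inv c ` K") auto
  then have "E u w = (LINT x:chart_inv c ` K|\<nu>. rinner G (grad G u) (grad G w) x)"
    unfolding test_E[OF u w] ip_def set_lebesgue_integral_def by presburger
  then show ?thesis unfolding chart_energy[OF c test_smooth[OF u] test_smooth[OF w] K] .
qed

lemma energy_chart_le:
  assumes c: "c \<in> atlas G" and u: "u \<in> T" and K: "compact K" "K \<subseteq> dom c"
  shows "(LINT y:K|lborel. conormal c (u \<circ> chart_inv c) y \<bullet> gradient (u \<circ> chart_inv c) y) \<le> E u u"
proof -
  note L = compact_chart_inv[OF c K]
  let ?r = "rinner G (grad G u) (grad G u)"
  have i: "set_integrable \<nu> \<Omega> ?r" by (rule rinner_integrable[OF test_grad_VF[OF u] test_grad_VF[OF u]])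
  have Lb: "chart_inv c ` K \<in> sets \<nu>" using borel_closed[OF compact_imp_closed[OF L(1)]] by simp
  have j: "set_integrable \<nu> (chart_inv c ` K) ?r" by (rule set_integrable_subset[OF i Lb]) (use L(2) in blast)
  have "(LINT x:chart_inv c ` K|\<nu>. ?r x) \<le> (LINT x:\<Omega>|\<nu>. ?r x)"
    unfolding set_lebesgue_integral_def
  proof (rule integral_mono)
    show "indicator (chart_inv c ` K) x *\<^sub>R ?r x \<le> indicator \<Omega> x *\<^sub>R ?r x" for x
      using L(2) rinner_nonneg[of "grad G u" x] by (auto simp: indicator_def)
  qed (use i j in \<open>simp_all only: set_integrable_def\<close>)
  then show ?thesis unfolding chart_energy[OF c test_smooth[OF u] test_smooth[OF u] K] test_E[OF u u] ip_def .
qed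

definition from_chart :: "('a, 'n) chart \<Rightarrow> (real^'n \<Rightarrow> real) \<Rightarrow> 'a \<Rightarrow> real" where
  "from_chart c H x = (if x \<in> fst c then H (snd c x) else 0)"

text \<open>Smoothness is local. Around a point of the domain of \<open>c\<close> the function is
  \<open>H\<close> after a transition map; any other point lies in the complement of the image of
  \<open>K\<close>, which is open since compact sets are closed, and there the function is
  zero.\<close>

lemma from_chart:
  assumes c: "c \<in> atlas G" and H: "smooth_on H (img c)" and K: "compact K" "K \<subseteq> dom c"
    and out: "\<And>y. y \<notin> K \<Longrightarrow> H y = 0"
  shows "from_chart c H \<in> T" "x \<notin> chart_inv c ` K \<Longrightarrow> from_chart c H x = 0"
    "y \<in> img c \<Longrightarrow> from_chart c H (chart_inv c y) = H y"
proof -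
  note L = compact_chart_inv[OF c K]
  show z: "from_chart c H x = 0" if "x \<notin> chart_inv c ` K" for x
  proof (cases "x \<in> fst c")
    case True
    have "snd c x \<notin> K"
    proof
      assume "snd c x \<in> K"
      then have "chart_inv c (snd c x) \<in> chart_inv c ` K" by blast
      then show False using that by (simp add: chart_inv_chart[OF c True])
    qed
    then show ?thesis by (simp add: from_chart_def out)
  qed (simp add: from_chart_def)
  show "from_chart c H (chart_inv c y) = H y" if "y \<in> img c" for y
    by (simp add: from_chart_def chart_inv_dom[OF that] chart_chart_inv[OF that])
  have "chart_smooth (from_chart c H)"
    unfolding chart_smooth_def smooth_on_def
  proof (intro ballI allI Ck_on_local)
    fix c' k y assume c': "c' \<in> atlas G" and y: "y \<in> img c'"
    define p where "p = chart_inv c' y"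
    have p: "p \<in> fst c'" "snd c' p = y" using chart_inv_dom[OF y] chart_chart_inv[OF y] by (simp_all add: p_def)
    show "\<exists>U. open U \<and> y \<in> U \<and> Ck_on k (from_chart c H \<circ> chart_inv c') U"
    proof (cases "p \<in> fst c")
      case True
      let ?U = "snd c' ` (fst c' \<inter> fst c)"
      have oU: "open ?U" by (rule open_overlap[OF c' c])
      have im: "transition c' c ` ?U \<subseteq> img c"
      proof
        fix z assume "z \<in> transition c' c ` ?U"
        then obtain q where q: "q \<in> fst c'" "q \<in> fst c" "z = transition c' c (snd c' q)" by blast
        then show "z \<in> img c" by (simp add: transition_apply[OF q(1) c'])
      qed
      have C: "Ck_on k (\<lambda>z. H (transition c' c z)) ?U"
        by (rule Ck_on_compose[OF oU open_img[OF c] im smooth_onD[OF smooth_transition[OF c' c]] smooth_onD[OF H]])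
      have e: "(from_chart c H \<circ> chart_inv c') z = H (transition c' c z)" if zU: "z \<in> ?U" for z
      proof -
        obtain q where q: "q \<in> fst c'" "q \<in> fst c" "z = snd c' q" using zU by blast
        then show ?thesis by (simp add: transition_apply[OF q(1) c'] chart_inv_chart[OF c' q(1)] from_chart_def)
      qed
      have "Ck_on k (from_chart c H \<circ> chart_inv c') ?U" by (rule Ck_on_cong[OF oU e, THEN iffD2, OF _ C])
      moreover have "y \<in> ?U" using True p by force
      ultimately show ?thesis using oU by (intro exI conjI)
    next
      case False
      let ?U = "snd c' ` (- (chart_inv c ` K) \<inter> fst c')"
      have oU: "open ?U" by (rule open_chart_image[OF c' open_Compl[OF compact_imp_closed[OF L(1)]]])
      have e: "(from_chart c H \<circ> chart_inv c') z = 0" if zU: "z \<in> ?U" for z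
      proof -
        obtain q where q: "q \<in> fst c'" "q \<notin> chart_inv c ` K" "z = snd c' q" using zU by blast
        then show ?thesis by (simp add: chart_inv_chart[OF c' q(1)] z)
      qed
      have "Ck_on k (from_chart c H \<circ> chart_inv c') ?U" by (rule Ck_on_cong[OF oU e, THEN iffD2, OF _ Ck_on_const])
      moreover have "p \<notin> chart_inv c ` K" using False L(2) by blast
      then have "y \<in> ?U" using p by force
      ultimately show ?thesis using oU by (intro exI conjI)
    qed
  qed
  then show "from_chart c H \<in> T" by (rule testI[OF _ L(1)]) (use L(2) z in blast)+
qed

lemma gradient_from_chart:
  assumes "c \<in> atlas G" "y \<in> img c" "\<And>y. y \<in> img c \<Longrightarrow> from_chart c H (chart_inv c y) = H y"
  shows "gradient (from_chart c H \<circ> chart_inv c) y = gradient H y"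
proof -
  have "partial i (from_chart c H \<circ> chart_inv c) y = partial i H y" for i
    by (rule partial_cong_open[OF open_img[OF assms(1)] assms(2)]) (simp add: assms(3))
  then show ?thesis by (simp add: gradient_def)
qed

text \<open>
  Testing with \<open>\<kappa> f'(v - \<psi>)\<close> for a convex \<open>f\<close>: the term that is quadratic in the gradient of \<open>v\<close> has a sign,
  and the one that is linear in it equals \<open>\<nabla>\<kappa> \<cdot> \<nabla>f(v - \<psi>)\<close> and can be integrated by parts.
\<close>
lemma test_cutoff:
  fixes \<kappa> \<psi> :: "real^'n \<Rightarrow> real"
  assumes c: "c \<in> atlas G" and K: "compact K" "K \<subseteq> dom c"
    and \<kappa>: "smooth_on \<kappa> (img c)" "\<And>y. 0 \<le> \<kappa> y" "\<And>y. \<kappa> y \<le> 1" "\<And>y. y \<notin> K \<Longrightarrow> \<kappa> y = 0"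
    and \<psi>: "smooth_on \<psi> (img c)" and v: "v \<in> T"
  defines "z \<equiv> \<lambda>y. v (chart_inv c y) - \<psi> y"
  defines "w \<equiv> from_chart c (\<lambda>y. \<kappa> y * convex_flat' (z y))"
  shows "w \<in> T" "w x \<ge> 0"
    and "E v w \<ge> (LINT y:K|lborel. - (divergence (conormal c \<kappa>) y * convex_flat (z y))
        - divergence (conormal c \<psi>) y * (\<kappa> y * convex_flat' (z y)))"
    and "E w w \<le> (LINT y:K|lborel. 2 * (conormal c \<kappa> y \<bullet> gradient \<kappa> y) + 144 * (conormal c \<psi> y \<bullet> gradient \<psi> y)) + 144 * E v v"
proof -
  let ?V = "v \<circ> chart_inv c"
  note oI = open_img[OF c] and KI = compact_chart_inv(3)[OF c K]
  define H where "H y = \<kappa> y * convex_flat' (z y)" for y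
  have w: "w = from_chart c H" by (simp add: w_def H_def[abs_def])
  have V: "smooth_on ?V (img c)" by (rule chart_smoothD[OF test_smooth[OF v] c])
  have zV: "z = (\<lambda>y. ?V y - \<psi> y)" by (simp add: z_def fun_eq_iff)
  have sz: "smooth_on z (img c)"
  proof -
    have "Ck_on k (\<lambda>y. ?V y + (-1) * \<psi> y) (img c)" for k
      by (intro Ck_on_add Ck_on_bilinear[OF bounded_bilinear_mult] oI Ck_on_const smooth_onD[OF V] smooth_onD[OF \<psi>])
    then show ?thesis by (simp add: smooth_on_def zV)
  qed
  have comp: "smooth_on (\<lambda>y. f (z y)) (img c)" if "smooth_on f UNIV" for f :: "real \<Rightarrow> real"
    unfolding smooth_on_def by (intro allI Ck_on_compose[OF oI open_UNIV _ smooth_onD[OF sz] smooth_onD[OF that]]) simp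
  have sW: "smooth_on H (img c)"
    unfolding smooth_on_def H_def[abs_def]
    by (intro allI Ck_on_bilinear[OF bounded_bilinear_mult] oI smooth_onD[OF \<kappa>(1)] smooth_onD[OF comp[OF smooth_convex_flat']])
  have W0: "H y = 0" if "y \<notin> K" for y by (simp add: H_def \<kappa>(4)[OF that])
  note fc = from_chart[OF c sW K W0]
  show wT: "w \<in> T" unfolding w by (rule fc(1))
  show "w x \<ge> 0" unfolding w from_chart_def H_def by (simp add: \<kappa>(2) convex_flat'_bounds(1))
  have gw: "gradient (w \<circ> chart_inv c) y = gradient H y" if "y \<in> img c" for y
    unfolding w by (rule gradient_from_chart[OF c that fc(3)])
  have d: "?V differentiable at y" "\<psi> differentiable at y" "\<kappa> differentiable at y" "z differentiable at y"
      "(\<lambda>y. convex_flat' (z y)) differentiable at y" if "y \<in> img c" for y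
    by (rule smooth_on_differentiable[OF _ that], fact V \<psi> \<kappa>(1) sz comp[OF smooth_convex_flat'])+
  have gz: "gradient z y = gradient ?V y - gradient \<psi> y" if "y \<in> img c" for y
    unfolding zV by (rule gradient_diff[OF d(1,2)[OF that]])
  have gW: "gradient H y = convex_flat' (z y) *\<^sub>R gradient \<kappa> y + (\<kappa> y * convex_flat'' (z y)) *\<^sub>R gradient z y" if y: "y \<in> img c" for y
    unfolding H_def[abs_def] gradient_mult[OF d(3,5)[OF y]] gradient_compose[OF d(4)[OF y] convex_flat'_has_derivative]
    by (simp add: algebra_simps)
  have gG: "gradient (\<lambda>y. convex_flat (z y)) y = convex_flat' (z y) *\<^sub>R gradient z y" if y: "y \<in> img c" for y
    by (rule gradient_compose[OF d(4)[OF y] convex_flat_has_derivative])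
  have cont: "continuous_on K f" if "smooth_on f (img c)" for f :: "real^'n \<Rightarrow> 'z::real_normed_vector"
    by (rule continuous_on_subset[OF smooth_on_continuous[OF that] KI])
  note sg = smooth_gradient[OF oI] and sc = smooth_conormal[OF c]
  have int: "set_integrable lborel K (\<lambda>y. conormal c F y \<bullet> gradient F' y)"
    if "smooth_on F (img c)" "smooth_on F' (img c)" for F F'
    by (intro set_integrable_continuous_compact[OF K(1)] continuous_on_inner cont sg sc that)
  let ?G = "\<lambda>y. convex_flat (z y)"
  note sG = comp[OF smooth_convex_flat]
  have co\<kappa>: "conormal c \<kappa> y = 0" if "y \<notin> K" for y
  proof -
    have "gradient \<kappa> y = 0"
      by (rule gradient_const_open[OF open_Compl[OF compact_imp_closed[OF K(1)]], where k = 0]) (use that \<kappa>(4) in auto)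
    then show ?thesis by (simp add: conormal_def cometric_zero)
  qed
  \<comment> \<open>The estimate starts from its lower bound: the divergence theorem puts the
    derivatives back onto \<open>?G\<close> and \<open>H\<close>, where they can be compared with
    the energy density pointwise.\<close>
  have "(LINT y:K|lborel. - (divergence (conormal c \<kappa>) y * ?G y) - divergence (conormal c \<psi>) y * H y)
      = - (LINT y:K|lborel. divergence (conormal c \<kappa>) y * ?G y) - (LINT y:K|lborel. divergence (conormal c \<psi>) y * H y)"
  proof -
    have "set_integrable lborel K (\<lambda>y. divergence (conormal c F) y * F' y)" if "smooth_on F (img c)" "smooth_on F' (img c)" for F F'
      by (intro set_integrable_continuous_compact[OF K(1)] continuous_on_mult cont that
          continuous_on_subset[OF continuous_divergence[OF oI sc] KI])
    note i = this[OF \<kappa>(1) sG] this[OF \<psi> sW]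
    have "set_integrable lborel K (\<lambda>y. - (divergence (conormal c \<kappa>) y * ?G y))"
      using i(1) unfolding set_integrable_def by simp
    from set_integral_diff(2)[OF this i(2)] show ?thesis by (simp add: set_lebesgue_integral_def)
  qed
  also have "\<dots> = (LINT y:K|lborel. conormal c \<kappa> y \<bullet> gradient ?G y) + (LINT y:K|lborel. conormal c \<psi> y \<bullet> gradient H y)"
    using divergence_theorem[OF oI sc[OF \<kappa>(1)] sG K(1) KI] divergence_theorem[OF oI sc[OF \<psi>] sW K(1) KI] co\<kappa> W0 by simp
  also have "\<dots> = (LINT y:K|lborel. conormal c \<kappa> y \<bullet> gradient ?G y + conormal c \<psi> y \<bullet> gradient H y)"
    by (rule set_integral_add(2)[symmetric, OF int[OF \<kappa>(1) sG] int[OF \<psi> sW]])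
  also have "\<dots> \<le> (LINT y:K|lborel. conormal c ?V y \<bullet> gradient (w \<circ> chart_inv c) y)"
  proof (rule set_integral_mono)
    show "set_integrable lborel K (\<lambda>y. conormal c \<kappa> y \<bullet> gradient ?G y + conormal c \<psi> y \<bullet> gradient H y)"
      by (rule set_integral_add(1)[OF int[OF \<kappa>(1) sG] int[OF \<psi> sW]])
    show "set_integrable lborel K (\<lambda>y. conormal c ?V y \<bullet> gradient (w \<circ> chart_inv c) y)"
      by (rule int[OF V chart_smoothD[OF test_smooth[OF wT] c]])
    fix y assume "y \<in> K"
    then have y: "y \<in> img c" using KI by blast
    have gV: "gradient ?V y = gradient z y + gradient \<psi> y" using gz[OF y] by simp
    have e1: "conormal c ?V y \<bullet> gradient H y = cometric c y (gradient z y) \<bullet> gradient H y + conormal c \<psi> y \<bullet> gradient H y"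
      unfolding conormal_def gV cometric_add inner_add_left ..
    \<comment> \<open>The cross term is exactly the gradient of \<open>?G\<close> paired with that
      of the cutoff, by symmetry of the cometric. The rest is quadratic in the gradient of
      \<open>z\<close> and nonnegative by convexity.\<close>
    have e2: "cometric c y (gradient z y) \<bullet> gradient H y =
        conormal c \<kappa> y \<bullet> gradient ?G y + (\<kappa> y * convex_flat'' (z y)) * (cometric c y (gradient z y) \<bullet> gradient z y)"
      unfolding gW[OF y] gG[OF y] conormal_def inner_add_right inner_scaleR_right
      using cometric_sym[OF c y, of "gradient z y" "gradient \<kappa> y"] by simp
    have e3: "0 \<le> (\<kappa> y * convex_flat'' (z y)) * (cometric c y (gradient z y) \<bullet> gradient z y)"
      by (intro mult_nonneg_nonneg \<kappa>(2) convex_flat''_bounds(1) cometric_nonneg[OF c y])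
    show "conormal c \<kappa> y \<bullet> gradient ?G y + conormal c \<psi> y \<bullet> gradient H y \<le> conormal c ?V y \<bullet> gradient (w \<circ> chart_inv c) y"
      unfolding gw[OF y] e1 e2 using e3 by linarith
  qed
  also have "\<dots> = E v w" by (rule energy_in_chart[OF c v wT K, symmetric]) (simp add: w fc(2))
  finally show "E v w \<ge> (LINT y:K|lborel. - (divergence (conormal c \<kappa>) y * convex_flat (z y))
        - divergence (conormal c \<psi>) y * (\<kappa> y * convex_flat' (z y)))" unfolding H_def .
  have i2: "set_integrable lborel K (\<lambda>y. 2 * (conormal c \<kappa> y \<bullet> gradient \<kappa> y) + 144 * (conormal c \<psi> y \<bullet> gradient \<psi> y))"
    by (intro set_integral_add(1) set_integrable_mult_right int \<kappa>(1) \<psi>)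
  have i3: "set_integrable lborel K (\<lambda>y. 144 * (conormal c ?V y \<bullet> gradient ?V y))"
    by (intro set_integrable_mult_right int V)
  have "E w w = (LINT y:K|lborel. conormal c (w \<circ> chart_inv c) y \<bullet> gradient (w \<circ> chart_inv c) y)"
    by (rule energy_in_chart[OF c wT wT K]) (simp add: w fc(2))
  also have "\<dots> \<le> (LINT y:K|lborel. (2 * (conormal c \<kappa> y \<bullet> gradient \<kappa> y) + 144 * (conormal c \<psi> y \<bullet> gradient \<psi> y))
      + 144 * (conormal c ?V y \<bullet> gradient ?V y))"
  proof (rule set_integral_mono)
    have sw: "smooth_on (w \<circ> chart_inv c) (img c)" by (rule chart_smoothD[OF test_smooth[OF wT] c])
    show "set_integrable lborel K (\<lambda>y. conormal c (w \<circ> chart_inv c) y \<bullet> gradient (w \<circ> chart_inv c) y)" by (rule int[OF sw sw])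
    show "set_integrable lborel K (\<lambda>y. (2 * (conormal c \<kappa> y \<bullet> gradient \<kappa> y) + 144 * (conormal c \<psi> y \<bullet> gradient \<psi> y))
      + 144 * (conormal c ?V y \<bullet> gradient ?V y))" by (rule set_integral_add(1)[OF i2 i3])
    fix y assume "y \<in> K"
    then have y: "y \<in> img c" using KI by blast
    let ?Q = "\<lambda>v. cometric c y v \<bullet> v"
    have sc: "?Q (a *\<^sub>R v) = a\<^sup>2 * ?Q v" for a v by (simp add: cometric_scale power2_eq_square)
    \<comment> \<open>Two applications of \<open>cometric_add_le\<close> with
      \<open>s\<^sup>2 \<le> 36\<close> between them account for the constant
      \<open>2 * 36 * 2 = 144\<close>.\<close>
    define s where "s = \<kappa> y * convex_flat'' (z y)"
    have s: "0 \<le> s" "s \<le> 6"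
      using \<kappa>(2,3)[of y] convex_flat''_bounds[of "z y"] mult_mono[of "\<kappa> y" 1 "convex_flat'' (z y)" 6] by (simp_all add: s_def)
    have s2: "s\<^sup>2 \<le> 36" using power_mono[OF s(2,1), of 2] by simp
    have t2: "(convex_flat' (z y))\<^sup>2 \<le> 1" using power_mono[OF convex_flat'_bounds(2,1), of "z y" 2] by simp
    have "?Q (gradient H y) \<le> 2 * ?Q (convex_flat' (z y) *\<^sub>R gradient \<kappa> y) + 2 * ?Q (s *\<^sub>R gradient z y)"
      unfolding gW[OF y] s_def by (rule cometric_add_le[OF c y])
    also have "\<dots> \<le> 2 * (1 * ?Q (gradient \<kappa> y)) + 2 * (36 * ?Q (gradient z y))"
      unfolding sc by (intro add_mono mult_left_mono mult_right_mono t2 s2 cometric_nonneg[OF c y]) auto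
    also have "?Q (gradient z y) \<le> 2 * ?Q (gradient ?V y) + 2 * ?Q ((-1) *\<^sub>R gradient \<psi> y)"
      using cometric_add_le[OF c y, of "gradient ?V y" "(-1) *\<^sub>R gradient \<psi> y"] by (simp add: gz[OF y])
    finally show "conormal c (w \<circ> chart_inv c) y \<bullet> gradient (w \<circ> chart_inv c) y \<le>
      2 * (conormal c \<kappa> y \<bullet> gradient \<kappa> y) + 144 * (conormal c \<psi> y \<bullet> gradient \<psi> y) + 144 * (conormal c ?V y \<bullet> gradient ?V y)"
      unfolding conormal_def gw[OF y] sc by simp
  qed
  also have "\<dots> = (LINT y:K|lborel. 2 * (conormal c \<kappa> y \<bullet> gradient \<kappa> y) + 144 * (conormal c \<psi> y \<bullet> gradient \<psi> y))
      + 144 * (LINT y:K|lborel. conormal c ?V y \<bullet> gradient ?V y)"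
    unfolding set_integral_add(2)[OF i2 i3] by (simp only: set_integral_mult_right)
  finally show "E w w \<le> (LINT y:K|lborel. 2 * (conormal c \<kappa> y \<bullet> gradient \<kappa> y) + 144 * (conormal c \<psi> y \<bullet> gradient \<psi> y)) + 144 * E v v"
    using energy_chart_le[OF c v K] by simp
qed

end

section \<open>Hopf's barrier and the strong maximum principle\<close>

context riemannian_domain
begin

text \<open>Hopf's barrier \<open>\<psi> = const - \<epsilon> exp (- \<alpha> |y - yc|\<^sup>2)\<close> is strictly superharmonic near \<open>y1\<close> for large \<open>\<alpha>\<close>.\<close>
lemma hopf_barrier:
  fixes U :: "real^'n \<Rightarrow> real"
  assumes c: "c \<in> atlas G" and U: "continuous_on (dom c) U" "\<And>y. y \<in> dom c \<Longrightarrow> U y \<le> m"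
    and R: "R > 0" "cball yc R \<subseteq> dom c" "norm (y1 - yc) = R" and y1: "U y1 = m"
    and ne: "\<And>y. y \<in> cball yc R \<Longrightarrow> y \<noteq> y1 \<Longrightarrow> U y \<noteq> m"
  obtains K \<kappa> \<psi> where "compact K" "K \<subseteq> dom c" "y1 \<in> interior K"
    "smooth_on \<kappa> (img c)" "\<And>y. 0 \<le> \<kappa> y" "\<And>y. \<kappa> y \<le> 1" "\<And>y. y \<notin> K \<Longrightarrow> \<kappa> y = 0" "\<kappa> y1 > 0"
    "smooth_on \<psi> (img c)" "\<And>y. y \<in> K \<Longrightarrow> divergence (conormal c \<psi>) y < 0" "\<psi> y1 < U y1"
    "\<And>y. y \<in> K \<Longrightarrow> divergence (conormal c \<kappa>) y = 0 \<or> U y \<le> \<psi> y"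
proof -
  note oI = open_img[OF c]
  have oD: "open (dom c)" by (rule open_chart_image[OF c open_domain])
  have DI: "dom c \<subseteq> img c" by blast
  define s where "s y = (y - yc) \<bullet> (y - yc)" for y
  have ss: "smooth_on s S" if "open S" for S using smooth_sqdist[OF that, of yc] by (simp add: s_def[abs_def])
  have ds: "s differentiable at y" for y by (rule smooth_on_differentiable[OF ss[OF open_UNIV] UNIV_I])
  have gs: "gradient s y = 2 *\<^sub>R (y - yc)" for y using gradient_sqdist[of yc y] by (simp add: s_def[abs_def])
  have sn: "s y = (norm (y - yc))\<^sup>2" for y by (simp add: s_def power2_norm_eq_inner)
  define X where "X = conormal c s"
  have sX: "smooth_on X (img c)" unfolding X_def by (rule smooth_conormal[OF c ss[OF oI]])
  \<comment> \<open>The divergence of the conormal field of the barrier is a positive multiple of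
    \<open>divergence X - \<alpha> * \<beta>\<close>. Since \<open>y1\<close> is not the centre,
    \<beta> is positive there, and a large \<alpha> decides the sign nearby.\<close>
  define \<beta> where "\<beta> y = X y \<bullet> gradient s y" for y
  have y1D: "y1 \<in> dom c" using R by (simp add: subset_iff dist_norm norm_minus_commute)
  then have y1I: "y1 \<in> img c" using DI by blast
  have "y1 - yc \<noteq> 0" using R by auto
  then have b1: "\<beta> y1 > 0"
    unfolding \<beta>_def X_def conormal_def by (intro cometric_pos[OF c y1I]) (simp add: gs)
  have c\<beta>: "continuous_on (img c) \<beta>"
    unfolding \<beta>_def[abs_def]
    by (intro continuous_on_inner smooth_on_continuous[OF sX] smooth_on_continuous[OF smooth_gradient[OF oI ss[OF oI]]])
  have "open (dom c \<inter> \<beta> -` {\<beta> y1 / 2<..})"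
    by (rule continuous_open_preimage[OF continuous_on_subset[OF c\<beta> DI] oD]) auto
  moreover have "y1 \<in> dom c \<inter> \<beta> -` {\<beta> y1 / 2<..}" using y1D b1 by simp
  ultimately obtain \<rho> where \<rho>: "\<rho> > 0" "cball y1 \<rho> \<subseteq> dom c \<inter> \<beta> -` {\<beta> y1 / 2<..}"
    using open_contains_cball by blast
  define K where "K = cball y1 \<rho>"
  have K: "compact K" "K \<subseteq> dom c" "K \<subseteq> img c" "\<And>y. y \<in> K \<Longrightarrow> \<beta> y > \<beta> y1 / 2" using \<rho>(2) DI by (auto simp: K_def)
  obtain B where B: "B > 0" "\<And>y. y \<in> K \<Longrightarrow> \<bar>divergence X y\<bar> \<le> B"
    using compact_in_chart[OF c K(1,3) continuous_divergence[OF oI sX]] by blast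
  \<comment> \<open>Chosen so that \<alpha> times the lower bound \<open>\<beta> y1 / 2\<close> of
    \<beta> on \<open>K\<close> equals \<open>B + 1\<close>, which exceeds the divergence of
    \<open>X\<close>.\<close>
  define \<alpha> where "\<alpha> = (B + 1) / (\<beta> y1 / 2)"
  have \<alpha>: "\<alpha> > 0" using B(1) b1 by (simp add: \<alpha>_def)
  have \<alpha>B: "\<alpha> * \<beta> y > divergence X y" if "y \<in> K" for y
  proof -
    have "B + 1 = \<alpha> * (\<beta> y1 / 2)" using b1 by (simp add: \<alpha>_def)
    also have "\<dots> < \<alpha> * \<beta> y" using K(4)[OF that] \<alpha> by (intro mult_strict_left_mono)
    finally show ?thesis using B(2)[OF that] by linarith
  qed
  define h where "h y = exp (- (\<alpha> * s y))" for y
  define hR where "hR = exp (- (\<alpha> * R\<^sup>2))"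
  have h01: "0 < h y" "h y \<le> 1" for y using \<alpha> by (simp_all add: h_def sn)
  have sh: "smooth_on h (img c)"
  proof -
    have "Ck_on k (\<lambda>y. (- \<alpha>) * s y) (img c)" for k
      by (intro Ck_on_bilinear[OF bounded_bilinear_mult] oI Ck_on_const smooth_onD[OF ss[OF oI]])
    from Ck_on_compose[OF oI open_UNIV _ this Ck_on_exp] show ?thesis
      by (simp add: smooth_on_def h_def[abs_def])
  qed
  \<comment> \<open>The part of \<open>K\<close> on which the cutoff varies; there the barrier has
    to lie above \<open>U\<close>. It excludes the touching point.\<close>
  define Ann where "Ann = K - ball y1 (\<rho> / 2)"
  have cAnn: "compact Ann" "Ann \<subseteq> dom c" unfolding Ann_def using K by (auto intro: compact_diff)
  have nA: "y \<noteq> y1" if "y \<in> Ann" for y using that \<rho>(1) by (auto simp: Ann_def)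
  have UA: "U y \<le> m" if "y \<in> Ann" for y using U(2) cAnn(2) that by blast
  have cU: "continuous_on S U" if "S \<subseteq> Ann" for S using continuous_on_subset[OF U(1)] that cAnn(2) by blast
  obtain \<eta> where \<eta>: "\<eta> > 0" "\<And>y. y \<in> Ann \<inter> cball yc R \<Longrightarrow> U y - m \<le> - \<eta>"
  proof (rule negative_on_compact[of "Ann \<inter> cball yc R" "\<lambda>y. U y - m"])
    show "compact (Ann \<inter> cball yc R)" by (rule compact_Int_closed[OF cAnn(1) closed_cball])
    show "continuous_on (Ann \<inter> cball yc R) (\<lambda>y. U y - m)" by (intro continuous_intros cU) simp
    show "U y - m < 0" if "y \<in> Ann \<inter> cball yc R" for y
      using ne[of y] nA[of y] UA[of y] that by auto
  qed blast
  \<comment> \<open>Inside the touching ball \<open>h - hR\<close> is at most 1, so half of the gap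
    \<eta> is small enough for the exponential not to close it.\<close>
  define \<epsilon> where "\<epsilon> = \<eta> / 2"
  have \<epsilon>: "\<epsilon> > 0" using \<eta> by (simp add: \<epsilon>_def)
  define f where "f y = U y - m + \<epsilon> * (h y - hR)" for y
  have hR0: "hR > 0" by (simp add: hR_def)
  \<comment> \<open>Inside the touching ball \<open>U\<close> stays below \<open>m\<close> by at
    least \<eta>; outside it \<open>U\<close> may equal \<open>m\<close>, but there \<open>h\<close>
    is less than \<open>hR\<close>.\<close>
  have fneg: "f y < 0" if y: "y \<in> Ann" for y
  proof (cases "y \<in> cball yc R")
    case True
    have "\<epsilon> * (h y - hR) \<le> \<epsilon> * 1" using h01(2)[of y] hR0 \<epsilon> by (intro mult_left_mono) auto
    moreover have "\<epsilon> * 1 < \<eta>" using \<eta>(1) by (simp add: \<epsilon>_def)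
    moreover have "U y - m \<le> - \<eta>" using \<eta>(2)[of y] y True by blast
    ultimately show ?thesis unfolding f_def by linarith
  next
    case False
    then have "R\<^sup>2 < s y" unfolding sn using R(1) by (intro power_strict_mono) (auto simp: dist_norm norm_minus_commute)
    then have "h y < hR" using \<alpha> by (simp add: h_def hR_def)
    then have "\<epsilon> * (h y - hR) < 0" using \<epsilon> by (simp add: mult_pos_neg)
    then show ?thesis using UA[OF y] by (simp add: f_def)
  qed
  obtain \<delta> where \<delta>: "\<delta> > 0" "\<And>y. y \<in> Ann \<Longrightarrow> f y \<le> - \<delta>"
  proof (rule negative_on_compact[OF cAnn(1) _ fneg])
    show "continuous_on Ann f"
      unfolding f_def[abs_def]
      by (intro continuous_intros cU continuous_on_subset[OF smooth_on_continuous[OF sh]]) (use cAnn(2) DI in auto)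
  qed blast+
  \<comment> \<open>Subtracting \<delta> still leaves the barrier above \<open>U\<close> on
    \<open>Ann\<close>, and at \<open>y1\<close>, where \<open>h\<close> equals \<open>hR\<close>,
    it makes the barrier equal to \<open>m - \<delta>\<close>, strictly below
    \<open>U\<close>.\<close>
  define k where "k = m + \<epsilon> * hR - \<delta>"
  define \<psi> where "\<psi> y = k - \<epsilon> * h y" for y
  have s\<psi>: "smooth_on \<psi> (img c)"
  proof -
    have "Ck_on j (\<lambda>y. k + (- \<epsilon>) * h y) (img c)" for j
      by (intro Ck_on_add Ck_on_bilinear[OF bounded_bilinear_mult] oI Ck_on_const smooth_onD[OF sh])
    then show ?thesis by (simp add: smooth_on_def \<psi>_def[abs_def])
  qed
  define g where "g y = \<epsilon> * \<alpha> * h y" for y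
  have sg: "smooth_on g (img c)"
    unfolding smooth_on_def g_def[abs_def]
    by (intro allI Ck_on_bilinear[OF bounded_bilinear_mult] oI Ck_on_const smooth_onD[OF sh])
  have g\<psi>: "gradient \<psi> y = g y *\<^sub>R gradient s y" for y
  proof -
    have "((\<lambda>t. k - \<epsilon> * exp (- (\<alpha> * t))) has_real_derivative g y) (at (s y))"
      unfolding g_def h_def by (auto intro!: derivative_eq_intros)
    from gradient_compose[OF ds this] show ?thesis by (simp add: \<psi>_def[abs_def] h_def)
  qed
  have gg: "gradient g y = (- \<alpha> * g y) *\<^sub>R gradient s y" for y
  proof -
    have "((\<lambda>t. \<epsilon> * \<alpha> * exp (- (\<alpha> * t))) has_real_derivative (- \<alpha> * g y)) (at (s y))"
      unfolding g_def h_def by (auto intro!: derivative_eq_intros)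
    from gradient_compose[OF ds this] show ?thesis by (simp add: g_def[abs_def] h_def)
  qed
  have cn\<psi>: "conormal c \<psi> = (\<lambda>y. g y *\<^sub>R X y)"
    by (rule ext) (simp only: conormal_def g\<psi> cometric_scale X_def)
  have div\<psi>: "divergence (conormal c \<psi>) y < 0" if y: "y \<in> K" for y
  proof -
    have yI: "y \<in> img c" using y K(3) by blast
    have "divergence (conormal c \<psi>) y = g y * divergence X y + gradient g y \<bullet> X y"
      unfolding cn\<psi> by (rule divergence_scale[OF oI yI sX sg])
    also have "\<dots> = g y * (divergence X y - \<alpha> * \<beta> y)"
      by (simp add: gg \<beta>_def inner_commute algebra_simps)
    also have "\<dots> < 0" using \<alpha>B[OF y] \<epsilon> \<alpha> h01(1)[of y] by (intro mult_pos_neg) (auto simp: g_def)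
    finally show ?thesis .
  qed
  define t where "t y = (y - y1) \<bullet> (y - y1)" for y
  have tn: "t y = (dist y1 y)\<^sup>2" for y by (simp add: t_def dist_norm norm_minus_commute power2_norm_eq_inner[symmetric])
  have st: "smooth_on t (img c)" using smooth_sqdist[OF oI, of y1] by (simp add: t_def[abs_def])
  \<comment> \<open>The affine expression \<open>4 / 3 - q * t\<close> takes the value 1 at distance
    \<open>\<rho> / 2\<close> from \<open>y1\<close> and 0 at distance \<rho>.\<close>
  define q where "q = 4 / (3 * \<rho>\<^sup>2)"
  have q: "q > 0" "q * \<rho>\<^sup>2 = 4 / 3" using \<rho>(1) by (simp_all add: q_def)
  define \<kappa> where "\<kappa> y = smooth_step (4 / 3 - q * t y)" for y
  have s\<kappa>: "smooth_on \<kappa> (img c)"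
  proof -
    have "Ck_on j (\<lambda>y. 4 / 3 + (- q) * t y) (img c)" for j
      by (intro Ck_on_add Ck_on_bilinear[OF bounded_bilinear_mult] oI Ck_on_const smooth_onD[OF st])
    from Ck_on_compose[OF oI open_UNIV _ this smooth_onD[OF smooth_smooth_step]] show ?thesis
      by (simp add: smooth_on_def \<kappa>_def[abs_def])
  qed
  have \<kappa>1: "\<kappa> y = 1" if "y \<in> ball y1 (\<rho> / 2)" for y
  proof -
    have "t y \<le> (\<rho> / 2)\<^sup>2" unfolding tn using that by (intro power_mono) auto
    then have "q * t y \<le> q * ((\<rho> / 2)\<^sup>2)" using q(1) by (intro mult_left_mono) auto
    also have "\<dots> = 1 / 3" using q(2) by (simp add: power_divide)
    finally show ?thesis unfolding \<kappa>_def by (intro smooth_step_1) simp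
  qed
  show ?thesis
  proof (rule that[of K \<kappa> \<psi>])
    show "y1 \<in> interior K" using \<rho>(1) by (simp add: K_def)
    show "\<kappa> y = 0" if "y \<notin> K" for y
    proof -
      have "\<rho>\<^sup>2 \<le> t y" unfolding tn using that \<rho>(1) by (intro power_mono) (auto simp: K_def)
      then have "q * \<rho>\<^sup>2 \<le> q * t y" using q(1) by (intro mult_left_mono) auto
      then show ?thesis unfolding \<kappa>_def using q(2) by (intro smooth_step_0) simp
    qed
    have "\<kappa> y1 = 1" using \<rho>(1) by (intro \<kappa>1) simp
    then show "\<kappa> y1 > 0" by simp
    show "\<psi> y1 < U y1"
      using \<delta>(1) y1 R(3) by (simp add: \<psi>_def k_def h_def hR_def sn)
    show "divergence (conormal c \<kappa>) y = 0 \<or> U y \<le> \<psi> y" if y: "y \<in> K" for y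
    proof (cases "y \<in> Ann")
      case True
      then show ?thesis using \<delta>(2)[OF True] by (simp add: f_def \<psi>_def k_def algebra_simps)
    next
      case False
      then have yb: "y \<in> ball y1 (\<rho> / 2)" using y by (simp add: Ann_def)
      have "conormal c \<kappa> z = 0" if zb: "z \<in> ball y1 (\<rho> / 2)" for z
      proof -
        have "gradient \<kappa> z = 0" by (rule gradient_const_open[OF open_ball zb, where k = 1]) (rule \<kappa>1)
        then show ?thesis by (simp add: conormal_def cometric_zero)
      qed
      from divergence_zero_open[OF open_ball yb this] show ?thesis by simp
    qed
  qed (use K s\<kappa> s\<psi> div\<psi> smooth_step_bounds in \<open>auto simp: \<kappa>_def\<close>)
qed

text \<open>The integral is the pairing of the absolute value with \<open>loc_fun\<close> of the
  indicator of \<open>K\<close>, so the Cauchy-Schwarz inequality in L2(\<nu>) applies.\<close>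

lemma L1_chart_bound:
  assumes c: "c \<in> atlas G" and K: "compact K" "K \<subseteq> dom c"
  obtains C where "C \<ge> 0" "\<And>f. f \<in> L2 \<nu> \<Omega> \<Longrightarrow> (LINT y:K|lborel. \<bar>f (chart_inv c y)\<bar>) \<le> C * L2i.nrm f"
proof -
  let ?h = "indicator K :: real^'n \<Rightarrow> real"
  have hm: "?h \<in> borel_measurable borel" using borel_closed[OF compact_imp_closed[OF K(1)]] by simp
  have h0: "?h y = 0" if "y \<notin> K" for y using that by simp
  have h1: "\<bar>?h y\<bar> \<le> 1" for y by (simp add: indicator_def)
  note lf = loc_fun[OF c hm K h0 h1]
  have l1: "loc_fun c ?h \<in> L2 \<nu> \<Omega>" by (rule lf(1))
  have "(LINT y:K|lborel. \<bar>f (chart_inv c y)\<bar>) \<le> L2i.nrm (loc_fun c ?h) * L2i.nrm f" if f: "f \<in> L2 \<nu> \<Omega>" for f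
  proof -
    have fa: "(\<lambda>x. \<bar>f x\<bar>) \<in> L2 \<nu> \<Omega>"
    proof -
      have "(\<lambda>x. \<bar>indicator \<Omega> x * f x\<bar>) \<in> borel_measurable \<nu>" using f unfolding L2_iff by (intro borel_measurable_abs) blast
      moreover have "\<bar>indicator \<Omega> x * f x\<bar> = indicator \<Omega> x * \<bar>f x\<bar>" for x by (simp add: abs_mult)
      ultimately show ?thesis using f unfolding L2_iff by (simp add: power_mult_distrib)
    qed
    have "(LINT y:K|lborel. \<bar>f (chart_inv c y)\<bar>) = (LINT y|lborel. \<bar>f (chart_inv c y)\<bar> * ?h y)"
      by (simp add: set_lebesgue_integral_def mult.commute)
    also have "\<dots> = (LINT x:\<Omega>|\<nu>. \<bar>f x\<bar> * loc_fun c ?h x)" by (rule lf(2)[OF _ fa, symmetric])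
    also have "\<dots> \<le> L2i.nrm (\<lambda>x. \<bar>f x\<bar>) * L2i.nrm (loc_fun c ?h)"
      using L2i.cauchy_schwarz[OF fa l1] by (simp add: L2i.nrm_def)
    also have "L2i.nrm (\<lambda>x. \<bar>f x\<bar>) = L2i.nrm f" by (simp add: L2i.nrm_def)
    finally show ?thesis by (simp add: mult.commute)
  qed
  then show ?thesis by (rule that[OF L2i.nrm_nonneg[OF l1]])
qed

end

context krein_feller
begin

text \<open>The barrier term formed with \<open>u\<close> has a fixed positive integral
  \<open>P\<close>. Passing to a test function \<open>v\<close> at W12-distance \<open>e\<close>
  costs at most \<open>C3 * C4 * e\<close>, and subharmonicity gives an energy of at most
  \<open>B * e\<close> for the pair \<open>v\<close>, \<open>w\<close>. For small \<open>e\<close>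
  this contradicts the lower bound of \<open>test_cutoff\<close>.\<close>

lemma no_touching_ball:
  assumes sub: "mu_subharmonic G \<nu> \<mu> \<Omega> u" and c: "c \<in> atlas G" and u: "continuous_on \<Omega> u" "\<And>x. x \<in> \<Omega> \<Longrightarrow> u x \<le> m"
    and R: "R > 0" "cball yc R \<subseteq> dom c" "norm (y1 - yc) = R" and y1: "u (chart_inv c y1) = m"
    and ne: "\<And>y. y \<in> cball yc R \<Longrightarrow> y \<noteq> y1 \<Longrightarrow> u (chart_inv c y) \<noteq> m"
  shows False
proof -
  define U where "U y = u (chart_inv c y)" for y
  note oI = open_img[OF c]
  have ci\<Omega>: "chart_inv c y \<in> \<Omega>" if "y \<in> dom c" for y
    using that by (auto simp: chart_inv_chart[OF c])
  have cU: "continuous_on (dom c) U" unfolding U_def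
    by (rule continuous_on_compose2[OF u(1) continuous_on_subset[OF continuous_chart_inv[OF c]]]) (use ci\<Omega> in auto)
  have Um: "U y \<le> m" if "y \<in> dom c" for y unfolding U_def by (rule u(2)[OF ci\<Omega>[OF that]])
  have y1': "U y1 = m" unfolding U_def by (rule y1)
  have ne': "U y \<noteq> m" if "y \<in> cball yc R" "y \<noteq> y1" for y unfolding U_def by (rule ne[OF that])
  obtain K \<kappa> \<psi> where K: "compact K" "K \<subseteq> dom c" "y1 \<in> interior K"
    and \<kappa>: "smooth_on \<kappa> (img c)" "\<And>y. 0 \<le> \<kappa> y" "\<And>y. \<kappa> y \<le> 1" "\<And>y. y \<notin> K \<Longrightarrow> \<kappa> y = 0" "\<kappa> y1 > 0"
    and \<psi>: "smooth_on \<psi> (img c)" "\<And>y. y \<in> K \<Longrightarrow> divergence (conormal c \<psi>) y < 0" "\<psi> y1 < U y1"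
    and zero: "\<And>y. y \<in> K \<Longrightarrow> divergence (conormal c \<kappa>) y = 0 \<or> U y \<le> \<psi> y"
    by (rule hopf_barrier[OF c cU Um R y1' ne']) blast+
  have KI: "K \<subseteq> img c" using K(2) by blast
  let ?d\<kappa> = "divergence (conormal c \<kappa>)" and ?d\<psi> = "divergence (conormal c \<psi>)"
  have cd: "continuous_on (img c) ?d\<kappa>" "continuous_on (img c) ?d\<psi>"
    by (intro continuous_divergence[OF oI] smooth_conormal[OF c] \<kappa> \<psi>)+
  obtain C1 where C1: "C1 > 0" "\<And>y. y \<in> K \<Longrightarrow> \<bar>?d\<kappa> y\<bar> \<le> C1" using compact_in_chart[OF c K(1) KI cd(1)] by blast
  obtain C2 where C2: "C2 > 0" "\<And>y. y \<in> K \<Longrightarrow> \<bar>?d\<psi> y\<bar> \<le> C2" using compact_in_chart[OF c K(1) KI cd(2)] by blast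
  \<comment> \<open>\<open>C1\<close> stems from the cutoff term, where \<open>convex_flat\<close>
    has Lipschitz constant 1, and \<open>6 * C2\<close> from the barrier term, where
    \<open>convex_flat'\<close> has Lipschitz constant 6.\<close>
  define C3 where "C3 = C1 + 6 * C2"
  obtain C4 where C4: "C4 \<ge> 0" "\<And>f. f \<in> L2 \<nu> \<Omega> \<Longrightarrow> (LINT y:K|lborel. \<bar>f (chart_inv c y)\<bar>) \<le> C4 * L2i.nrm f"
    using L1_chart_bound[OF c K(1,2)] by blast
  have cf: "continuous_on UNIV convex_flat" "continuous_on UNIV convex_flat'"
    by (rule smooth_on_continuous smooth_convex_flat smooth_convex_flat')+
  have cont: "continuous_on K ?d\<kappa>" "continuous_on K ?d\<psi>" "continuous_on K \<kappa>" "continuous_on K \<psi>" "continuous_on K U"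
    using continuous_on_subset[OF cd(1) KI] continuous_on_subset[OF cd(2) KI]
      continuous_on_subset[OF smooth_on_continuous[OF \<kappa>(1)] KI] continuous_on_subset[OF smooth_on_continuous[OF \<psi>(1)] KI]
      continuous_on_subset[OF cU K(2)] by simp_all
  \<comment> \<open>The integrand of the lower bound in \<open>test_cutoff\<close>, with
    \<open>U\<close> in place of the test function. Its cutoff term is absent, since for
    \<open>U\<close> it is zero: where the divergence does not vanish, \<open>U\<close> is at most
    \<psi>.\<close>
  define F where "F y = - ?d\<psi> y * (\<kappa> y * convex_flat' (U y - \<psi> y))" for y
  have cF: "continuous_on K F"
    unfolding F_def[abs_def]
    by (intro continuous_on_mult continuous_on_minus continuous_on_compose2[OF cf(2)] continuous_on_diff cont) auto
  define P where "P = (LINT y:K|lborel. F y)"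
  have P: "P > 0"
    unfolding P_def
  proof (rule set_integral_pos_compact[OF K(1) cF _ K(3)])
    show "F y \<ge> 0" if "y \<in> K" for y
      unfolding F_def using \<psi>(2)[OF that] \<kappa>(2)[of y] convex_flat'_bounds(1) by (intro mult_nonneg_nonneg) auto
    have "y1 \<in> K" using K(3) interior_subset by blast
    then show "F y1 > 0" unfolding F_def using \<psi>(2)[of y1] \<psi>(3) \<kappa>(5) by (intro mult_pos_pos convex_flat'_pos) auto
  qed
  define B2 where "B2 = (LINT y:K|lborel. 2 * (conormal c \<kappa> y \<bullet> gradient \<kappa> y) + 144 * (conormal c \<psi> y \<bullet> gradient \<psi> y))"
  note uW = W0_W[OF subharmonic_W0[OF sub]]
  define M where "M = Wi.nrm u"
  have M: "M \<ge> 0" unfolding M_def by (rule Wi.nrm_nonneg[OF uW])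
  \<comment> \<open>Bounds the energy norm of the test function \<open>w\<close> independently of
    the approximation: with an error below 1 the energy of \<open>v\<close> is at most
    \<open>(M + 1)\<^sup>2\<close>.\<close>
  define B where "B = sqrt (\<bar>B2\<bar> + 144 * (M + 1)\<^sup>2)"
  have B: "B \<ge> 0" by (simp add: B_def)
  define N where "N = C3 * C4 + B + 1"
  have C3: "C3 > 0" using C1(1) C2(1) by (simp add: C3_def)
  have N: "N > 0" using C3 C4(1) B by (simp add: N_def add_nonneg_pos)
  obtain vs where vs: "\<And>n. vs n \<in> T" "(\<lambda>n. Wi.nrm (\<lambda>x. u x - vs n x)) \<longlonglongrightarrow> 0"
    using W0_approx[OF subharmonic_W0[OF sub]] by blast
  have "min 1 (P / N) > 0" using P N by simp
  from order_tendstoD(2)[OF vs(2) this] obtain n where n: "Wi.nrm (\<lambda>x. u x - vs n x) < min 1 (P / N)"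
    using eventually_happens'[OF sequentially_bot] by blast
  define v where "v = vs n"
  have v: "v \<in> T" unfolding v_def by (rule vs(1))
  note vW = test_W[OF v]
  define f where "f x = u x - v x" for x
  have fW: "f \<in> W" unfolding f_def[abs_def] by (rule Wi.diff[OF uW vW])
  define e where "e = Wi.nrm f"
  have e: "e \<ge> 0" "e < 1" "e < P / N" using n Wi.nrm_nonneg[OF fW] by (simp_all add: e_def f_def[abs_def] v_def)
  note tc = test_cutoff[OF c K(1,2) \<kappa>(1-4) \<psi>(1) v]
  define w where "w = from_chart c (\<lambda>y. \<kappa> y * convex_flat' (v (chart_inv c y) - \<psi> y))"
  note tc = tc[folded w_def]
  have wW: "w \<in> W" by (rule test_W[OF tc(1)])
  have cV: "continuous_on K (\<lambda>y. v (chart_inv c y))"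
    using continuous_on_subset[OF smooth_on_continuous[OF chart_smoothD[OF test_smooth[OF v] c]] KI] by (simp add: o_def)
  let ?I = "\<lambda>y. - (?d\<kappa> y * convex_flat (v (chart_inv c y) - \<psi> y)) - ?d\<psi> y * (\<kappa> y * convex_flat' (v (chart_inv c y) - \<psi> y))"
  have cI: "continuous_on K ?I"
    by (intro continuous_on_diff continuous_on_minus continuous_on_mult cont continuous_on_compose2[OF cf(1)]
        continuous_on_compose2[OF cf(2)] cV) auto
  have cff: "continuous_on K (\<lambda>y. C3 * \<bar>f (chart_inv c y)\<bar>)"
    using cont(5) cV unfolding f_def U_def by (intro continuous_intros)
  have "P - C3 * (LINT y:K|lborel. \<bar>f (chart_inv c y)\<bar>) = (LINT y:K|lborel. F y - C3 * \<bar>f (chart_inv c y)\<bar>)"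
    unfolding P_def
    by (subst set_integral_diff(2)[OF set_integrable_continuous_compact[OF K(1) cF] set_integrable_continuous_compact[OF K(1) cff]])
      (simp only: set_integral_mult_right)
  also have "\<dots> \<le> (LINT y:K|lborel. ?I y)"
  proof (rule set_integral_mono)
    show "set_integrable lborel K (\<lambda>y. F y - C3 * \<bar>f (chart_inv c y)\<bar>)"
      by (intro set_integrable_continuous_compact[OF K(1)] continuous_on_diff cF cff)
    show "set_integrable lborel K ?I" by (rule set_integrable_continuous_compact[OF K(1) cI])
    fix y assume y: "y \<in> K"
    define a where "a = U y - \<psi> y"
    define b where "b = v (chart_inv c y) - \<psi> y"
    define r where "r = \<bar>f (chart_inv c y)\<bar>"
    have ab: "\<bar>b - a\<bar> = r" by (simp add: a_def b_def r_def f_def U_def)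
    \<comment> \<open>This term has no sign. Where it is nonzero, \<open>a \<le> 0\<close> and hence
      \<open>convex_flat a = 0\<close>, so \<open>convex_flat b\<close> is as small as the
      approximation error.\<close>
    have 1: "?d\<kappa> y * convex_flat b \<le> C1 * r"
    proof (cases "?d\<kappa> y = 0")
      case True
      then show ?thesis using C1(1) ab by (simp add: r_def)
    next
      case False
      then have "a \<le> 0" using zero[OF y] by (simp add: a_def)
      then have "\<bar>convex_flat b\<bar> \<le> r" using convex_flat_lipschitz[of b a] ab by (simp add: convex_flat_nonpos)
      then have "\<bar>?d\<kappa> y\<bar> * \<bar>convex_flat b\<bar> \<le> C1 * r" using C1 y by (intro mult_mono) auto
      then show ?thesis using abs_le_D1[of "?d\<kappa> y * convex_flat b"] by (simp add: abs_mult)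
    qed
    have "(- ?d\<psi> y * \<kappa> y) * (convex_flat' a - convex_flat' b) \<le> C2 * (6 * r)"
    proof -
      have p: "0 \<le> - ?d\<psi> y * \<kappa> y" "- ?d\<psi> y * \<kappa> y \<le> C2"
      proof -
        have d: "0 \<le> - ?d\<psi> y" "- ?d\<psi> y \<le> C2" using \<psi>(2)[OF y] C2(2)[OF y] by linarith+
        show "0 \<le> - ?d\<psi> y * \<kappa> y" by (rule mult_nonneg_nonneg[OF d(1) \<kappa>(2)])
        show "- ?d\<psi> y * \<kappa> y \<le> C2" using mult_mono[OF d(2) \<kappa>(3)[of y]] C2(1) \<kappa>(2)[of y] by simp
      qed
      have l: "convex_flat' a - convex_flat' b \<le> 6 * r" 
        using abs_le_D1[OF convex_flat'_lipschitz[of a b]] unfolding abs_minus_commute[of a b] ab .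
      have "(- ?d\<psi> y * \<kappa> y) * (convex_flat' a - convex_flat' b) \<le> (- ?d\<psi> y * \<kappa> y) * (6 * r)"
        by (rule mult_left_mono[OF l p(1)])
      also have "\<dots> \<le> C2 * (6 * r)" by (rule mult_right_mono[OF p(2)]) (simp add: r_def)
      finally show ?thesis .
    qed
    with 1 have "F y - C3 * r \<le> - (?d\<kappa> y * convex_flat b) - ?d\<psi> y * (\<kappa> y * convex_flat' b)"
      unfolding F_def C3_def a_def[symmetric] by (simp add: algebra_simps)
    then show "F y - C3 * \<bar>f (chart_inv c y)\<bar> \<le> ?I y" unfolding r_def b_def .
  qed
  also have "\<dots> \<le> E v w" by (rule tc(3))
  finally have low: "P - C3 * (LINT y:K|lborel. \<bar>f (chart_inv c y)\<bar>) \<le> E v w" .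
  have "(LINT y:K|lborel. \<bar>f (chart_inv c y)\<bar>) \<le> C4 * L2i.nrm f" by (rule C4(2)[OF W_L2[OF fW]])
  also have "\<dots> \<le> C4 * e" unfolding e_def by (rule mult_left_mono[OF Wi_ge(1)[OF fW] C4(1)])
  finally have L1: "C3 * (LINT y:K|lborel. \<bar>f (chart_inv c y)\<bar>) \<le> C3 * (C4 * e)" using C3 by (intro mult_left_mono) auto
  have "(\<lambda>x. u x - f x) = v" by (simp add: f_def)
  then have "Wi.nrm v \<le> Wi.nrm u + Wi.nrm f" using Wi.nrm_diff[OF uW fW] by simp
  then have "Wi.nrm v \<le> M + 1" using e(2) unfolding M_def e_def by linarith
  then have "Ei.nrm v \<le> M + 1" using Wi_ge(2)[OF vW] by linarith
  then have "(Ei.nrm v)\<^sup>2 \<le> (M + 1)\<^sup>2" by (rule power_mono) (rule Ei.nrm_nonneg[OF vW])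
  then have Ev: "E v v \<le> (M + 1)\<^sup>2" by (simp add: Ei.nrm_sq[OF vW])
  have "E w w \<le> \<bar>B2\<bar> + 144 * (M + 1)\<^sup>2" using tc(4) Ev unfolding B2_def by linarith
  then have Bw: "sqrt (E w w) \<le> B" unfolding B_def by (rule real_sqrt_le_mono)
  \<comment> \<open>Subharmonicity is available for \<open>u\<close>, not for \<open>v\<close>. The
    discrepancy is an energy pairing with the error \<open>f\<close>, controlled because only the
    energy of \<open>w\<close>, not its smoothness, enters.\<close>
  have "E v w = E u w - E f w" using Ei.B_diff[OF uW vW wW] by (simp add: f_def[abs_def])
  also have "\<dots> \<le> - E f w" using subharmonic_test[OF sub tc(1,2)] by simp
  also have "\<dots> \<le> sqrt (E f f) * sqrt (E w w)" using Ei.cauchy_schwarz[OF fW wW] by linarith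
  also have "\<dots> \<le> e * B"
    using Wi_ge(2)[OF fW] Bw e(1) Ei.pos[OF wW] Ei.pos[OF fW] by (intro mult_mono) (auto simp: Ei.nrm_def e_def)
  finally have "P \<le> (C3 * C4 + B) * e" using low L1 by (simp add: algebra_simps)
  also have "\<dots> \<le> N * e" using e(1) by (intro mult_right_mono) (simp_all add: N_def)
  also have "\<dots> < N * (P / N)" using e(3) N by (intro mult_strict_left_mono)
  also have "\<dots> = P" using N by simp
  finally show False by simp
qed

lemma strong_maximum_principle:
  assumes sub: "mu_subharmonic G \<nu> \<mu> \<Omega> u" and u: "continuous_on \<Omega> u" and conn: "connected \<Omega>"
    and x0: "x0 \<in> \<Omega>" "\<And>x. x \<in> \<Omega> \<Longrightarrow> u x \<le> u x0" and x: "x \<in> \<Omega>"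
  shows "u x = u x0"
proof -
  define m where "m = u x0"
  have le: "u x \<le> m" if "x \<in> \<Omega>" for x unfolding m_def by (rule x0(2)[OF that])
  let ?A = "{x \<in> \<Omega>. u x = m}" and ?B = "\<Omega> \<inter> u -` (- {m})"
  have B: "open ?B" by (rule continuous_open_preimage[OF u open_domain]) auto
  have A: "open ?A"
  proof (rule ccontr)
    assume "\<not> open ?A"
    then obtain p where p: "p \<in> ?A" "\<And>V. open V \<Longrightarrow> p \<in> V \<Longrightarrow> \<not> V \<subseteq> ?A" using open_subopen[of ?A] by blast
    let ?c = "chart_at G p"
    note c = chart_at[of p]
    define f where "f y = u (chart_inv ?c y)" for y
    have fp: "f (snd ?c q) = u q" if "q \<in> fst ?c" for q by (simp add: f_def chart_inv_chart[OF c(1) that])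
    have oD: "open (dom ?c)" by (rule open_chart_image[OF c(1) open_domain])
    have cf: "continuous_on (dom ?c) f"
      unfolding f_def
      by (rule continuous_on_compose2[OF u continuous_on_subset[OF continuous_chart_inv[OF c(1)]]])
        (auto simp: chart_inv_chart[OF c(1)])
    have pD: "snd ?c p \<in> dom ?c" "f (snd ?c p) = m" using p(1) c(2) fp by auto
    have near: "\<exists>y. dist (snd ?c p) y < r \<and> f y \<noteq> m" if r: "r > 0" for r
    proof (rule ccontr)
      assume no: "\<not> (\<exists>y. dist (snd ?c p) y < r \<and> f y \<noteq> m)"
      let ?V = "{q \<in> fst ?c. snd ?c q \<in> ball (snd ?c p) r} \<inter> \<Omega>"
      have "open ?V" by (intro open_Int open_chart_preimage[OF c(1)] open_domain) auto
      moreover have "p \<in> ?V" using p(1) c(2) r by simp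
      moreover have "?V \<subseteq> ?A"
      proof
        fix q assume q: "q \<in> ?V"
        then have "f (snd ?c q) = m" using no by auto
        then show "q \<in> ?A" using q fp by auto
      qed
      ultimately show False using p(2) by blast
    qed
    obtain y1 yc R where "R > 0" "cball yc R \<subseteq> dom ?c" "norm (y1 - yc) = R" "f y1 = m"
      "\<And>y. y \<in> cball yc R \<Longrightarrow> y \<noteq> y1 \<Longrightarrow> f y \<noteq> m"
      by (rule interior_touching_ball[OF oD cf pD near]) blast+
    then show False using no_touching_ball[OF sub c(1) u le, of R yc y1] unfolding f_def by blast
  qed
  have "?A \<inter> \<Omega> = {} \<or> ?B \<inter> \<Omega> = {}" by (rule connectedD[OF conn A B]) auto
  then have "?B = {}" using x0(1) by (auto simp: m_def)
  then show ?thesis using x by (auto simp: m_def)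
qed

end

theorem theorem3p3:
  fixes G :: "('a::{t2_space, second_countable_topology}, 'n::finite) riemannian_structure"
    and \<nu> \<mu> :: "'a measure"
    and \<Omega> :: "'a set"
    and u :: "'a \<Rightarrow> real"
  assumes manifold: "oriented_riemannian_manifold G"
    and complete: "riemannian_complete G"
    and volume: "is_riemannian_volume G \<nu>"
    and domain: "open \<Omega>" "connected \<Omega>"
    and bounded: "riemannian_bounded G \<Omega>"
    and borel: "sets \<mu> = sets borel"
    and finite: "finite_measure \<mu>"
    and support: "measure_support \<mu> \<subseteq> closure \<Omega>"
    and positive: "emeasure \<mu> \<Omega> > 0"
    and poincare: "MPI G \<nu> \<mu> UNIV"
    and continuous: "continuous_on (closure \<Omega>) u"
    and subharmonic: "mu_subharmonic G \<nu> \<mu> \<Omega> u"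
    and nonconstant: "\<not> u constant_on closure \<Omega>"
  shows "\<not> (\<exists>x\<in>\<Omega>. \<forall>y\<in>closure \<Omega>. u y \<le> u x)"
proof
  assume "\<exists>x\<in>\<Omega>. \<forall>y\<in>closure \<Omega>. u y \<le> u x"
  then obtain x0 where x0: "x0 \<in> \<Omega>" "\<And>y. y \<in> closure \<Omega> \<Longrightarrow> u y \<le> u x0" by blast
  have r: "riemannian G \<nu>" using manifold volume by (rule riemannian.intro)
  interpret krein_feller G \<nu> \<Omega> \<mu>
    by (intro krein_feller.intro riemannian_domain.intro riemannian_domain_axioms.intro krein_feller_axioms.intro
        r domain(1) borel finite poincare riemannian.bounded_finite_volume[OF r complete bounded])
  have "u x = u x0" if "x \<in> \<Omega>" for x
  proof (rule strong_maximum_principle[OF subharmonic _ domain(2) x0(1) _ that])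
    show "continuous_on \<Omega> u" by (rule continuous_on_subset[OF continuous closure_subset])
    show "u y \<le> u x0" if "y \<in> \<Omega>" for y by (rule x0(2)) (use that closure_subset in blast)
  qed
  \<comment> \<open>Continuity up to the closure carries the constant value to the boundary, where
    nonconstancy of \<open>u\<close> could still have been hidden.\<close>
  then have "u y = u x0" if "y \<in> closure \<Omega>" for y
    using continuous_constant_on_closure[OF continuous _ that] by blast
  then have "u constant_on closure \<Omega>" unfolding constant_on_def by blast
  then show False using nonconstant by contradiction
qed

end
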